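(* Let $n\ge1$. The class $\mathfrak S(\mathfrak Z_n)$ of strictly singular operators on $\mathfrak Z_n$ coincides with the class $\mathfrak C(\mathfrak Z_n)$ of strictly cosingular operators on $\mathfrak Z_n$, and it is the unique maximal nontrivial (two-sided) ideal of the algebra $\mathfrak L(\mathfrak Z_n)$ of bounded operators on $\mathfrak Z_n$: every proper ideal of $\mathfrak L(\mathfrak Z_n)$ is contained in $\mathfrak S(\mathfrak Z_n)$.
   Context: Let $\mathbb S=\{z\in\mathbb C:0<\mathrm{Re}\,z<1\}$ and let $\mathcal C$ be the Calderón space of the pair $(\ell_\infty,\ell_1)$: bounded continuous functions $f:\overline{\mathbb S}\to\ell_\infty$, holomorphic on $\mathbb S$, with $f(1+it)\in\ell_1$ for all real $t$ and $\|f\|_{\mathcal C}=\max(\sup_t\|f(it)\|_\infty,\sup_t\|f(1+it)\|_1)<\infty$. For $n\ge1$ the Rochberg space $\mathfrak Z_n$ is the space of arrays $(x_{n-1},\dots,x_0)\in\ell_\infty^n$ for which there is $f\in\mathcal C$ with $x_j=f^{(j)}(1/2)/j!$ for $0\le j\le n-1$, normed by the infimum of $\|f\|_{\mathcal C}$ over such $f$. An operator $T:X\to Y$ is strictly singular if its restriction to no infinite-dimensional closed subspace is an isomorphism; it is strictly cosingular if for no infinite-codimensional closed subspace $Z\subseteq Y$ the composition $QT$ with the quotient map $Q:Y\to Y/Z$ is onto. *)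

theory Defs
  imports "HOL-Analysis.Analysis"
begin

definition bounded_seq :: "(nat \<Rightarrow> complex) \<Rightarrow> bool" where
  "bounded_seq x \<longleftrightarrow> bdd_above (range (\<lambda>k. cmod (x k)))"

definition linf_norm :: "(nat \<Rightarrow> complex) \<Rightarrow> real" where
  "linf_norm x = (SUP k. cmod (x k))"

definition l1_norm :: "(nat \<Rightarrow> complex) \<Rightarrow> real" where
  "l1_norm x = (\<Sum>k. cmod (x k))"

definition strip_cl :: "complex set" where
  "strip_cl = {z. 0 \<le> Re z \<and> Re z \<le> 1}"

definition strip_open :: "complex set" where
  "strip_open = {z. 0 < Re z \<and> Re z < 1}"

definition calderon :: "(complex \<Rightarrow> nat \<Rightarrow> complex) set" where
  "calderon = {f.
     (\<forall>z\<in>strip_cl. bounded_seq (f z)) \<and>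
     bdd_above ((\<lambda>z. linf_norm (f z)) ` strip_cl) \<and>
     (\<forall>z\<in>strip_cl. ((\<lambda>w. linf_norm (\<lambda>k. f w k - f z k)) \<longlongrightarrow> 0) (at z within strip_cl)) \<and>
     (\<forall>z\<in>strip_open. \<exists>g. bounded_seq g \<and>
        ((\<lambda>w. linf_norm (\<lambda>k. (f w k - f z k) / (w - z) - g k)) \<longlongrightarrow> 0) (at z)) \<and>
     (\<forall>t::real. summable (\<lambda>k. cmod (f (1 + \<i> * complex_of_real t) k))) \<and>
     bdd_above (range (\<lambda>t::real. l1_norm (f (1 + \<i> * complex_of_real t))))}"

definition cald_norm :: "(complex \<Rightarrow> nat \<Rightarrow> complex) \<Rightarrow> real" where
  "cald_norm f = max (SUP t::real. linf_norm (f (\<i> * complex_of_real t)))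
                     (SUP t::real. l1_norm (f (1 + \<i> * complex_of_real t)))"

text \<open>An array (x_{n-1},...,x_0) is encoded as x :: nat => nat => complex,
  x j k = k-th coordinate of x_j, with x j = 0 for j >= n.\<close>

definition represents :: "nat \<Rightarrow> (complex \<Rightarrow> nat \<Rightarrow> complex) \<Rightarrow> (nat \<Rightarrow> nat \<Rightarrow> complex) \<Rightarrow> bool" where
  "represents n f x \<longleftrightarrow>
     (\<forall>j<n. \<forall>k. x j k = (deriv ^^ j) (\<lambda>z. f z k) (1/2) / fact j) \<and>
     (\<forall>j\<ge>n. \<forall>k. x j k = 0)"

definition Zn :: "nat \<Rightarrow> (nat \<Rightarrow> nat \<Rightarrow> complex) set" where
  "Zn n = {x. \<exists>f\<in>calderon. represents n f x}"

definition zn_norm :: "nat \<Rightarrow> (nat \<Rightarrow> nat \<Rightarrow> complex) \<Rightarrow> real" where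
  "zn_norm n x = Inf (cald_norm ` {f \<in> calderon. represents n f x})"

definition vzero :: "nat \<Rightarrow> nat \<Rightarrow> complex" where
  "vzero = (\<lambda>j k. 0)"

definition vadd :: "(nat \<Rightarrow> nat \<Rightarrow> complex) \<Rightarrow> (nat \<Rightarrow> nat \<Rightarrow> complex) \<Rightarrow> (nat \<Rightarrow> nat \<Rightarrow> complex)" where
  "vadd x y = (\<lambda>j k. x j k + y j k)"

definition vscale :: "complex \<Rightarrow> (nat \<Rightarrow> nat \<Rightarrow> complex) \<Rightarrow> (nat \<Rightarrow> nat \<Rightarrow> complex)" where
  "vscale c x = (\<lambda>j k. c * x j k)"

definition vsub :: "(nat \<Rightarrow> nat \<Rightarrow> complex) \<Rightarrow> (nat \<Rightarrow> nat \<Rightarrow> complex) \<Rightarrow> (nat \<Rightarrow> nat \<Rightarrow> complex)" where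
  "vsub x y = (\<lambda>j k. x j k - y j k)"

definition cspan :: "(nat \<Rightarrow> nat \<Rightarrow> complex) set \<Rightarrow> (nat \<Rightarrow> nat \<Rightarrow> complex) set" where
  "cspan F = {v. \<exists>c. v = (\<lambda>j k. \<Sum>u\<in>F. c u * u j k)}"

definition is_subspace :: "nat \<Rightarrow> (nat \<Rightarrow> nat \<Rightarrow> complex) set \<Rightarrow> bool" where
  "is_subspace n M \<longleftrightarrow> M \<subseteq> Zn n \<and> vzero \<in> M \<and>
     (\<forall>x\<in>M. \<forall>y\<in>M. vadd x y \<in> M) \<and> (\<forall>c. \<forall>x\<in>M. vscale c x \<in> M)"

definition closed_sub :: "nat \<Rightarrow> (nat \<Rightarrow> nat \<Rightarrow> complex) set \<Rightarrow> bool" where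
  "closed_sub n M \<longleftrightarrow>
     (\<forall>x\<in>Zn n. (\<forall>e>0. \<exists>m\<in>M. zn_norm n (vsub x m) < e) \<longrightarrow> x \<in> M)"

definition infinite_dim :: "(nat \<Rightarrow> nat \<Rightarrow> complex) set \<Rightarrow> bool" where
  "infinite_dim M \<longleftrightarrow> (\<forall>F. finite F \<and> F \<subseteq> M \<longrightarrow> \<not> M \<subseteq> cspan F)"

definition infinite_codim :: "nat \<Rightarrow> (nat \<Rightarrow> nat \<Rightarrow> complex) set \<Rightarrow> bool" where
  "infinite_codim n M \<longleftrightarrow> (\<forall>F. finite F \<and> F \<subseteq> Zn n \<longrightarrow>
     \<not> Zn n \<subseteq> {vadd u m | u m. u \<in> cspan F \<and> m \<in> M})"

text \<open>Operators are normalised to vanish outside Z_n, so that an operator on Z_n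
  is identified with a unique HOL function.\<close>

definition bop :: "nat \<Rightarrow> ((nat \<Rightarrow> nat \<Rightarrow> complex) \<Rightarrow> (nat \<Rightarrow> nat \<Rightarrow> complex)) set" where
  "bop n = {T. (\<forall>x\<in>Zn n. T x \<in> Zn n) \<and>
     (\<forall>x\<in>Zn n. \<forall>y\<in>Zn n. T (vadd x y) = vadd (T x) (T y)) \<and>
     (\<forall>c. \<forall>x\<in>Zn n. T (vscale c x) = vscale c (T x)) \<and>
     (\<exists>C. \<forall>x\<in>Zn n. zn_norm n (T x) \<le> C * zn_norm n x) \<and>
     (\<forall>x. x \<notin> Zn n \<longrightarrow> T x = vzero)}"

definition strictly_singular :: "nat \<Rightarrow> ((nat \<Rightarrow> nat \<Rightarrow> complex) \<Rightarrow> (nat \<Rightarrow> nat \<Rightarrow> complex)) \<Rightarrow> bool" where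
  "strictly_singular n T \<longleftrightarrow> \<not> (\<exists>M. is_subspace n M \<and> closed_sub n M \<and> infinite_dim M \<and>
      (\<exists>c>0. \<forall>x\<in>M. c * zn_norm n x \<le> zn_norm n (T x)))"

definition strictly_cosingular :: "nat \<Rightarrow> ((nat \<Rightarrow> nat \<Rightarrow> complex) \<Rightarrow> (nat \<Rightarrow> nat \<Rightarrow> complex)) \<Rightarrow> bool" where
  "strictly_cosingular n T \<longleftrightarrow> \<not> (\<exists>M. is_subspace n M \<and> closed_sub n M \<and> infinite_codim n M \<and>
      Zn n \<subseteq> {vadd (T x) m | x m. x \<in> Zn n \<and> m \<in> M})"

definition SS :: "nat \<Rightarrow> ((nat \<Rightarrow> nat \<Rightarrow> complex) \<Rightarrow> (nat \<Rightarrow> nat \<Rightarrow> complex)) set" where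
  "SS n = {T \<in> bop n. strictly_singular n T}"

definition SC :: "nat \<Rightarrow> ((nat \<Rightarrow> nat \<Rightarrow> complex) \<Rightarrow> (nat \<Rightarrow> nat \<Rightarrow> complex)) set" where
  "SC n = {T \<in> bop n. strictly_cosingular n T}"

definition op_ideal :: "nat \<Rightarrow> ((nat \<Rightarrow> nat \<Rightarrow> complex) \<Rightarrow> (nat \<Rightarrow> nat \<Rightarrow> complex)) set \<Rightarrow> bool" where
  "op_ideal n I \<longleftrightarrow> I \<subseteq> bop n \<and> (\<lambda>x. vzero) \<in> I \<and>
     (\<forall>S\<in>I. \<forall>T\<in>I. (\<lambda>x. vadd (S x) (T x)) \<in> I) \<and>
     (\<forall>c. \<forall>S\<in>I. (\<lambda>x. vscale c (S x)) \<in> I) \<and>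
     (\<forall>S\<in>I. \<forall>A\<in>bop n. A \<circ> S \<in> I \<and> S \<circ> A \<in> I)"

end

theory Submission
  imports Defs "HOL-Complex_Analysis.Complex_Analysis" "HOL-Library.Function_Algebras"
    "HOL-Computational_Algebra.Fundamental_Theorem_Algebra"
begin

text \<open>An operator \<open>T\<close> factors the identity if \<open>A T B = 1\<close> for some bounded \<open>A\<close>, \<open>B\<close>. Such a \<open>T\<close> is neither
  strictly singular nor strictly cosingular and lies in no proper ideal, so everything reduces to the converse:
  a \<open>T\<close> that is bounded below on an infinite-dimensional subspace, or onto modulo a closed subspace of infinite
  codimension, factors the identity.

  Two facts carry the argument. If \<open>T\<close> has infinitely many diagonal entries bounded away from \<open>0\<close> in the column of
  the last slot, then on a sparse set of coordinates \<open>T\<close> is a small perturbation of one constant matrix acting on jets;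
  boundedness on flat vectors forces this matrix to commute with the shift \<open>J\<close> of the slots, so it is a power series
  in \<open>J\<close>. A nonzero entry in its last column can only be the constant coefficient, hence it is invertible. In general a normalised block sequence in a subspace on
  which \<open>T\<close> is bounded below is moved into the last slot by averaging over \<open>N\<close> blocks: this twists jets by
  \<open>N\<^sup>1\<^sup>/\<^sup>2\<^sup>-\<^sup>z\<close>, whose powers of \<open>ln N\<close> single out the highest power of \<open>J\<close>. Complemented copies of the space
  spanned by blocks, obtained from \<open>z \<mapsto> a \<bar>a\<bar>\<^sup>2\<^sup>z\<^sup>-\<^sup>1\<close>, then reduce to the diagonal case.

  The cosingular half follows by duality: \<open>f(1/2 + \<zeta>) g(1/2 - \<zeta>)\<close> pairs the space with itself perfectly.\<close>

section \<open>Bounded holomorphic functions on the strip\<close>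


unbundle no vec_syntax

text \<open>The difficulty is that only the leading nonzero slot of an array is controlled linearly,
  by its l2 norm; later slots enter through a nonlinear twist, and rescaling a sum of N disjoint
  vectors mixes the slots by powers of ln N. The same logarithms are the tool: a bound that has to
  hold for all N forces identities between polynomials in ln N. The norm is an infimum over
  functions with values in l-infinity. All estimates are made instead on finitely supported
  representatives, whose coordinates are scalar functions. Nothing is lost, because the space
  behaves like a reflexive one: N disjoint vectors of norm at most 1 have a sum of norm at most sqrt
  N times a power of 1 + ln N, up to a constant; hence bounded functionals tend to 0 along disjoint
  bounded sequences; hence bounded finite sections have vanishing tails and glue to one function in
  the Calderon space with almost the same bound. For the same reason every bounded functional is
  given by the pairing, which supplies adjoints on the space itself.\<close>

definition sgood :: "(complex \<Rightarrow> complex) \<Rightarrow> bool" where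
  "sgood h \<longleftrightarrow> continuous_on strip_cl h \<and> h holomorphic_on strip_open \<and> bounded (h ` strip_cl)"

lemma strip_open_subset_cl: "strip_open \<subseteq> strip_cl"
  by (auto simp: strip_open_def strip_cl_def)

lemma open_strip_open: "open strip_open"
proof -
  have "strip_open = {z. 0 < Re z} \<inter> {z. Re z < 1}" by (auto simp: strip_open_def)
  moreover have "open ({z. 0 < Re z} \<inter> {z. Re z < 1})"
    by (intro open_Int open_halfspace_Re_gt open_halfspace_Re_lt)
  ultimately show ?thesis by simp
qed

lemma half_in_strip: "1/2 \<in> strip_open" by (simp add: strip_open_def)

lemma sgood_const: "sgood (\<lambda>z. c)"
  by (auto simp: sgood_def intro!: boundedI)

lemma sgood_add: "sgood f \<Longrightarrow> sgood g \<Longrightarrow> sgood (\<lambda>z. f z + g z)"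
  unfolding sgood_def by (auto intro!: continuous_intros holomorphic_intros bounded_plus_comp)

lemma sgood_mult: assumes "sgood f" "sgood g" shows "sgood (\<lambda>z. f z * g z)"
proof -
  obtain a where a: "\<And>z. z \<in> strip_cl \<Longrightarrow> norm (f z) \<le> a" using assms(1) unfolding sgood_def bounded_iff by auto
  obtain b where b: "\<And>z. z \<in> strip_cl \<Longrightarrow> norm (g z) \<le> b" using assms(2) unfolding sgood_def bounded_iff by auto
  have "bounded ((\<lambda>z. f z * g z) ` strip_cl)"
  proof (rule boundedI, clarify)
    fix z assume z: "z \<in> strip_cl"
    show "norm (f z * g z) \<le> a * b"
      unfolding norm_mult using a[OF z] b[OF z] norm_ge_zero by (meson mult_mono order_trans)
  qed
  then show ?thesis using assms unfolding sgood_def by (auto intro!: continuous_intros holomorphic_intros)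
qed

lemma sgood_sum: "(\<And>i. i \<in> I \<Longrightarrow> sgood (f i)) \<Longrightarrow> sgood (\<lambda>z. \<Sum>i\<in>I. f i z)"
  by (induction I rule: infinite_finite_induct) (auto intro: sgood_const sgood_add)

lemma sgood_reflect: assumes "sgood f" shows "sgood (\<lambda>z. f (1 - z))"
proof -
  have m: "z \<in> strip_cl \<Longrightarrow> 1 - z \<in> strip_cl" "z \<in> strip_open \<Longrightarrow> 1 - z \<in> strip_open" for z
    by (auto simp: strip_cl_def strip_open_def)
  have 1: "continuous_on strip_cl (\<lambda>z. f (1 - z))"
    using assms unfolding sgood_def
    by (intro continuous_on_compose2[of strip_cl f strip_cl "\<lambda>z. 1 - z"]) (auto intro!: continuous_intros m)
  have 2: "(\<lambda>z. f (1 - z)) holomorphic_on strip_open"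
    using assms unfolding sgood_def
    by (intro holomorphic_on_compose_gen[of "\<lambda>z. 1 - z" strip_open f strip_open, unfolded o_def])
       (auto intro!: holomorphic_intros m)
  have 3: "bounded ((\<lambda>z. f (1 - z)) ` strip_cl)"
    using assms unfolding sgood_def by (auto elim!: bounded_subset intro!: m imageI)
  show ?thesis using 1 2 3 by (simp add: sgood_def)
qed

lemma sgood_exp: "sgood (\<lambda>z. exp (of_real a * z + b))"
proof -
  have "bounded ((\<lambda>z. exp (of_real a * z + b)) ` strip_cl)"
  proof (rule boundedI, clarify)
    fix z assume z: "z \<in> strip_cl"
    have "\<bar>a * Re z\<bar> \<le> \<bar>a\<bar>"
      using z by (simp add: strip_cl_def abs_mult mult_left_le)
    then have "a * Re z \<le> \<bar>a\<bar>" by linarith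
    then show "norm (exp (of_real a * z + b)) \<le> exp (\<bar>a\<bar> + Re b)" by simp
  qed
  then show ?thesis unfolding sgood_def by (auto intro!: continuous_intros holomorphic_intros)
qed

text \<open>Three lines theorem in its maximum form. Multiplication by exp(e z^2) makes h small near
  the ends of the strip, since Re(z^2) = (Re z)^2 - (Im z)^2, so that the maximum principle on a
  long rectangle applies; finally e tends to 0.\<close>

lemma strip_max:
  assumes h: "sgood h" and b0: "\<And>t. cmod (h (\<i> * of_real t)) \<le> M" and b1: "\<And>t. cmod (h (1 + \<i> * of_real t)) \<le> M"
    and z: "z \<in> strip_cl"
  shows "cmod (h z) \<le> M"
proof -
  obtain D where D: "\<And>z. z \<in> strip_cl \<Longrightarrow> norm (h z) \<le> D" using h unfolding sgood_def bounded_iff by auto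
  have M0: "0 \<le> M" using b0[of 0] norm_ge_zero order_trans by blast
  have D0: "0 \<le> D" using D[OF z] norm_ge_zero order_trans by blast
  \<comment> \<open>The margin \<open>M + e\<close> is positive even for M = 0, as needed for the
    horizontal sides; \<open>exp e\<close> bounds the factor exp(e (Re w)^2) on the strip.\<close>
  have key: "cmod (h z) * exp (e * Re (z^2)) \<le> (M + e) * exp e" if e: "0 < e" for e
  proof -
    define g where "g = (\<lambda>w. h w * exp (of_real e * w^2))"
    have "((\<lambda>R::real. D * exp (- (e * R))) \<longlongrightarrow> 0) at_top" using e by real_asymp
    then have "eventually (\<lambda>R. D * exp (- (e * R)) < M + e) at_top"
      using M0 e by (intro order_tendstoD(2)) auto
    then obtain R0 where R0: "\<And>R. R \<ge> R0 \<Longrightarrow> D * exp (- (e * R)) < M + e"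
      by (auto simp: eventually_at_top_linorder)
    \<comment> \<open>R \<ge> 1 gives R^2 \<ge> R, so that the decay exp(-e R^2) is past the
      threshold \<open>R0\<close>; the last entry puts z into the rectangle.\<close>
    define R where "R = max (max R0 1) \<bar>Im z\<bar>"
    have R: "R \<ge> R0" "R \<ge> 1" "\<bar>Im z\<bar> \<le> R" by (auto simp: R_def)
    have RR: "R\<^sup>2 \<ge> R0" using R by (smt (verit) power2_eq_square mult_le_cancel_left1)
    define S where "S = cbox (Complex 0 (-R)) (Complex 1 R)"
    have S_sub: "S \<subseteq> strip_cl" by (auto simp: S_def in_cbox_complex_iff strip_cl_def)
    have intS: "interior S \<subseteq> strip_open" unfolding S_def interior_cbox by (auto simp: in_box_complex_iff strip_open_def)
    have cb: "cmod (exp (of_real e * w^2)) = exp (e * (Re w)^2) * exp (- (e * (Im w)^2))" for w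
      by (simp add: Re_power2 right_diff_distrib exp_diff exp_minus field_simps)
    have "cmod (g z) \<le> (M + e) * exp e"
    proof (rule maximum_modulus_frontier[of g S])
      show "g holomorphic_on interior S"
        unfolding g_def using h intS unfolding sgood_def
        by (intro holomorphic_intros) (auto elim: holomorphic_on_subset)
      show "continuous_on (closure S) g"
        unfolding g_def S_def using h S_sub unfolding sgood_def S_def
        by (auto intro!: continuous_intros elim: continuous_on_subset)
      show "bounded S" by (simp add: S_def)
      show "z \<in> S" using z R by (auto simp: S_def in_cbox_complex_iff strip_cl_def)
      fix w assume w: "w \<in> frontier S"
      then have wS: "w \<in> S" and wn: "w \<notin> box (Complex 0 (-R)) (Complex 1 R)"
        by (auto simp: S_def frontier_cbox)
      have wcl: "w \<in> strip_cl" using wS S_sub by auto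
      have r1: "exp (e * (Re w)^2) \<le> exp e"
        using wcl e by (simp add: strip_cl_def power_le_one)
      have r2: "exp (- (e * (Im w)^2)) \<le> 1" using e by simp
      consider "Re w = 0" | "Re w = 1" | "\<bar>Im w\<bar> = R"
        using wS wn by (force simp: S_def in_cbox_complex_iff in_box_complex_iff)
      then have "cmod (h w) * exp (- (e * (Im w)^2)) \<le> M + e"
      proof cases
        case 1
        then have "w = \<i> * of_real (Im w)" by (simp add: complex_eq_iff)
        then have "cmod (h w) \<le> M" using b0 by metis
        then show ?thesis using r2 e M0 by (smt (verit) mult_left_le norm_ge_zero)
      next
        case 2
        then have "w = 1 + \<i> * of_real (Im w)" by (simp add: complex_eq_iff)
        then have "cmod (h w) \<le> M" using b1 by metis
        then show ?thesis using r2 e M0 by (smt (verit) mult_left_le norm_ge_zero)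
      next
        case 3
        then have "(Im w)^2 = R^2" by (metis power2_abs)
        then have "cmod (h w) * exp (- (e * (Im w)^2)) \<le> D * exp (- (e * R^2))"
          using D[OF wcl] by (simp add: mult_right_mono)
        also have "\<dots> < M + e" using R0[OF RR] by simp
        finally show ?thesis by simp
      qed
      then have "(cmod (h w) * exp (- (e * (Im w)^2))) * exp (e * (Re w)^2) \<le> (M + e) * exp e"
        using r1 e M0 by (intro mult_mono) auto
      then show "norm (g w) \<le> (M + e) * exp e"
        unfolding g_def norm_mult cb by (simp add: algebra_simps)
    qed
    then show ?thesis unfolding g_def norm_mult by simp
  qed
  have "((\<lambda>e. cmod (h z) * exp (e * Re (z^2))) \<longlongrightarrow> cmod (h z) * exp (0 * Re (z^2))) (at_right 0)"
    by (intro tendsto_intros)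
  moreover have "((\<lambda>e. (M + e) * exp e) \<longlongrightarrow> (M + 0) * exp 0) (at_right 0)"
    by (intro tendsto_intros)
  moreover have "eventually (\<lambda>e. cmod (h z) * exp (e * Re (z^2)) \<le> (M + e) * exp e) (at_right 0)"
    using key by (auto simp: eventually_at_right_less eventually_at_right_field intro!: exI[of _ 1])
  ultimately have "cmod (h z) * exp (0 * Re (z^2)) \<le> (M + 0) * exp 0"
    by (intro tendsto_le[of "at_right 0"]) auto
  then show ?thesis by simp
qed

section \<open>Taylor jets at 1/2\<close>

definition jet :: "(complex \<Rightarrow> complex) \<Rightarrow> complex fps" where
  "jet h = fps_expansion h (1/2)"

lemma jet_nth: "jet h $ j = (deriv ^^ j) h (1/2) / fact j"
  by (simp add: jet_def fps_expansion_def)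

lemma sgood_has_fps: assumes "sgood h" shows "(\<lambda>x. h (1/2 + x)) has_fps_expansion jet h"
  unfolding jet_def
  using assms open_strip_open half_in_strip unfolding sgood_def
  by (intro analytic_at_imp_has_fps_expansion) (auto simp: analytic_at)

lemma jet_eqI: assumes "sgood h" "(\<lambda>x. h (1/2 + x)) has_fps_expansion F" shows "jet h = F"
  using fps_expansion_unique_complex[OF sgood_has_fps[OF assms(1)] assms(2)] .

lemma jet_add: assumes "sgood f" "sgood g" shows "jet (\<lambda>z. f z + g z) = jet f + jet g"
  by (rule jet_eqI[OF sgood_add[OF assms] has_fps_expansion_add[OF assms[THEN sgood_has_fps]]])

lemma jet_mult: assumes "sgood f" "sgood g" shows "jet (\<lambda>z. f z * g z) = jet f * jet g"
  by (rule jet_eqI[OF sgood_mult[OF assms] has_fps_expansion_mult[OF assms[THEN sgood_has_fps]]])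

lemma jet_const: "jet (\<lambda>z. c) = fps_const c"
  by (rule jet_eqI[OF sgood_const has_fps_expansion_const])

lemma jet_sum: assumes "\<And>i. i \<in> I \<Longrightarrow> sgood (f i)" shows "jet (\<lambda>z. \<Sum>i\<in>I. f i z) = (\<Sum>i\<in>I. jet (f i))"
  by (rule jet_eqI[OF sgood_sum[OF assms] has_fps_expansion_sum[OF sgood_has_fps[OF assms]]])

lemma jet_exp: "jet (\<lambda>z. exp (of_real a * z + b)) = fps_const (exp (of_real a / 2 + b)) * fps_exp (of_real a)"
proof -
  have 1: "(\<lambda>x. exp (of_real a / 2 + b) * exp (of_real a * x)) has_fps_expansion fps_const (exp (of_real a / 2 + b)) * fps_exp (of_real a)"
    by (rule has_fps_expansion_mult[OF has_fps_expansion_const has_fps_expansion_exp])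
  have 2: "(\<lambda>x. exp (of_real a * (1 / 2 + x) + b)) = (\<lambda>x. exp (of_real a / 2 + b) * exp (of_real a * x))"
  proof
    fix x :: complex
    have "of_real a * (1 / 2 + x) + b = (of_real a / 2 + b) + of_real a * x" by (simp add: distrib_left)
    then show "exp (of_real a * (1 / 2 + x) + b) = exp (of_real a / 2 + b) * exp (of_real a * x)" by (simp only: exp_add)
  qed
  show ?thesis
    by (rule jet_eqI[OF sgood_exp]) (use 1 in \<open>simp only: 2\<close>)
qed

text \<open>Reflection at 1/2 substitutes -X for X in the jet; the alternating signs of the pairing
  come from here.\<close>

lemma jet_reflect: assumes "sgood h" shows "jet (\<lambda>z. h (1 - z)) $ j = (-1)^j * jet h $ j"
proof -
  have "jet (\<lambda>z. h (1 - z)) = fps_compose (jet h) (- fps_X)"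
  proof (rule jet_eqI[OF sgood_reflect[OF assms]])
    have "((\<lambda>x. h (1/2 + x)) \<circ> (\<lambda>x. - x)) has_fps_expansion fps_compose (jet h) (- fps_X)"
      by (intro has_fps_expansion_compose sgood_has_fps assms has_fps_expansion_minus has_fps_expansion_fps_X) auto
    then show "(\<lambda>x. h (1 - (1/2 + x))) has_fps_expansion fps_compose (jet h) (- fps_X)"
      by (simp add: o_def)
  qed
  then show ?thesis by (simp add: fps_compose_uminus')
qed

text \<open>Cauchy's inequality on the circle of radius 1/4 about 1/2, which stays inside the open
  strip.\<close>

lemma jet_bound:
  assumes h: "sgood h" and b: "\<And>z. z \<in> strip_cl \<Longrightarrow> cmod (h z) \<le> M"
  shows "cmod (jet h $ j) \<le> 4^j * M"
proof -
  have m: "z \<in> strip_open" if "norm (1/2 - z) \<le> 1/4" for z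
  proof -
    have "\<bar>Re (1/2 - z)\<bar> \<le> 1/4" using that abs_Re_le_cmod order_trans by blast
    then have "\<bar>1/2 - Re z\<bar> \<le> 1/4" by simp
    then have "0 < Re z" "Re z < 1" by linarith+
    then show ?thesis by (simp add: strip_open_def)
  qed
  have "norm ((deriv ^^ j) h (1/2)) \<le> fact j * M / (1/4)^j"
  proof (rule Cauchy_inequality)
    show "h holomorphic_on ball (1/2) (1/4)" using h m unfolding sgood_def
      by (auto simp: dist_norm elim!: holomorphic_on_subset)
    show "continuous_on (cball (1/2) (1/4)) h" using h m strip_open_subset_cl unfolding sgood_def
      by (auto simp: dist_norm elim!: continuous_on_subset)
    show "norm (h x) \<le> M" if "norm (1/2 - x) = 1/4" for x
      using that m strip_open_subset_cl by (intro b) auto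
  qed simp
  then show ?thesis by (simp add: jet_nth norm_divide divide_simps power_one_over mult_ac)
qed

section \<open>Jets of finitely supported functions\<close>


type_synonym arr = "nat \<Rightarrow> nat \<Rightarrow> complex"

lemma sum_fun_apply: "(\<Sum>i\<in>I. f i) x = (\<Sum>i\<in>I. f i x)"
  by (induction I rule: infinite_finite_induct) auto

text \<open>Multiplication of an n-jet by a power series, at all coordinates at once: slot j holds
  the coefficient of X^j. In particular \<open>act n fps_X\<close> is the shift of the
  slots.\<close>

definition act :: "nat \<Rightarrow> complex fps \<Rightarrow> arr \<Rightarrow> arr" where
  "act n p x = (\<lambda>j k. if j < n then \<Sum>i\<le>j. fps_nth p i * x (j - i) k else 0)"

definition proj :: "nat set \<Rightarrow> arr \<Rightarrow> arr" where
  "proj S x = (\<lambda>j k. if k \<in> S then x j k else 0)"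

definition uvec :: "nat \<Rightarrow> nat \<Rightarrow> arr" where
  "uvec k l = (\<lambda>j i. if j = l \<and> i = k then 1 else 0)"

definition below :: "nat \<Rightarrow> arr \<Rightarrow> bool" where
  "below n x \<longleftrightarrow> (\<forall>j\<ge>n. \<forall>k. x j k = 0)"

definition supp_in :: "nat set \<Rightarrow> arr \<Rightarrow> bool" where
  "supp_in S x \<longleftrightarrow> (\<forall>j k. k \<notin> S \<longrightarrow> x j k = 0)"

text \<open>With finite support, continuity and holomorphy are matters of single coordinates, and
  the norm is governed by the two boundary bounds alone.\<close>

definition fcal :: "nat set \<Rightarrow> real \<Rightarrow> (complex \<Rightarrow> nat \<Rightarrow> complex) \<Rightarrow> bool" where
  "fcal S C f \<longleftrightarrow> finite S \<and> (\<forall>k. sgood (\<lambda>z. f z k)) \<and> (\<forall>k z. k \<notin> S \<longrightarrow> f z k = 0) \<and>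
     (\<forall>t k. cmod (f (\<i> * complex_of_real t) k) \<le> C) \<and>
     (\<forall>t. (\<Sum>k\<in>S. cmod (f (1 + \<i> * complex_of_real t) k)) \<le> C)"

text \<open>\<open>rb n S x C\<close> and \<open>nb n x C\<close> are the relations \<open>\<parallel>x\<parallel> \<le> C\<close>, for representatives supported in the finite set \<open>S\<close>
  and for arbitrary arrays respectively; they avoid the infimum in the norm.\<close>
definition rb :: "nat \<Rightarrow> nat set \<Rightarrow> arr \<Rightarrow> real \<Rightarrow> bool" where
  "rb n S x C \<longleftrightarrow> (\<exists>f. fcal S C f \<and> represents n f x)"

lemma represents_jet:
  "represents n f x \<longleftrightarrow> (\<forall>j k. x j k = (if j < n then fps_nth (jet (\<lambda>z. f z k)) j else 0))"
  unfolding represents_def jet_nth by (auto simp: not_less)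

lemma rb_finite: "rb n S x C \<Longrightarrow> finite S" by (auto simp: rb_def fcal_def)

lemma rb_below: "rb n S x C \<Longrightarrow> below n x" by (auto simp: rb_def represents_def below_def)

lemma rb_supp: assumes "rb n S x C" shows "supp_in S x"
proof -
  obtain f where f: "fcal S C f" "represents n f x" using assms by (auto simp: rb_def)
  have "x j k = 0" if "k \<notin> S" for j k
  proof -
    have "(\<lambda>z. f z k) = (\<lambda>z. 0)" using f(1) that by (auto simp: fcal_def)
    then show ?thesis using f(2) by (simp add: represents_jet jet_const)
  qed
  then show ?thesis by (simp add: supp_in_def)
qed

lemma rb_nonneg: assumes "rb n S x C" shows "0 \<le> C"
proof -
  obtain f where f: "fcal S C f" using assms by (auto simp: rb_def)
  then have "cmod (f (\<i> * complex_of_real 0) 0) \<le> C" unfolding fcal_def by blast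
  then show ?thesis using norm_ge_zero order_trans by blast
qed

lemma rb_mono: assumes "rb n S x C" "C \<le> D" shows "rb n S x D"
  using assms unfolding rb_def fcal_def by (meson order_trans)

lemma rb_supset: assumes "rb n S x C" "S \<subseteq> S'" "finite S'" shows "rb n S' x C"
proof -
  obtain f where f: "fcal S C f" "represents n f x" using assms by (auto simp: rb_def)
  have "(\<Sum>k\<in>S'. cmod (f (1 + \<i> * complex_of_real t) k)) = (\<Sum>k\<in>S. cmod (f (1 + \<i> * complex_of_real t) k))" for t
    using f(1) assms unfolding fcal_def by (intro sum.mono_neutral_right) auto
  then have "fcal S' C f" using f(1) assms unfolding fcal_def by (auto simp: subset_iff)
  then show ?thesis using f(2) by (auto simp: rb_def)
qed

lemma rb_zero: "finite S \<Longrightarrow> 0 \<le> C \<Longrightarrow> rb n S 0 C"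
  unfolding rb_def fcal_def represents_jet
  by (rule exI[of _ "\<lambda>z k. 0"]) (auto simp: sgood_const jet_const)

lemma rb_add: assumes "rb n S x A" "rb n S y B" shows "rb n S (x + y) (A + B)"
proof -
  obtain f where f: "fcal S A f" "represents n f x" using assms by (auto simp: rb_def)
  obtain g where g: "fcal S B g" "represents n g y" using assms by (auto simp: rb_def)
  have "fcal S (A + B) (\<lambda>z k. f z k + g z k)"
    unfolding fcal_def
  proof (intro conjI allI impI)
    show "finite S" using f by (simp add: fcal_def)
    show "sgood (\<lambda>z. f z k + g z k)" for k using f g by (auto simp: fcal_def intro: sgood_add)
    show "f z k + g z k = 0" if "k \<notin> S" for z k using f g that by (auto simp: fcal_def)
    show "cmod (f (\<i> * complex_of_real t) k + g (\<i> * complex_of_real t) k) \<le> A + B" for t k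
      using f(1) g(1) unfolding fcal_def by (meson norm_triangle_mono)
    show "(\<Sum>k\<in>S. cmod (f (1 + \<i> * complex_of_real t) k + g (1 + \<i> * complex_of_real t) k)) \<le> A + B" for t
    proof -
      have "(\<Sum>k\<in>S. cmod (f (1 + \<i> * complex_of_real t) k + g (1 + \<i> * complex_of_real t) k))
        \<le> (\<Sum>k\<in>S. cmod (f (1 + \<i> * complex_of_real t) k)) + (\<Sum>k\<in>S. cmod (g (1 + \<i> * complex_of_real t) k))"
        unfolding sum.distrib[symmetric] by (intro sum_mono norm_triangle_ineq)
      also have "\<dots> \<le> A + B" using f(1) g(1) unfolding fcal_def by (intro add_mono) auto
      finally show ?thesis .
    qed
  qed
  moreover have "represents n (\<lambda>z k. f z k + g z k) (x + y)"
    using f g by (auto simp: represents_jet fcal_def jet_add)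
  ultimately show ?thesis by (auto simp: rb_def)
qed

text \<open>The space is a module over the bounded scalar functions: multiplying a representative by
  h multiplies its jet by the jet of h.\<close>

lemma rb_mult:
  assumes x: "rb n S x A" and h: "sgood h" and b0: "\<And>t. cmod (h (\<i> * of_real t)) \<le> C"
    and b1: "\<And>t. cmod (h (1 + \<i> * of_real t)) \<le> C"
  shows "rb n S (act n (jet h) x) (C * A)"
proof -
  obtain f where f: "fcal S A f" "represents n f x" using assms by (auto simp: rb_def)
  have C0: "0 \<le> C" using b0[of 0] norm_ge_zero order_trans by blast
  have "fcal S (C * A) (\<lambda>z k. h z * f z k)"
    unfolding fcal_def
  proof (intro conjI allI impI)
    show "finite S" using f by (simp add: fcal_def)
    show "sgood (\<lambda>z. h z * f z k)" for k using f h by (auto simp: fcal_def intro: sgood_mult)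
    show "h z * f z k = 0" if "k \<notin> S" for z k using f that by (auto simp: fcal_def)
    show "cmod (h (\<i> * complex_of_real t) * f (\<i> * complex_of_real t) k) \<le> C * A" for t k
      using f(1) b0 C0 unfolding norm_mult fcal_def by (intro mult_mono) auto
    show "(\<Sum>k\<in>S. cmod (h (1 + \<i> * complex_of_real t) * f (1 + \<i> * complex_of_real t) k)) \<le> C * A" for t
      unfolding norm_mult sum_distrib_left[symmetric]
      using f(1) b1 C0 unfolding norm_mult fcal_def by (intro mult_mono sum_nonneg) auto
  qed
  moreover have "represents n (\<lambda>z k. h z * f z k) (act n (jet h) x)"
    using f h by (auto simp: represents_jet fcal_def jet_mult fps_mult_nth act_def atLeast0AtMost intro!: sum.cong)
  ultimately show ?thesis by (auto simp: rb_def)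
qed

lemma act_const: "below n x \<Longrightarrow> act n (fps_const c) x = vscale c x"
  by (auto simp: act_def fun_eq_iff below_def vscale_def sum.atMost_shift not_less)

lemma rb_scale: assumes "rb n S x A" shows "rb n S (vscale c x) (cmod c * A)"
  using rb_mult[OF assms sgood_const[of c] order_refl order_refl] rb_below[OF assms]
  by (simp add: jet_const act_const)

text \<open>Deleting coordinates of a representative increases neither boundary norm, so coordinate
  projections are contractions.\<close>

lemma rb_proj: assumes "rb n S x A" shows "rb n (S \<inter> T) (proj T x) A"
proof -
  obtain f where f: "fcal S A f" "represents n f x" using assms by (auto simp: rb_def)
  have A: "0 \<le> A" using rb_nonneg assms .
  have "fcal (S \<inter> T) A (\<lambda>z k. if k \<in> T then f z k else 0)"
    unfolding fcal_def
  proof (intro conjI allI impI)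
    show "finite (S \<inter> T)" using f by (simp add: fcal_def)
    show "sgood (\<lambda>z. if k \<in> T then f z k else 0)" for k
      using f by (cases "k \<in> T") (auto simp: fcal_def sgood_const)
    show "(if k \<in> T then f z k else 0) = 0" if "k \<notin> S \<inter> T" for z k
      using f that by (auto simp: fcal_def)
    show "cmod (if k \<in> T then f (\<i> * complex_of_real t) k else 0) \<le> A" for t k
      using f(1) A by (auto simp: fcal_def)
    show "(\<Sum>k\<in>S \<inter> T. cmod (if k \<in> T then f (1 + \<i> * complex_of_real t) k else 0)) \<le> A" for t
    proof -
      have "(\<Sum>k\<in>S \<inter> T. cmod (if k \<in> T then f (1 + \<i> * complex_of_real t) k else 0))
         = (\<Sum>k\<in>S \<inter> T. cmod (f (1 + \<i> * complex_of_real t) k))" by (intro sum.cong) auto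
      also have "\<dots> \<le> (\<Sum>k\<in>S. cmod (f (1 + \<i> * complex_of_real t) k))"
        using f(1) by (intro sum_mono2) (auto simp: fcal_def)
      also have "\<dots> \<le> A" using f(1) by (auto simp: fcal_def)
      finally show ?thesis .
    qed
  qed
  moreover have "represents n (\<lambda>z k. if k \<in> T then f z k else 0) (proj T x)"
    using f by (auto simp: represents_jet proj_def jet_const)
  ultimately show ?thesis by (auto simp: rb_def)
qed

lemma proj_supp: "supp_in S x \<Longrightarrow> S \<subseteq> T \<Longrightarrow> proj T x = x"
  by (auto simp: supp_in_def proj_def fun_eq_iff)

lemma fcal_sup: assumes f: "fcal S A f" and z: "z \<in> strip_cl" shows "cmod (f z k) \<le> A"
proof (rule strip_max[OF _ _ _ z])
  show "sgood (\<lambda>z. f z k)" using f by (simp add: fcal_def)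
  show "cmod (f (\<i> * complex_of_real t) k) \<le> A" for t using f by (simp add: fcal_def)
  show "cmod (f (1 + \<i> * complex_of_real t) k) \<le> A" for t
  proof (cases "k \<in> S")
    case True
    then have "cmod (f (1 + \<i> * complex_of_real t) k) \<le> (\<Sum>k\<in>S. cmod (f (1 + \<i> * complex_of_real t) k))"
      using f by (intro member_le_sum) (auto simp: fcal_def)
    also have "\<dots> \<le> A" using f by (simp add: fcal_def)
    finally show ?thesis .
  next
    case False
    have "0 \<le> A" using f unfolding fcal_def by (meson norm_ge_zero order_trans)
    then show ?thesis using f False by (simp add: fcal_def)
  qed
qed

lemma rb_coord: assumes "rb n S x A" shows "cmod (x j k) \<le> 4^n * A"
proof (cases "j < n")
  case True
  obtain f where f: "fcal S A f" "represents n f x" using assms by (auto simp: rb_def)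
  have "cmod (x j k) \<le> 4^j * A"
    using f True jet_bound[OF _ fcal_sup[OF f(1)]] by (auto simp: represents_jet fcal_def)
  also have "\<dots> \<le> 4^n * A" using True rb_nonneg[OF assms] by (intro mult_right_mono power_increasing) auto
  finally show ?thesis .
next
  case False
  then show ?thesis using rb_below[OF assms] rb_nonneg[OF assms] by (simp add: below_def)
qed

lemma act_mult: "act n (p * q) x = act n p (act n q x)"
proof (intro ext)
  fix j k
  show "act n (p * q) x j k = act n p (act n q x) j k"
  proof (cases "j < n")
    case True
    define X where "X = Abs_fps (\<lambda>j. x j k)"
    have a: "act n p x j k = fps_nth (p * Abs_fps (\<lambda>j. x j k)) j" if "j < n" for p x j
      using that by (simp add: act_def fps_mult_nth atLeast0AtMost)
    have "act n p (act n q x) j k = (\<Sum>i\<le>j. fps_nth p i * fps_nth (q * X) (j - i))"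
      using True by (simp add: act_def[of n p] a X_def)
    also have "\<dots> = fps_nth (p * (q * X)) j" by (simp add: fps_mult_nth[of p] atLeast0AtMost)
    also have "\<dots> = act n (p * q) x j k" using True by (simp add: a X_def mult.assoc)
    finally show ?thesis by simp
  qed (simp add: act_def)
qed

lemma act_add: "act n (p + q) x = act n p x + act n q x"
  by (auto simp: act_def fun_eq_iff algebra_simps sum.distrib)

lemma act_add_right: "act n p (x + y) = act n p x + act n p y"
  by (auto simp: act_def fun_eq_iff algebra_simps sum.distrib)

lemma act_cong: "(\<And>i. i < n \<Longrightarrow> fps_nth p i = fps_nth q i) \<Longrightarrow> act n p x = act n q x"
  by (auto simp: act_def fun_eq_iff intro!: sum.cong)

lemma act_one: "below n x \<Longrightarrow> act n 1 x = x"
  using act_const[of n x 1] by (simp add: vscale_def fps_const_1_eq_1)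

lemma act_X_power: "act n (fps_X ^ m) x j k = (if j < n \<and> m \<le> j then x (j - m) k else 0)"
proof (cases "j < n \<and> m \<le> j")
  case True
  have "(\<Sum>i\<le>j. fps_nth (fps_X ^ m) i * x (j - i) k) = (\<Sum>i\<in>{m}. x (j - i) k)"
    using True by (intro sum.mono_neutral_cong_right) (auto simp: fps_X_power_nth)
  then show ?thesis using True by (simp add: act_def)
next
  case False
  then show ?thesis by (auto simp: act_def fps_X_power_nth intro!: sum.neutral)
qed

lemma supp_in_act: "supp_in S x \<Longrightarrow> supp_in S (act n p x)"
  by (auto simp: supp_in_def act_def)

lemma below_act: "below n (act n p x)" by (simp add: below_def act_def)

lemma proj_act: "proj S (act n p x) = act n p (proj S x)"
  by (auto simp: proj_def act_def fun_eq_iff)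

text \<open>The Cayley transform of the right half plane onto the disc with its zero at 1/2: bounded
  by 1 on the strip, with a simple zero at the point where jets are taken.\<close>

definition dfun :: "complex \<Rightarrow> complex" where "dfun z = (z - 1/2) / (z + 1/2)"

lemma strip_plus_half_nz: "z \<in> strip_cl \<Longrightarrow> z + 1/2 \<noteq> 0"
proof
  assume "z \<in> strip_cl" "z + 1/2 = 0"
  then have "Re (z + 1/2) = 0" "0 \<le> Re z" by (auto simp: strip_cl_def)
  then show False by simp
qed

lemma dfun_le_1: assumes "z \<in> strip_cl" shows "cmod (dfun z) \<le> 1"
proof -
  have "cmod (z - 1/2) \<le> cmod (z + 1/2)"
  proof (rule power2_le_imp_le)
    show "(cmod (z - 1/2))\<^sup>2 \<le> (cmod (z + 1/2))\<^sup>2"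
      using assms unfolding cmod_power2 by (simp add: strip_cl_def power2_eq_square algebra_simps)
  qed simp
  then show ?thesis using strip_plus_half_nz[OF assms] by (simp add: dfun_def norm_divide divide_le_eq_1)
qed

lemma sgood_dfun: "sgood dfun"
  unfolding sgood_def
proof (intro conjI)
  show "continuous_on strip_cl dfun"
    unfolding dfun_def[abs_def] using strip_plus_half_nz by (intro continuous_intros) auto
  show "dfun holomorphic_on strip_open"
    unfolding dfun_def[abs_def] using strip_plus_half_nz strip_open_subset_cl by (intro holomorphic_intros) auto
  show "bounded (dfun ` strip_cl)" using dfun_le_1 by (auto intro!: boundedI[of _ 1])
qed

lemma jet_dfun: "jet dfun = fps_X * inverse (1 + fps_X)"
proof (rule jet_eqI[OF sgood_dfun])
  have 1: "(\<lambda>x::complex. 1 + x) has_fps_expansion 1 + fps_X"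
    by (rule has_fps_expansion_add[OF has_fps_expansion_1 has_fps_expansion_fps_X])
  have "fps_nth (1 + fps_X :: complex fps) 0 \<noteq> 0" by simp
  note 2 = has_fps_expansion_mult[OF has_fps_expansion_fps_X has_fps_expansion_inverse[OF 1 this]]
  have "(\<lambda>x. dfun (1/2 + x)) = (\<lambda>x::complex. x * inverse (1 + x))"
  proof
    fix x :: complex
    have "1/2 + x - 1/2 = x" "1/2 + x + 1/2 = 1 + x" by simp_all
    then show "dfun (1/2 + x) = x * inverse (1 + x)" unfolding dfun_def divide_inverse by simp
  qed
  then show "(\<lambda>x. dfun (1/2 + x)) has_fps_expansion fps_X * inverse (1 + fps_X)"
    using 2 by (simp only:)
qed

text \<open>Multiplication by \<open>z - 1/2\<close> is not bounded on the strip, but its jet of order \<open>n\<close> agrees with that of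
  the bounded function \<open>d + d^2 + \<dots> + d^(n-1)\<close>, because \<open>d = \<zeta> / (1 + \<zeta>)\<close> means \<open>\<zeta> = d / (1 - d)\<close>.\<close>
lemma rb_act_X: assumes "rb n S x A" shows "rb n S (act n fps_X x) (n * A)"
proof -
  define h where "h = (\<lambda>z. \<Sum>m\<in>{1..<n}. dfun z ^ m)"
  have p: "sgood (\<lambda>z. dfun z ^ m) \<and> jet (\<lambda>z. dfun z ^ m) = jet dfun ^ m" for m
    by (induction m) (auto simp: sgood_const jet_const jet_mult[OF sgood_dfun] intro: sgood_mult sgood_dfun)
  have h: "sgood h" unfolding h_def using p by (intro sgood_sum) auto
  have jh: "jet h = (\<Sum>m\<in>{1..<n}. jet dfun ^ m)" unfolding h_def using p by (subst jet_sum) auto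
  have b: "cmod (h z) \<le> n" if "z \<in> strip_cl" for z
  proof -
    have "cmod (h z) \<le> (\<Sum>m\<in>{1..<n}. cmod (dfun z ^ m))" unfolding h_def by (rule norm_sum)
    also have "\<dots> \<le> (\<Sum>m\<in>{1..<n}. 1)"
      using dfun_le_1[OF that] by (intro sum_mono) (auto simp: norm_power power_le_one)
    also have "\<dots> \<le> n" by simp
    finally show ?thesis .
  qed
  define d where "d = jet dfun"
  have d: "d * (1 + fps_X) = fps_X" unfolding d_def jet_dfun
    by (simp add: mult.assoc inverse_mult_eq_1)
  have geo: "jet h * (1 - d) = d - d ^ n" if "n \<ge> 1" 
  proof -
    have "(\<Sum>m\<in>{1..<k}. d ^ m) * (1 - d) = d - d ^ k" if "k \<ge> 1" for k
      using that
    proof (induction k rule: nat_induct_at_least)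
      case (Suc k)
      have "(\<Sum>m\<in>{1..<Suc k}. d ^ m) * (1 - d) = (\<Sum>m\<in>{1..<k}. d ^ m) * (1 - d) + d ^ k * (1 - d)"
        using Suc.hyps by (simp add: atLeastLessThanSuc distrib_right)
      also have "\<dots> = d - d ^ Suc k" unfolding Suc.IH by (simp add: algebra_simps)
      finally show ?case .
    qed auto
    then show ?thesis using that unfolding jh d_def by blast
  qed
  have one: "(1 - d) * (1 + fps_X) = 1" using d by (simp add: algebra_simps)
  have "act n (jet h) x = act n fps_X x"
  proof (cases "n \<ge> 1")
    case True
    \<comment> \<open>\<open>1 - d\<close> inverts 1 + X, so the geometric sum equals X up to a
      multiple of d^n, which starts in order n and is invisible to n-jets.\<close>
    have "jet h = jet h * ((1 - d) * (1 + fps_X))" using one by simp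
    also have "\<dots> = (d - d ^ n) * (1 + fps_X)" using geo[OF True] by (simp add: mult.assoc[symmetric])
    also have "\<dots> = fps_X - d ^ n * (1 + fps_X)" using d by (simp add: algebra_simps)
    finally have 1: "jet h = fps_X - d ^ n * (1 + fps_X)" .
    obtain e where e: "d = fps_X * e" unfolding d_def jet_dfun by blast
    have "d ^ n * (1 + fps_X) = fps_X ^ n * (e ^ n * (1 + fps_X))" by (simp add: e power_mult_distrib mult.assoc)
    then have "fps_nth (d ^ n * (1 + fps_X)) i = 0" if "i < n" for i
      using that by (simp only:) (simp add: fps_X_power_mult_nth)
    then show ?thesis using 1 by (intro act_cong) simp
  qed (simp add: act_def)
  then show ?thesis
    using rb_mult[OF assms h, of "real n"] b by (auto simp: strip_cl_def)
qed

section \<open>Block vectors and norming functionals\<close>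


lemma rb_act_X_power: assumes "rb n S x A" shows "rb n S (act n (fps_X ^ m) x) (real n ^ m * A)"
proof (induction m)
  case 0
  then show ?case using assms act_one[OF rb_below[OF assms]] by simp
next
  case (Suc m)
  have "act n (fps_X ^ Suc m) x = act n fps_X (act n (fps_X ^ m) x)" by (simp add: act_mult)
  then show ?case using rb_act_X[OF Suc.IH] by (simp add: mult.assoc)
qed

lemma rb_sum: fixes x :: "'i \<Rightarrow> arr" assumes "finite I" "finite S" "\<And>i. i \<in> I \<Longrightarrow> rb n S (x i) (A i)" shows "rb n S (\<Sum>i\<in>I. x i) (\<Sum>i\<in>I. A i)"
  using assms(1,3)
proof (induction I rule: finite_induct)
  case empty
  show ?case by (simp only: sum.empty) (rule rb_zero[OF assms(2) order_refl])
next
  case (insert a I)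
  have a: "rb n S (x a) (A a)" using insert.prems by blast
  have I: "rb n S (\<Sum>i\<in>I. x i) (\<Sum>i\<in>I. A i)" using insert.prems by (intro insert.IH) blast
  show ?case by (simp only: sum.insert[OF insert.hyps]) (rule rb_add[OF a I])
qed

lemma act_expand: "act n p x = (\<Sum>i<n. vscale (fps_nth p i) (act n (fps_X ^ i) x))"
proof (intro ext)
  fix j k
  show "act n p x j k = (\<Sum>i<n. vscale (fps_nth p i) (act n (fps_X ^ i) x)) j k"
  proof (cases "j < n")
    case True
    have "(\<Sum>i<n. fps_nth p i * (if i \<le> j then x (j - i) k else 0)) = (\<Sum>i\<le>j. fps_nth p i * x (j - i) k)"
      using True by (intro sum.mono_neutral_cong_right) auto
    then show ?thesis using True by (simp add: act_def[of n p] sum_fun_apply vscale_def act_X_power)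
  next
    case False
    then show ?thesis by (simp add: act_def[of n p] sum_fun_apply vscale_def act_X_power)
  qed
qed

text \<open>Bound for \<open>act n p\<close> per unit of the coefficients of p: X^i acts with norm
  at most n^i.\<close>

definition cact :: "nat \<Rightarrow> real" where "cact n = (\<Sum>i<n. real n ^ i)"

lemma cact_nonneg: "0 \<le> cact n" by (simp add: cact_def sum_nonneg)

lemma rb_act: assumes x: "rb n S x A" and p: "\<And>i. i < n \<Longrightarrow> cmod (fps_nth p i) \<le> P"
  shows "rb n S (act n p x) (cact n * P * A)"
proof -
  have "rb n S (act n p x) (\<Sum>i<n. cmod (fps_nth p i) * (real n ^ i * A))"
    unfolding act_expand[of n p] by (intro rb_sum rb_scale rb_act_X_power rb_finite[OF x] x) auto
  moreover have "(\<Sum>i<n. cmod (fps_nth p i) * (real n ^ i * A)) \<le> (\<Sum>i<n. P * (real n ^ i * A))"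
    using p rb_nonneg[OF x] by (intro sum_mono mult_right_mono) auto
  moreover have "(\<Sum>i<n. P * (real n ^ i * A)) = cact n * P * A"
    by (simp add: cact_def sum_distrib_left sum_distrib_right mult_ac)
  ultimately show ?thesis using rb_mono by metis
qed

lemma uvec_0: assumes "n \<ge> 1" shows "rb n {k} (uvec k 0) 1"
proof -
  have "fcal {k} 1 (\<lambda>z i. if i = k then 1 else 0)"
    unfolding fcal_def by (auto simp: sgood_const)
  moreover have "represents n (\<lambda>z i. if i = k then 1 else 0) (uvec k 0)"
    using assms by (auto simp: represents_jet uvec_def jet_const)
  ultimately show ?thesis by (auto simp: rb_def)
qed

lemma uvec_act: "l < n \<Longrightarrow> uvec k l = act n (fps_X ^ l) (uvec k 0)"
  by (auto simp: fun_eq_iff act_X_power uvec_def)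

text \<open>The constant \<open>real n ^ n\<close> dominates the bounds n^l for all shifts X^l with
  l < n at once; this is its meaning wherever it recurs.\<close>

lemma rb_uvec: assumes "l < n" shows "rb n {k} (uvec k l) (real n ^ n)"
proof -
  have "rb n {k} (uvec k l) (real n ^ l * 1)"
    unfolding uvec_act[OF assms] using assms by (intro rb_act_X_power uvec_0) auto
  moreover have "real n ^ l * 1 \<le> real n ^ n" using assms by (simp add: power_increasing)
  ultimately show ?thesis using rb_mono by blast
qed

text \<open>Local pairing at coordinate \<open>k\<close>: the coefficient of \<open>\<zeta>\<^sup>n\<^sup>-\<^sup>1\<close> in \<open>f(1/2 + \<zeta>) g(1/2 - \<zeta>)\<close>. \<close>
definition bp :: "nat \<Rightarrow> arr \<Rightarrow> arr \<Rightarrow> nat \<Rightarrow> complex" where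
  "bp n x y k = (\<Sum>i<n. (-1) ^ i * x (n - 1 - i) k * y i k)"

text \<open>The reflection z to 1 - z exchanges the boundary lines, so that on each of them an
  l-infinity bound for one factor meets an l1 bound for the other. The sum of products is therefore
  bounded by A D on the strip, and the pairing is one of its Taylor coefficients.\<close>

lemma bp_bound:
  assumes x: "rb n S x A" and y: "rb n S' y D" and T: "finite T"
  shows "cmod (\<Sum>k\<in>T. bp n x y k) \<le> 4 ^ n * (A * D)"
proof -
  obtain f where f: "fcal (S \<inter> T) A f" "represents n f (proj T x)" using rb_proj[OF x, of T] by (auto simp: rb_def)
  obtain g where g: "fcal (S' \<inter> T) D g" "represents n g (proj T y)" using rb_proj[OF y, of T] by (auto simp: rb_def)
  have A0: "0 \<le> A" "0 \<le> D" using x y rb_nonneg by auto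
  define h where "h = (\<lambda>z. \<Sum>k\<in>T. g (1 - z) k * f z k)"
  have sg: "sgood (\<lambda>z. g (1 - z) k)" for k using g sgood_reflect[of "\<lambda>z. g z k"] by (simp add: fcal_def)
  have sf: "sgood (\<lambda>z. f z k)" for k using f by (simp add: fcal_def)
  have h: "sgood h" unfolding h_def by (intro sgood_sum sgood_mult sg sf)
  have F1: "(\<Sum>k\<in>T. cmod (f (1 + \<i> * complex_of_real t) k)) \<le> A" for t
  proof -
    have "(\<Sum>k\<in>T. cmod (f (1 + \<i> * complex_of_real t) k)) = (\<Sum>k\<in>S \<inter> T. cmod (f (1 + \<i> * complex_of_real t) k))"
      using f(1) T by (intro sum.mono_neutral_right) (auto simp: fcal_def)
    also have "\<dots> \<le> A" using f(1) by (simp add: fcal_def)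
    finally show ?thesis .
  qed
  have G1: "(\<Sum>k\<in>T. cmod (g (1 + \<i> * complex_of_real t) k)) \<le> D" for t
  proof -
    have "(\<Sum>k\<in>T. cmod (g (1 + \<i> * complex_of_real t) k)) = (\<Sum>k\<in>S' \<inter> T. cmod (g (1 + \<i> * complex_of_real t) k))"
      using g(1) T by (intro sum.mono_neutral_right) (auto simp: fcal_def)
    also have "\<dots> \<le> D" using g(1) by (simp add: fcal_def)
    finally show ?thesis .
  qed
  have b: "cmod (h z) \<le> A * D" if "z \<in> strip_cl" for z
  proof (rule strip_max[OF h _ _ that])
    fix t
    have e: "1 - \<i> * complex_of_real t = 1 + \<i> * complex_of_real (-t)" by simp
    have "cmod (h (\<i> * complex_of_real t)) \<le> (\<Sum>k\<in>T. cmod (g (1 + \<i> * complex_of_real (-t)) k) * A)"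
      unfolding h_def e[symmetric] using f(1)
      by (intro order_trans[OF norm_sum] sum_mono) (auto simp: norm_mult fcal_def intro!: mult_left_mono)
    also have "\<dots> \<le> D * A" unfolding sum_distrib_right[symmetric] using G1[of "-t"] A0 by (intro mult_right_mono) simp_all
    finally show "cmod (h (\<i> * complex_of_real t)) \<le> A * D" by (simp add: mult.commute)
    have e: "1 - (1 + \<i> * complex_of_real t) = \<i> * complex_of_real (-t)" by simp
    have "cmod (h (1 + \<i> * complex_of_real t)) \<le> (\<Sum>k\<in>T. D * cmod (f (1 + \<i> * complex_of_real t) k))"
      unfolding h_def e using g(1)
      by (intro order_trans[OF norm_sum] sum_mono) (auto simp: norm_mult fcal_def simp del: of_real_minus intro!: mult_right_mono)
    also have "\<dots> \<le> D * A" unfolding sum_distrib_left[symmetric] using F1 A0 by (intro mult_left_mono) auto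
    finally show "cmod (h (1 + \<i> * complex_of_real t)) \<le> A * D" by (simp add: mult.commute)
  qed
  show ?thesis
  \<comment> \<open>For n = 0 the pairing is an empty sum, whereas the coefficient of order n - 1
    would be that of order 0.\<close>
  proof (cases "n = 0")
    case True
    then show ?thesis using A0 by (simp add: bp_def)
  next
    case False
    have jk: "fps_nth (jet (\<lambda>z. g (1 - z) k * f z k)) (n - 1) = bp n x y k" if "k \<in> T" for k
    proof -
      have "fps_nth (jet (\<lambda>z. g (1 - z) k * f z k)) (n - 1) =
         (\<Sum>i\<le>n - 1. fps_nth (jet (\<lambda>z. g (1 - z) k)) i * fps_nth (jet (\<lambda>z. f z k)) (n - 1 - i))"
        by (simp add: jet_mult[OF sg sf] fps_mult_nth atLeast0AtMost)
      also have "\<dots> = (\<Sum>i<n. (-1) ^ i * x (n - 1 - i) k * y i k)"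
      proof (intro sum.cong)
        show "{..n - 1} = {..<n}" using False by auto
        fix i assume "i \<in> {..<n}"
        then have i: "i < n" "n - 1 - i < n" by auto
        have "fps_nth (jet (\<lambda>z. g (1 - z) k)) i = (-1) ^ i * y i k"
          using jet_reflect[of "\<lambda>z. g z k" i] g(1) g(2)[unfolded represents_jet, rule_format, of i k] i that
          by (simp add: fcal_def proj_def)
        moreover have "fps_nth (jet (\<lambda>z. f z k)) (n - 1 - i) = x (n - 1 - i) k"
          using f(2)[unfolded represents_jet, rule_format, of "n - 1 - i" k] i that by (simp add: proj_def)
        ultimately show "fps_nth (jet (\<lambda>z. g (1 - z) k)) i * fps_nth (jet (\<lambda>z. f z k)) (n - 1 - i) = (-1) ^ i * x (n - 1 - i) k * y i k"
          by simp
      qed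
      finally show ?thesis by (simp add: bp_def)
    qed
    have "jet h = (\<Sum>k\<in>T. jet (\<lambda>z. g (1 - z) k * f z k))"
      unfolding h_def by (rule jet_sum) (intro sgood_mult sg sf)
    then have "fps_nth (jet h) (n - 1) = (\<Sum>k\<in>T. bp n x y k)" using jk by (simp add: fps_sum_nth)
    then have "cmod (\<Sum>k\<in>T. bp n x y k) \<le> 4 ^ (n - 1) * (A * D)" using jet_bound[OF h b, of "n - 1"] by simp
    also have "\<dots> \<le> 4 ^ n * (A * D)" using A0 by (intro mult_right_mono power_increasing) auto
    finally show ?thesis .
  qed
qed

text \<open>On the sum of \<open>N\<close> disjoint functions the norm is at most \<open>A\<close> on the left and \<open>N A\<close> on the right
  boundary line; the factor \<open>N\<^sup>1\<^sup>/\<^sup>2\<^sup>-\<^sup>z\<close> balances the two.\<close>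
lemma rb_disjoint_sum:
  fixes x :: "'i \<Rightarrow> arr"
  assumes I: "finite I" "card I = N" "N \<ge> 1" and disj: "disjoint_family_on S I"
    and x: "\<And>i. i \<in> I \<Longrightarrow> rb n (S i) (x i) A"
  shows "rb n (\<Union>i\<in>I. S i) (act n (fps_exp (- of_real (ln N))) (\<Sum>i\<in>I. x i)) (sqrt N * A)"
proof -
  have "\<exists>f. \<forall>i\<in>I. fcal (S i) A (f i) \<and> represents n (f i) (x i)"
    using x unfolding rb_def by (intro bchoice) auto
  then obtain f where f: "\<And>i. i \<in> I \<Longrightarrow> fcal (S i) A (f i)" "\<And>i. i \<in> I \<Longrightarrow> represents n (f i) (x i)" by blast
  obtain i0 where "i0 \<in> I" using I by (metis card.empty ex_in_conv not_one_le_zero)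
  then have A0: "0 \<le> A" using x rb_nonneg by blast
  define L where "L = ln (real N)"
  have N0: "real N > 0" using I by simp
  define h where "h = (\<lambda>z::complex. exp (of_real (- L) * z + of_real (L/2)))"
  define F where "F = (\<lambda>z k. h z * (\<Sum>i\<in>I. f i z k))"
  have hg: "sgood h" unfolding h_def by (rule sgood_exp)
  have jh: "jet h = fps_exp (- of_real L)"
    unfolding h_def by (subst jet_exp) simp
  have sq: "exp (L/2) = sqrt N"
  proof -
    have "L/2 = ln (sqrt N)" unfolding L_def using N0 by (simp add: ln_sqrt)
    moreover have "exp (ln (sqrt N)) = sqrt N" using N0 by (intro exp_ln) simp
    ultimately show ?thesis by simp
  qed
  have h0: "cmod (h (\<i> * of_real t)) = sqrt N" for t
    unfolding h_def norm_exp_eq_Re using sq by simp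
  have h1: "cmod (h (1 + \<i> * of_real t)) = 1 / sqrt N" for t
  proof -
    have "cmod (h (1 + \<i> * of_real t)) = exp (- (L/2))" unfolding h_def norm_exp_eq_Re by simp
    then show ?thesis by (simp add: exp_minus sq inverse_eq_divide)
  qed
  have sgf: "sgood (\<lambda>z. f i z k)" if "i \<in> I" for i k using f(1)[OF that] by (simp add: fcal_def)
  have uniq: "(\<Sum>i\<in>I. f i z k) = f j z k" if "j \<in> I" "k \<in> S j" for j k and z :: complex
  proof -
    have "f i z k = 0" if "i \<in> I" "i \<noteq> j" for i
    proof -
      have "k \<notin> S i" using disj \<open>j \<in> I\<close> \<open>k \<in> S j\<close> that unfolding disjoint_family_on_def by blast
      then show ?thesis using f(1)[OF that(1)] by (simp add: fcal_def)
    qed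
    then have "(\<Sum>i\<in>I. f i z k) = (\<Sum>i\<in>{j}. f i z k)" using I that by (intro sum.mono_neutral_right) auto
    then show ?thesis by simp
  qed
  have nul: "(\<Sum>i\<in>I. f i z k) = 0" if "k \<notin> (\<Union>i\<in>I. S i)" for k and z :: complex
    using f(1) that by (intro sum.neutral) (auto simp: fcal_def)
  have "fcal (\<Union>i\<in>I. S i) (sqrt N * A) F"
    unfolding fcal_def
  proof (intro conjI allI impI)
    show fin: "finite (\<Union>i\<in>I. S i)" using I f(1) by (auto simp: fcal_def)
    show "sgood (\<lambda>z. F z k)" for k unfolding F_def by (intro sgood_mult hg sgood_sum sgf)
    show "F z k = 0" if "k \<notin> (\<Union>i\<in>I. S i)" for z k unfolding F_def nul[OF that] by simp
    show "cmod (F (\<i> * complex_of_real t) k) \<le> sqrt N * A" for t k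
    proof (cases "k \<in> (\<Union>i\<in>I. S i)")
      case True
      then obtain j where j: "j \<in> I" "k \<in> S j" by auto
      then have "cmod (f j (\<i> * complex_of_real t) k) \<le> A" using f(1) by (auto simp: fcal_def)
      then show ?thesis unfolding F_def uniq[OF j] norm_mult h0 by (intro mult_left_mono) auto
    next
      case False
      then show ?thesis unfolding F_def using nul[OF False] A0 by simp
    qed
    show "(\<Sum>k\<in>(\<Union>i\<in>I. S i). cmod (F (1 + \<i> * complex_of_real t) k)) \<le> sqrt N * A" for t
    proof -
      let ?w = "1 + \<i> * complex_of_real t"
      have "(\<Sum>k\<in>(\<Union>i\<in>I. S i). cmod (F ?w k)) = (\<Sum>j\<in>I. \<Sum>k\<in>S j. cmod (F ?w k))"
        using I f(1) disj by (intro sum.UNION_disjoint) (auto simp: fcal_def disjoint_family_on_def)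
      also have "\<dots> = (\<Sum>j\<in>I. \<Sum>k\<in>S j. 1 / sqrt N * cmod (f j ?w k))"
        by (intro sum.cong) (auto simp: F_def uniq norm_mult h1)
      also have "\<dots> \<le> (\<Sum>j\<in>I. 1 / sqrt N * A)"
        unfolding sum_distrib_left[symmetric] using f(1) by (intro sum_mono mult_left_mono) (auto simp: fcal_def)
      also have "\<dots> = N / sqrt N * A" using I by simp
      also have "N / sqrt N = sqrt N" using N0 by (simp add: real_div_sqrt)
      finally show ?thesis .
    qed
  qed
  moreover have "represents n F (act n (fps_exp (- of_real (ln N))) (\<Sum>i\<in>I. x i))"
    unfolding represents_jet
  proof (intro allI)
    fix j k
    have 1: "jet (\<lambda>z. F z k) = jet h * (\<Sum>i\<in>I. jet (\<lambda>z. f i z k))"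
      unfolding F_def by (subst jet_mult) (auto simp: hg sgf jet_sum intro!: sgood_sum)
    have 2: "(\<Sum>i\<in>I. x i) j k = fps_nth (\<Sum>i\<in>I. jet (\<lambda>z. f i z k)) j" if "j < n" for j
      unfolding sum_fun_apply fps_sum_nth using f(2) that by (intro sum.cong) (auto simp: represents_jet)
    show "act n (fps_exp (- of_real (ln N))) (\<Sum>i\<in>I. x i) j k = (if j < n then fps_nth (jet (\<lambda>z. F z k)) j else 0)"
      unfolding 1 by (simp add: act_def jh L_def fps_mult_nth atLeast0AtMost 2)
  qed
  ultimately show ?thesis unfolding rb_def by blast
qed

text \<open>The twist is undone by exp(s X) with s = ln N, whose coefficients of order below n are
  at most (1 + s)^n; so only logarithms are lost against sqrt N.\<close>

lemma rb_disjoint_sum_bound: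
  fixes x :: "'i \<Rightarrow> arr"
  assumes I: "finite I" "card I = N" "N \<ge> 1" and disj: "disjoint_family_on S I"
    and x: "\<And>i. i \<in> I \<Longrightarrow> rb n (S i) (x i) A"
  shows "rb n (\<Union>i\<in>I. S i) (\<Sum>i\<in>I. x i) (cact n * (1 + ln N) ^ n * (sqrt N * A))"
proof -
  define s where "s = ln (real N)"
  have s: "0 \<le> s" using I by (simp add: s_def)
  have bel: "below n (\<Sum>i\<in>I. x i)" using rb_below[OF x] by (auto simp: below_def sum_fun_apply)
  have "act n (fps_exp (of_real s)) (act n (fps_exp (- of_real s)) (\<Sum>i\<in>I. x i)) = (\<Sum>i\<in>I. x i)"
    unfolding act_mult[symmetric] fps_exp_add_mult[symmetric] using act_one[OF bel] by simp
  moreover have "rb n (\<Union>i\<in>I. S i) (act n (fps_exp (of_real s)) (act n (fps_exp (- of_real s)) (\<Sum>i\<in>I. x i)))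
     (cact n * (1 + s) ^ n * (sqrt N * A))"
  proof (rule rb_act)
    show "rb n (\<Union>i\<in>I. S i) (act n (fps_exp (- of_real s)) (\<Sum>i\<in>I. x i)) (sqrt N * A)"
      unfolding s_def by (rule rb_disjoint_sum[OF assms])
    fix i assume i: "i < n"
    have "cmod (fps_nth (fps_exp (complex_of_real s)) i) = s ^ i / fact i"
      using s by (simp add: norm_divide norm_power)
    also have "\<dots> \<le> s ^ i" using s mult_left_mono[OF fact_ge_1, of "s ^ i" i] by (simp add: divide_le_eq)
    also have "\<dots> \<le> (1 + s) ^ i" using s by (intro power_mono) auto
    also have "\<dots> \<le> (1 + s) ^ n" using s i by (intro power_increasing) auto
    finally show "cmod (fps_nth (fps_exp (complex_of_real s)) i) \<le> (1 + s) ^ n" .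
  qed
  ultimately show ?thesis by (simp add: s_def)
qed

text \<open>This is \<open>a \<bar>a\<bar>\<^sup>2\<^sup>z\<^sup>-\<^sup>1\<close>, an extremal of the interpolation between \<open>\<ell>\<^sub>\<infinity>\<close> and \<open>\<ell>\<^sub>1\<close>; it is \<open>0\<close> for \<open>a = 0\<close>, as \<open>ln 0 = 0\<close>.\<close>
definition xpow :: "complex \<Rightarrow> complex \<Rightarrow> complex" where
  "xpow a z = a * exp (of_real (2 * ln (cmod a)) * z + of_real (- ln (cmod a)))"

lemma sgood_xpow: "sgood (xpow a)"
  unfolding xpow_def[abs_def] by (rule sgood_mult[OF sgood_const sgood_exp])

text \<open>Lift of a scalar sequence to an array: slot 0 is u itself, and slot j carries u_k (2 ln
  |u_k|)^j / j!, the logarithmic terms typical of these spaces.\<close>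

definition xvec :: "nat \<Rightarrow> (nat \<Rightarrow> complex) \<Rightarrow> arr" where
  "xvec n u = (\<lambda>j k. if j < n then fps_nth (jet (xpow (u k))) j else 0)"

lemma xvec_0: "n \<ge> 1 \<Longrightarrow> xvec n u 0 k = u k"
  by (simp add: xvec_def jet_nth xpow_def)

lemma cmod_xpow: "a \<noteq> 0 \<Longrightarrow> cmod (xpow a z) = exp (2 * Re z * ln (cmod a))"
proof -
  assume "a \<noteq> 0"
  then have "cmod a = exp (ln (cmod a))" by simp
  then have "cmod (xpow a z) = exp (ln (cmod a)) * exp (2 * ln (cmod a) * Re z - ln (cmod a))"
    unfolding xpow_def norm_mult norm_exp_eq_Re by simp
  also have "\<dots> = exp (2 * Re z * ln (cmod a))" unfolding exp_add[symmetric] by (simp add: mult_ac)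
  finally show ?thesis .
qed

lemma xpow_0: "a \<noteq> 0 \<Longrightarrow> cmod (xpow a (\<i> * of_real t)) = 1"
  by (simp add: cmod_xpow)

lemma xpow_1: "cmod (xpow a (1 + \<i> * of_real t)) = (cmod a)\<^sup>2"
proof (cases "a = 0")
  case False
  then have "cmod (xpow a (1 + \<i> * of_real t)) = exp (ln (cmod a) + ln (cmod a))" by (simp add: cmod_xpow)
  then show ?thesis using False by (simp only: exp_add) (simp add: power2_eq_square)
qed (simp add: xpow_def)

definition unit_on :: "nat set \<Rightarrow> (nat \<Rightarrow> complex) \<Rightarrow> bool" where
  "unit_on S u \<longleftrightarrow> finite S \<and> (\<forall>k. k \<notin> S \<longrightarrow> u k = 0) \<and> (\<Sum>k\<in>S. (cmod (u k))\<^sup>2) = 1"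

text \<open>On the left line all moduli of the extremal are at most 1; on the right line they are
  the squares |u_k|^2, whose sum is 1.\<close>

lemma rb_xvec: assumes u: "unit_on S u" shows "rb n S (xvec n u) 1"
proof -
  have "fcal S 1 (\<lambda>z k. xpow (u k) z)"
    unfolding fcal_def
  proof (intro conjI allI impI)
    show "finite S" using u by (simp add: unit_on_def)
    show "sgood (xpow (u k))" for k by (rule sgood_xpow)
    show "xpow (u k) z = 0" if "k \<notin> S" for k z using u that by (simp add: unit_on_def xpow_def)
    show "cmod (xpow (u k) (\<i> * complex_of_real t)) \<le> 1" for k t
      using xpow_0[of "u k" t] by (cases "u k = 0") (simp_all add: xpow_def[of 0])
    show "(\<Sum>k\<in>S. cmod (xpow (u k) (1 + \<i> * complex_of_real t))) \<le> 1" for t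
      using u by (simp add: xpow_1 unit_on_def)
  qed
  moreover have "represents n (\<lambda>z k. xpow (u k) z) (xvec n u)"
    by (simp add: represents_jet xvec_def)
  ultimately show ?thesis by (auto simp: rb_def)
qed

lemma bp_add: "bp n x (y + z) k = bp n x y k + bp n x z k"
  by (simp add: bp_def algebra_simps sum.distrib)
lemma bp_scale: "bp n x (vscale c y) k = c * bp n x y k"
  by (simp add: bp_def vscale_def sum_distrib_left mult_ac)

section \<open>The l2 norm of a slot and norming vectors\<close>

definition slot_norm :: "nat set \<Rightarrow> arr \<Rightarrow> nat \<Rightarrow> real" where
  "slot_norm S y q = sqrt (\<Sum>k\<in>S. (cmod (y q k))\<^sup>2)"

lemma slot_norm_nonneg: "0 \<le> slot_norm S y q" by (simp add: slot_norm_def sum_nonneg)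

lemma slot_norm_power2: "(slot_norm S y q)\<^sup>2 = (\<Sum>k\<in>S. (cmod (y q k))\<^sup>2)" by (simp add: slot_norm_def sum_nonneg)

text \<open>Shifting by n - 1 - q arranges that only slot q of y is met: lower slots of y vanish,
  and opposite the higher ones the shifted jet vanishes. With u the conjugate of y_q divided by its
  norm, the pairing becomes the l2 norm.\<close>

lemma slot_pairing:
  assumes S: "finite S" and su: "supp_in S y" and q: "q < n" and z: "\<forall>j<q. \<forall>k. y j k = 0" and s: "slot_norm S y q > 0"
  shows "\<exists>u. unit_on S u \<and> cmod (\<Sum>k\<in>S. bp n (act n (fps_X ^ (n - 1 - q)) (xvec n u)) y k) = slot_norm S y q"
proof -
  define s where "s = slot_norm S y q"
  have s0: "s > 0" and s2: "s\<^sup>2 = (\<Sum>k\<in>S. (cmod (y q k))\<^sup>2)" using s slot_norm_power2 by (simp_all add: s_def)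
  define u where "u = (\<lambda>k. cnj (y q k) / of_real s)"
  have un: "unit_on S u"
    using S su s2 s0 unfolding unit_on_def u_def
    by (auto simp: supp_in_def norm_divide power_divide sum_divide_distrib[symmetric])
  have "bp n (act n (fps_X ^ (n - 1 - q)) (xvec n u)) y k = (-1) ^ q * (of_real ((cmod (y q k))\<^sup>2) / of_real s)" for k
  proof -
    have "bp n (act n (fps_X ^ (n - 1 - q)) (xvec n u)) y k = (\<Sum>i\<in>{q}. (-1) ^ i * act n (fps_X ^ (n - 1 - q)) (xvec n u) (n - 1 - i) k * y i k)"
      unfolding bp_def
    proof (rule sum.mono_neutral_right)
      show "\<forall>i\<in>{..<n} - {q}. (- 1) ^ i * act n (fps_X ^ (n - 1 - q)) (xvec n u) (n - 1 - i) k * y i k = 0"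
      proof
        fix i assume i: "i \<in> {..<n} - {q}"
        show "(- 1) ^ i * act n (fps_X ^ (n - 1 - q)) (xvec n u) (n - 1 - i) k * y i k = 0"
        proof (cases "i < q")
          case True
          then show ?thesis using z by simp
        next
          case False
          then have "\<not> n - 1 - q \<le> n - 1 - i" using i q by auto
          then show ?thesis by (simp add: act_X_power)
        qed
      qed
    qed (use q in auto)
    also have "\<dots> = (-1) ^ q * (u k * y q k)" using q by (simp add: act_X_power xvec_0)
    also have "u k * y q k = of_real ((cmod (y q k))\<^sup>2) / of_real s"
      unfolding u_def complex_norm_square by (simp add: mult.commute)
    finally show ?thesis .
  qed
  then have "(\<Sum>k\<in>S. bp n (act n (fps_X ^ (n - 1 - q)) (xvec n u)) y k) = (-1) ^ q * (of_real (s\<^sup>2) / of_real s)"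
    by (simp add: s2 sum_distrib_left[symmetric] sum_divide_distrib[symmetric])
  then have "cmod (\<Sum>k\<in>S. bp n (act n (fps_X ^ (n - 1 - q)) (xvec n u)) y k) = s"
    using s0 by (simp add: norm_mult norm_divide norm_power power2_eq_square)
  then show ?thesis using un s_def by blast
qed

text \<open>The shifted jet of the normalised slot q agrees with y up to slot q and costs only a
  multiple of the l2 norm of that slot; subtracting it makes y start one slot later.\<close>

lemma peel_slot:
  assumes S: "finite S" and su: "supp_in S y" and q: "q < n" and z: "\<forall>j<q. \<forall>k. y j k = 0"
  shows "\<exists>w. rb n S w (real n ^ n * slot_norm S y q) \<and> (\<forall>j\<le>q. \<forall>k. w j k = y j k)"
proof (cases "slot_norm S y q = 0")
  case True
  then have "(\<Sum>k\<in>S. (cmod (y q k))\<^sup>2) = 0" using slot_norm_power2[of S y q] by simp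
  then have "\<forall>k\<in>S. y q k = 0" using S by (subst (asm) sum_nonneg_eq_0_iff) auto
  then have "\<forall>k. y q k = 0" using su by (auto simp: supp_in_def)
  then have "\<forall>j\<le>q. \<forall>k. (0::arr) j k = y j k" using z by (auto simp: le_less)
  then show ?thesis using rb_zero[OF S] True by (intro exI[of _ 0]) simp
next
  case False
  define s where "s = slot_norm S y q"
  have s0: "s > 0" using False slot_norm_nonneg[of S y q] by (simp add: s_def)
  have s2: "s\<^sup>2 = (\<Sum>k\<in>S. (cmod (y q k))\<^sup>2)" using slot_norm_power2 by (simp add: s_def)
  define v where "v = (\<lambda>k. y q k / of_real s)"
  have un: "unit_on S v"
    using S su s2 s0 unfolding unit_on_def v_def
    by (auto simp: supp_in_def norm_divide power_divide sum_divide_distrib[symmetric])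
  define w where "w = act n (fps_X ^ q) (xvec n v)"
  have "real n ^ q * 1 \<le> real n ^ n" using q by (simp add: power_increasing)
  then have w: "rb n S w (real n ^ n)"
    unfolding w_def by (rule rb_mono[OF rb_act_X_power[OF rb_xvec[OF un]]])
  have "rb n S (vscale (of_real s) w) (real n ^ n * s)" using rb_scale[OF w, of "of_real s"] s0 by (simp add: mult.commute)
  moreover have "vscale (of_real s) w j k = y j k" if "j \<le> q" for j k
    using that z q s0 unfolding w_def by (auto simp: act_X_power vscale_def xvec_0 v_def)
  ultimately show ?thesis unfolding s_def by blast
qed

text \<open>Peeling off one slot at a time: if \<open>y\<close> starts at slot \<open>q\<close>, the pairing with a shifted jet bounds the
  \<open>\<ell>\<^sub>2\<close> norm of \<open>y\<^sub>q\<close>, and then the jet of \<open>y\<^sub>q\<close> itself can be subtracted.\<close>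
lemma norming:
  "\<exists>c\<ge>0. \<forall>(S::nat set) y D. finite S \<longrightarrow> below n y \<longrightarrow> supp_in S y \<longrightarrow> 0 \<le> D \<longrightarrow>
     (\<forall>r<n. \<forall>u. unit_on S u \<longrightarrow> cmod (\<Sum>k\<in>S. bp n (act n (fps_X ^ (n - 1 - r)) (xvec n u)) y k) \<le> D) \<longrightarrow>
     rb n S y (c * D)"
proof -
  have "\<exists>c\<ge>0. \<forall>(S::nat set) y D. finite S \<longrightarrow> below n y \<longrightarrow> supp_in S y \<longrightarrow> 0 \<le> D \<longrightarrow> (\<forall>j<n - m. \<forall>k. y j k = 0) \<longrightarrow>
     (\<forall>r<n. \<forall>u. unit_on S u \<longrightarrow> cmod (\<Sum>k\<in>S. bp n (act n (fps_X ^ (n - 1 - r)) (xvec n u)) y k) \<le> D) \<longrightarrow>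
     rb n S y (c * D)" if "m \<le> n" for m
    using that
  proof (induction m)
    case 0
    show ?case
    proof (rule exI[of _ 0], clarsimp)
      fix S :: "nat set" and y :: arr assume "finite S" "below n y" "\<forall>j<n. \<forall>k. y j k = 0"
      then have "y = 0" by (auto simp: below_def fun_eq_iff) (metis not_le)
      then show "rb n S y 0" using rb_zero \<open>finite S\<close> by auto
    qed
  next
    case (Suc m)
    then obtain c where c: "c \<ge> 0" and IH: "\<And>S y D. finite S \<Longrightarrow> below n y \<Longrightarrow> supp_in S y \<Longrightarrow> 0 \<le> D \<Longrightarrow> (\<forall>j<n - m. \<forall>k. y j k = 0) \<Longrightarrow>
     (\<forall>r<n. \<forall>u. unit_on S u \<longrightarrow> cmod (\<Sum>k\<in>S. bp n (act n (fps_X ^ (n - 1 - r)) (xvec n u)) y k) \<le> D) \<Longrightarrow>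
     rb n S y (c * D)" by auto
    \<comment> \<open>\<open>E * D\<close> bounds the pairing of the subtracted vector with the test
      vectors, so the remainder satisfies the hypothesis with D (1 + E) in place of D.\<close>
    define E where "E = 4 ^ n * (real n ^ n * real n ^ n)"
    define c' where "c' = c * (1 + E) + real n ^ n"
    have E0: "E \<ge> 0" by (simp add: E_def)
    show ?case
    proof (rule exI[of _ c'], intro conjI allI impI)
      show "0 \<le> c'" using c E0 by (simp add: c'_def)
      fix S :: "nat set" and y :: arr and D :: real assume S: "finite S" and bel: "below n y" and su: "supp_in S y" and D: "0 \<le> D"
        and z: "\<forall>j<n - Suc m. \<forall>k. y j k = 0"
        and B: "\<forall>r<n. \<forall>u. unit_on S u \<longrightarrow> cmod (\<Sum>k\<in>S. bp n (act n (fps_X ^ (n - 1 - r)) (xvec n u)) y k) \<le> D"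
      define q where "q = n - Suc m"
      have q: "q < n" "n - m = Suc q" using Suc.prems by (auto simp: q_def)
      note zq = z[folded q_def]
      have sD: "slot_norm S y q \<le> D"
      proof (cases "slot_norm S y q > 0")
        case True
        then show ?thesis using slot_pairing[OF S su q(1) zq] B q(1) by metis
      next
        case False
        then show ?thesis using D by simp
      qed
      obtain w where w0: "rb n S w (real n ^ n * slot_norm S y q)" and wy: "\<forall>j\<le>q. \<forall>k. w j k = y j k"
        using peel_slot[OF S su q(1) zq] by blast
      have w: "rb n S w (real n ^ n * D)" using sD by (intro rb_mono[OF w0] mult_left_mono) auto
      define y' where "y' = y + vscale (-1) w"
      have y': "supp_in S y'" "below n y'" using su bel rb_supp[OF w] rb_below[OF w]
        by (auto simp: y'_def supp_in_def below_def vscale_def)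
      have yq: "\<forall>j<n - m. \<forall>k. y' j k = 0" using wy unfolding q(2) by (simp add: y'_def vscale_def less_Suc_eq_le)
      have "rb n S y' (c * (D + D * E))"
      proof (rule IH[OF S y'(2,1) _ yq])
        show "0 \<le> D + D * E" using D E0 by simp
        show "\<forall>r<n. \<forall>u. unit_on S u \<longrightarrow> cmod (\<Sum>k\<in>S. bp n (act n (fps_X ^ (n - 1 - r)) (xvec n u)) y' k) \<le> D + D * E"
        proof (intro allI impI)
          fix r u' assume r: "r < n" and u': "unit_on S u'"
          define x where "x = act n (fps_X ^ (n - 1 - r)) (xvec n u')"
          have "real n ^ (n - 1 - r) * 1 \<le> real n ^ n" using r by (simp add: power_increasing)
          then have x: "rb n S x (real n ^ n)"
            unfolding x_def by (rule rb_mono[OF rb_act_X_power[OF rb_xvec[OF u']]])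
          have "(\<Sum>k\<in>S. bp n x y' k) = (\<Sum>k\<in>S. bp n x y k) - (\<Sum>k\<in>S. bp n x w k)"
            unfolding y'_def bp_add bp_scale by (simp add: sum_subtractf)
          then have "cmod (\<Sum>k\<in>S. bp n x y' k) \<le> cmod (\<Sum>k\<in>S. bp n x y k) + cmod (\<Sum>k\<in>S. bp n x w k)"
            using norm_triangle_ineq4[of "\<Sum>k\<in>S. bp n x y k" "\<Sum>k\<in>S. bp n x w k"] by simp
          also have "\<dots> \<le> D + D * E"
            using B r u' bp_bound[OF x w S] unfolding E_def x_def by (intro add_mono) (auto simp: mult_ac)
          finally show "cmod (\<Sum>k\<in>S. bp n (act n (fps_X ^ (n - 1 - r)) (xvec n u')) y' k) \<le> D + D * E" unfolding x_def .
        qed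
      qed
      then have "rb n S (y' + w) (c * (D + D * E) + real n ^ n * D)" by (rule rb_add[OF _ w])
      moreover have "y' + w = y" by (auto simp: y'_def vscale_def fun_eq_iff)
      moreover have "c * (D + D * E) + real n ^ n * D = c' * D" by (simp add: c'_def algebra_simps)
      ultimately show "rb n S y (c' * D)" by simp
    qed
  qed
  from this[OF order_refl] show ?thesis by simp
qed

section \<open>The pairing\<close>


text \<open>For arbitrary arrays the sum may diverge; it is used when the left argument is finitely
  supported or both arguments lie in \<open>Zn n\<close>.\<close>

definition bil :: "nat \<Rightarrow> arr \<Rightarrow> arr \<Rightarrow> complex" where
  "bil n x y = (\<Sum>k. bp n x y k)"

lemma bil_finite: assumes "finite S" "supp_in S x" shows "bil n x y = (\<Sum>k\<in>S. bp n x y k)"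
  unfolding bil_def using assms by (intro suminf_finite) (auto simp: bp_def supp_in_def)

definition nb :: "nat \<Rightarrow> arr \<Rightarrow> real \<Rightarrow> bool" where
  "nb n x C \<longleftrightarrow> below n x \<and> (\<forall>K. rb n {..<K} (proj {..<K} x) C)"

lemma proj_proj: "proj S (proj T x) = proj (S \<inter> T) x"
  by (auto simp: proj_def fun_eq_iff)

lemma nb_rb: assumes "nb n x C" "finite S" shows "rb n S (proj S x) C"
proof -
  obtain K where K: "S \<subseteq> {..<K}" using assms(2) finite_nat_iff_bounded by blast
  then have "{..<K} \<inter> S = S" "S \<inter> {..<K} = S" by auto
  then show ?thesis using assms(1) rb_proj[of n "{..<K}" "proj {..<K} x" C S] by (simp add: nb_def proj_proj)
qed

lemma nbI: assumes "below n x" "\<And>S. finite S \<Longrightarrow> rb n S (proj S x) C" shows "nb n x C"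
  using assms by (auto simp: nb_def)

section \<open>Functionals along disjoint sequences\<close>

lemma growth:
  assumes "\<And>N. N \<ge> 1 \<Longrightarrow> real N * d \<le> C * ((1 + ln (real N)) ^ n * sqrt (real N))"
  shows "d \<le> 0"
proof -
  have lim: "((\<lambda>x::real. C * ((1 + ln x) ^ n * sqrt x) / x) \<longlongrightarrow> 0) at_top" by real_asymp
  have "((\<lambda>N::nat. C * ((1 + ln (real N)) ^ n * sqrt (real N)) / real N) \<longlongrightarrow> 0) sequentially"
    using filterlim_compose[OF lim filterlim_real_sequentially] .
  moreover have "eventually (\<lambda>N::nat. d \<le> C * ((1 + ln (real N)) ^ n * sqrt (real N)) / real N) sequentially"
    using eventually_ge_at_top[of 1]
  proof eventually_elim
    case (elim N)
    then show ?case using assms[of N] by (simp add: field_simps)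
  qed
  ultimately show ?thesis by (intro tendsto_lowerbound[of _ 0 sequentially]) auto
qed

text \<open>Unimodular coefficients align the values, so N values of size d add up to at least N d,
  while the sum of N disjoint bounded vectors has norm of order sqrt N up to logarithms. Disjoint
  bounded sequences are weakly null in this sense.\<close>

lemma disjoint_null:
  fixes \<phi> :: "arr \<Rightarrow> complex"
  assumes lin: "\<And>I c. finite I \<Longrightarrow> \<phi> (\<Sum>i\<in>I. vscale (c i) (y i)) = (\<Sum>i\<in>I. c i * \<phi> (y i))"
    and bd: "\<And>S x A. rb n S x A \<Longrightarrow> cmod (\<phi> x) \<le> C * A"
    and y: "\<And>i. rb n (S i) (y i) A" and disj: "disjoint_family S" and d: "d > 0"
  shows "finite {i::nat. d \<le> cmod (\<phi> (y i))}"
proof (rule ccontr)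
  assume inf: "infinite {i. d \<le> cmod (\<phi> (y i))}"
  define C' where "C' = C * cact n * A"
  have "real N * d \<le> C' * ((1 + ln (real N)) ^ n * sqrt (real N))" if N: "N \<ge> 1" for N
  proof -
    obtain I where I: "finite I" "card I = N" "I \<subseteq> {i. d \<le> cmod (\<phi> (y i))}"
      using infinite_arbitrarily_large[OF inf] by blast
    define c where "c = (\<lambda>i. cnj (sgn (\<phi> (y i))))"
    have c: "cmod (c i) = 1" "c i * \<phi> (y i) = of_real (cmod (\<phi> (y i)))" if "i \<in> I" for i
    proof -
      have "\<phi> (y i) \<noteq> 0" using that I d by auto
      then show "cmod (c i) = 1" by (simp add: c_def norm_sgn)
      show "c i * \<phi> (y i) = of_real (cmod (\<phi> (y i)))"
        using \<open>\<phi> (y i) \<noteq> 0\<close> complex_norm_square[of "\<phi> (y i)"] unfolding c_def sgn_eq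
        by (simp add: field_simps power2_eq_square)
    qed
    have "rb n (S i) (vscale (c i) (y i)) A" if "i \<in> I" for i using rb_scale[OF y, of i "c i"] c(1)[OF that] by simp
    then have "rb n (\<Union>i\<in>I. S i) (\<Sum>i\<in>I. vscale (c i) (y i)) (cact n * (1 + ln N) ^ n * (sqrt N * A))"
      using I N disj by (intro rb_disjoint_sum_bound) (auto simp: disjoint_family_on_def)
    then have "cmod (\<phi> (\<Sum>i\<in>I. vscale (c i) (y i))) \<le> C * (cact n * (1 + ln N) ^ n * (sqrt N * A))" by (rule bd)
    moreover have "cmod (\<phi> (\<Sum>i\<in>I. vscale (c i) (y i))) = (\<Sum>i\<in>I. cmod (\<phi> (y i)))"
    proof -
      have "\<phi> (\<Sum>i\<in>I. vscale (c i) (y i)) = of_real (\<Sum>i\<in>I. cmod (\<phi> (y i)))"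
        unfolding lin[OF I(1)] using c(2) by simp
      then show ?thesis by (simp only: norm_of_real) (simp add: sum_nonneg)
    qed
    moreover have "real N * d \<le> (\<Sum>i\<in>I. cmod (\<phi> (y i)))"
      using sum_mono[of I "\<lambda>_. d" "\<lambda>i. cmod (\<phi> (y i))"] I by auto
    ultimately show ?thesis unfolding C'_def by (simp add: mult_ac)
  qed
  then have "d \<le> 0" by (rule growth)
  then show False using d by simp
qed

text \<open>Finite sets found beyond every bound are picked one after the other, each beyond all
  earlier ones. The parameter k i of the i-th choice is recorded because P may contain an accuracy
  that depends on it; i \<le> k i lets this accuracy improve along the sequence.\<close>

lemma disjoint_blocks:
  fixes P :: "nat \<Rightarrow> nat set \<Rightarrow> 'a \<Rightarrow> bool"
  assumes "\<And>K. \<exists>S a. finite S \<and> S \<subseteq> {K..} \<and> P K S a"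
  obtains S a k where "\<And>i. finite (S i)" "\<And>i. S i \<subseteq> {i..}" "\<And>i. i \<le> k i" "\<And>i. P (k i) (S i) (a i)"
    "disjoint_family S"
proof -
  obtain S a where Sa: "\<And>K. finite (S K) \<and> S K \<subseteq> {K..} \<and> P K (S K) (a K)" using assms by metis
  \<comment> \<open>Inserting K covers an empty block and makes k strictly increasing.\<close>
  define k where "k = rec_nat 0 (\<lambda>i K. Suc (Max (insert K (S K))))"
  have kS: "k (Suc i) = Suc (Max (insert (k i) (S (k i))))" for i by (simp add: k_def)
  have k1: "k i < k (Suc i)" for i unfolding kS using Sa by (simp add: less_Suc_eq_le)
  have k2: "x < k (Suc i)" if "x \<in> S (k i)" for x i unfolding kS using Sa that by (simp add: less_Suc_eq_le)
  have sm: "strict_mono k" using k1 by (simp add: strict_mono_Suc_iff)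
  have ki: "i \<le> k i" for i using sm by (rule strict_mono_imp_increasing)
  have lt: "S (k i) \<inter> S (k j) = {}" if "i < j" for i j
  proof -
    have "k (Suc i) \<le> k j" using that sm by (simp add: strict_mono_less_eq)
    then show ?thesis using k2[of _ i] Sa[of "k j"] by fastforce
  qed
  have "disjoint_family (\<lambda>i. S (k i))"
    unfolding disjoint_family_on_def using lt by (metis Int_commute linorder_neqE_nat)
  moreover have "S (k i) \<subseteq> {i..}" for i using Sa[of "k i"] ki[of i] by auto
  ultimately show ?thesis using Sa ki by (intro that[of "\<lambda>i. S (k i)" k "\<lambda>i. a (k i)"]) auto
qed

lemma bp_add_left: "bp n (x + y) z k = bp n x z k + bp n y z k"
  by (simp add: bp_def algebra_simps sum.distrib)
lemma bp_scale_left: "bp n (vscale c x) y k = c * bp n x y k"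
  by (simp add: bp_def vscale_def sum_distrib_left mult_ac)
lemma bp_sum_left: fixes x :: "'i \<Rightarrow> arr" shows "bp n (\<Sum>i\<in>I. x i) y k = (\<Sum>i\<in>I. bp n (x i) y k)"
proof (induction I rule: infinite_finite_induct)
  case (insert a I)
  show ?case by (simp only: sum.insert[OF insert.hyps] bp_add_left insert.IH)
qed (simp_all add: bp_def)

lemma bil_sum_left_finite:
  fixes w :: "'i \<Rightarrow> arr"
  assumes I: "finite I" and w: "\<And>i. i \<in> I \<Longrightarrow> finite (S i) \<and> supp_in (S i) (w i)"
  shows "bil n (\<Sum>i\<in>I. vscale (c i) (w i)) y = (\<Sum>i\<in>I. c i * bil n (w i) y)"
proof -
  define T where "T = (\<Union>i\<in>I. S i)"
  have T: "finite T" using I w by (auto simp: T_def)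
  have wT: "supp_in T (w i)" if "i \<in> I" for i using w[OF that] that unfolding supp_in_def T_def by blast
  have "supp_in T (\<Sum>i\<in>I. vscale (c i) (w i))" using wT by (auto simp: supp_in_def sum_fun_apply vscale_def intro!: sum.neutral)
  then have "bil n (\<Sum>i\<in>I. vscale (c i) (w i)) y = (\<Sum>k\<in>T. \<Sum>i\<in>I. c i * bp n (w i) y k)"
    by (simp add: bil_finite[OF T] bp_sum_left bp_scale_left)
  also have "\<dots> = (\<Sum>i\<in>I. c i * bil n (w i) y)"
    unfolding sum.swap[of _ I] by (intro sum.cong refl) (simp add: bil_finite[OF T wT] sum_distrib_left)
  finally show ?thesis .
qed

lemma bil_bound_nb:
  assumes x: "rb n S x A" and y: "nb n y D" shows "cmod (bil n x y) \<le> 4 ^ n * D * A"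
proof -
  have "bil n x y = (\<Sum>k\<in>S. bp n x (proj S y) k)"
    unfolding bil_finite[OF rb_finite[OF x] rb_supp[OF x]] by (intro sum.cong) (auto simp: bp_def proj_def)
  then show ?thesis using bp_bound[OF x nb_rb[OF y rb_finite[OF x]] rb_finite[OF x]] by (simp add: mult_ac)
qed

text \<open>The norming constant as a function of n, fixed once by choice and made positive so that
  it can be divided by.\<close>

definition nrm :: "nat \<Rightarrow> real" where
  "nrm n = (SOME c. c > 0 \<and> (\<forall>(S::nat set) y D. finite S \<longrightarrow> below n y \<longrightarrow> supp_in S y \<longrightarrow> 0 \<le> D \<longrightarrow>
     (\<forall>r<n. \<forall>u. unit_on S u \<longrightarrow> cmod (bil n (act n (fps_X ^ (n - 1 - r)) (xvec n u)) y) \<le> D) \<longrightarrow>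
     rb n S y (c * D)))"

lemma nrm: "nrm n > 0"
  "\<lbrakk>finite S; below n y; supp_in S y; 0 \<le> D;
   \<And>r u. r < n \<Longrightarrow> unit_on S u \<Longrightarrow> cmod (bil n (act n (fps_X ^ (n - 1 - r)) (xvec n u)) y) \<le> D\<rbrakk>
   \<Longrightarrow> rb n S y (nrm n * D)"
proof -
  obtain c where c: "c \<ge> 0" "\<And>(S::nat set) y D. \<lbrakk>finite S; below n y; supp_in S y; 0 \<le> D;
     \<forall>r<n. \<forall>u. unit_on S u \<longrightarrow> cmod (\<Sum>k\<in>S. bp n (act n (fps_X ^ (n - 1 - r)) (xvec n u)) y k) \<le> D\<rbrakk> \<Longrightarrow>
     rb n S y (c * D)" using norming[of n] by blast
  have e: "bil n (act n p (xvec n u)) y = (\<Sum>k\<in>S. bp n (act n p (xvec n u)) y k)" if "unit_on S u" for S u p y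
    using that supp_in_act[OF rb_supp[OF rb_xvec[OF that]]] by (intro bil_finite) (auto simp: unit_on_def)
  have "\<exists>c. c > 0 \<and> (\<forall>(S::nat set) y D. finite S \<longrightarrow> below n y \<longrightarrow> supp_in S y \<longrightarrow> 0 \<le> D \<longrightarrow>
     (\<forall>r<n. \<forall>u. unit_on S u \<longrightarrow> cmod (bil n (act n (fps_X ^ (n - 1 - r)) (xvec n u)) y) \<le> D) \<longrightarrow>
     rb n S y (c * D))"
  proof (rule exI[of _ "c + 1"], intro conjI allI impI)
    show "c + 1 > 0" using c by simp
    fix S :: "nat set" and y :: arr and D :: real
    assume a: "finite S" "below n y" "supp_in S y" "0 \<le> D" 
      "\<forall>r<n. \<forall>u. unit_on S u \<longrightarrow> cmod (bil n (act n (fps_X ^ (n - 1 - r)) (xvec n u)) y) \<le> D"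
    then have "\<forall>r<n. \<forall>u. unit_on S u \<longrightarrow> cmod (\<Sum>k\<in>S. bp n (act n (fps_X ^ (n - 1 - r)) (xvec n u)) y k) \<le> D"
      using e by metis
    then have "rb n S y (c * D)" using c(2)[OF a(1-4)] by blast
    then show "rb n S y ((c + 1) * D)" using a(4) by (elim rb_mono) (simp add: algebra_simps)
  qed
  from someI_ex[OF this]
  have 1: "nrm n > 0 \<and> (\<forall>(S::nat set) y D. finite S \<longrightarrow> below n y \<longrightarrow> supp_in S y \<longrightarrow> 0 \<le> D \<longrightarrow>
     (\<forall>r<n. \<forall>u. unit_on S u \<longrightarrow> cmod (bil n (act n (fps_X ^ (n - 1 - r)) (xvec n u)) y) \<le> D) \<longrightarrow>
     rb n S y (nrm n * D))" unfolding nrm_def .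
  then show "nrm n > 0" by blast
  show "\<lbrakk>finite S; below n y; supp_in S y; 0 \<le> D;
   \<And>r u. r < n \<Longrightarrow> unit_on S u \<Longrightarrow> cmod (bil n (act n (fps_X ^ (n - 1 - r)) (xvec n u)) y) \<le> D\<rbrakk>
   \<Longrightarrow> rb n S y (nrm n * D)" using 1 by blast
qed

lemma rb_shift_xvec: assumes "unit_on S u" "r < n"
  shows "rb n S (act n (fps_X ^ r) (xvec n u)) (real n ^ n)"
proof (rule rb_mono)
  show "rb n S (act n (fps_X ^ r) (xvec n u)) (real n ^ r * 1)" by (intro rb_act_X_power rb_xvec assms)
  show "real n ^ r * 1 \<le> real n ^ n" using assms(2) by (simp add: power_increasing)
qed

text \<open>Otherwise blocks of x arbitrarily far out are not small. Norming vectors on disjoint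
  blocks of this kind form a bounded disjoint sequence along which the functional given by x does
  not tend to 0. So bounded finite sections alone force vanishing tails.\<close>

lemma nb_tails:
  assumes x: "nb n x A" and e: "e > 0"
  shows "\<exists>K. \<forall>S. finite S \<longrightarrow> S \<subseteq> {K..} \<longrightarrow> rb n S (proj S x) e"
proof (rule ccontr)
  assume "\<not> ?thesis"
  then have H: "\<And>K. \<exists>S. finite S \<and> S \<subseteq> {K..} \<and> \<not> rb n S (proj S x) e" by blast
  define D where "D = e / nrm n"
  have D: "D > 0" using e nrm(1) by (simp add: D_def)
  \<comment> \<open>The witness a = (r, u) names a norming vector by its slot and its unit
    sequence.\<close>
  define P where "P = (\<lambda>(K::nat) S (a :: nat \<times> (nat \<Rightarrow> complex)). fst a < n \<and> unit_on S (snd a) \<and>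
     D < cmod (bil n (act n (fps_X ^ (n - 1 - fst a)) (xvec n (snd a))) x))"
  have "\<exists>S a. finite S \<and> S \<subseteq> {K..} \<and> P K S a" for K
  proof -
    obtain S where S: "finite S" "S \<subseteq> {K..}" "\<not> rb n S (proj S x) e" using H by blast
    have "\<exists>r u. r < n \<and> unit_on S u \<and> D < cmod (bil n (act n (fps_X ^ (n - 1 - r)) (xvec n u)) (proj S x))"
    proof (rule ccontr)
      assume neg: "\<not> ?thesis"
      have "rb n S (proj S x) (nrm n * D)"
      proof (intro nrm(2))
        show "below n (proj S x)" "supp_in S (proj S x)"
          using x by (auto simp: nb_def below_def proj_def supp_in_def)
        show "cmod (bil n (act n (fps_X ^ (n - 1 - r)) (xvec n u)) (proj S x)) \<le> D" if "r < n" "unit_on S u" for r u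
          using neg that by (meson not_less)
      qed (use S D in auto)
      then show False using S(3) nrm(1)[of n] by (simp add: D_def)
    qed
    then obtain r u where ru: "r < n" "unit_on S u" "D < cmod (bil n (act n (fps_X ^ (n - 1 - r)) (xvec n u)) (proj S x))" by blast
    have "bil n (act n (fps_X ^ (n - 1 - r)) (xvec n u)) (proj S x) = bil n (act n (fps_X ^ (n - 1 - r)) (xvec n u)) x"
      using S(1) supp_in_act[OF rb_supp[OF rb_xvec[OF ru(2)]]]
      by (simp add: bil_finite[of S] bp_def proj_def cong: sum.cong)
    then show ?thesis using S ru by (intro exI[of _ S] exI[of _ "(r, u)"]) (auto simp: P_def)
  qed
  then obtain S a k where Sk: "\<And>i. finite (S i)" "\<And>i. S i \<subseteq> {i..}" "\<And>i. i \<le> k i" "\<And>i. P (k i) (S i) (a i)"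
    "disjoint_family S" by (rule disjoint_blocks) (rule that)
  have Sa: "fst (a i) < n" "unit_on (S i) (snd (a i))"
     "D < cmod (bil n (act n (fps_X ^ (n - 1 - fst (a i))) (xvec n (snd (a i)))) x)" for i
    using Sk(4)[of i] by (auto simp: P_def)
  define w where "w = (\<lambda>i. act n (fps_X ^ (n - 1 - fst (a i))) (xvec n (snd (a i))))"
  have w: "rb n (S i) (w i) (real n ^ n)" for i unfolding w_def using Sa(1)[of i] by (intro rb_shift_xvec Sa(2)) auto
  have "finite {i. D \<le> cmod (bil n (w i) x)}"
  proof (rule disjoint_null[where n = n and C = "4 ^ n * A" and y = w])
    show "bil n (\<Sum>i\<in>I. vscale (c i) (w i)) x = (\<Sum>i\<in>I. c i * bil n (w i) x)" if "finite I" for I c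
      using that Sk(1) rb_supp[OF w] by (intro bil_sum_left_finite[where S = S]) auto
    show "cmod (bil n y x) \<le> 4 ^ n * A * A'" if "rb n S y A'" for S y A' using bil_bound_nb[OF that x] .
  qed (use w Sk(5) D in auto)
  moreover have "D \<le> cmod (bil n (w i) x)" for i using Sa(3)[of i] unfolding w_def by simp
  ultimately show False by simp
qed

section \<open>The norm in terms of finite sections\<close>


lemma cmod_le_linf: "bounded_seq x \<Longrightarrow> cmod (x k) \<le> linf_norm x"
  unfolding bounded_seq_def linf_norm_def by (rule cSUP_upper) auto

lemma bounded_seqI: "(\<And>k. cmod (x k) \<le> M) \<Longrightarrow> bounded_seq x"
  unfolding bounded_seq_def by (auto intro!: bdd_aboveI[of _ M])

lemma linf_le: "(\<And>k. cmod (x k) \<le> M) \<Longrightarrow> linf_norm x \<le> M"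
  unfolding linf_norm_def by (rule cSUP_least) auto

lemma linf_nonneg: assumes "bounded_seq x" shows "0 \<le> linf_norm x"
  using cmod_le_linf[OF assms, of 0] norm_ge_zero order_trans by blast

lemma bounded_seq_diff: assumes "bounded_seq x" "bounded_seq y" shows "bounded_seq (\<lambda>k. x k - y k)"
proof (rule bounded_seqI)
  fix k
  show "cmod (x k - y k) \<le> linf_norm x + linf_norm y"
    using norm_triangle_ineq4[of "x k" "y k"] cmod_le_linf[OF assms(1), of k] cmod_le_linf[OF assms(2), of k] by linarith
qed

lemma bounded_seq_scale: assumes "bounded_seq x" shows "bounded_seq (\<lambda>k. x k / c)"
proof (rule bounded_seqI)
  fix k
  show "cmod (x k / c) \<le> linf_norm x / cmod c"
    unfolding norm_divide by (intro divide_right_mono cmod_le_linf assms) simp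
qed

text \<open>Coordinates are contractive functionals on l-infinity, so continuity, complex
  differentiability and boundedness pass to them.\<close>

lemma calderon_sgood: assumes f: "f \<in> calderon" shows "sgood (\<lambda>z. f z k)"
  unfolding sgood_def
proof (intro conjI)
  have bs: "bounded_seq (f z)" if "z \<in> strip_cl" for z using f that by (auto simp: calderon_def)
  show "continuous_on strip_cl (\<lambda>z. f z k)"
    unfolding continuous_on_def
  proof
    fix z assume z: "z \<in> strip_cl"
    have "((\<lambda>w. linf_norm (\<lambda>k. f w k - f z k)) \<longlongrightarrow> 0) (at z within strip_cl)" using f z by (auto simp: calderon_def)
    then have "((\<lambda>w. f w k - f z k) \<longlongrightarrow> 0) (at z within strip_cl)"
    proof (rule Lim_null_comparison[rotated])
      show "\<forall>\<^sub>F w in at z within strip_cl. norm (f w k - f z k) \<le> linf_norm (\<lambda>k. f w k - f z k)"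
        unfolding eventually_at_filter
        using cmod_le_linf[OF bounded_seq_diff[OF bs bs[OF z]]] by (auto intro!: always_eventually)
    qed
    then show "((\<lambda>z. f z k) \<longlongrightarrow> f z k) (at z within strip_cl)" by (simp add: LIM_zero_iff)
  qed
  show "(\<lambda>z. f z k) holomorphic_on strip_open"
    unfolding holomorphic_on_open[OF open_strip_open]
  proof
    fix z assume z: "z \<in> strip_open"
    then obtain g where g: "bounded_seq g" "((\<lambda>w. linf_norm (\<lambda>k. (f w k - f z k) / (w - z) - g k)) \<longlongrightarrow> 0) (at z)"
      using f by (auto simp: calderon_def)
    have "((\<lambda>w. (f w k - f z k) / (w - z) - g k) \<longlongrightarrow> 0) (at z)"
    proof (rule Lim_null_comparison[OF _ g(2)])
      have "\<forall>\<^sub>F w in at z. w \<in> strip_open" using z open_strip_open by (simp add: eventually_at_in_open')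
      then show "\<forall>\<^sub>F w in at z. norm ((f w k - f z k) / (w - z) - g k) \<le> linf_norm (\<lambda>k. (f w k - f z k) / (w - z) - g k)"
      proof eventually_elim
        case (elim w)
        have zw: "w \<in> strip_cl" "z \<in> strip_cl" using elim z strip_open_subset_cl by auto
        show ?case
          by (rule cmod_le_linf[OF bounded_seq_diff[OF bounded_seq_scale[OF bounded_seq_diff[OF bs[OF zw(1)] bs[OF zw(2)]]] g(1)]])
      qed
    qed
    then have "((\<lambda>z. f z k) has_field_derivative g k) (at z)"
      by (simp add: has_field_derivative_iff LIM_zero_iff)
    then show "\<exists>f'. ((\<lambda>z. f z k) has_field_derivative f') (at z)" by blast
  qed
  obtain M where M: "\<And>z. z \<in> strip_cl \<Longrightarrow> linf_norm (f z) \<le> M" using f by (auto simp: calderon_def bdd_above_def)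
  show "bounded ((\<lambda>z. f z k) ` strip_cl)"
  proof (rule boundedI, clarify)
    fix z assume "z \<in> strip_cl"
    then show "norm (f z k) \<le> M" using cmod_le_linf[OF bs, of z k] M by fastforce
  qed
qed

lemma cald_norm_bounds:
  assumes f: "f \<in> calderon"
  shows "cmod (f (\<i> * complex_of_real t) k) \<le> cald_norm f"
    and "(\<Sum>k<K. cmod (f (1 + \<i> * complex_of_real t) k)) \<le> cald_norm f"
proof -
  have s: "\<i> * complex_of_real t \<in> strip_cl" for t by (simp add: strip_cl_def)
  obtain M where M: "\<And>z. z \<in> strip_cl \<Longrightarrow> linf_norm (f z) \<le> M" using f by (auto simp: calderon_def bdd_above_def)
  have "cmod (f (\<i> * complex_of_real t) k) \<le> linf_norm (f (\<i> * complex_of_real t))"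
    using f s by (intro cmod_le_linf) (auto simp: calderon_def)
  also have "\<dots> \<le> (SUP t::real. linf_norm (f (\<i> * complex_of_real t)))"
    using M s by (intro cSUP_upper bdd_aboveI[of _ M]) auto
  also have "\<dots> \<le> cald_norm f" by (simp add: cald_norm_def)
  finally show "cmod (f (\<i> * complex_of_real t) k) \<le> cald_norm f" .
  have "(\<Sum>k<K. cmod (f (1 + \<i> * complex_of_real t) k)) \<le> l1_norm (f (1 + \<i> * complex_of_real t))"
    unfolding l1_norm_def using f by (intro sum_le_suminf) (auto simp: calderon_def)
  also have "\<dots> \<le> (SUP t::real. l1_norm (f (1 + \<i> * complex_of_real t)))"
    using f by (intro cSUP_upper) (auto simp: calderon_def)
  also have "\<dots> \<le> cald_norm f" by (simp add: cald_norm_def)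
  finally show "(\<Sum>k<K. cmod (f (1 + \<i> * complex_of_real t) k)) \<le> cald_norm f" .
qed

lemma cald_norm_nonneg: "f \<in> calderon \<Longrightarrow> 0 \<le> cald_norm f"
  using cald_norm_bounds(1)[of f 0 0] norm_ge_zero order_trans by blast

lemma calderon_nb:
  assumes f: "f \<in> calderon" and r: "represents n f x" shows "nb n x (cald_norm f)"
  unfolding nb_def
proof (intro conjI allI)
  show "below n x" using r by (auto simp: represents_def below_def)
  fix K
  have "fcal {..<K} (cald_norm f) (\<lambda>z k. if k < K then f z k else 0)"
    unfolding fcal_def
  proof (intro conjI allI impI)
    show "sgood (\<lambda>z. if k < K then f z k else 0)" for k
      using calderon_sgood[OF f, of k] by (cases "k < K") (auto simp: sgood_const)
    show "cmod (if k < K then f (\<i> * complex_of_real t) k else 0) \<le> cald_norm f" for t k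
      using cald_norm_bounds(1)[OF f] cald_norm_nonneg[OF f] by auto
    show "(\<Sum>k<K. cmod (if k < K then f (1 + \<i> * complex_of_real t) k else 0)) \<le> cald_norm f" for t
      using cald_norm_bounds(2)[OF f, where K = K and t = t] by simp
  qed auto
  moreover have "represents n (\<lambda>z k. if k < K then f z k else 0) (proj {..<K} x)"
    using r by (auto simp: represents_jet proj_def jet_const)
  ultimately show "rb n {..<K} (proj {..<K} x) (cald_norm f)" by (auto simp: rb_def)
qed

text \<open>Norm holomorphy comes for free: a uniformly bounded family of scalar holomorphic functions has
  uniformly bounded second derivatives on smaller discs.\<close>
lemma linf_holomorphic:
  assumes h: "\<And>k. (\<lambda>z. f z k) holomorphic_on strip_open" and b: "\<And>z k. z \<in> strip_open \<Longrightarrow> cmod (f z k) \<le> M"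
    and z: "z \<in> strip_open"
  shows "\<exists>g. bounded_seq g \<and> ((\<lambda>w. linf_norm (\<lambda>k. (f w k - f z k) / (w - z) - g k)) \<longlongrightarrow> 0) (at z)"
proof -
  obtain R where R: "R > 0" "ball z R \<subseteq> strip_open" using z open_strip_open open_contains_ball by blast
  define r where "r = R / 4"
  have r: "r > 0" using R by (simp add: r_def)
  have sub: "cball w r \<subseteq> strip_open" if "w \<in> ball z r" for w
  proof
    fix v assume "v \<in> cball w r"
    then have "dist z v \<le> r + r" using that dist_triangle[of z v w] by auto
    then have "v \<in> ball z R" using r by (simp add: r_def)
    then show "v \<in> strip_open" using R by auto
  qed
  have zr: "z \<in> ball z r" using r by simp
  have cauchy: "cmod ((deriv ^^ i) (\<lambda>z. f z k) w) \<le> fact i * M / r ^ i" if "w \<in> ball z r" for i k w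
  proof (rule Cauchy_inequality[OF _ _ r])
    show "(\<lambda>z. f z k) holomorphic_on ball w r" "continuous_on (cball w r) (\<lambda>z. f z k)"
      using h[of k] sub[OF that] ball_subset_cball[of w r]
      by (blast intro: holomorphic_on_subset holomorphic_on_imp_continuous_on)+
    show "cmod (f x k) \<le> M" if "cmod (w - x) = r" for x
      using sub[OF \<open>w \<in> ball z r\<close>] that by (intro b) (auto simp: dist_norm)
  qed
  define g where "g = (\<lambda>k. deriv (\<lambda>z. f z k) z)"
  define L where "L = 2 * M / r ^ 2"
  have est: "cmod ((f w k - f z k) / (w - z) - g k) \<le> L * cmod (w - z)" if w: "w \<in> ball z r" "w \<noteq> z" for w k
  proof -
    have "cmod ((deriv ^^ 0) (\<lambda>z. f z k) w - (\<Sum>i\<le>1. (deriv ^^ i) (\<lambda>z. f z k) z * (w - z) ^ i / fact i))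
       \<le> L * cmod (w - z) ^ Suc 1 / fact 1"
    proof (rule complex_Taylor[where S = "ball z r"])
      fix i x assume x: "x \<in> ball z r" "i \<le> (1::nat)"
      have "(deriv ^^ i) (\<lambda>z. f z k) holomorphic_on strip_open" using h open_strip_open holomorphic_higher_deriv by blast
      moreover have "x \<in> strip_open" using sub[OF x(1)] r by auto
      ultimately have "((deriv ^^ i) (\<lambda>z. f z k) has_field_derivative deriv ((deriv ^^ i) (\<lambda>z. f z k)) x) (at x)"
        using open_strip_open holomorphic_derivI by blast
      then show "((deriv ^^ i) (\<lambda>z. f z k) has_field_derivative (deriv ^^ Suc i) (\<lambda>z. f z k) x) (at x within ball z r)"
        by (simp add: has_field_derivative_at_within)
    next
      fix x assume "x \<in> ball z r"
      then show "cmod ((deriv ^^ Suc 1) (\<lambda>z. f z k) x) \<le> L"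
        using cauchy[of x "Suc 1" k] unfolding L_def by (simp add: numeral_2_eq_2)
    qed (use w zr in auto)
    then have "cmod (f w k - (f z k + g k * (w - z))) \<le> L * cmod (w - z) * cmod (w - z)"
      by (simp add: g_def mult.assoc)
    moreover have "(f w k - f z k) / (w - z) - g k = (f w k - (f z k + g k * (w - z))) / (w - z)"
      using w by (simp add: field_simps)
    ultimately show ?thesis using w by (simp add: norm_divide divide_le_eq)
  qed
  have "bounded_seq g" using cauchy[OF zr, of 1] by (intro bounded_seqI[of _ "M / r"]) (simp add: g_def)
  moreover have "((\<lambda>w. linf_norm (\<lambda>k. (f w k - f z k) / (w - z) - g k)) \<longlongrightarrow> 0) (at z)"
  proof (rule Lim_null_comparison)
    have "((\<lambda>w. L * cmod (w - z)) \<longlongrightarrow> L * cmod (z - z)) (at z)" by (intro tendsto_intros)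
    then show "((\<lambda>w. L * cmod (w - z)) \<longlongrightarrow> 0) (at z)" by simp
    have "\<forall>\<^sub>F w in at z. w \<in> ball z r - {z}" using r by (intro eventually_at_in_open) auto
    then show "\<forall>\<^sub>F w in at z. norm (linf_norm (\<lambda>k. (f w k - f z k) / (w - z) - g k)) \<le> L * cmod (w - z)"
    proof eventually_elim
      case (elim w)
      then have e: "cmod ((f w k - f z k) / (w - z) - g k) \<le> L * cmod (w - z)" for k using est by auto
      show ?case using linf_le[OF e] linf_nonneg[OF bounded_seqI[OF e]] by simp
    qed
  qed
  ultimately show ?thesis by blast
qed

text \<open>The coordinates are cut into consecutive blocks; the initial one costs C and the
  following ones e/2, e/4 and so on, by the vanishing tails. Representatives of the blocks have
  disjoint supports, their sum is bounded by C + e, and the summability of the bounds makes the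
  glued function norm continuous.\<close>

lemma nb_calderon:
  assumes x: "nb n x C" and e: "e > 0"
  shows "\<exists>f\<in>calderon. represents n f x \<and> cald_norm f \<le> C + e"
proof -
  define em where "em = (\<lambda>m::nat. e * (1/2) ^ Suc m)"
  have em: "em m > 0" for m using e by (simp add: em_def)
  have "\<forall>m. \<exists>K. \<forall>S. finite S \<longrightarrow> S \<subseteq> {K..} \<longrightarrow> rb n S (proj S x) (em m)" using nb_tails[OF x em] by blast
  then obtain T where T: "\<And>m S. finite S \<Longrightarrow> S \<subseteq> {T m..} \<Longrightarrow> rb n S (proj S x) (em m)" by metis
  \<comment> \<open>The summand m makes K strictly increasing with K m \<ge> m, so coordinate k lies
    in no block after number k + 1; the sum puts K m beyond T m.\<close>
  define K where "K = (\<lambda>m. m + (\<Sum>i\<le>m. T i))"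
  have K1: "m \<le> K m" "T m \<le> K m" "K m < K (Suc m)" for m
    unfolding K_def by (auto intro: member_le_sum trans_le_add2)
  define S where "S = (\<lambda>m. case m of 0 \<Rightarrow> {..<K 0} | Suc i \<Rightarrow> {K i..<K (Suc i)})"
  define c where "c = (\<lambda>m. case m of 0 \<Rightarrow> C | Suc i \<Rightarrow> em i)"
  have fS: "finite (S m)" for m by (cases m) (auto simp: S_def)
  have rbS: "rb n (S m) (proj (S m) x) (c m)" for m
  proof (cases m)
    case 0
    then show ?thesis using x by (simp add: S_def c_def nb_def)
  next
    case (Suc i)
    have "S m \<subseteq> {T i..}" using K1(2)[of i] Suc by (auto simp: S_def)
    then show ?thesis using T[of "S m" i] fS[of m] Suc by (simp add: c_def)
  qed
  have "\<forall>m. \<exists>g. fcal (S m) (c m) g \<and> represents n g (proj (S m) x)" using rbS by (simp add: rb_def)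
  then obtain g where g: "\<And>m. fcal (S m) (c m) (g m)" "\<And>m. represents n (g m) (proj (S m) x)" by metis
  have c0: "c m \<ge> 0" for m using rb_nonneg[OF rbS] .
  have "em sums (e * (1/2 * (1 / (1 - 1/2))))"
    unfolding em_def power_Suc by (intro sums_mult geometric_sums) auto
  then have "(\<lambda>m. c (Suc m)) sums e" by (simp add: c_def)
  then have c_sums: "c sums (C + e)" using sums_Suc[of c e] by (simp add: c_def add.commute)
  have csum: "(\<Sum>m\<in>M. c m) \<le> C + e" if "finite M" for M
    using sum_le_suminf[OF sums_summable[OF c_sums] that] c0 sums_unique[OF c_sums] by simp
  define f where "f = (\<lambda>z k. \<Sum>m\<le>Suc k. g m z k)"
  have gz: "g m z k = 0" if km: "m > Suc k" for m z k
  proof -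
    obtain i where i: "m = Suc i" "i > k" using km by (cases m) auto
    then have "k \<notin> S m" using K1(1)[of i] by (simp add: S_def)
    then show ?thesis using g(1)[of m] by (simp add: fcal_def)
  qed
  have fM: "f z k = (\<Sum>m\<le>M. g m z k)" if "M \<ge> Suc k" for z k M
    unfolding f_def using that by (intro sum.mono_neutral_left) (auto intro: gz)
  have gs: "sgood (\<lambda>z. g m z k)" for m k using g(1)[of m] by (simp add: fcal_def)
  have fs: "sgood (\<lambda>z. f z k)" for k unfolding f_def by (intro sgood_sum gs)
  have gb: "cmod (g m z k) \<le> c m" if "z \<in> strip_cl" for m z k using fcal_sup[OF g(1) that] .
  have fb: "cmod (f z k) \<le> C + e" if "z \<in> strip_cl" for z k
  proof -
    have "cmod (f z k) \<le> (\<Sum>m\<le>Suc k. c m)" unfolding f_def by (intro order_trans[OF norm_sum] sum_mono gb that)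
    also have "\<dots> \<le> C + e" by (intro csum) simp
    finally show ?thesis .
  qed
  have l1: "(\<Sum>k<L. cmod (f (1 + \<i> * complex_of_real t) k)) \<le> C + e" for L t
  proof -
    let ?w = "1 + \<i> * complex_of_real t"
    have "(\<Sum>k<L. cmod (f ?w k)) \<le> (\<Sum>k<L. \<Sum>m\<le>Suc L. cmod (g m ?w k))"
    proof (intro sum_mono)
      fix k assume "k \<in> {..<L}"
      then have "f ?w k = (\<Sum>m\<le>Suc L. g m ?w k)" by (intro fM) auto
      then show "cmod (f ?w k) \<le> (\<Sum>m\<le>Suc L. cmod (g m ?w k))" by (simp only: norm_sum)
    qed
    also have "\<dots> = (\<Sum>m\<le>Suc L. \<Sum>k<L. cmod (g m ?w k))" by (rule sum.swap)
    also have "\<dots> \<le> (\<Sum>m\<le>Suc L. c m)"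
    proof (intro sum_mono)
      fix m
      have "(\<Sum>k<L. cmod (g m ?w k)) = (\<Sum>k\<in>{..<L} \<inter> S m. cmod (g m ?w k))"
        using g(1)[of m] by (intro sum.mono_neutral_right) (auto simp: fcal_def)
      also have "\<dots> \<le> (\<Sum>k\<in>S m. cmod (g m ?w k))" using fS by (intro sum_mono2) auto
      also have "\<dots> \<le> c m" using g(1)[of m] by (simp add: fcal_def)
      finally show "(\<Sum>k<L. cmod (g m ?w k)) \<le> c m" .
    qed
    also have "\<dots> \<le> C + e" by (intro csum) simp
    finally show ?thesis .
  qed
  have summ: "summable (\<lambda>k. cmod (f (1 + \<i> * complex_of_real t) k))" for t
    using l1[of t] by (intro summableI_nonneg_bounded[where x = "C + e"]) auto
  have l1n: "l1_norm (f (1 + \<i> * complex_of_real t)) \<le> C + e" for t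
    unfolding l1_norm_def using l1 by (intro suminf_le_const summ) auto
  have cont: "((\<lambda>w. linf_norm (\<lambda>k. f w k - f z k)) \<longlongrightarrow> 0) (at z within strip_cl)" if z: "z \<in> strip_cl" for z
  proof (rule tendstoI)
    fix \<epsilon> :: real assume \<epsilon>: "\<epsilon> > 0"
    have "(\<lambda>R. \<Sum>m<R. c m) \<longlonglongrightarrow> C + e" using c_sums by (simp add: sums_def)
    then have "\<forall>\<^sub>F R in sequentially. (\<Sum>m<R. c m) > C + e - \<epsilon>/4" using \<epsilon> by (intro order_tendstoD) auto
    then obtain R where R: "(\<Sum>m<R. c m) > C + e - \<epsilon>/4" by (auto simp: eventually_sequentially)
    \<comment> \<open>Blocks from R on change f by at most 2 (\<epsilon>/4), wherever w is; the
      blocks before R involve finitely many continuous scalar functions, whose total change is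
      \<open>G\<close>.\<close>
    define G where "G = (\<lambda>w. \<Sum>m<R. \<Sum>k\<in>S m. cmod (g m w k - g m z k))"
    have "(G \<longlongrightarrow> (\<Sum>m<R. \<Sum>k\<in>S m. cmod (g m z k - g m z k))) (at z within strip_cl)"
      unfolding G_def using gs z by (intro tendsto_intros) (auto simp: sgood_def continuous_on_def)
    then have "(G \<longlongrightarrow> 0) (at z within strip_cl)" by simp
    then have "\<forall>\<^sub>F w in at z within strip_cl. G w < \<epsilon>/4" using \<epsilon> by (intro order_tendstoD) auto
    moreover have "\<forall>\<^sub>F w in at z within strip_cl. w \<in> strip_cl" by (simp add: eventually_at_filter)
    ultimately show "\<forall>\<^sub>F w in at z within strip_cl. dist (linf_norm (\<lambda>k. f w k - f z k)) 0 < \<epsilon>"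
    proof eventually_elim
      case (elim w)
      have b: "cmod (f w k - f z k) \<le> 3 * \<epsilon> / 4" for k
      proof -
        have "f w k - f z k = (\<Sum>m\<le>Suc k + R. g m w k - g m z k)"
          by (simp add: fM[of k "Suc k + R"] sum_subtractf)
        also have "{..Suc k + R} = {..<R} \<union> {R..Suc k + R}" by auto
        also have "(\<Sum>m\<in>{..<R} \<union> {R..Suc k + R}. g m w k - g m z k) = (\<Sum>m<R. g m w k - g m z k) + (\<Sum>m\<in>{R..Suc k + R}. g m w k - g m z k)"
          by (rule sum.union_disjoint) auto
        finally have 0: "f w k - f z k = (\<Sum>m<R. g m w k - g m z k) + (\<Sum>m\<in>{R..Suc k + R}. g m w k - g m z k)" .
        have "cmod (\<Sum>m<R. g m w k - g m z k) \<le> G w"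
          unfolding G_def
        proof (intro order_trans[OF norm_sum] sum_mono)
          fix m
          show "cmod (g m w k - g m z k) \<le> (\<Sum>k\<in>S m. cmod (g m w k - g m z k))"
          proof (cases "k \<in> S m")
            case True
            then show ?thesis using fS by (intro member_le_sum) auto
          next
            case False
            then show ?thesis using g(1)[of m] by (simp add: fcal_def sum_nonneg)
          qed
        qed
        then have 1: "cmod (\<Sum>m<R. g m w k - g m z k) \<le> \<epsilon>/4" using elim(1) by simp
        have "cmod (\<Sum>m\<in>{R..Suc k + R}. g m w k - g m z k) \<le> (\<Sum>m\<in>{R..Suc k + R}. c m + c m)"
        proof (intro order_trans[OF norm_sum] sum_mono)
          fix m
          show "cmod (g m w k - g m z k) \<le> c m + c m"
            using norm_triangle_ineq4[of "g m w k" "g m z k"] gb[OF elim(2), of m k] gb[OF z, of m k] by linarith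
        qed
        also have "\<dots> = 2 * (\<Sum>m\<in>{R..Suc k + R}. c m)"
          unfolding sum.distrib by simp
        also have "(\<Sum>m\<in>{R..Suc k + R}. c m) = (\<Sum>m\<in>{..Suc k + R}. c m) - (\<Sum>m<R. c m)"
        proof -
          have "{..Suc k + R} = {..<R} \<union> {R..Suc k + R}" by auto
          then have "(\<Sum>m\<in>{..Suc k + R}. c m) = (\<Sum>m<R. c m) + (\<Sum>m\<in>{R..Suc k + R}. c m)"
            by (simp only:) (rule sum.union_disjoint, auto)
          then show ?thesis by simp
        qed
        also have "\<dots> \<le> \<epsilon>/4" using csum[of "{..Suc k + R}"] R by simp
        finally have 2: "cmod (\<Sum>m\<in>{R..Suc k + R}. g m w k - g m z k) \<le> \<epsilon>/2" by simp
        show ?thesis unfolding 0 using norm_triangle_mono[OF 1 2] by simp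
      qed
      have "linf_norm (\<lambda>k. f w k - f z k) \<le> 3 * \<epsilon> / 4" by (rule linf_le) (rule b)
      moreover have "0 \<le> linf_norm (\<lambda>k. f w k - f z k)" by (rule linf_nonneg, rule bounded_seqI, rule b)
      ultimately show ?case using \<epsilon> by simp
    qed
  qed
  have "f \<in> calderon"
    unfolding calderon_def mem_Collect_eq
  proof (intro conjI ballI allI)
    show "bounded_seq (f z)" if "z \<in> strip_cl" for z using fb[OF that] by (rule bounded_seqI)
    show "bdd_above ((\<lambda>z. linf_norm (f z)) ` strip_cl)" using linf_le[OF fb] by (intro bdd_aboveI2)
    show "\<exists>g. bounded_seq g \<and> ((\<lambda>w. linf_norm (\<lambda>k. (f w k - f z k) / (w - z) - g k)) \<longlongrightarrow> 0) (at z)"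
      if "z \<in> strip_open" for z
      using fs fb strip_open_subset_cl that by (intro linf_holomorphic[where M = "C + e"]) (auto simp: sgood_def)
    show "bdd_above (range (\<lambda>t. l1_norm (f (1 + \<i> * complex_of_real t))))" using l1n by (intro bdd_aboveI2)
  qed (use cont summ in auto)
  moreover have "represents n f x"
    unfolding represents_jet
  proof (intro allI)
    fix j k
    have tel: "(\<Sum>m\<le>M. proj (S m) x j k) = proj {..<K M} x j k" for M
    proof (induction M)
      case 0
      then show ?case by (simp add: S_def)
    next
      case (Suc M)
      have "(\<Sum>m\<le>Suc M. proj (S m) x j k) = proj {..<K M} x j k + proj (S (Suc M)) x j k" using Suc.IH by simp
      then show ?case using K1(3)[of M] by (simp add: S_def proj_def)
    qed
    have kK: "k < K (Suc k)" using K1(1)[of "Suc k"] by simp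
    show "x j k = (if j < n then fps_nth (jet (\<lambda>z. f z k)) j else 0)"
    proof (cases "j < n")
      case True
      have "fps_nth (jet (\<lambda>z. f z k)) j = (\<Sum>m\<le>Suc k. fps_nth (jet (\<lambda>z. g m z k)) j)"
        unfolding f_def by (subst jet_sum[OF gs]) (simp add: fps_sum_nth)
      also have "\<dots> = (\<Sum>m\<le>Suc k. proj (S m) x j k)"
        using g(2) True by (intro sum.cong) (auto simp: represents_jet)
      also have "\<dots> = x j k" unfolding tel using kK by (simp add: proj_def)
      finally show ?thesis using True by simp
    next
      case False
      then show ?thesis using x by (simp add: nb_def below_def)
    qed
  qed
  moreover have "cald_norm f \<le> C + e"
    unfolding cald_norm_def using l1n linf_le[OF fb] 
    by (intro max.boundedI cSUP_least) (auto simp: strip_cl_def)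
  ultimately show ?thesis by blast
qed

text \<open>Together with \<open>zn_norm_le\<close> and \<open>nb_if_norm_less\<close> this replaces
  the Calderon space by finite sections in the later arguments.\<close>

lemma Zn_iff: "x \<in> Zn n \<longleftrightarrow> (\<exists>C. nb n x C)"
  using calderon_nb nb_calderon[OF _ zero_less_one] unfolding Zn_def by blast

lemma zn_norm_bdd: "bdd_below (cald_norm ` {f \<in> calderon. represents n f x})"
  using cald_norm_nonneg by (intro bdd_belowI2[of _ 0]) auto

lemma zn_norm_le: assumes "nb n x C" shows "zn_norm n x \<le> C"
proof (rule field_le_epsilon)
  fix e :: real assume "e > 0"
  then obtain f where f: "f \<in> calderon" "represents n f x" "cald_norm f \<le> C + e" using nb_calderon[OF assms] by blast
  then have "zn_norm n x \<le> cald_norm f" unfolding zn_norm_def by (intro cINF_lower zn_norm_bdd) auto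
  then show "zn_norm n x \<le> C + e" using f(3) by simp
qed

lemma nb_mono: "nb n x C \<Longrightarrow> C \<le> D \<Longrightarrow> nb n x D"
  unfolding nb_def using rb_mono by blast

lemma nb_if_norm_less: assumes "x \<in> Zn n" "zn_norm n x < C" shows "nb n x C"
proof -
  obtain f0 where f0: "f0 \<in> calderon" "represents n f0 x" using assms(1) unfolding Zn_def by blast
  then obtain f where "f \<in> calderon" "represents n f x" "cald_norm f < C"
    using cInf_lessD[of "cald_norm ` {f \<in> calderon. represents n f x}" C] assms(2) unfolding zn_norm_def by auto
  then show ?thesis using nb_mono[OF calderon_nb] by (meson less_imp_le)
qed

lemma zn_norm_nonneg: "x \<in> Zn n \<Longrightarrow> 0 \<le> zn_norm n x"
  unfolding zn_norm_def using cald_norm_nonneg by (intro cINF_greatest) (auto simp: Zn_def)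

section \<open>Bounded operators\<close>


lemma vadd_eq: "vadd x y = x + y" by (simp add: vadd_def fun_eq_iff)
lemma vsub_eq: "vsub x y = x - y" by (simp add: vsub_def fun_eq_iff)
lemma vzero_eq: "vzero = 0" by (simp add: vzero_def fun_eq_iff)
lemma vscale_add: "vscale c (x + y) = vscale c x + vscale c y" by (simp add: vscale_def fun_eq_iff algebra_simps)
lemma vscale_diff: "vscale c (x - y) = vscale c x - vscale c y" by (simp add: vscale_def fun_eq_iff algebra_simps)
lemma vscale_zero [simp]: "vscale c 0 = 0" "vscale 0 x = 0" by (simp_all add: vscale_def fun_eq_iff)
lemma vscale_one [simp]: "vscale 1 x = x" by (simp add: vscale_def)
lemma vscale_vscale [simp]: "vscale c (vscale d x) = vscale (c * d) x" by (simp add: vscale_def fun_eq_iff mult.assoc)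
lemma vscale_minus_one: "vscale (-1) x = - x" by (simp add: vscale_def fun_eq_iff)
lemma proj_add: "proj S (x + y) = proj S x + proj S y" by (auto simp: proj_def fun_eq_iff)
lemma proj_scale: "proj S (vscale c x) = vscale c (proj S x)" by (auto simp: proj_def fun_eq_iff vscale_def)
lemma proj_compl: "proj {..<K} x + proj {K..} x = x" by (auto simp: proj_def fun_eq_iff)

lemma nb_add: "nb n x A \<Longrightarrow> nb n y B \<Longrightarrow> nb n (x + y) (A + B)"
  unfolding nb_def proj_add using rb_add by (auto simp: below_def)
lemma nb_scale: "nb n x A \<Longrightarrow> nb n (vscale c x) (cmod c * A)"
  unfolding nb_def proj_scale using rb_scale by (auto simp: below_def vscale_def)
lemma nb_proj: "nb n x A \<Longrightarrow> nb n (proj S x) A"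
proof (rule nbI)
  assume x: "nb n x A"
  show "below n (proj S x)" using x by (simp add: nb_def below_def proj_def)
  fix T :: "nat set" assume T: "finite T"
  have "rb n T (proj T x) A" by (rule nb_rb[OF x T])
  then have "rb n (T \<inter> S) (proj S (proj T x)) A" by (rule rb_proj)
  then show "rb n T (proj T (proj S x)) A" using rb_supset[of n "T \<inter> S" _ A T] T by (simp add: proj_proj Int_commute)
qed
lemma nb_act: "nb n x A \<Longrightarrow> (\<And>i. i < n \<Longrightarrow> cmod (fps_nth p i) \<le> P) \<Longrightarrow> nb n (act n p x) (cact n * P * A)"
  unfolding nb_def proj_act by (intro conjI allI below_act rb_act) auto
lemma nb_zero: "nb n 0 0"
proof -
  have "proj S 0 = 0" for S by (auto simp: proj_def fun_eq_iff)
  then show ?thesis using rb_zero by (simp add: nb_def below_def)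
qed
lemma rb_nb: assumes "rb n S x A" shows "nb n x A"
proof (rule nbI[OF rb_below[OF assms]])
  fix T :: "nat set" assume "finite T"
  then show "rb n T (proj T x) A" using rb_supset[OF rb_proj[OF assms, of T]] by blast
qed

lemma Zn_zero [simp]: "0 \<in> Zn n" using nb_zero Zn_iff by blast
lemma Zn_add: "x \<in> Zn n \<Longrightarrow> y \<in> Zn n \<Longrightarrow> x + y \<in> Zn n" unfolding Zn_iff using nb_add by metis
lemma Zn_scale: "x \<in> Zn n \<Longrightarrow> vscale c x \<in> Zn n" unfolding Zn_iff using nb_scale by metis
lemma Zn_diff: "x \<in> Zn n \<Longrightarrow> y \<in> Zn n \<Longrightarrow> x - y \<in> Zn n"
  using Zn_add[of x n "vscale (-1) y"] Zn_scale[of y n "-1"] by (simp add: vscale_minus_one)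
lemma Zn_proj: "x \<in> Zn n \<Longrightarrow> proj S x \<in> Zn n" unfolding Zn_iff using nb_proj by metis
lemma Zn_sum: fixes x :: "'i \<Rightarrow> arr" shows "(\<And>i. i \<in> I \<Longrightarrow> x i \<in> Zn n) \<Longrightarrow> (\<Sum>i\<in>I. x i) \<in> Zn n"
proof (induction I rule: infinite_finite_induct)
  case (insert a I)
  have "x a + (\<Sum>i\<in>I. x i) \<in> Zn n" using insert by (intro Zn_add) auto
  then show ?case by (simp only: sum.insert[OF insert.hyps])
next
  case empty show ?case by (simp only: sum.empty Zn_zero)
next
  case (infinite A) show ?case by (simp only: sum.infinite[OF infinite.hyps] Zn_zero)
qed
lemma Zn_below: "x \<in> Zn n \<Longrightarrow> below n x" by (auto simp: Zn_iff nb_def)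
lemma Zn_rb: "rb n S x A \<Longrightarrow> x \<in> Zn n" using rb_nb Zn_iff by blast
lemma zn_norm_rb: "rb n S x A \<Longrightarrow> zn_norm n x \<le> A" using rb_nb zn_norm_le by blast
lemma Zn_act: "x \<in> Zn n \<Longrightarrow> act n p x \<in> Zn n"
proof -
  assume "x \<in> Zn n"
  then obtain A where A: "nb n x A" by (auto simp: Zn_iff)
  have "cmod (fps_nth p i) \<le> (\<Sum>i<n. cmod (fps_nth p i))" if "i < n" for i using that by (intro member_le_sum) auto
  from nb_act[OF A this] show ?thesis by (auto simp: Zn_iff)
qed

section \<open>Norm estimates, tails and completeness\<close>

text \<open>Operator bounds are proved for \<open>nb\<close> and transferred to the norm here. The
  bound \<open>nb\<close> is at hand only strictly above the norm, whence the margin; C + 1 keeps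
  its definition meaningful for C = 0.\<close>

lemma zn_norm_le_by_nb:
  assumes "x \<in> Zn n" and C: "C \<ge> 0" and "\<And>A. nb n x A \<Longrightarrow> nb n y (C * A)" shows "zn_norm n y \<le> C * zn_norm n x"
proof (rule field_le_epsilon)
  fix e :: real assume e: "e > 0"
  have "nb n x (zn_norm n x + e / (C + 1))" using assms(1) e C by (intro nb_if_norm_less) auto
  then have "zn_norm n y \<le> C * (zn_norm n x + e / (C + 1))" using assms(3) zn_norm_le by blast
  also have "\<dots> = C * zn_norm n x + e * (C / (C + 1))" by (simp add: distrib_left)
  also have "e * (C / (C + 1)) \<le> e * 1" using e C by (intro mult_left_mono) (auto simp: divide_simps)
  finally show "zn_norm n y \<le> C * zn_norm n x + e" by simp
qed

lemma zn_norm_triangle: assumes "x \<in> Zn n" "y \<in> Zn n" shows "zn_norm n (x + y) \<le> zn_norm n x + zn_norm n y"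
proof (rule field_le_epsilon)
  fix e :: real assume e: "e > 0"
  have "nb n x (zn_norm n x + e/2)" "nb n y (zn_norm n y + e/2)" using assms e by (auto intro!: nb_if_norm_less)
  then have "nb n (x + y) ((zn_norm n x + e/2) + (zn_norm n y + e/2))" by (rule nb_add)
  then show "zn_norm n (x + y) \<le> zn_norm n x + zn_norm n y + e" using zn_norm_le by fastforce
qed

lemma zn_norm_scale_le: assumes "x \<in> Zn n" shows "zn_norm n (vscale c x) \<le> cmod c * zn_norm n x"
  using assms nb_scale by (intro zn_norm_le_by_nb) auto

lemma zn_norm_scale: assumes "x \<in> Zn n" shows "zn_norm n (vscale c x) = cmod c * zn_norm n x"
proof (cases "c = 0")
  case True
  have "zn_norm n 0 \<le> 0" using zn_norm_le[OF nb_zero] .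
  then show ?thesis using True zn_norm_nonneg[OF Zn_zero, of n] by simp
next
  case False
  have "zn_norm n (vscale (inverse c) (vscale c x)) \<le> cmod (inverse c) * zn_norm n (vscale c x)"
    by (intro zn_norm_scale_le Zn_scale assms)
  then have "zn_norm n x \<le> inverse (cmod c) * zn_norm n (vscale c x)" using False by (simp add: norm_inverse)
  then have "cmod c * zn_norm n x \<le> cmod c * (inverse (cmod c) * zn_norm n (vscale c x))" by (intro mult_left_mono) auto
  then have "cmod c * zn_norm n x \<le> zn_norm n (vscale c x)" using False by (simp add: mult.assoc[symmetric])
  then show ?thesis using zn_norm_scale_le[OF assms, of c] by simp
qed

lemma zn_norm_zero [simp]: "zn_norm n 0 = 0"
  using zn_norm_scale[OF Zn_zero, of n 0] by simp

lemma zn_norm_minus: assumes "x \<in> Zn n" shows "zn_norm n (- x) = zn_norm n x"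
  using zn_norm_scale[OF assms, of "-1"] by (simp add: vscale_minus_one)

lemma zn_norm_commute: assumes "x \<in> Zn n" "y \<in> Zn n" shows "zn_norm n (x - y) = zn_norm n (y - x)"
  using zn_norm_minus[OF Zn_diff[OF assms]] by simp

lemma zn_norm_triangle_diff: assumes "x \<in> Zn n" "y \<in> Zn n" shows "zn_norm n (x - y) \<le> zn_norm n x + zn_norm n y"
  using zn_norm_triangle[OF assms(1) Zn_scale[OF assms(2)], of "-1"] zn_norm_minus[OF assms(2)]
  by (simp add: vscale_minus_one)

lemma zn_norm_triangle_sub: assumes "x \<in> Zn n" "y \<in> Zn n" shows "zn_norm n x - zn_norm n y \<le> zn_norm n (x - y)"
  using zn_norm_triangle[OF Zn_diff[OF assms] assms(2)] by simp

lemma zn_norm_sum: fixes x :: "'i \<Rightarrow> arr"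
  shows "finite I \<Longrightarrow> (\<And>i. i \<in> I \<Longrightarrow> x i \<in> Zn n) \<Longrightarrow> zn_norm n (\<Sum>i\<in>I. x i) \<le> (\<Sum>i\<in>I. zn_norm n (x i))"
proof (induction I rule: finite_induct)
  case (insert a I)
  have "zn_norm n (x a + (\<Sum>i\<in>I. x i)) \<le> zn_norm n (x a) + zn_norm n (\<Sum>i\<in>I. x i)"
    using insert by (intro zn_norm_triangle Zn_sum) auto
  also have "\<dots> \<le> zn_norm n (x a) + (\<Sum>i\<in>I. zn_norm n (x i))" using insert by auto
  finally show ?case by (simp only: sum.insert[OF insert.hyps])
next
  case empty show ?case by (simp only: sum.empty zn_norm_zero order_refl)
qed

lemma zn_coord: assumes "x \<in> Zn n" shows "cmod (x j k) \<le> 4 ^ n * zn_norm n x"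
proof (rule field_le_epsilon)
  fix e :: real assume e: "e > 0"
  have "nb n x (zn_norm n x + e / 4 ^ n)" using assms e by (intro nb_if_norm_less) auto
  from rb_coord[OF nb_rb[OF this, of "{k}"], of j k]
  show "cmod (x j k) \<le> 4 ^ n * zn_norm n x + e" by (simp add: proj_def distrib_left)
qed

lemma zn_norm_eq_0: assumes "x \<in> Zn n" "zn_norm n x \<le> 0" shows "x = 0"
proof (intro ext)
  fix j k
  have "4 ^ n * zn_norm n x \<le> 0" using assms(2) by (simp add: mult_nonneg_nonpos)
  then have "cmod (x j k) \<le> 0" using zn_coord[OF assms(1), of j k] by linarith
  then show "x j k = 0 j k" by simp
qed

lemma zn_norm_proj: "x \<in> Zn n \<Longrightarrow> zn_norm n (proj S x) \<le> zn_norm n x"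
  using zn_norm_le_by_nb[of x n 1 "proj S x"] nb_proj by simp

lemma rb_of_norm: assumes "x \<in> Zn n" "finite S" "supp_in S x" "zn_norm n x < C" shows "rb n S x C"
  using nb_rb[OF nb_if_norm_less[OF assms(1,4)] assms(2)] proj_supp[OF assms(3) order_refl] by simp

lemma zn_norm_act: assumes "x \<in> Zn n" "\<And>i. i < n \<Longrightarrow> cmod (fps_nth p i) \<le> P" "0 \<le> P"
  shows "zn_norm n (act n p x) \<le> cact n * P * zn_norm n x"
  using assms cact_nonneg by (intro zn_norm_le_by_nb nb_act) auto

lemma zn_tails: assumes "x \<in> Zn n" "e > 0" shows "\<exists>K. \<forall>S. S \<subseteq> {K..} \<longrightarrow> zn_norm n (proj S x) < e"
proof -
  obtain A where A: "nb n x A" using assms by (auto simp: Zn_iff)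
  obtain K where K: "\<And>S. finite S \<Longrightarrow> S \<subseteq> {K..} \<Longrightarrow> rb n S (proj S x) (e/2)" using nb_tails[OF A, of "e/2"] assms by auto
  have "zn_norm n (proj S x) \<le> e/2" if "S \<subseteq> {K..}" for S
  proof (rule zn_norm_le, rule nbI)
    show "below n (proj S x)" using A by (simp add: nb_def below_def proj_def)
    fix T :: "nat set" assume "finite T"
    then show "rb n T (proj T (proj S x)) (e/2)"
      using rb_supset[OF K[of "T \<inter> S"], of T] that by (simp add: proj_proj le_infI2)
  qed
  moreover have "e/2 < e" using assms(2) by simp
  ultimately have "\<forall>S. S \<subseteq> {K..} \<longrightarrow> zn_norm n (proj S x) < e" by (meson le_less_trans)
  then show ?thesis ..
qed

lemma zn_tails_K: assumes "x \<in> Zn n" "e > 0" shows "\<exists>K0. \<forall>K\<ge>K0. zn_norm n (proj {K..} x) < e \<and> zn_norm n (x - proj {..<K} x) < e"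
proof -
  have "x - proj {..<K} x = proj {K..} x" for K by (auto simp: proj_def fun_eq_iff)
  moreover obtain K0 where "\<And>S. S \<subseteq> {K0..} \<Longrightarrow> zn_norm n (proj S x) < e" using zn_tails[OF assms] by blast
  ultimately show ?thesis by (intro exI[of _ K0]) auto
qed

lemma finite_expand: assumes "finite S" "supp_in S x" "below n x"
  shows "x = (\<Sum>k\<in>S. \<Sum>j<n. vscale (x j k) (uvec k j))"
proof (intro ext)
  fix j k
  have "(\<Sum>k'\<in>S. \<Sum>j'<n. vscale (x j' k') (uvec k' j')) j k = (\<Sum>k'\<in>S. \<Sum>j'<n. if j' = j then (if k' = k then x j k else 0) else 0)"
    unfolding sum_fun_apply by (intro sum.cong refl) (auto simp: vscale_def uvec_def)
  also have "\<dots> = (if j < n \<and> k \<in> S then x j k else 0)" using assms(1) by (cases "j < n") auto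
  also have "\<dots> = x j k" using assms by (auto simp: supp_in_def below_def not_less)
  finally show "x j k = (\<Sum>k\<in>S. \<Sum>j<n. vscale (x j k) (uvec k j)) j k" by simp
qed

lemma rb_finite_coords: assumes "finite S" "supp_in S x" "below n x"
  shows "rb n S x (\<Sum>k\<in>S. \<Sum>j<n. cmod (x j k) * real n ^ n)"
proof -
  have "rb n S (\<Sum>k\<in>S. \<Sum>j<n. vscale (x j k) (uvec k j)) (\<Sum>k\<in>S. \<Sum>j<n. cmod (x j k) * real n ^ n)"
    using assms(1) by (intro rb_sum rb_scale rb_supset[OF rb_uvec]) auto
  then show ?thesis using finite_expand[OF assms] by simp
qed

lemma Zn_uvec: "l < n \<Longrightarrow> uvec k l \<in> Zn n" using rb_uvec Zn_rb by blast

text \<open>The limit is taken coordinatewise. On a finite set of coordinates, convergence of the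
  coordinates is convergence in norm; the index l at which this is applied may depend on the
  section, because the Cauchy bound is uniform.\<close>

lemma zn_complete:
  assumes X: "\<And>m. X m \<in> Zn n" and C: "\<And>e. e > 0 \<Longrightarrow> \<exists>M. \<forall>m\<ge>M. \<forall>l\<ge>M. zn_norm n (X l - X m) < e"
  shows "\<exists>x\<in>Zn n. (\<lambda>m. zn_norm n (X m - x)) \<longlonglongrightarrow> 0"
proof -
  have "Cauchy (\<lambda>m. X m j k)" for j k
  proof (rule CauchyI)
    fix e :: real assume e: "e > 0"
    then obtain M where M: "\<forall>m\<ge>M. \<forall>l\<ge>M. zn_norm n (X l - X m) < e / 4 ^ n" using C[of "e / 4 ^ n"] by auto
    show "\<exists>M. \<forall>m\<ge>M. \<forall>l\<ge>M. norm (X m j k - X l j k) < e"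
    proof (intro exI[of _ M] allI impI)
      fix m l assume "m \<ge> M" "l \<ge> M"
      then have "zn_norm n (X m - X l) < e / 4 ^ n" using M by auto
      moreover have "cmod ((X m - X l) j k) \<le> 4 ^ n * zn_norm n (X m - X l)" by (intro zn_coord Zn_diff X)
      ultimately show "norm (X m j k - X l j k) < e" by (simp add: field_simps)
    qed
  qed
  then have "\<forall>j k. \<exists>L. (\<lambda>m. X m j k) \<longlonglongrightarrow> L" using Cauchy_convergent convergent_def by blast
  then obtain x where x: "\<And>j k. (\<lambda>m. X m j k) \<longlonglongrightarrow> x j k" by metis
  have xb: "below n x"
    unfolding below_def
  proof (intro allI impI)
    fix j k assume "j \<ge> n"
    then have "(\<lambda>m. X m j k) = (\<lambda>m. 0)" using Zn_below[OF X] by (auto simp: below_def)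
    then show "x j k = 0" using x[of j k] by (simp add: LIMSEQ_const_iff)
  qed
  have key: "nb n (X m - x) (2 * e)" if e: "e > 0" and M: "\<forall>m\<ge>M. \<forall>l\<ge>M. zn_norm n (X l - X m) < e" and m: "m \<ge> M" for e m M
  proof (rule nbI)
    show "below n (X m - x)" using xb Zn_below[OF X, of m] by (simp add: below_def)
    fix S :: "nat set" assume S: "finite S"
    have "(\<lambda>l. \<Sum>k\<in>S. \<Sum>j<n. cmod (X l j k - x j k) * real n ^ n) \<longlonglongrightarrow> (\<Sum>k\<in>S. \<Sum>j<n. cmod (x j k - x j k) * real n ^ n)"
      by (intro tendsto_intros x)
    then have "(\<lambda>l. \<Sum>k\<in>S. \<Sum>j<n. cmod (X l j k - x j k) * real n ^ n) \<longlonglongrightarrow> 0" by simp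
    then have "\<forall>\<^sub>F l in sequentially. (\<Sum>k\<in>S. \<Sum>j<n. cmod (X l j k - x j k) * real n ^ n) < e"
      using e by (intro order_tendstoD) auto
    then obtain L where L: "\<And>l. l \<ge> L \<Longrightarrow> (\<Sum>k\<in>S. \<Sum>j<n. cmod (X l j k - x j k) * real n ^ n) < e"
      by (auto simp: eventually_sequentially)
    define l where "l = max L M"
    have "zn_norm n (X m - X l) < e" using M m by (auto simp: l_def)
    then have 1: "rb n S (proj S (X m - X l)) e" by (intro nb_rb[OF _ S] nb_if_norm_less Zn_diff X)
    have "rb n S (proj S (X l - x)) (\<Sum>k\<in>S. \<Sum>j<n. cmod (proj S (X l - x) j k) * real n ^ n)"
      using xb Zn_below[OF X, of l] by (intro rb_finite_coords S) (auto simp: supp_in_def proj_def below_def)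
    also have "(\<Sum>k\<in>S. \<Sum>j<n. cmod (proj S (X l - x) j k) * real n ^ n) = (\<Sum>k\<in>S. \<Sum>j<n. cmod (X l j k - x j k) * real n ^ n)"
      by (intro sum.cong) (auto simp: proj_def)
    finally have 2: "rb n S (proj S (X l - x)) e" using L[of l] by (elim rb_mono) (simp add: l_def)
    have "proj S (X m - x) = proj S (X m - X l) + proj S (X l - x)" by (simp add: proj_add[symmetric])
    then show "rb n S (proj S (X m - x)) (2 * e)" using rb_add[OF 1 2] by simp
  qed
  obtain M1 where "\<forall>m\<ge>M1. \<forall>l\<ge>M1. zn_norm n (X l - X m) < 1" using C[of 1] by auto
  then have "nb n (X M1 - x) (2 * 1)" using key[of 1 M1 M1] by simp
  then have "X M1 - x \<in> Zn n" by (auto simp: Zn_iff)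
  then have xZ: "x \<in> Zn n" using Zn_diff[OF X[of M1], of "X M1 - x"] by simp
  have "(\<lambda>m. zn_norm n (X m - x)) \<longlonglongrightarrow> 0"
  proof (rule LIMSEQ_I)
    fix r :: real assume r: "r > 0"
    obtain M where M: "\<forall>m\<ge>M. \<forall>l\<ge>M. zn_norm n (X l - X m) < r/4" using C[of "r/4"] r by auto
    show "\<exists>M. \<forall>m\<ge>M. norm (zn_norm n (X m - x) - 0) < r"
    proof (intro exI[of _ M] allI impI)
      fix m assume "m \<ge> M"
      then have "zn_norm n (X m - x) \<le> 2 * (r/4)" using key[of "r/4" M m] M r by (intro zn_norm_le) simp
      then show "norm (zn_norm n (X m - x) - 0) < r" using zn_norm_nonneg[OF Zn_diff[OF X xZ], of m] r by simp
    qed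
  qed
  then show ?thesis using xZ by blast
qed

section \<open>The algebra of bounded operators\<close>

lemma bopD:
  assumes "T \<in> bop n"
  shows "x \<in> Zn n \<Longrightarrow> T x \<in> Zn n" "x \<in> Zn n \<Longrightarrow> y \<in> Zn n \<Longrightarrow> T (x + y) = T x + T y"
    "x \<in> Zn n \<Longrightarrow> T (vscale c x) = vscale c (T x)" "x \<notin> Zn n \<Longrightarrow> T x = 0" "T 0 = 0"
    "x \<in> Zn n \<Longrightarrow> y \<in> Zn n \<Longrightarrow> T (x - y) = T x - T y"
proof -
  show "x \<in> Zn n \<Longrightarrow> T x \<in> Zn n" and a: "\<And>x y. x \<in> Zn n \<Longrightarrow> y \<in> Zn n \<Longrightarrow> T (x + y) = T x + T y"
    and b: "\<And>x c. x \<in> Zn n \<Longrightarrow> T (vscale c x) = vscale c (T x)" and "x \<notin> Zn n \<Longrightarrow> T x = 0"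
    using assms by (auto simp: bop_def vadd_eq vzero_eq)
  show "T 0 = 0" using b[OF Zn_zero, of 0] by simp
  show "x \<in> Zn n \<Longrightarrow> y \<in> Zn n \<Longrightarrow> T (x - y) = T x - T y"
    using a[of x "vscale (-1) y"] b[of y "-1"] Zn_scale[of y n "-1"] by (simp add: vscale_minus_one)
qed

lemma bop_bound: assumes "T \<in> bop n" obtains C where "C > 0" "\<And>x. x \<in> Zn n \<Longrightarrow> zn_norm n (T x) \<le> C * zn_norm n x"
proof -
  obtain C where C: "\<And>x. x \<in> Zn n \<Longrightarrow> zn_norm n (T x) \<le> C * zn_norm n x" using assms unfolding bop_def by blast
  have "zn_norm n (T x) \<le> (\<bar>C\<bar> + 1) * zn_norm n x" if "x \<in> Zn n" for x
    using C[OF that] mult_right_mono[of C "\<bar>C\<bar> + 1" "zn_norm n x"] zn_norm_nonneg[OF that] by linarith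
  then show ?thesis using that[of "\<bar>C\<bar> + 1"] by simp
qed

lemma bopI:
  assumes "\<And>x. x \<in> Zn n \<Longrightarrow> T x \<in> Zn n" "\<And>x y. x \<in> Zn n \<Longrightarrow> y \<in> Zn n \<Longrightarrow> T (x + y) = T x + T y"
    "\<And>x c. x \<in> Zn n \<Longrightarrow> T (vscale c x) = vscale c (T x)" "\<And>x. x \<notin> Zn n \<Longrightarrow> T x = 0"
    "\<And>x. x \<in> Zn n \<Longrightarrow> zn_norm n (T x) \<le> C * zn_norm n x"
  shows "T \<in> bop n"
proof -
  have "\<exists>C. \<forall>x\<in>Zn n. zn_norm n (T x) \<le> C * zn_norm n x" using assms(5) by blast
  then show ?thesis using assms(1-4) unfolding bop_def vadd_eq vzero_eq by simp
qed

lemma bop_sum: fixes x :: "'i \<Rightarrow> arr" assumes T: "T \<in> bop n" and x: "\<And>i. i \<in> I \<Longrightarrow> x i \<in> Zn n"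
  shows "T (\<Sum>i\<in>I. x i) = (\<Sum>i\<in>I. T (x i))"
  using x
proof (induction I rule: infinite_finite_induct)
  case (insert a I)
  have "T (x a + (\<Sum>i\<in>I. x i)) = T (x a) + T (\<Sum>i\<in>I. x i)" using insert by (intro bopD[OF T] Zn_sum) auto
  also have "T (\<Sum>i\<in>I. x i) = (\<Sum>i\<in>I. T (x i))" using insert by auto
  finally show ?case by (simp only: sum.insert[OF insert.hyps])
next
  case empty show ?case by (simp only: sum.empty bopD[OF T])
next
  case (infinite A) show ?case by (simp only: sum.infinite[OF infinite.hyps] bopD[OF T])
qed

lemma bop_sum_scale: fixes x :: "'i \<Rightarrow> arr" assumes T: "T \<in> bop n" and x: "\<And>i. i \<in> I \<Longrightarrow> x i \<in> Zn n"
  shows "T (\<Sum>i\<in>I. vscale (c i) (x i)) = (\<Sum>i\<in>I. vscale (c i) (T (x i)))"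
proof -
  have "T (\<Sum>i\<in>I. vscale (c i) (x i)) = (\<Sum>i\<in>I. T (vscale (c i) (x i)))" using x by (intro bop_sum[OF T] Zn_scale) auto
  also have "\<dots> = (\<Sum>i\<in>I. vscale (c i) (T (x i)))" using x by (intro sum.cong) (auto simp: bopD[OF T])
  finally show ?thesis .
qed

lemma bop_comp: assumes A: "A \<in> bop n" and B: "B \<in> bop n" shows "A \<circ> B \<in> bop n"
proof -
  obtain C where C: "C > 0" "\<And>x. x \<in> Zn n \<Longrightarrow> zn_norm n (A x) \<le> C * zn_norm n x" using bop_bound[OF A] by blast
  obtain D where D: "D > 0" "\<And>x. x \<in> Zn n \<Longrightarrow> zn_norm n (B x) \<le> D * zn_norm n x" using bop_bound[OF B] by blast
  show ?thesis
  proof (rule bopI[where C = "C * D"])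
    fix x assume x: "x \<in> Zn n"
    have "zn_norm n (A (B x)) \<le> C * zn_norm n (B x)" using x by (intro C bopD[OF B])
    also have "\<dots> \<le> C * (D * zn_norm n x)" using C x by (intro mult_left_mono D) auto
    finally show "zn_norm n ((A \<circ> B) x) \<le> C * D * zn_norm n x" by simp
  qed (auto simp: bopD[OF A] bopD[OF B])
qed

lemma bop_add: assumes A: "A \<in> bop n" and B: "B \<in> bop n" shows "(\<lambda>x. A x + B x) \<in> bop n"
proof -
  obtain C where C: "C > 0" "\<And>x. x \<in> Zn n \<Longrightarrow> zn_norm n (A x) \<le> C * zn_norm n x" using bop_bound[OF A] by blast
  obtain D where D: "D > 0" "\<And>x. x \<in> Zn n \<Longrightarrow> zn_norm n (B x) \<le> D * zn_norm n x" using bop_bound[OF B] by blast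
  show ?thesis
  proof (rule bopI[where C = "C + D"])
    fix x assume x: "x \<in> Zn n"
    show "zn_norm n (A x + B x) \<le> (C + D) * zn_norm n x"
      using zn_norm_triangle[OF bopD(1)[OF A x] bopD(1)[OF B x]] C(2)[OF x] D(2)[OF x] by (simp add: distrib_right)
  qed (auto simp: bopD[OF A] bopD[OF B] vscale_add intro!: Zn_add)
qed

lemma bop_scale: assumes A: "A \<in> bop n" shows "(\<lambda>x. vscale c (A x)) \<in> bop n"
proof -
  obtain C where C: "C > 0" "\<And>x. x \<in> Zn n \<Longrightarrow> zn_norm n (A x) \<le> C * zn_norm n x" using bop_bound[OF A] by blast
  show ?thesis
  proof (rule bopI[where C = "cmod c * C"])
    fix x assume x: "x \<in> Zn n"
    show "zn_norm n (vscale c (A x)) \<le> cmod c * C * zn_norm n x"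
      using mult_left_mono[OF C(2)[OF x], of "cmod c"] zn_norm_scale[OF bopD(1)[OF A x], of c] by simp
  qed (auto simp: bopD[OF A] vscale_add mult.commute intro!: Zn_scale)
qed

lemma bop_zero: "(\<lambda>x. 0) \<in> bop n"
  by (rule bopI[where C = 0]) auto

text \<open>Operators have to vanish outside the space, whereas the formulas for them make sense for
  all arrays.\<close>

definition restr :: "nat \<Rightarrow> (arr \<Rightarrow> arr) \<Rightarrow> arr \<Rightarrow> arr" where
  "restr n T = (\<lambda>x. if x \<in> Zn n then T x else 0)"

lemma restr_eq: "x \<in> Zn n \<Longrightarrow> restr n T x = T x" by (simp add: restr_def)

lemma restr_bop:
  assumes "\<And>x A. nb n x A \<Longrightarrow> nb n (T x) (C * A)" "C \<ge> 0" "\<And>x y. T (x + y) = T x + T y" "\<And>x c. T (vscale c x) = vscale c (T x)"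
  shows "restr n T \<in> bop n"
proof (rule bopI[where C = C])
  show "zn_norm n (restr n T x) \<le> C * zn_norm n x" if "x \<in> Zn n" for x
    unfolding restr_eq[OF that] using that assms by (intro zn_norm_le_by_nb) auto
  show "restr n T x \<in> Zn n" if "x \<in> Zn n" for x using that assms(1) by (auto simp: restr_def Zn_iff)
qed (auto simp: restr_def assms Zn_add Zn_scale)

definition idop :: "nat \<Rightarrow> arr \<Rightarrow> arr" where "idop n = restr n (\<lambda>x. x)"

lemma idop_bop: "idop n \<in> bop n" unfolding idop_def by (rule restr_bop[where C = 1]) auto

lemma act_scale: "act n p (vscale c x) = vscale c (act n p x)"
  by (auto simp: act_def vscale_def fun_eq_iff sum_distrib_left mult_ac)

lemma act_bop: "restr n (act n p) \<in> bop n"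
proof (rule restr_bop[where C = "cact n * (\<Sum>i<n. cmod (fps_nth p i))"])
  have "cmod (fps_nth p i) \<le> (\<Sum>i<n. cmod (fps_nth p i))" if "i < n" for i using that by (intro member_le_sum) auto
  then show "nb n (act n p x) (cact n * (\<Sum>i<n. cmod (fps_nth p i)) * A)" if "nb n x A" for x A
    using that nb_act by blast
qed (auto simp: cact_nonneg sum_nonneg act_add_right act_scale)

lemma proj_bop: "restr n (proj S) \<in> bop n"
  by (rule restr_bop[where C = 1]) (auto simp: nb_proj proj_add proj_scale)

section \<open>Operators given by matrices of holomorphic multipliers\<close>

text \<open>The effect on jets of a matrix of functions: coordinate k of the image of f is the sum
  of G k l (z) f_l (z) over l in \<open>R k\<close>.\<close>

definition mop :: "nat \<Rightarrow> (nat \<Rightarrow> nat set) \<Rightarrow> (nat \<Rightarrow> nat \<Rightarrow> complex \<Rightarrow> complex) \<Rightarrow> arr \<Rightarrow> arr" where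
  "mop n R G x = (\<lambda>j k. if j < n then \<Sum>l\<in>R k. \<Sum>i\<le>j. fps_nth (jet (G k l)) i * x (j - i) l else 0)"

lemma mop_add: "mop n R G (x + y) = mop n R G x + mop n R G y"
  by (simp add: mop_def fun_eq_iff distrib_left sum.distrib)

lemma mop_scale: "mop n R G (vscale c x) = vscale c (mop n R G x)"
  by (simp add: mop_def fun_eq_iff vscale_def sum_distrib_left mult_ac)

text \<open>Interpolation with an analytic family: row sums bound the matrix on l-infinity over the
  left line, column sums bound it on l1 over the right line. Embeddings and projections along
  subsequences and blocks are instances.\<close>

lemma mop_nb:
  assumes x: "nb n x A" and R: "\<And>k. finite (R k)" and G: "\<And>k l. sgood (G k l)"
    and row: "\<And>t k. (\<Sum>l\<in>R k. cmod (G k l (\<i> * complex_of_real t))) \<le> C"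
    and col: "\<And>t l S. finite S \<Longrightarrow> (\<Sum>k\<in>S. if l \<in> R k then cmod (G k l (1 + \<i> * complex_of_real t)) else 0) \<le> C"
  shows "nb n (mop n R G x) (C * A)"
proof (rule nbI)
  show "below n (mop n R G x)" by (simp add: below_def mop_def)
  fix S :: "nat set" assume S: "finite S"
  define L where "L = (\<Union>k\<in>S. R k)"
  have L: "finite L" using S R by (auto simp: L_def)
  have RL: "R k \<subseteq> L" if "k \<in> S" for k using that by (auto simp: L_def)
  obtain f where f: "fcal L A f" "represents n f (proj L x)" using nb_rb[OF x L] by (auto simp: rb_def)
  have A0: "0 \<le> A" using nb_rb[OF x L] rb_nonneg by blast
  have C0: "0 \<le> C" using row[of 0 0] by (meson sum_nonneg norm_ge_zero order_trans)
  have fs: "sgood (\<lambda>z. f z l)" for l using f(1) by (simp add: fcal_def)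
  define F where "F = (\<lambda>z k. if k \<in> S then \<Sum>l\<in>R k. G k l z * f z l else 0)"
  have "fcal S (C * A) F"
    unfolding fcal_def
  proof (intro conjI allI impI)
    show "finite S" by (rule S)
    show "sgood (\<lambda>z. F z k)" for k
      unfolding F_def by (cases "k \<in> S") (auto intro!: sgood_const sgood_sum sgood_mult fs G)
    show "F z k = 0" if "k \<notin> S" for z k using that by (simp add: F_def)
    show "cmod (F (\<i> * complex_of_real t) k) \<le> C * A" for t k
    proof (cases "k \<in> S")
      case True
      have "cmod (F (\<i> * complex_of_real t) k) \<le> (\<Sum>l\<in>R k. cmod (G k l (\<i> * complex_of_real t)) * A)"
        unfolding F_def using True f(1)
        by (auto simp: norm_mult fcal_def intro!: order_trans[OF norm_sum] sum_mono mult_left_mono)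
      also have "\<dots> \<le> C * A" unfolding sum_distrib_right[symmetric] using row A0 by (intro mult_right_mono)
      finally show ?thesis .
    qed (simp add: F_def A0 C0)
    show "(\<Sum>k\<in>S. cmod (F (1 + \<i> * complex_of_real t) k)) \<le> C * A" for t
    proof -
      let ?w = "1 + \<i> * complex_of_real t"
      have "(\<Sum>k\<in>S. cmod (F ?w k)) \<le> (\<Sum>k\<in>S. \<Sum>l\<in>L. (if l \<in> R k then cmod (G k l ?w) else 0) * cmod (f ?w l))"
      proof (intro sum_mono)
        fix k assume k: "k \<in> S"
        have "cmod (F ?w k) \<le> (\<Sum>l\<in>R k. cmod (G k l ?w) * cmod (f ?w l))"
          unfolding F_def using k by (simp add: norm_mult[symmetric] norm_sum)
        also have "\<dots> = (\<Sum>l\<in>L. (if l \<in> R k then cmod (G k l ?w) else 0) * cmod (f ?w l))"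
          using L RL[OF k] by (intro sum.mono_neutral_cong_left) auto
        finally show "cmod (F ?w k) \<le> (\<Sum>l\<in>L. (if l \<in> R k then cmod (G k l ?w) else 0) * cmod (f ?w l))" .
      qed
      also have "\<dots> = (\<Sum>l\<in>L. (\<Sum>k\<in>S. if l \<in> R k then cmod (G k l ?w) else 0) * cmod (f ?w l))"
        unfolding sum_distrib_right by (rule sum.swap)
      also have "\<dots> \<le> (\<Sum>l\<in>L. C * cmod (f ?w l))" by (intro sum_mono mult_right_mono col S) auto
      also have "\<dots> \<le> C * A" unfolding sum_distrib_left[symmetric] using f(1) C0
        by (intro mult_left_mono) (auto simp: fcal_def)
      finally show ?thesis .
    qed
  qed
  moreover have "represents n F (proj S (mop n R G x))"
    unfolding represents_jet
  proof (intro allI)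
    fix j k
    show "proj S (mop n R G x) j k = (if j < n then fps_nth (jet (\<lambda>z. F z k)) j else 0)"
    proof (cases "j < n \<and> k \<in> S")
      case True
      then have jn: "j < n" and kS: "k \<in> S" by auto
      have "fps_nth (jet (\<lambda>z. F z k)) j = (\<Sum>l\<in>R k. fps_nth (jet (G k l) * jet (\<lambda>z. f z l)) j)"
        unfolding F_def using kS by (simp add: jet_sum[OF sgood_mult[OF G fs]] jet_mult[OF G fs] fps_sum_nth)
      also have "\<dots> = (\<Sum>l\<in>R k. \<Sum>i\<le>j. fps_nth (jet (G k l)) i * x (j - i) l)"
      proof (intro sum.cong refl)
        fix l assume l: "l \<in> R k"
        have "fps_nth (jet (\<lambda>z. f z l)) i = x i l" if "i < n" for i
          using f(2)[unfolded represents_jet, rule_format, of i l] that l RL[OF kS] by (auto simp: proj_def)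
        then show "fps_nth (jet (G k l) * jet (\<lambda>z. f z l)) j = (\<Sum>i\<le>j. fps_nth (jet (G k l)) i * x (j - i) l)"
          using jn by (simp add: fps_mult_nth atLeast0AtMost)
      qed
      finally show ?thesis using True by (simp add: proj_def mop_def)
    next
      case False
      then show ?thesis by (auto simp: proj_def mop_def F_def jet_const)
    qed
  qed
  ultimately show "rb n S (proj S (mop n R G x)) (C * A)" by (auto simp: rb_def)
qed

lemma mop_bop:
  assumes R: "\<And>k. finite (R k)" and G: "\<And>k l. sgood (G k l)"
    and row: "\<And>t k. (\<Sum>l\<in>R k. cmod (G k l (\<i> * complex_of_real t))) \<le> C"
    and col: "\<And>t l S. finite S \<Longrightarrow> (\<Sum>k\<in>S. if l \<in> R k then cmod (G k l (1 + \<i> * complex_of_real t)) else 0) \<le> C"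
  shows "restr n (mop n R G) \<in> bop n"
proof (rule restr_bop[where C = C])
  show "nb n (mop n R G x) (C * A)" if "nb n x A" for x A using mop_nb[OF that R G row col] .
  show "C \<ge> 0" using row[of 0 0] by (meson sum_nonneg norm_ge_zero order_trans)
qed (auto simp: mop_add mop_scale)

section \<open>Factoring the identity through nearly diagonal operators\<close>


definition Fac :: "nat \<Rightarrow> (arr \<Rightarrow> arr) \<Rightarrow> bool" where
  "Fac n T \<longleftrightarrow> (\<exists>A\<in>bop n. \<exists>B\<in>bop n. \<forall>x\<in>Zn n. A (T (B x)) = x)"

lemma Fac_comp: assumes "Fac n (\<lambda>x. A (T (B x)))" "A \<in> bop n" "B \<in> bop n" shows "Fac n T"
proof -
  obtain A' B' where AB: "A' \<in> bop n" "B' \<in> bop n" "\<And>x. x \<in> Zn n \<Longrightarrow> A' (A (T (B (B' x)))) = x"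
    using assms(1) unfolding Fac_def by blast
  have "\<forall>x\<in>Zn n. (A' \<circ> A) (T ((B \<circ> B') x)) = x" using AB(3) by simp
  then show ?thesis unfolding Fac_def using bop_comp[OF AB(1) assms(2)] bop_comp[OF assms(3) AB(2)] by blast
qed

lemma mult_jet_one: "(\<Sum>i\<le>j. fps_nth (jet (\<lambda>z. 1)) i * x (j - i)) = x j" for x :: "nat \<Rightarrow> complex"
  by (simp add: jet_const sum.atMost_shift)

section \<open>Subsequences of coordinates\<close>

definition subseq_restrict :: "nat \<Rightarrow> (nat \<Rightarrow> nat) \<Rightarrow> arr \<Rightarrow> arr" where
  "subseq_restrict n \<sigma> = restr n (mop n (\<lambda>p. {\<sigma> p}) (\<lambda>k l z. 1))"

definition subseq_embed :: "nat \<Rightarrow> (nat \<Rightarrow> nat) \<Rightarrow> arr \<Rightarrow> arr" where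
  "subseq_embed n \<sigma> = restr n (mop n (\<lambda>k. {p. \<sigma> p = k}) (\<lambda>k l z. 1))"

lemma subseq_restrict_bop: assumes "inj \<sigma>" shows "subseq_restrict n \<sigma> \<in> bop n"
  unfolding subseq_restrict_def
proof (rule mop_bop[where C = 1])
  fix t :: real and l and S :: "nat set" assume S: "finite S"
  have "(\<Sum>k\<in>S. if l \<in> {\<sigma> k} then cmod 1 else 0) = card {k\<in>S. l = \<sigma> k}" using S by (simp add: sum.If_cases Int_def)
  also have "\<dots> \<le> real 1"
  proof -
    have "card {k\<in>S. l = \<sigma> k} \<le> card {inv \<sigma> l}" using assms by (intro card_mono) auto
    then show ?thesis by simp
  qed
  finally show "(\<Sum>k\<in>S. if l \<in> {\<sigma> k} then cmod 1 else 0) \<le> 1" by simp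
qed (auto simp: sgood_const)

lemma subseq_embed_bop: assumes "inj \<sigma>" shows "subseq_embed n \<sigma> \<in> bop n"
proof -
  have sub: "{p. \<sigma> p = k} \<subseteq> {inv \<sigma> k}" for k using assms by auto
  have fin: "finite {p. \<sigma> p = k}" for k using finite_subset[OF sub] by auto
  have c: "card {p. \<sigma> p = k} \<le> 1" for k using card_mono[OF _ sub] by simp
  show ?thesis
    unfolding subseq_embed_def
  proof (rule mop_bop[where C = 1])
    show "(\<Sum>l\<in>{p. \<sigma> p = k}. cmod 1) \<le> 1" for k using c[of k] by simp
    fix t :: real and l and S :: "nat set" assume S: "finite S"
    have "(\<Sum>k\<in>S. if l \<in> {p. \<sigma> p = k} then cmod 1 else 0) = (\<Sum>k\<in>S. if k = \<sigma> l then 1 else 0)" by (intro sum.cong) auto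
    also have "\<dots> \<le> 1" using S by simp
    finally show "(\<Sum>k\<in>S. if l \<in> {p. \<sigma> p = k} then cmod 1 else 0) \<le> 1" .
  qed (auto simp: fin sgood_const)
qed

lemma subseq_restrict_apply: "x \<in> Zn n \<Longrightarrow> subseq_restrict n \<sigma> x j p = x j (\<sigma> p)"
  using Zn_below[of x n] mult_jet_one[where x = "\<lambda>j. x j (\<sigma> p)"]
  by (auto simp: subseq_restrict_def restr_eq mop_def below_def)

lemma subseq_embed_uvec: assumes "l < n" "inj \<sigma>" shows "subseq_embed n \<sigma> (uvec p l) = uvec (\<sigma> p) l"
proof (intro ext)
  fix j k
  have "subseq_embed n \<sigma> (uvec p l) j k = (if j < n then \<Sum>q\<in>{q. \<sigma> q = k}. uvec p l j q else 0)"
    using mult_jet_one[where x = "\<lambda>j. uvec p l j _"] by (simp add: subseq_embed_def restr_eq Zn_uvec assms mop_def)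
  also have "\<dots> = uvec (\<sigma> p) l j k"
  proof (cases "k = \<sigma> p")
    case True
    then have "{q. \<sigma> q = k} = {p}" using assms(2) by (auto dest: injD)
    then show ?thesis using True assms(1) by (simp add: uvec_def)
  next
    case False
    then show ?thesis by (auto simp: uvec_def intro!: sum.neutral)
  qed
  finally show "subseq_embed n \<sigma> (uvec p l) j k = uvec (\<sigma> p) l j k" .
qed

lemma coord_null: assumes "x \<in> Zn n" shows "(\<lambda>k. x j k) \<longlonglongrightarrow> 0"
proof (rule LIMSEQ_I)
  fix r :: real assume r: "r > 0"
  obtain K where K: "\<And>S. S \<subseteq> {K..} \<Longrightarrow> zn_norm n (proj S x) < r / 4 ^ n" using zn_tails[OF assms, of "r / 4 ^ n"] r by auto
  show "\<exists>K. \<forall>k\<ge>K. norm (x j k - 0) < r"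
  proof (intro exI[of _ K] allI impI)
    fix k assume "k \<ge> K"
    then have "cmod (x j k) = cmod (proj {K..} x j k)" by (simp add: proj_def)
    also have "\<dots> \<le> 4 ^ n * zn_norm n (proj {K..} x)" by (intro zn_coord Zn_proj assms)
    also have "\<dots> < r" using K[of "{K..}"] by (simp add: field_simps)
    finally show "norm (x j k - 0) < r" by simp
  qed
qed

text \<open>The coordinates of T are bounded functionals and so vanish along bounded disjoint
  sequences. For unit vectors this says that the rows of the matrix of T are null; its columns are
  null by \<open>coord_null\<close>.\<close>

lemma disjoint_coord_null:
  assumes T: "T \<in> bop n" and y: "\<And>i. rb n (S i) (y i) A" and disj: "disjoint_family S"
  shows "(\<lambda>i. T (y i) j k) \<longlonglongrightarrow> 0"
proof (rule LIMSEQ_I)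
  fix r :: real assume r: "r > 0"
  obtain C where C: "C > 0" "\<And>x. x \<in> Zn n \<Longrightarrow> zn_norm n (T x) \<le> C * zn_norm n x" using bop_bound[OF T] by blast
  have yZ: "y i \<in> Zn n" for i using y Zn_rb by blast
  have "finite {i. r \<le> cmod (T (y i) j k)}"
  proof (rule disjoint_null[where n = n and C = "4 ^ n * C" and \<phi> = "\<lambda>x. T x j k" and A = A])
    show "T (\<Sum>i\<in>I. vscale (c i) (y i)) j k = (\<Sum>i\<in>I. c i * T (y i) j k)" for I c
      unfolding bop_sum_scale[OF T yZ] by (simp add: sum_fun_apply vscale_def)
    fix S x A assume x: "rb n S x A"
    have "cmod (T x j k) \<le> 4 ^ n * zn_norm n (T x)" by (intro zn_coord bopD[OF T] Zn_rb[OF x])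
    also have "\<dots> \<le> 4 ^ n * (C * zn_norm n x)" using C(2)[OF Zn_rb[OF x]] by simp
    also have "\<dots> \<le> 4 ^ n * (C * A)" using C(1) zn_norm_rb[OF x] by simp
    finally show "cmod (T x j k) \<le> 4 ^ n * C * A" by simp
  qed (use y disj r in auto)
  then obtain M where M: "\<forall>i\<in>{i. r \<le> cmod (T (y i) j k)}. i < M" using finite_nat_set_iff_bounded by blast
  show "\<exists>M. \<forall>i\<ge>M. norm (T (y i) j k - 0) < r" using M by (intro exI[of _ M]) (auto simp: not_less[symmetric])
qed

lemma row_null: assumes T: "T \<in> bop n" and l: "l < n" shows "(\<lambda>i. T (uvec i l) j k) \<longlonglongrightarrow> 0"
  using rb_uvec[OF l] by (intro disjoint_coord_null[OF T, where S = "\<lambda>i. {i}"]) (auto simp: disjoint_family_on_def)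

lemma finite_convergent_subseq:
  fixes f :: "'a \<Rightarrow> nat \<Rightarrow> complex"
  assumes "finite F" "\<And>a i. a \<in> F \<Longrightarrow> cmod (f a i) \<le> B"
  shows "\<exists>\<sigma> L. strict_mono \<sigma> \<and> (\<forall>a\<in>F. (\<lambda>i. f a (\<sigma> i)) \<longlonglongrightarrow> L a)"
  using assms
proof (induction F rule: finite_induct)
  case empty
  then show ?case using strict_mono_id by auto
next
  case (insert a F)
  then obtain \<sigma> L where s: "strict_mono \<sigma>" "\<forall>a\<in>F. (\<lambda>i. f a (\<sigma> i)) \<longlonglongrightarrow> L a" by auto
  have "bounded (range (\<lambda>i. f a (\<sigma> i)))" using insert.prems by (intro boundedI[of _ B]) auto
  then obtain l \<tau> where t: "strict_mono \<tau>" "((\<lambda>i. f a (\<sigma> i)) \<circ> \<tau>) \<longlonglongrightarrow> l"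
    using bounded_imp_convergent_subsequence by blast
  have "(\<lambda>i. f b ((\<sigma> \<circ> \<tau>) i)) \<longlonglongrightarrow> (if b = a then l else L b)" if "b \<in> insert a F" for b
  proof (cases "b = a")
    case True
    then show ?thesis using t(2) by (simp add: o_def)
  next
    case False
    then show ?thesis using LIMSEQ_subseq_LIMSEQ[OF _ t(1)] s(2) that by (fastforce simp: o_def)
  qed
  then show ?case using strict_mono_o[OF s(1) t(1)] by (intro exI[of _ "\<sigma> \<circ> \<tau>"] exI[of _ "\<lambda>b. if b = a then l else L b"]) blast
qed

text \<open>Each index is chosen so late that its entries against all earlier ones are tiny. The
  bound \<eta> 4^-p, with p the larger index, is at most \<eta> 2^-p 2^-q, which is summable in both
  indices.\<close>

lemma thin_matrix:
  fixes c :: "nat \<Rightarrow> nat \<Rightarrow> nat \<Rightarrow> nat \<Rightarrow> complex"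
  assumes col: "\<And>j l q. j < n \<Longrightarrow> l < n \<Longrightarrow> (\<lambda>i. c j i l q) \<longlonglongrightarrow> 0"
    and row: "\<And>j l q. j < n \<Longrightarrow> l < n \<Longrightarrow> (\<lambda>i. c j q l i) \<longlonglongrightarrow> 0"
    and diag: "\<And>j l. j < n \<Longrightarrow> l < n \<Longrightarrow> (\<lambda>i. c j i l i) \<longlonglongrightarrow> A j l"
    and eta: "\<eta> > 0"
  shows "\<exists>\<tau>. strict_mono \<tau> \<and> (\<forall>p q j l. j < n \<longrightarrow> l < n \<longrightarrow>
     cmod (c j (\<tau> p) l (\<tau> q) - (if p = q then A j l else 0)) \<le> \<eta> * ((1/2) ^ p * (1/2) ^ q))"
proof -
  have ev: "\<exists>M. \<forall>i\<ge>M. (\<forall>q\<le>m. \<forall>j<n. \<forall>l<n. cmod (c j i l q) < e \<and> cmod (c j q l i) < e) \<and>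
     (\<forall>j<n. \<forall>l<n. cmod (c j i l i - A j l) < e)" if e: "e > 0" for m e
  proof -
    have 1: "\<forall>\<^sub>F i in sequentially. \<forall>q\<in>{..m}. \<forall>j\<in>{..<n}. \<forall>l\<in>{..<n}. dist (c j i l q) 0 < e"
      by (intro eventually_ball_finite ballI tendstoD[OF col] e) auto
    have 2: "\<forall>\<^sub>F i in sequentially. \<forall>q\<in>{..m}. \<forall>j\<in>{..<n}. \<forall>l\<in>{..<n}. dist (c j q l i) 0 < e"
      by (intro eventually_ball_finite ballI tendstoD[OF row] e) auto
    have 3: "\<forall>\<^sub>F i in sequentially. \<forall>j\<in>{..<n}. \<forall>l\<in>{..<n}. dist (c j i l i) (A j l) < e"
      by (intro eventually_ball_finite ballI tendstoD[OF diag] e) auto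
    have "\<forall>\<^sub>F i in sequentially. (\<forall>q\<le>m. \<forall>j<n. \<forall>l<n. cmod (c j i l q) < e \<and> cmod (c j q l i) < e) \<and>
     (\<forall>j<n. \<forall>l<n. cmod (c j i l i - A j l) < e)"
      using 1 2 3 by eventually_elim (auto simp: dist_norm)
    then show ?thesis by (simp add: eventually_sequentially)
  qed
  define e where "e = (\<lambda>p::nat. \<eta> * (1/4) ^ p)"
  have e0: "e p > 0" for p using eta by (simp add: e_def)
  have "\<forall>m p. \<exists>M. \<forall>i\<ge>M. (\<forall>q\<le>m. \<forall>j<n. \<forall>l<n. cmod (c j i l q) < e p \<and> cmod (c j q l i) < e p) \<and>
     (\<forall>j<n. \<forall>l<n. cmod (c j i l i - A j l) < e p)" using ev[OF e0] by blast
  then obtain M where M: "\<And>m p i. i \<ge> M m p \<Longrightarrow> (\<forall>q\<le>m. \<forall>j<n. \<forall>l<n. cmod (c j i l q) < e p \<and> cmod (c j q l i) < e p) \<and>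
     (\<forall>j<n. \<forall>l<n. cmod (c j i l i - A j l) < e p)" by metis
  define \<tau> where "\<tau> = rec_nat (M 0 0) (\<lambda>p t. max (Suc t) (M t (Suc p)))"
  have t0: "\<tau> 0 = M 0 0" and tS: "\<tau> (Suc p) = max (Suc (\<tau> p)) (M (\<tau> p) (Suc p))" for p by (simp_all add: \<tau>_def)
  have sm: "strict_mono \<tau>" unfolding strict_mono_Suc_iff tS by (auto simp: less_max_iff_disj)
  have off: "cmod (c j (\<tau> p) l (\<tau> q)) < e p \<and> cmod (c j (\<tau> q) l (\<tau> p)) < e p" if pq: "q < p" and jl: "j < n" "l < n" for p q j l
  proof -
    obtain p' where p: "p = Suc p'" "q \<le> p'" using pq by (cases p) auto
    have "\<tau> p \<ge> M (\<tau> p') p" "\<tau> q \<le> \<tau> p'" using p sm by (auto simp: tS strict_mono_less_eq)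
    then show ?thesis using M jl by blast
  qed
  have dia: "cmod (c j (\<tau> p) l (\<tau> p) - A j l) < e p" if jl: "j < n" "l < n" for p j l
  proof (cases p)
    case 0
    then show ?thesis using M[of 0 0 "\<tau> 0"] jl by (simp add: t0)
  next
    case (Suc p')
    have "\<tau> p \<ge> M (\<tau> p') p" by (simp add: tS Suc)
    then show ?thesis using M jl by blast
  qed
  have ebound: "e p \<le> \<eta> * ((1/2) ^ p * (1/2) ^ q)" if "q \<le> p" for p q
  proof -
    have "(1/4::real) ^ p = (1/2) ^ p * (1/2) ^ p" by (simp add: power_mult_distrib[symmetric])
    also have "\<dots> \<le> (1/2) ^ p * (1/2) ^ q" using that by (intro mult_left_mono power_decreasing) auto
    finally show ?thesis using eta by (simp add: e_def)
  qed
  show ?thesis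
  proof (intro exI[of _ \<tau>] conjI sm allI impI)
    fix p q j l :: nat assume jl: "j < n" "l < n"
    consider "p = q" | "q < p" | "p < q" by linarith
    then show "cmod (c j (\<tau> p) l (\<tau> q) - (if p = q then A j l else 0)) \<le> \<eta> * ((1/2) ^ p * (1/2) ^ q)"
    proof cases
      case 1
      then show ?thesis using dia[OF jl, of p] ebound[of p p] by simp
    next
      case 2
      then show ?thesis using off[OF 2 jl] ebound[of q p] by simp
    next
      case 3
      then show ?thesis using off[OF 3 jl] ebound[of p q] by (simp add: mult.commute)
    qed
  qed
qed

section \<open>Constant matrices acting on slots\<close>

text \<open>ln N tends to infinity, so a polynomial that is bounded at all these points is
  constant.\<close>

lemma poly_bounded_coeff_1:
  fixes P :: "complex poly"
  assumes "\<And>N. N \<ge> 1 \<Longrightarrow> cmod (poly P (of_real (ln (real N)))) \<le> B"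
  shows "coeff P 1 = 0"
proof -
  obtain a p where P: "P = pCons a p" by (cases P)
  have "p = 0"
  proof (rule ccontr)
    assume "p \<noteq> 0"
    then obtain r where r: "\<And>z. r \<le> cmod z \<Longrightarrow> B + 1 \<le> cmod (poly P z)" using poly_infinity[of p "B + 1" a] P by auto
    obtain N :: nat where N: "real N \<ge> exp (max r 0)" using real_arch_simple by blast
    have N0: "real N > 0" using N exp_gt_zero[of "max r 0"] by linarith
    have "max r 0 \<le> ln (real N)" using N ln_ge_iff[OF N0] by blast
    then have "r \<le> cmod (of_real (ln (real N)))" by simp
    then have "B + 1 \<le> cmod (poly P (of_real (ln (real N))))" by (rule r)
    moreover have "N \<ge> 1" using N0 by simp
    ultimately show False using assms[of N] by simp
  qed
  then show ?thesis by (simp add: P)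
qed

definition mact :: "nat \<Rightarrow> (nat \<Rightarrow> nat \<Rightarrow> complex) \<Rightarrow> arr \<Rightarrow> arr" where
  "mact n A x = (\<lambda>j k. if j < n then \<Sum>l<n. A j l * x l k else 0)"

text \<open>Testing a constant matrix \<open>A\<close> on flat vectors of length \<open>N\<close> shows that \<open>e\<^sup>s\<^sup>J A e\<^sup>-\<^sup>s\<^sup>J\<close> stays bounded
  for \<open>s = ln N\<close>. Its entries are polynomials in \<open>s\<close>, so the linear coefficient \<open>[J, A]\<close> vanishes.\<close>
lemma mact_bounded_coeffs:
  assumes A: "\<And>S x D. rb n S x D \<Longrightarrow> D > 0 \<Longrightarrow> nb n (mact n A x) (C * D)" and r: "r < n" and l: "l < n"
  shows "(if r = 0 then 0 else A (r - 1) l) = (if Suc l < n then A r (Suc l) else 0)"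
proof -
  \<comment> \<open>w starts in slot l, and q in slot n - 1 - r, which the pairing matches with slot
    r. Both have norm of order sqrt N, and the pairing consists of N equal terms, so each term is
    bounded independently of N.\<close>
  define w where "w = (\<lambda>N. act n (fps_exp (- of_real (ln (real N)))) (\<Sum>k<N. uvec k l))"
  define q where "q = (\<lambda>N. act n (fps_exp (- of_real (ln (real N)))) (\<Sum>k<N. uvec k (n - 1 - r)))"
  \<comment> \<open>The entry (r, l) of exp(s J) A exp(-s J) as a polynomial in s.\<close>
  define P where "P = (\<Sum>i\<le>r. \<Sum>j\<in>{l..<n}. monom ((-1) ^ (j - l) * A i j / (fact (r - i) * fact (j - l))) (r - i + (j - l)))"
  have flat: "rb n {..<N} (act n (fps_exp (- of_real (ln (real N)))) (\<Sum>k<N. uvec k m)) (sqrt N * real n ^ n)"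
    if "N \<ge> 1" "m < n" for N m
    using rb_disjoint_sum[of "{..<N}" N "\<lambda>k. {k}" n "\<lambda>k. uvec k m" "real n ^ n"] rb_uvec[OF that(2)] that(1)
    by (simp add: disjoint_family_on_def)
  have flatc: "act n (fps_exp s) (\<Sum>k<N. uvec k m) j k = (if k < N \<and> m \<le> j \<and> j < n then s ^ (j - m) / fact (j - m) else 0)"
    for s N m j k
  proof -
    have "(\<Sum>k<N. uvec k m) i k = (if i = m \<and> k < N then 1 else 0)" for i
    proof -
      have "(\<Sum>k'<N. uvec k' m) i k = (\<Sum>k'<N. if k' = k then (if i = m then 1 else 0) else 0)"
        unfolding sum_fun_apply by (intro sum.cong) (auto simp: uvec_def)
      then show ?thesis by auto
    qed
    then have "act n (fps_exp s) (\<Sum>k<N. uvec k m) j k = (if j < n then \<Sum>i\<le>j. s ^ i / fact i * (if j - i = m \<and> k < N then 1 else 0) else 0)"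
      by (simp add: act_def)
    also have "(\<Sum>i\<le>j. s ^ i / fact i * (if j - i = m \<and> k < N then 1 else 0)) = (\<Sum>i\<le>j. if i = j - m then (if m \<le> j \<and> k < N then s ^ i / fact i else 0) else 0)"
      by (intro sum.cong) auto
    also have "\<dots> = (if m \<le> j \<and> k < N then s ^ (j - m) / fact (j - m) else 0)" by simp
    finally show ?thesis by simp
  qed
  have bpe: "bp n (q N) (mact n A (w N)) k = (-1) ^ r * poly P (of_real (ln (real N)))" if k: "k < N" for N k
  proof -
    define s where "s = complex_of_real (ln (real N))"
    have qc: "q N (n - 1 - i) k = (if i \<le> r then (- s) ^ (r - i) / fact (r - i) else 0)" if "i < n" for i
    proof -
      have "n - 1 - i - (n - 1 - r) = r - i" "n - 1 - r \<le> n - 1 - i \<longleftrightarrow> i \<le> r" "n - 1 - i < n" using that r by auto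
      then show ?thesis using k by (simp add: q_def flatc s_def)
    qed
    have wc: "mact n A (w N) i k = (\<Sum>j\<in>{l..<n}. A i j * ((- s) ^ (j - l) / fact (j - l)))" if "i < n" for i
    proof -
      have "mact n A (w N) i k = (\<Sum>j<n. A i j * (if l \<le> j then (- s) ^ (j - l) / fact (j - l) else 0))"
        using that k unfolding mact_def w_def flatc s_def by (auto intro!: sum.cong)
      also have "\<dots> = (\<Sum>j\<in>{l..<n}. A i j * ((- s) ^ (j - l) / fact (j - l)))"
        by (intro sum.mono_neutral_cong_right) auto
      finally show ?thesis .
    qed
    have "bp n (q N) (mact n A (w N)) k = (\<Sum>i<n. (-1) ^ i * (if i \<le> r then (- s) ^ (r - i) / fact (r - i) else 0) * (\<Sum>j\<in>{l..<n}. A i j * ((- s) ^ (j - l) / fact (j - l))))"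
      unfolding bp_def by (intro sum.cong refl) (simp only: qc wc lessThan_iff)
    also have "\<dots> = (\<Sum>i\<le>r. (-1) ^ i * ((- s) ^ (r - i) / fact (r - i)) * (\<Sum>j\<in>{l..<n}. A i j * ((- s) ^ (j - l) / fact (j - l))))"
      using r by (intro sum.mono_neutral_cong_right) auto
    also have "\<dots> = (\<Sum>i\<le>r. \<Sum>j\<in>{l..<n}. (-1) ^ r * ((-1) ^ (j - l) * A i j / (fact (r - i) * fact (j - l)) * s ^ (r - i + (j - l))))"
    proof (intro sum.cong refl)
      fix i assume i: "i \<in> {..r}"
      have sg: "(-1) ^ i * (- s) ^ (r - i) = (-1) ^ r * s ^ (r - i)"
      proof -
        have "(- s) ^ (r - i) = (-1) ^ (r - i) * s ^ (r - i)" by (rule power_minus)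
        moreover have "(-1::complex) ^ i * (-1) ^ (r - i) = (-1) ^ r" using i by (simp add: power_add[symmetric])
        ultimately show ?thesis by (simp add: mult.assoc[symmetric])
      qed
      have "(-1) ^ i * ((- s) ^ (r - i) / fact (r - i)) * (\<Sum>j\<in>{l..<n}. A i j * ((- s) ^ (j - l) / fact (j - l)))
        = (\<Sum>j\<in>{l..<n}. (((-1) ^ i * (- s) ^ (r - i)) / fact (r - i)) * (A i j * ((-1) ^ (j - l) * s ^ (j - l) / fact (j - l))))"
        unfolding sum_distrib_left by (intro sum.cong refl) (simp add: power_minus[of s])
      also have "\<dots> = (\<Sum>j\<in>{l..<n}. (-1) ^ r * ((-1) ^ (j - l) * A i j / (fact (r - i) * fact (j - l)) * s ^ (r - i + (j - l))))"
        unfolding sg power_add by (intro sum.cong refl) simp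
      finally show "(-1) ^ i * ((- s) ^ (r - i) / fact (r - i)) * (\<Sum>j\<in>{l..<n}. A i j * ((- s) ^ (j - l) / fact (j - l)))
        = (\<Sum>j\<in>{l..<n}. (-1) ^ r * ((-1) ^ (j - l) * A i j / (fact (r - i) * fact (j - l)) * s ^ (r - i + (j - l))))" .
    qed
    also have "\<dots> = (-1) ^ r * poly P s"
      by (simp add: P_def poly_sum poly_monom sum_distrib_left)
    finally show ?thesis by (simp add: s_def)
  qed
  have "cmod (poly P (of_real (ln (real N)))) \<le> 4 ^ n * C * (real n ^ n * real n ^ n)" if N: "N \<ge> 1" for N
  proof -
    have qr: "rb n {..<N} (q N) (sqrt N * real n ^ n)" unfolding q_def using flat[OF N, of "n - 1 - r"] r by simp
    have wr: "nb n (mact n A (w N)) (C * (sqrt N * real n ^ n))" unfolding w_def using A[OF flat[OF N l]] N l by simp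
    have "bil n (q N) (mact n A (w N)) = of_nat N * ((-1) ^ r * poly P (of_real (ln (real N))))"
      unfolding bil_finite[OF rb_finite[OF qr] rb_supp[OF qr]] using bpe by simp
    then have "real N * cmod (poly P (of_real (ln (real N)))) = cmod (bil n (q N) (mact n A (w N)))"
      by (simp add: norm_mult norm_power)
    also have "\<dots> \<le> 4 ^ n * (C * (sqrt N * real n ^ n)) * (sqrt N * real n ^ n)" by (rule bil_bound_nb[OF qr wr])
    also have "\<dots> = real N * (4 ^ n * C * (real n ^ n * real n ^ n))"
      using real_sqrt_mult_self[of "real N"] by (simp add: mult_ac)
    finally show ?thesis using N by simp
  qed
  then have c1: "coeff P 1 = 0" by (rule poly_bounded_coeff_1)
  \<comment> \<open>A linear term needs r - i + (j - l) = 1: either i = r - 1 and j = l, or i = r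
    and j = l + 1, with opposite signs.\<close>
  have "coeff P 1 = (\<Sum>i\<le>r. \<Sum>j\<in>{l..<n}. if r - i + (j - l) = 1 then (-1) ^ (j - l) * A i j / (fact (r - i) * fact (j - l)) else 0)"
    by (simp add: P_def coeff_sum coeff_monom)
  also have "\<dots> = (\<Sum>(i,j)\<in>{..r} \<times> {l..<n}. if r - i + (j - l) = 1 then (-1) ^ (j - l) * A i j / (fact (r - i) * fact (j - l)) else 0)"
    by (rule sum.cartesian_product)
  also have "\<dots> = (\<Sum>(i,j)\<in>(if r = 0 then {} else {(r - 1, l)}) \<union> (if Suc l < n then {(r, Suc l)} else {}). (-1) ^ (j - l) * A i j / (fact (r - i) * fact (j - l)))"
    using r l by (intro sum.mono_neutral_cong_right) (auto split: if_splits)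
  also have "\<dots> = (if r = 0 then 0 else A (r - 1) l) - (if Suc l < n then A r (Suc l) else 0)"
    using r by auto
  finally show ?thesis using c1 by simp
qed

text \<open>Commuting with the shift makes A constant along its diagonals, and the value 0
  prescribed above row 0 propagates to all entries above the main diagonal.\<close>

lemma mact_toeplitz:
  assumes A: "\<And>S x D. rb n S x D \<Longrightarrow> D > 0 \<Longrightarrow> nb n (mact n A x) (C * D)" and "j < n" "l < n"
  shows "A j l = (if l \<le> j then A (j - l) 0 else 0)"
  using assms(2,3)
proof (induction l arbitrary: j)
  case (Suc l)
  have *: "(if j = 0 then 0 else A (j - 1) l) = A j (Suc l)"
    using mact_bounded_coeffs[OF A Suc.prems(1), where l = l] Suc.prems(2) by simp
  show ?case
  proof (cases j)
    case 0
    then show ?thesis using * by simp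
  next
    case (Suc j')
    have "A j' l = (if l \<le> j' then A (j' - l) 0 else 0)" using Suc Suc.prems by (intro Suc.IH) auto
    then show ?thesis using * Suc by (simp split: if_splits)
  qed
qed simp

lemma mact_eq_act:
  assumes "\<And>j l. j < n \<Longrightarrow> l < n \<Longrightarrow> A j l = (if l \<le> j then A (j - l) 0 else 0)"
  shows "mact n A x = act n (Abs_fps (\<lambda>i. A i 0)) x"
proof (intro ext)
  fix j k
  show "mact n A x j k = act n (Abs_fps (\<lambda>i. A i 0)) x j k"
  proof (cases "j < n")
    case True
    have "(\<Sum>l<n. A j l * x l k) = (\<Sum>l\<le>j. A (j - l) 0 * x l k)"
      using True assms[OF True] by (intro sum.mono_neutral_cong_right) auto
    also have "\<dots> = (\<Sum>i\<le>j. A i 0 * x (j - i) k)"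
      by (rule sum.reindex_bij_witness[where i = "\<lambda>i. j - i" and j = "\<lambda>i. j - i"]) auto
    finally show ?thesis using True by (simp add: mact_def act_def)
  qed (simp add: mact_def act_def)
qed

section \<open>Perturbation and the diagonal criterion\<close>

text \<open>The equation x + K x = y is solved by iterating x to y - K x, a contraction with factor
  1/2 on a complete space; the solution operator is linear by uniqueness and bounded by 2.\<close>

lemma neumann:
  assumes K: "K \<in> bop n" and half: "\<And>x. x \<in> Zn n \<Longrightarrow> zn_norm n (K x) \<le> zn_norm n x / 2"
  shows "\<exists>Q\<in>bop n. \<forall>x\<in>Zn n. Q (x + K x) = x"
proof -
  have lower: "zn_norm n x \<le> 2 * zn_norm n (x + K x)" if x: "x \<in> Zn n" for x
    using zn_norm_triangle_diff[OF Zn_add[OF x bopD(1)[OF K x]] bopD(1)[OF K x]] half[OF x] by simp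
  have surj: "\<exists>x\<in>Zn n. x + K x = y" if y: "y \<in> Zn n" for y
  proof -
    define X where "X = rec_nat 0 (\<lambda>m x. y - K x)"
    have X0: "X 0 = 0" and XS: "X (Suc m) = y - K (X m)" for m by (simp_all add: X_def)
    have XZ: "X m \<in> Zn n" for m
    proof (induction m)
      case 0
      show ?case unfolding X0 by (rule Zn_zero)
    next
      case (Suc m)
      show ?case unfolding XS by (rule Zn_diff[OF y bopD(1)[OF K Suc.IH]])
    qed
    have step: "zn_norm n (X (Suc m) - X m) \<le> zn_norm n y * (1/2) ^ m" for m
    proof (induction m)
      case 0
      then show ?case by (simp add: X0 XS bopD[OF K])
    next
      case (Suc m)
      have "X (Suc (Suc m)) - X (Suc m) = K (X m) - K (X (Suc m))" by (simp add: XS)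
      also have "\<dots> = K (X m - X (Suc m))" by (rule bopD(6)[OF K XZ XZ, symmetric])
      finally have "zn_norm n (X (Suc (Suc m)) - X (Suc m)) \<le> zn_norm n (X m - X (Suc m)) / 2"
        using half[OF Zn_diff[OF XZ XZ]] by simp
      then show ?case using Suc.IH zn_norm_commute[OF XZ XZ, of m "Suc m"] by (simp add: fun_diff_def)
    qed
    have tele: "zn_norm n (X (m + l) - X m) \<le> zn_norm n y * (2 * (1/2) ^ m - 2 * (1/2) ^ (m + l))" for m l
    proof (induction l)
      case (Suc l)
      have "zn_norm n (X (Suc (m + l)) - X m) = zn_norm n ((X (Suc (m + l)) - X (m + l)) + (X (m + l) - X m))" by simp
      also have "\<dots> \<le> zn_norm n (X (Suc (m + l)) - X (m + l)) + zn_norm n (X (m + l) - X m)"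
        by (intro zn_norm_triangle Zn_diff XZ)
      also have "\<dots> \<le> zn_norm n y * (1/2) ^ (m + l) + zn_norm n y * (2 * (1/2) ^ m - 2 * (1/2) ^ (m + l))"
        using step[of "m + l"] Suc.IH by (simp add: fun_diff_def)
      finally have "zn_norm n (X (Suc (m + l)) - X m) \<le> zn_norm n y * (2 * (1/2) ^ m - 2 * (1/2) ^ (m + Suc l))"
        by (simp add: algebra_simps)
      then show ?case by (simp add: fun_diff_def)
    next
      case 0
      have "zn_norm n (X (m + 0) - X m) \<le> zn_norm n y * (2 * (1/2) ^ m - 2 * (1/2) ^ (m + 0))" by simp
      then show ?case by (simp only: fun_diff_def)
    qed
    have tail: "zn_norm n (X l - X m) \<le> 2 * zn_norm n y * (1/2) ^ M" if "M \<le> m" "M \<le> l" for l m M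
    proof -
      have *: "zn_norm n (X b - X a) \<le> 2 * zn_norm n y * (1/2) ^ M" if ab: "a \<le> b" "M \<le> a" for a b
      proof -
        have "zn_norm n (X b - X a) \<le> zn_norm n y * (2 * (1/2) ^ a - 2 * (1/2) ^ b)" using tele[of a "b - a"] ab by simp
        also have "\<dots> \<le> zn_norm n y * (2 * (1/2) ^ a)" using zn_norm_nonneg[OF y] by (intro mult_left_mono) auto
        also have "\<dots> \<le> zn_norm n y * (2 * (1/2) ^ M)" using zn_norm_nonneg[OF y] ab by (intro mult_left_mono power_decreasing) auto
        finally show ?thesis by simp
      qed
      show ?thesis using *[of m l] *[of l m] that zn_norm_commute[OF XZ XZ, of l m] by (cases "m \<le> l") auto
    qed
    have "\<exists>x\<in>Zn n. (\<lambda>m. zn_norm n (X m - x)) \<longlonglongrightarrow> 0"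
    proof (rule zn_complete[OF XZ])
      fix e :: real assume e: "e > 0"
      have "(\<lambda>M. 2 * zn_norm n y * (1/2) ^ M) \<longlonglongrightarrow> 2 * zn_norm n y * 0"
        by (intro tendsto_intros LIMSEQ_power_zero) simp
      then have "\<forall>\<^sub>F M in sequentially. 2 * zn_norm n y * (1/2) ^ M < e" using e by (intro order_tendstoD) auto
      then obtain M where "2 * zn_norm n y * (1/2) ^ M < e" by (auto simp: eventually_sequentially)
      then show "\<exists>M. \<forall>m\<ge>M. \<forall>l\<ge>M. zn_norm n (X l - X m) < e" using tail by (meson le_less_trans)
    qed
    then obtain x where x: "x \<in> Zn n" "(\<lambda>m. zn_norm n (X m - x)) \<longlonglongrightarrow> 0" by blast
    have Kx: "K x \<in> Zn n" using x by (intro bopD[OF K])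
    have "zn_norm n (x + K x - y) \<le> zn_norm n (X (Suc m) - x) + zn_norm n (X m - x)" for m
    proof -
      have e: "- (x + K x - y) = (X (Suc m) - x) + K (X m - x)" by (simp add: XS bopD(6)[OF K XZ x(1)])
      have "zn_norm n (x + K x - y) = zn_norm n ((X (Suc m) - x) + K (X m - x))"
        using zn_norm_minus[OF Zn_diff[OF Zn_add[OF x(1) Kx] y]] unfolding e by (simp only:)
      also have "\<dots> \<le> zn_norm n (X (Suc m) - x) + zn_norm n (K (X m - x))"
        by (intro zn_norm_triangle Zn_diff XZ x bopD[OF K])
      also have "zn_norm n (K (X m - x)) \<le> zn_norm n (X m - x)"
        using half[OF Zn_diff[OF XZ x(1)], of m] zn_norm_nonneg[OF Zn_diff[OF XZ x(1)], of m] by linarith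
      finally show ?thesis by (simp add: fun_diff_def)
    qed
    moreover have "(\<lambda>m. zn_norm n (X (Suc m) - x) + zn_norm n (X m - x)) \<longlonglongrightarrow> 0 + 0"
      by (intro tendsto_add x(2) LIMSEQ_Suc[OF x(2)])
    ultimately have "zn_norm n (x + K x - y) \<le> 0" by (intro LIMSEQ_le_const[of _ 0]) auto
    then have "x + K x - y = 0" by (intro zn_norm_eq_0[OF Zn_diff[OF Zn_add[OF x(1) Kx] y]])
    then show ?thesis using x(1) by (intro bexI[of _ x]) auto
  qed
  define Q where "Q = restr n (\<lambda>y. SOME x. x \<in> Zn n \<and> x + K x = y)"
  have Q: "Q y \<in> Zn n \<and> Q y + K (Q y) = y" if "y \<in> Zn n" for y
    unfolding Q_def restr_eq[OF that] using surj[OF that] by (metis (mono_tags, lifting) someI_ex)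
  have uniq: "x = x'" if "x \<in> Zn n" "x' \<in> Zn n" "x + K x = x' + K x'" for x x'
  proof -
    have "(x - x') + K (x - x') = 0" using that by (simp add: bopD(6)[OF K] algebra_simps)
    then have "zn_norm n (x - x') \<le> 0" using lower[OF Zn_diff[OF that(1,2)]] by simp
    then show ?thesis using zn_norm_eq_0[OF Zn_diff[OF that(1,2)]] by simp
  qed
  have "Q \<in> bop n"
  proof (rule bopI[where C = 2])
    show "Q (x + y) = Q x + Q y" if xy: "x \<in> Zn n" "y \<in> Zn n" for x y
    proof (rule uniq)
      have "K (Q x + Q y) = K (Q x) + K (Q y)" using Q xy by (intro bopD(2)[OF K]) auto
      then have "Q x + Q y + K (Q x + Q y) = (Q x + K (Q x)) + (Q y + K (Q y))" by (simp only: add_ac)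
      then show "Q (x + y) + K (Q (x + y)) = Q x + Q y + K (Q x + Q y)" using Q xy Zn_add[OF xy] by simp
    qed (use Q xy Zn_add in auto)
    show "Q (vscale c x) = vscale c (Q x)" if x: "x \<in> Zn n" for x c
    proof (rule uniq)
      have "K (vscale c (Q x)) = vscale c (K (Q x))" using Q x by (intro bopD(3)[OF K]) auto
      then have "vscale c (Q x) + K (vscale c (Q x)) = vscale c (Q x + K (Q x))" by (simp only: vscale_add)
      then show "Q (vscale c x) + K (Q (vscale c x)) = vscale c (Q x) + K (vscale c (Q x))" using Q x Zn_scale[OF x] by simp
    qed (use Q x Zn_scale in auto)
    show "zn_norm n (Q x) \<le> 2 * zn_norm n x" if "x \<in> Zn n" for x using lower[of "Q x"] Q[OF that] by simp
  qed (use Q in \<open>auto simp: Q_def restr_def\<close>)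
  moreover have "\<forall>x\<in>Zn n. Q (x + K x) = x"
  proof
    fix x assume x: "x \<in> Zn n"
    have "x + K x \<in> Zn n" by (intro Zn_add bopD[OF K] x)
    then show "Q (x + K x) = x" using Q uniq x by blast
  qed
  ultimately show ?thesis by blast
qed

text \<open>Vanishing tails make the finitely supported vectors dense, and T is already known to be
  continuous.\<close>

lemma bop_bound_dense:
  assumes T: "T \<in> bop n" and fin: "\<And>K x. x \<in> Zn n \<Longrightarrow> zn_norm n (T (proj {..<K} x)) \<le> M * zn_norm n x" and x: "x \<in> Zn n"
  shows "zn_norm n (T x) \<le> M * zn_norm n x"
proof (rule field_le_epsilon)
  fix e :: real assume e: "e > 0"
  obtain C where C: "C > 0" "\<And>x. x \<in> Zn n \<Longrightarrow> zn_norm n (T x) \<le> C * zn_norm n x" using bop_bound[OF T] by blast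
  obtain K where K: "zn_norm n (proj {K..} x) < e / C" using zn_tails_K[OF x, of "e / C"] e C by auto
  have "T x = T (proj {..<K} x) + T (proj {K..} x)" by (subst bopD(2)[OF T, symmetric]) (auto simp: proj_compl intro!: Zn_proj x)
  then have "zn_norm n (T x) \<le> zn_norm n (T (proj {..<K} x)) + zn_norm n (T (proj {K..} x))"
    using zn_norm_triangle by (simp add: bopD[OF T] Zn_proj x)
  also have "\<dots> \<le> M * zn_norm n x + C * zn_norm n (proj {K..} x)" by (intro add_mono fin x C Zn_proj)
  also have "C * zn_norm n (proj {K..} x) \<le> e" using K C(1) by (simp add: field_simps)
  finally show "zn_norm n (T x) \<le> M * zn_norm n x + e" by simp
qed

lemma geo_half_sum: "finite S \<Longrightarrow> (\<Sum>k\<in>S. (1/2::real) ^ k) \<le> 2"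
  using sum_le_suminf[of "\<lambda>k. (1/2::real) ^ k" S] by (simp add: suminf_geometric)

text \<open>In the constant, 2 bounds the geometric sum, one factor n counts the slots, and n^n
  bounds the unit vectors.\<close>

lemma nb_of_decay:
  assumes b: "below n y" and d: "\<And>j p. j < n \<Longrightarrow> cmod (y j p) \<le> E * (1/2) ^ p" and E: "E \<ge> 0"
  shows "nb n y (2 * real n * real n ^ n * E)"
proof (rule nbI[OF b])
  fix S :: "nat set" assume S: "finite S"
  have "rb n S (proj S y) (\<Sum>k\<in>S. \<Sum>j<n. cmod (proj S y j k) * real n ^ n)"
    using b by (intro rb_finite_coords S) (auto simp: supp_in_def proj_def below_def)
  moreover have "(\<Sum>k\<in>S. \<Sum>j<n. cmod (proj S y j k) * real n ^ n) \<le> (\<Sum>k\<in>S. \<Sum>j<n. E * (1/2) ^ k * real n ^ n)"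
    using d by (intro sum_mono mult_right_mono) (auto simp: proj_def)
  moreover have "(\<Sum>k\<in>S. \<Sum>j<n. E * (1/2) ^ k * real n ^ n) = (real n * real n ^ n * E) * (\<Sum>k\<in>S. (1/2) ^ k)"
    by (simp add: sum_distrib_left mult_ac)
  moreover have "(real n * real n ^ n * E) * (\<Sum>k\<in>S. (1/2) ^ k) \<le> (real n * real n ^ n * E) * 2"
    using geo_half_sum[OF S] E by (intro mult_left_mono) auto
  ultimately show "rb n S (proj S y) (2 * real n * real n ^ n * E)"
    using rb_mono by (metis (no_types, lifting) mult.assoc mult.commute order_trans)
qed

text \<open>Entry errors \<eta> 2^-p 2^-q are summed against coordinates of size at most 4^n times
  the norm of x: the factor in q pays for the sum over the support, the factor in p gives the decay
  of the result.\<close>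

lemma near_mact:
  assumes W: "W \<in> bop n" and eta: "\<eta> \<ge> 0"
    and err: "\<And>p q j l. j < n \<Longrightarrow> l < n \<Longrightarrow> cmod (W (uvec q l) j p - (if p = q then A j l else 0)) \<le> \<eta> * ((1/2) ^ p * (1/2) ^ q)"
    and x: "x \<in> Zn n" "finite S" "supp_in S x"
  shows "nb n (W x - mact n A x) (2 * real n * real n ^ n * (2 * real n * 4 ^ n * \<eta>) * zn_norm n x)"
proof -
  have bx: "below n x" using Zn_below[OF x(1)] .
  have "nb n (W x - mact n A x) (2 * real n * real n ^ n * (2 * real n * 4 ^ n * \<eta> * zn_norm n x))"
  proof (rule nb_of_decay)
    show "below n (W x - mact n A x)" using Zn_below[OF bopD(1)[OF W x(1)]] by (simp add: below_def mact_def)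
    show "0 \<le> 2 * real n * 4 ^ n * \<eta> * zn_norm n x" using eta zn_norm_nonneg[OF x(1)] by simp
    fix j p assume j: "j < n"
    have "W x = W (\<Sum>q\<in>S. \<Sum>l<n. vscale (x l q) (uvec q l))" using finite_expand[OF x(2,3) bx] by simp
    also have "\<dots> = (\<Sum>q\<in>S. W (\<Sum>l<n. vscale (x l q) (uvec q l)))"
      by (intro bop_sum[OF W] Zn_sum Zn_scale Zn_uvec) auto
    also have "\<dots> = (\<Sum>q\<in>S. \<Sum>l<n. vscale (x l q) (W (uvec q l)))"
      by (intro sum.cong bop_sum_scale[OF W] Zn_uvec) auto
    finally have 1: "W x j p = (\<Sum>q\<in>S. \<Sum>l<n. x l q * W (uvec q l) j p)"
      by (simp add: sum_fun_apply vscale_def)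
    have "mact n A x j p = (\<Sum>l<n. A j l * (if p \<in> S then x l p else 0))"
      using j x(3) by (auto simp: mact_def supp_in_def intro!: sum.cong)
    also have "\<dots> = (\<Sum>q\<in>S. if q = p then \<Sum>l<n. A j l * x l p else 0)" using x(2) by simp
    also have "\<dots> = (\<Sum>q\<in>S. \<Sum>l<n. x l q * (if p = q then A j l else 0))"
      by (intro sum.cong refl) (auto simp: mult.commute)
    finally have 2: "mact n A x j p = (\<Sum>q\<in>S. \<Sum>l<n. x l q * (if p = q then A j l else 0))" .
    have "(W x - mact n A x) j p = (\<Sum>q\<in>S. \<Sum>l<n. x l q * (W (uvec q l) j p - (if p = q then A j l else 0)))"
      using 1 2 by (simp add: sum_subtractf right_diff_distrib)
    also have "cmod \<dots> \<le> (\<Sum>q\<in>S. \<Sum>l<n. (4 ^ n * zn_norm n x) * (\<eta> * ((1/2) ^ p * (1/2) ^ q)))"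
    proof (intro order_trans[OF norm_sum] sum_mono)
      fix q l assume "q \<in> S" "l \<in> {..<n}"
      then show "cmod (x l q * (W (uvec q l) j p - (if p = q then A j l else 0))) \<le> (4 ^ n * zn_norm n x) * (\<eta> * ((1/2) ^ p * (1/2) ^ q))"
        unfolding norm_mult using zn_norm_nonneg[OF x(1)] by (intro mult_mono zn_coord[OF x(1)] err[OF j]) auto
    qed
    also have "\<dots> = (real n * 4 ^ n * \<eta> * zn_norm n x * (1/2) ^ p) * (\<Sum>q\<in>S. (1/2) ^ q)"
      by (simp add: sum_distrib_left mult_ac)
    also have "\<dots> \<le> (real n * 4 ^ n * \<eta> * zn_norm n x * (1/2) ^ p) * 2"
      using geo_half_sum[OF x(2)] eta zn_norm_nonneg[OF x(1)] by (intro mult_left_mono) auto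
    finally show "cmod ((W x - mact n A x) j p) \<le> 2 * real n * 4 ^ n * \<eta> * zn_norm n x * (1/2) ^ p" by (simp add: mult_ac)
  qed
  then show ?thesis by (simp add: mult_ac)
qed

text \<open>Thinning is used twice. With \<eta> = 1 it only shows that the limit matrix is a bounded
  operator, hence a power series in the shift; this yields an inverse, whose norm then dictates how
  small \<eta> has to be in the second thinning for the error to be absorbed.\<close>

lemma diagonal_Fac:
  assumes S: "S \<in> bop n" and r: "r < n" and d: "d > 0" and inf: "infinite {i. d \<le> cmod (S (uvec i (n - 1)) r i)}"
  shows "Fac n S"
proof -
  have n1: "n \<ge> 1" using r by simp
  obtain CS where CS: "CS > 0" "\<And>x. x \<in> Zn n \<Longrightarrow> zn_norm n (S x) \<le> CS * zn_norm n x" using bop_bound[OF S] by blast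
  define c where "c = (\<lambda>j k l i. S (uvec i l) j k)"
  obtain \<sigma>0 :: "nat \<Rightarrow> nat" where s0: "strict_mono \<sigma>0" "\<And>i. d \<le> cmod (c r (\<sigma>0 i) (n - 1) (\<sigma>0 i))"
    using infinite_enumerate[OF inf] unfolding c_def mem_Collect_eq by metis
  have cb: "cmod (c j k l i) \<le> 4 ^ n * (CS * real n ^ n)" if "l < n" for j k l i
  proof -
    have "cmod (c j k l i) \<le> 4 ^ n * zn_norm n (S (uvec i l))" unfolding c_def using that by (intro zn_coord bopD[OF S] Zn_uvec)
    also have "\<dots> \<le> 4 ^ n * (CS * zn_norm n (uvec i l))" using CS(2)[OF Zn_uvec[OF that]] by simp
    also have "\<dots> \<le> 4 ^ n * (CS * real n ^ n)" using zn_norm_rb[OF rb_uvec[OF that]] CS(1) by simp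
    finally show ?thesis .
  qed
  \<comment> \<open>All n^2 entries of the diagonal blocks have to converge, as the comparison
    operator is the whole limit matrix and not one entry of it.\<close>
  have "\<exists>\<sigma> L. strict_mono \<sigma> \<and> (\<forall>a\<in>{..<n} \<times> {..<n}. (\<lambda>i. c (fst a) (\<sigma>0 (\<sigma> i)) (snd a) (\<sigma>0 (\<sigma> i))) \<longlonglongrightarrow> L a)"
    by (rule finite_convergent_subseq[where f = "\<lambda>a i. c (fst a) (\<sigma>0 i) (snd a) (\<sigma>0 i)"]) (auto intro: cb)
  then obtain \<sigma>1 L where s1: "strict_mono \<sigma>1"
     "\<And>a. a \<in> {..<n} \<times> {..<n} \<Longrightarrow> (\<lambda>i. c (fst a) (\<sigma>0 (\<sigma>1 i)) (snd a) (\<sigma>0 (\<sigma>1 i))) \<longlonglongrightarrow> L a" by blast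
  define \<rho> where "\<rho> = (\<lambda>i. \<sigma>0 (\<sigma>1 i))"
  define A where "A = (\<lambda>j l. L (j, l))"
  have rho: "strict_mono \<rho>" using strict_mono_o[OF s0(1) s1(1)] by (simp add: \<rho>_def o_def)
  have diag: "(\<lambda>i. c j (\<rho> i) l (\<rho> i)) \<longlonglongrightarrow> A j l" if "j < n" "l < n" for j l
    using s1(2)[of "(j, l)"] that by (simp add: \<rho>_def A_def)
  have col: "(\<lambda>i. c j (\<rho> i) l q) \<longlonglongrightarrow> 0" if "l < n" for j l q
    using LIMSEQ_subseq_LIMSEQ[OF coord_null[OF bopD(1)[OF S Zn_uvec[OF that]]] rho] by (simp add: c_def o_def)
  have row: "(\<lambda>i. c j q l (\<rho> i)) \<longlonglongrightarrow> 0" if "l < n" for j l q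
    using LIMSEQ_subseq_LIMSEQ[OF row_null[OF S that] rho] by (simp add: c_def o_def)
  define W where "W = (\<lambda>\<sigma> x. subseq_restrict n \<sigma> (S (subseq_embed n \<sigma> x)))"
  have ex: "\<exists>\<sigma>. inj \<sigma> \<and> W \<sigma> \<in> bop n \<and> (\<forall>p q j l. j < n \<longrightarrow> l < n \<longrightarrow>
     cmod (W \<sigma> (uvec q l) j p - (if p = q then A j l else 0)) \<le> \<eta> * ((1/2) ^ p * (1/2) ^ q))" if eta: "\<eta> > 0" for \<eta>
  proof -
    obtain \<tau> where tau: "strict_mono \<tau>" "\<And>p q j l. j < n \<Longrightarrow> l < n \<Longrightarrow>
     cmod (c j (\<rho> (\<tau> p)) l (\<rho> (\<tau> q)) - (if p = q then A j l else 0)) \<le> \<eta> * ((1/2) ^ p * (1/2) ^ q)"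
      using thin_matrix[where c = "\<lambda>j k l i. c j (\<rho> k) l (\<rho> i)" and A = A and \<eta> = \<eta> and n = n] col row diag eta by blast
    define \<sigma> where "\<sigma> = (\<lambda>p. \<rho> (\<tau> p))"
    have inj: "inj \<sigma>" using strict_mono_imp_inj_on[OF strict_mono_o[OF rho tau(1)]] by (simp add: \<sigma>_def o_def)
    have "W \<sigma> = subseq_restrict n \<sigma> \<circ> (S \<circ> subseq_embed n \<sigma>)" by (auto simp: W_def)
    then have "W \<sigma> \<in> bop n" using bop_comp[OF subseq_restrict_bop[OF inj] bop_comp[OF S subseq_embed_bop[OF inj]]] by simp
    moreover have "W \<sigma> (uvec q l) j p = c j (\<sigma> p) l (\<sigma> q)" if "l < n" for j p q l
      unfolding W_def subseq_embed_uvec[OF that inj] c_def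
      by (rule subseq_restrict_apply[OF bopD(1)[OF S Zn_uvec[OF that]]])
    ultimately show ?thesis using inj tau(2) unfolding \<sigma>_def by (intro exI[of _ "\<lambda>p. \<rho> (\<tau> p)"]) auto
  qed
  define c0 where "c0 = 2 * real n * real n ^ n * (2 * real n * 4 ^ n)"
  have c0: "c0 > 0" using n1 by (simp add: c0_def)
  have near: "nb n (W \<sigma> x - mact n A x) (c0 * \<eta> * zn_norm n x)"
    if "\<eta> > 0" "W \<sigma> \<in> bop n" "\<forall>p q j l. j < n \<longrightarrow> l < n \<longrightarrow>
     cmod (W \<sigma> (uvec q l) j p - (if p = q then A j l else 0)) \<le> \<eta> * ((1/2) ^ p * (1/2) ^ q)"
     "x \<in> Zn n" "finite T" "supp_in T x" for \<sigma> \<eta> x T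
    using near_mact[OF that(2) _ _ that(4-6), of \<eta> A] that(1,3) by (simp add: c0_def mult_ac)
  obtain \<sigma>a where sa: "W \<sigma>a \<in> bop n" "\<forall>p q j l. j < n \<longrightarrow> l < n \<longrightarrow>
     cmod (W \<sigma>a (uvec q l) j p - (if p = q then A j l else 0)) \<le> 1 * ((1/2) ^ p * (1/2) ^ q)" using ex[of 1] by auto
  obtain CW where CW: "CW > 0" "\<And>x. x \<in> Zn n \<Longrightarrow> zn_norm n (W \<sigma>a x) \<le> CW * zn_norm n x" using bop_bound[OF sa(1)] by blast
  have "nb n (mact n A x) ((CW + 1 + c0) * D)" if x: "rb n T x D" and D: "D > 0" for T x D
  proof -
    have xZ: "x \<in> Zn n" and xD: "zn_norm n x \<le> D" using Zn_rb[OF x] zn_norm_rb[OF x] .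
    have "zn_norm n (W \<sigma>a x) \<le> CW * D" using CW(1) by (intro order_trans[OF CW(2)[OF xZ] mult_left_mono[OF xD]]) simp
    then have 1: "nb n (W \<sigma>a x) ((CW + 1) * D)" using D by (intro nb_if_norm_less bopD[OF sa(1)] xZ) (simp add: distrib_right)
    have "nb n (W \<sigma>a x - mact n A x) (c0 * 1 * zn_norm n x)" using near[OF zero_less_one sa xZ rb_finite[OF x] rb_supp[OF x]] .
    then have "nb n (W \<sigma>a x - mact n A x) (c0 * D)" using xD c0 by (elim nb_mono) simp
    then have 2: "nb n (vscale (-1) (W \<sigma>a x - mact n A x)) (c0 * D)" using nb_scale[of n _ "c0 * D" "-1"] by simp
    have "mact n A x = W \<sigma>a x + vscale (-1) (W \<sigma>a x - mact n A x)" by (simp add: vscale_minus_one)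
    then show ?thesis using nb_add[OF 1 2] by (simp add: distrib_right)
  qed
  note toep = mact_toeplitz[OF this]
  define p where "p = Abs_fps (\<lambda>i. A i 0)"
  have mp: "mact n A x = act n p x" for x unfolding p_def by (rule mact_eq_act) (rule toep)
  have "d \<le> cmod (A r (n - 1))"
  proof (rule LIMSEQ_le_const)
    show "(\<lambda>i. cmod (c r (\<rho> i) (n - 1) (\<rho> i))) \<longlonglongrightarrow> cmod (A r (n - 1))" using r by (intro tendsto_norm diag) auto
    show "\<exists>N. \<forall>i\<ge>N. d \<le> cmod (c r (\<rho> i) (n - 1) (\<rho> i))" using s0(2) by (auto simp: \<rho>_def)
  qed
  then have "A r (n - 1) \<noteq> 0" using d by auto
  then have p0: "fps_nth p 0 \<noteq> 0" using toep[where j = r and l = "n - 1"] r by (auto simp: p_def split: if_splits)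
  define ip where "ip = inverse p"
  have ip: "act n ip (act n p x) = x" if "x \<in> Zn n" for x
    unfolding act_mult[symmetric] ip_def inverse_mult_eq_1[OF p0] by (rule act_one[OF Zn_below[OF that]])
  define V where "V = restr n (act n ip)"
  have V: "V \<in> bop n" unfolding V_def by (rule act_bop)
  obtain CV where CV: "CV > 0" "\<And>x. x \<in> Zn n \<Longrightarrow> zn_norm n (V x) \<le> CV * zn_norm n x" using bop_bound[OF V] by blast
  \<comment> \<open>The error \<open>E\<close> has norm at most c0 \<eta>, so \<open>V\<close> after
    \<open>E\<close> has norm at most 1/2.\<close>
  define \<eta> where "\<eta> = 1 / (2 * CV * c0)"
  have eta: "\<eta> > 0" using CV c0 by (simp add: \<eta>_def)
  obtain \<sigma> where inj: "inj \<sigma>" and W: "W \<sigma> \<in> bop n" and err: "\<forall>p q j l. j < n \<longrightarrow> l < n \<longrightarrow>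
     cmod (W \<sigma> (uvec q l) j p - (if p = q then A j l else 0)) \<le> \<eta> * ((1/2) ^ p * (1/2) ^ q)" using ex[OF eta] by blast
  define E where "E = (\<lambda>x. W \<sigma> x + vscale (-1) (restr n (act n p) x))"
  have E: "E \<in> bop n" unfolding E_def by (intro bop_add W bop_scale act_bop)
  have Ebound: "zn_norm n (E x) \<le> c0 * \<eta> * zn_norm n x" if x: "x \<in> Zn n" for x
  proof (rule bop_bound_dense[OF E _ x])
    fix K x assume x: "x \<in> Zn n"
    have e: "E (proj {..<K} x) = W \<sigma> (proj {..<K} x) - mact n A (proj {..<K} x)"
      unfolding E_def by (simp add: restr_eq Zn_proj x mp vscale_minus_one)
    have "zn_norm n (E (proj {..<K} x)) \<le> c0 * \<eta> * zn_norm n (proj {..<K} x)"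
      unfolding e using near[OF eta W err Zn_proj[OF x], of "{..<K}" "{..<K}"]
      by (intro zn_norm_le) (auto simp: supp_in_def proj_def)
    also have "\<dots> \<le> c0 * \<eta> * zn_norm n x" using zn_norm_proj[OF x] c0 eta by (intro mult_left_mono) auto
    finally show "zn_norm n (E (proj {..<K} x)) \<le> c0 * \<eta> * zn_norm n x" .
  qed
  have VE: "V \<circ> E \<in> bop n" by (rule bop_comp[OF V E])
  have "zn_norm n ((V \<circ> E) x) \<le> zn_norm n x / 2" if x: "x \<in> Zn n" for x
  proof -
    have "zn_norm n (V (E x)) \<le> CV * zn_norm n (E x)" by (intro CV bopD[OF E] x)
    also have "\<dots> \<le> CV * (c0 * \<eta> * zn_norm n x)" using CV(1) Ebound[OF x] by (intro mult_left_mono) auto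
    also have "\<dots> = zn_norm n x / 2" using CV(1) c0 by (simp add: \<eta>_def)
    finally show ?thesis by simp
  qed
  then obtain Q where Q: "Q \<in> bop n" "\<forall>x\<in>Zn n. Q (x + (V \<circ> E) x) = x" using neumann[OF VE] by blast
  have "Q (V (W \<sigma> x)) = x" if x: "x \<in> Zn n" for x
  proof -
    have ax: "act n p x \<in> Zn n" by (rule Zn_act[OF x])
    have "V (E x) = V (W \<sigma> x - act n p x)" unfolding E_def by (simp add: restr_eq x vscale_minus_one)
    also have "\<dots> = V (W \<sigma> x) - V (act n p x)" by (intro bopD[OF V] ax bopD[OF W] x)
    also have "V (act n p x) = x" unfolding V_def restr_eq[OF ax] by (rule ip[OF x])
    finally have "x + (V \<circ> E) x = V (W \<sigma> x)" by (simp add: fun_eq_iff)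
    then show ?thesis using Q(2) x by metis
  qed
  then have "\<forall>x\<in>Zn n. (Q \<circ> (V \<circ> subseq_restrict n \<sigma>)) (S (subseq_embed n \<sigma> x)) = x" by (simp add: W_def)
  then show ?thesis unfolding Fac_def
    using bop_comp[OF Q(1) bop_comp[OF V subseq_restrict_bop[OF inj]]] subseq_embed_bop[OF inj] by blast
qed

section \<open>Block sequences\<close>


lemma xpow_0_le: "cmod (xpow a (\<i> * of_real t)) \<le> 1"
  using xpow_0[of a t] by (cases "a = 0") (simp_all add: xpow_def[of 0])

lemma card_disjoint_le_1: assumes "disjoint_family S" shows "finite {i. k \<in> S i}" "card {i. k \<in> S i} \<le> 1"
proof -
  have "{i. k \<in> S i} \<subseteq> {SOME i. k \<in> S i}"
  proof
    fix i assume i: "i \<in> {i. k \<in> S i}"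
    then have "k \<in> S (SOME i. k \<in> S i)" by (metis mem_Collect_eq someI_ex)
    then show "i \<in> {SOME i. k \<in> S i}" using i assms unfolding disjoint_family_on_def by blast
  qed
  then show "finite {i. k \<in> S i}" "card {i. k \<in> S i} \<le> 1"
    using finite_subset card_mono[of "{SOME i. k \<in> S i}" "{i. k \<in> S i}"] by (auto intro: finite_subset)
qed

text \<open>For disjoint unit blocks v i each row has at most one entry, of modulus at most 1 on the
  left line, and on the right line column i sums to the sum of |v i k|^2, which is 1.\<close>

definition block_embed :: "nat \<Rightarrow> (nat \<Rightarrow> nat set) \<Rightarrow> (nat \<Rightarrow> nat \<Rightarrow> complex) \<Rightarrow> arr \<Rightarrow> arr" where
  "block_embed n S v = restr n (mop n (\<lambda>k. {i. k \<in> S i}) (\<lambda>k i. xpow (v i k)))"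

text \<open>The multipliers of an embedding, transposed and reflected: 1 - z exchanges the boundary
  lines, just as transposition exchanges row and column bounds.\<close>

definition block_project :: "nat \<Rightarrow> (nat \<Rightarrow> nat set) \<Rightarrow> (nat \<Rightarrow> nat \<Rightarrow> complex) \<Rightarrow> arr \<Rightarrow> arr" where
  "block_project n S u = restr n (mop n S (\<lambda>p l z. xpow (u p l) (1 - z)))"

lemma block_embed_bop:
  assumes v: "\<And>i. unit_on (S i) (v i)" and d: "disjoint_family S" shows "block_embed n S v \<in> bop n"
  unfolding block_embed_def
proof (rule mop_bop[where C = 1])
  show "finite {i. k \<in> S i}" for k by (rule card_disjoint_le_1[OF d])
  show "(\<Sum>l\<in>{i. k \<in> S i}. cmod (xpow (v l k) (\<i> * complex_of_real t))) \<le> 1" for t k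
  proof -
    have "(\<Sum>l\<in>{i. k \<in> S i}. cmod (xpow (v l k) (\<i> * complex_of_real t))) \<le> (\<Sum>l\<in>{i. k \<in> S i}. 1)"
      by (intro sum_mono xpow_0_le)
    also have "\<dots> \<le> 1" using card_disjoint_le_1(2)[OF d, of k] by simp
    finally show ?thesis .
  qed
  fix t :: real and l and T :: "nat set" assume T: "finite T"
  have "(\<Sum>k\<in>T. if l \<in> {i. k \<in> S i} then cmod (xpow (v l k) (1 + \<i> * complex_of_real t)) else 0) = (\<Sum>k\<in>T \<inter> S l. (cmod (v l k))\<^sup>2)"
    unfolding xpow_1 using T by (simp add: sum.inter_restrict)
  also have "\<dots> \<le> (\<Sum>k\<in>S l. (cmod (v l k))\<^sup>2)" using v[of l] by (intro sum_mono2) (auto simp: unit_on_def)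
  also have "\<dots> = 1" using v[of l] by (simp add: unit_on_def)
  finally show "(\<Sum>k\<in>T. if l \<in> {i. k \<in> S i} then cmod (xpow (v l k) (1 + \<i> * complex_of_real t)) else 0) \<le> 1" .
qed (rule sgood_xpow)

lemma block_project_bop:
  assumes u: "\<And>p. unit_on (S p) (u p)" and d: "disjoint_family S" shows "block_project n S u \<in> bop n"
  unfolding block_project_def
proof (rule mop_bop[where C = 1])
  show "finite (S k)" for k using u[of k] by (simp add: unit_on_def)
  show "sgood (\<lambda>z. xpow (u k l) (1 - z))" for k l by (rule sgood_reflect[OF sgood_xpow])
  show "(\<Sum>l\<in>S k. cmod (xpow (u k l) (1 - \<i> * complex_of_real t))) \<le> 1" for t k
    using u[of k] xpow_1[of _ "-t"] by (simp add: unit_on_def)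
  fix t :: real and l and T :: "nat set" assume T: "finite T"
  have e: "1 - (1 + \<i> * complex_of_real t) = \<i> * complex_of_real (-t)" by simp
  have "(\<Sum>k\<in>T. if l \<in> S k then cmod (xpow (u k l) (1 - (1 + \<i> * complex_of_real t))) else 0) \<le> (\<Sum>k\<in>T. if l \<in> S k then 1 else 0)"
    unfolding e by (intro sum_mono) (simp only: xpow_0_le split: if_splits, simp)
  also have "\<dots> = card (T \<inter> {k. l \<in> S k})" using T by (simp add: sum.If_cases)
  also have "\<dots> \<le> real 1"
    using card_disjoint_le_1[OF d, of l] card_mono[of "{k. l \<in> S k}" "T \<inter> {k. l \<in> S k}"] by simp
  finally show "(\<Sum>k\<in>T. if l \<in> S k then cmod (xpow (u k l) (1 - (1 + \<i> * complex_of_real t))) else 0) \<le> 1" by simp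
qed

text \<open>A scalar sequence in the last slot. The shift annihilates it (for n \<ge> 1), so no
  twist is visible there and the norm is comparable to that of l2.\<close>

definition iota :: "nat \<Rightarrow> (nat \<Rightarrow> complex) \<Rightarrow> arr" where
  "iota n v = (\<lambda>j k. if j = n - 1 then v k else 0)"

lemma iota_act: "n \<ge> 1 \<Longrightarrow> iota n v = act n (fps_X ^ (n - 1)) (xvec n v)"
  by (auto simp: iota_def act_X_power fun_eq_iff xvec_0)

lemma rb_iota: assumes "n \<ge> 1" "unit_on S v" shows "rb n S (iota n v) (real n ^ n)"
  unfolding iota_act[OF assms(1)] using assms(1) by (intro rb_shift_xvec assms(2)) simp

text \<open>In the last slot only the constant term of a multiplier survives, and
  \<open>xpow a\<close> takes the value a at 1/2.\<close>

lemma block_embed_uvec: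
  assumes v: "\<And>i. unit_on (S i) (v i)" and d: "disjoint_family S" and n1: "n \<ge> 1"
  shows "block_embed n S v (uvec p (n - 1)) = iota n (v p)"
proof (intro ext)
  fix j k
  have u: "uvec p (n - 1) \<in> Zn n" using n1 by (intro Zn_uvec) simp
  have "block_embed n S v (uvec p (n - 1)) j k =
     (if j < n then \<Sum>l\<in>{i. k \<in> S i}. \<Sum>i\<le>j. fps_nth (jet (xpow (v l k))) i * uvec p (n - 1) (j - i) l else 0)"
    unfolding block_embed_def restr_eq[OF u] mop_def ..
  also have "\<dots> = (if j = n - 1 then \<Sum>l\<in>{i. k \<in> S i}. if l = p then v p k else 0 else 0)"
  proof (cases "j < n")
    case True
    have "(\<Sum>i\<le>j. fps_nth (jet (xpow (v l k))) i * uvec p (n - 1) (j - i) l) = (if j = n - 1 then if l = p then v p k else 0 else 0)" for l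
    proof -
      have "(\<Sum>i\<le>j. fps_nth (jet (xpow (v l k))) i * uvec p (n - 1) (j - i) l)
        = (\<Sum>i\<le>j. if i = 0 then (if j = n - 1 \<and> l = p then fps_nth (jet (xpow (v l k))) i else 0) else 0)"
        using True by (intro sum.cong) (auto simp: uvec_def)
      also have "\<dots> = (if j = n - 1 \<and> l = p then fps_nth (jet (xpow (v l k))) 0 else 0)" by simp
      finally show ?thesis by (simp add: jet_nth xpow_def)
    qed
    then show ?thesis using True by simp
  next
    case False
    then show ?thesis using n1 by auto
  qed
  also have "\<dots> = iota n (v p) j k"
    using card_disjoint_le_1(1)[OF d, of k] v[of p] by (auto simp: iota_def unit_on_def)
  finally show "block_embed n S v (uvec p (n - 1)) j k = iota n (v p) j k" .
qed

text \<open>The entries of the projection are, up to sign, pairings with norming vectors; a vector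
  detected by such a pairing thus produces a large coordinate.\<close>

lemma block_project_bil:
  assumes u: "unit_on (S p) (u p)" and r: "r < n" and z: "z \<in> Zn n"
  shows "cmod (block_project n S u z r p) = cmod (bil n (act n (fps_X ^ (n - 1 - r)) (xvec n (u p))) z)"
proof -
  have fin: "finite (S p)" using u by (simp add: unit_on_def)
  have "bil n (act n (fps_X ^ (n - 1 - r)) (xvec n (u p))) z = (\<Sum>l\<in>S p. bp n (act n (fps_X ^ (n - 1 - r)) (xvec n (u p))) z l)"
    by (rule bil_finite[OF fin supp_in_act[OF rb_supp[OF rb_xvec[OF u]]]])
  also have "\<dots> = (\<Sum>l\<in>S p. \<Sum>i\<le>r. (-1) ^ r * ((-1) ^ i * fps_nth (jet (xpow (u p l))) i * z (r - i) l))"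
  proof (rule sum.cong[OF refl])
    fix l
    have "bp n (act n (fps_X ^ (n - 1 - r)) (xvec n (u p))) z l = (\<Sum>i\<le>r. (-1) ^ i * fps_nth (jet (xpow (u p l))) (r - i) * z i l)"
      unfolding bp_def
    proof (rule sum.mono_neutral_cong_right)
      show "\<forall>i\<in>{..<n} - {..r}. (- 1) ^ i * act n (fps_X ^ (n - 1 - r)) (xvec n (u p)) (n - 1 - i) l * z i l = 0"
        by (auto simp: act_X_power)
      fix i assume i: "i \<in> {..r}"
      then have "n - 1 - i < n" "n - 1 - r \<le> n - 1 - i" "n - 1 - i - (n - 1 - r) = r - i" "r - i < n" using r by auto
      then show "(- 1) ^ i * act n (fps_X ^ (n - 1 - r)) (xvec n (u p)) (n - 1 - i) l * z i l = (-1) ^ i * fps_nth (jet (xpow (u p l))) (r - i) * z i l"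
        by (simp only: act_X_power xvec_def) simp
    qed (use r in auto)
    also have "\<dots> = (\<Sum>i\<le>r. (-1) ^ (r - i) * fps_nth (jet (xpow (u p l))) i * z (r - i) l)"
      by (rule sum.reindex_bij_witness[where i = "\<lambda>i. r - i" and j = "\<lambda>i. r - i"]) auto
    also have "\<dots> = (\<Sum>i\<le>r. (-1) ^ r * ((-1) ^ i * fps_nth (jet (xpow (u p l))) i * z (r - i) l))"
    proof (rule sum.cong[OF refl])
      fix i assume "i \<in> {..r}"
      then have "(-1::complex) ^ r = (-1) ^ (r - i) * (-1) ^ i" by (simp add: power_add[symmetric])
      moreover have "(-1::complex) ^ i * (-1) ^ i = 1" by (simp add: power_mult_distrib[symmetric])
      ultimately have "(-1::complex) ^ (r - i) = (-1) ^ r * (-1) ^ i" by (simp add: mult.assoc)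
      then show "(-1) ^ (r - i) * fps_nth (jet (xpow (u p l))) i * z (r - i) l = (-1) ^ r * ((-1) ^ i * fps_nth (jet (xpow (u p l))) i * z (r - i) l)"
        by simp
    qed
    finally show "bp n (act n (fps_X ^ (n - 1 - r)) (xvec n (u p))) z l = (\<Sum>i\<le>r. (-1) ^ r * ((-1) ^ i * fps_nth (jet (xpow (u p l))) i * z (r - i) l))" .
  qed
  also have "\<dots> = (-1) ^ r * block_project n S u z r p"
    unfolding block_project_def restr_eq[OF z] using r
    by (simp add: mop_def sum_distrib_left jet_reflect[OF sgood_xpow])
  finally show ?thesis by (simp add: norm_mult norm_power)
qed

lemma norming_Zn:
  assumes z: "z \<in> Zn n" and S: "finite S" and D: "D \<ge> 0" and big: "nrm n * D < zn_norm n (proj S z)"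
  shows "\<exists>r u. r < n \<and> unit_on S u \<and> D < cmod (bil n (act n (fps_X ^ (n - 1 - r)) (xvec n u)) z)"
proof (rule ccontr)
  assume neg: "\<not> ?thesis"
  have e: "bil n (act n p (xvec n u)) (proj S z) = bil n (act n p (xvec n u)) z" if "unit_on S u" for u p
    using S supp_in_act[OF rb_supp[OF rb_xvec[OF that]]]
    by (simp add: bil_finite[of S] bp_def proj_def cong: sum.cong)
  have "rb n S (proj S z) (nrm n * D)"
  proof (intro nrm(2) S D)
    show "below n (proj S z)" "supp_in S (proj S z)" using Zn_below[OF z] by (auto simp: below_def supp_in_def proj_def)
    show "cmod (bil n (act n (fps_X ^ (n - 1 - r)) (xvec n u)) (proj S z)) \<le> D" if "r < n" "unit_on S u" for r u
      using neg that e[OF that(2)] by (metis not_less)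
  qed
  then show False using zn_norm_rb big by fastforce
qed

text \<open>The images z i have norm at least \<delta> and null coordinates, so a late one is
  concentrated on a finite set far out and is detected there by a norming vector. Embedding along
  the v i and projecting along the norming vectors gives an operator with diagonal entries bounded
  away from 0.\<close>

lemma block_Fac:
  fixes S :: "nat \<Rightarrow> nat set"
  assumes T: "T \<in> bop n" and n1: "n \<ge> 1" and v: "\<And>i. unit_on (S i) (v i)" and d: "disjoint_family S"
    and del: "\<delta> > 0" "\<And>i. \<delta> \<le> zn_norm n (T (iota n (v i)))"
  shows "Fac n T"
proof -
  define U where "U = block_embed n S v"
  have U: "U \<in> bop n" unfolding U_def by (rule block_embed_bop[OF v d])
  have n1': "n - 1 < n" using n1 by simp
  define z where "z = (\<lambda>i. T (U (uvec i (n - 1))))"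
  have z_eq: "z i = T (iota n (v i))" for i unfolding z_def U_def block_embed_uvec[OF v d n1] ..
  have zZ: "z i \<in> Zn n" for i unfolding z_def by (intro bopD[OF T] bopD[OF U] Zn_uvec n1')
  have znull: "(\<lambda>i. z i j k) \<longlonglongrightarrow> 0" for j k
    using row_null[OF bop_comp[OF T U] n1', of j k] by (simp add: z_def)
  \<comment> \<open>Head and tail of z i each take less than \<delta>/4, so the middle part keeps
    more than \<delta>/2, well above \<open>nrm n * D\<close>.\<close>
  define D where "D = \<delta> / (4 * nrm n)"
  have D: "D > 0" "nrm n * D = \<delta> / 4" using del(1) nrm(1)[of n] by (auto simp: D_def)
  define P where "P = (\<lambda>(K::nat) B (a :: nat \<times> nat \<times> (nat \<Rightarrow> complex)). fst a \<in> B \<and> fst (snd a) < n \<and> unit_on B (snd (snd a)) \<and>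
     D < cmod (bil n (act n (fps_X ^ (n - 1 - fst (snd a))) (xvec n (snd (snd a)))) (z (fst a))))"
  have "\<exists>B a. finite B \<and> B \<subseteq> {K..} \<and> P K B a" for K
  proof -
    have "(\<lambda>i. \<Sum>k<K. \<Sum>j<n. cmod (z i j k) * real n ^ n) \<longlonglongrightarrow> (\<Sum>k<K. \<Sum>j<n. cmod 0 * real n ^ n)"
      by (intro tendsto_intros znull)
    then have "(\<lambda>i. \<Sum>k<K. \<Sum>j<n. cmod (z i j k) * real n ^ n) \<longlonglongrightarrow> 0" by simp
    then have "\<forall>\<^sub>F i in sequentially. (\<Sum>k<K. \<Sum>j<n. cmod (z i j k) * real n ^ n) < \<delta> / 4"
      using del(1) by (intro order_tendstoD) auto
    then obtain I where I: "\<And>i. i \<ge> I \<Longrightarrow> (\<Sum>k<K. \<Sum>j<n. cmod (z i j k) * real n ^ n) < \<delta> / 4"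
      by (auto simp: eventually_sequentially)
    define i where "i = max I K"
    have "rb n {..<K} (proj {..<K} (z i)) (\<Sum>k<K. \<Sum>j<n. cmod (proj {..<K} (z i) j k) * real n ^ n)"
      using Zn_below[OF zZ, of i] by (intro rb_finite_coords) (auto simp: supp_in_def proj_def below_def)
    then have "zn_norm n (proj {..<K} (z i)) \<le> (\<Sum>k<K. \<Sum>j<n. cmod (z i j k) * real n ^ n)"
      by (intro order_trans[OF zn_norm_rb]) (auto simp: proj_def)
    then have 1: "zn_norm n (proj {..<K} (z i)) < \<delta> / 4" using I[of i] by (simp add: i_def)
    obtain L0 where L0: "\<And>L. L \<ge> L0 \<Longrightarrow> zn_norm n (proj {L..} (z i)) < \<delta> / 4" using zn_tails_K[OF zZ, of "\<delta>/4" i] del(1) by auto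
    \<comment> \<open>\<open>Suc i\<close> puts the index i itself into B, so that disjointness of
      the sets B makes the selected indices distinct.\<close>
    define L where "L = max L0 (Suc i)"
    define B where "B = {K..<L}"
    have "K \<le> L" by (simp add: L_def i_def)
    then have dec: "z i = proj {..<K} (z i) + (proj B (z i) + proj {L..} (z i))" by (auto simp: proj_def fun_eq_iff B_def)
    have "zn_norm n (z i) \<le> zn_norm n (proj {..<K} (z i)) + zn_norm n (proj B (z i) + proj {L..} (z i))"
      by (subst dec) (intro zn_norm_triangle Zn_add Zn_proj zZ)
    moreover have "zn_norm n (proj B (z i) + proj {L..} (z i)) \<le> zn_norm n (proj B (z i)) + zn_norm n (proj {L..} (z i))"
      by (intro zn_norm_triangle Zn_proj zZ)
    moreover have "\<delta> \<le> zn_norm n (z i)" using del(2) by (simp add: z_eq)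
    ultimately have "nrm n * D < zn_norm n (proj B (z i))" using 1 L0[of L] del(1) unfolding D(2) by (simp add: L_def)
    then obtain r u where "r < n" "unit_on B u" "D < cmod (bil n (act n (fps_X ^ (n - 1 - r)) (xvec n u)) (z i))"
      using norming_Zn[OF zZ, of B D i] D(1) by (auto simp: B_def)
    moreover have "i < L" "K \<le> i" by (simp_all add: L_def i_def less_max_iff_disj del: max_less_iff_conj)
    then have "i \<in> B" by (simp add: B_def)
    ultimately show ?thesis by (intro exI[of _ B] exI[of _ "(i, r, u)"]) (auto simp: P_def B_def)
  qed
  then obtain B a k where Bk: "\<And>i. finite (B i)" "\<And>i. B i \<subseteq> {i..}" "\<And>i. i \<le> k i" "\<And>i. P (k i) (B i) (a i)"
    "disjoint_family B" by (rule disjoint_blocks) (rule that)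
  define \<iota> where "\<iota> = (\<lambda>p. fst (a p))"
  define r where "r = (\<lambda>p. fst (snd (a p)))"
  define u where "u = (\<lambda>p. snd (snd (a p)))"
  have Ba: "\<iota> p \<in> B p" "r p < n" "unit_on (B p) (u p)"
     "D < cmod (bil n (act n (fps_X ^ (n - 1 - r p)) (xvec n (u p))) (z (\<iota> p)))" for p
    using Bk(4)[of p] by (auto simp: P_def \<iota>_def r_def u_def)
  have inj: "inj \<iota>" using Ba(1) Bk(5) unfolding inj_def disjoint_family_on_def by (metis UNIV_I disjoint_iff)
  define V where "V = block_project n B u"
  have V: "V \<in> bop n" unfolding V_def by (rule block_project_bop[OF Ba(3) Bk(5)])
  define T2 where "T2 = (\<lambda>x. V (T ((U \<circ> subseq_embed n \<iota>) x)))"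
  have "T2 = V \<circ> (T \<circ> (U \<circ> subseq_embed n \<iota>))" by (auto simp: T2_def)
  then have T2: "T2 \<in> bop n" using bop_comp[OF V bop_comp[OF T bop_comp[OF U subseq_embed_bop[OF inj]]]] by simp
  have "D \<le> cmod (T2 (uvec p (n - 1)) (r p) p)" for p
  proof -
    have "T2 (uvec p (n - 1)) = V (z (\<iota> p))" unfolding T2_def z_def o_def subseq_embed_uvec[OF n1' inj] ..
    then show ?thesis using Ba(4)[of p] block_project_bil[of B p u "r p" n "z (\<iota> p)", OF Ba(3) Ba(2) zZ] by (simp add: V_def)
  qed
  \<comment> \<open>The detecting slot r p varies with p; one of its n possible values serves for
    infinitely many p.\<close>
  then have "(\<Union>\<rho><n. {p. D \<le> cmod (T2 (uvec p (n - 1)) \<rho> p)}) = UNIV" using Ba(2) by blast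
  then have "infinite (\<Union>\<rho><n. {p. D \<le> cmod (T2 (uvec p (n - 1)) \<rho> p)})" by simp
  then obtain \<rho> where "\<rho> < n" "infinite {p. D \<le> cmod (T2 (uvec p (n - 1)) \<rho> p)}" by auto
  then have "Fac n T2" using diagonal_Fac[OF T2 _ D(1)] by blast
  then show ?thesis unfolding T2_def by (rule Fac_comp[OF _ V bop_comp[OF U subseq_embed_bop[OF inj]]])
qed

text \<open>A single norming vector reads off the leading slot of y, so the continuity of the
  pairing bounds its l2 norm.\<close>

lemma slot_pairing_bil:
  assumes S: "finite S" and su: "supp_in S y" and q: "q < n" and z: "\<forall>j<q. \<forall>k. y j k = 0" and y: "y \<in> Zn n"
  shows "slot_norm S y q \<le> 4 ^ n * real n ^ n * zn_norm n y"
proof (rule field_le_epsilon)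
  fix e :: real assume e: "e > 0"
  show "slot_norm S y q \<le> 4 ^ n * real n ^ n * zn_norm n y + e"
  proof (cases "slot_norm S y q > 0")
    case True
    obtain u where u: "unit_on S u" "cmod (\<Sum>k\<in>S. bp n (act n (fps_X ^ (n - 1 - q)) (xvec n u)) y k) = slot_norm S y q"
      using slot_pairing[OF S su q z True] by blast
    define e' where "e' = e / (4 ^ n * real n ^ n)"
    have e': "e' > 0" using e q by (simp add: e'_def)
    have x: "rb n S (act n (fps_X ^ (n - 1 - q)) (xvec n u)) (real n ^ n)" using q by (intro rb_shift_xvec u) auto
    have "rb n S y (zn_norm n y + e')" using e' by (intro rb_of_norm y S su) simp
    from bp_bound[OF x this S] u(2) have "slot_norm S y q \<le> 4 ^ n * (real n ^ n * (zn_norm n y + e'))" by simp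
    also have "\<dots> = 4 ^ n * real n ^ n * zn_norm n y + e" using q by (simp add: e'_def distrib_left)
    finally show ?thesis .
  next
    case False
    have "0 \<le> 4 ^ n * real n ^ n * zn_norm n y" using zn_norm_nonneg[OF y] by simp
    then show ?thesis using False e by linarith
  qed
qed

text \<open>The shift by n - 1 - r moves slot r of w i to the last slot and everything later out of
  range. The result is a bounded multiple of a unit block in the last slot, and if T were not small
  along such blocks, \<open>block_Fac\<close> would apply.\<close>

lemma top_slot_null:
  fixes S :: "nat \<Rightarrow> nat set"
  assumes T: "T \<in> bop n" and nF: "\<not> Fac n T" and r: "r < n" and w: "\<And>i. rb n (S i) (w i) A" and d: "disjoint_family S"
    and z: "\<And>i j k. j < r \<Longrightarrow> w i j k = 0"
  shows "(\<lambda>i. zn_norm n (T (act n (fps_X ^ (n - 1 - r)) (w i)))) \<longlonglongrightarrow> 0"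
proof -
  have n1: "n \<ge> 1" using r by simp
  have wZ: "w i \<in> Zn n" for i using Zn_rb[OF w] .
  define C where "C = 4 ^ n * real n ^ n * A + 1"
  have A0: "A \<ge> 0" using rb_nonneg[OF w] .
  have C0: "C > 0" using A0 by (simp add: C_def add_nonneg_pos)
  define f where "f = (\<lambda>i. zn_norm n (T (act n (fps_X ^ (n - 1 - r)) (w i))))"
  have f0: "f i \<ge> 0" for i unfolding f_def by (intro zn_norm_nonneg bopD[OF T] Zn_act wZ)
  have fin: "finite {i. \<delta> \<le> f i}" if del: "\<delta> > 0" for \<delta>
  proof (rule ccontr)
    assume "infinite {i. \<delta> \<le> f i}"
    then obtain \<sigma> :: "nat \<Rightarrow> nat" where s: "strict_mono \<sigma>" "\<And>i. \<delta> \<le> f (\<sigma> i)"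
      using infinite_enumerate unfolding mem_Collect_eq by (metis (mono_tags, lifting) mem_Collect_eq)
    define t where "t = (\<lambda>i. slot_norm (S i) (w i) r)"
    define v where "v = (\<lambda>i k. w i r k / of_real (t i))"
    have tC: "t i \<le> C" for i
    proof -
      have "t i \<le> 4 ^ n * real n ^ n * zn_norm n (w i)"
        unfolding t_def using z by (intro slot_pairing_bil rb_finite[OF w] rb_supp[OF w] r wZ) auto
      also have "\<dots> \<le> 4 ^ n * real n ^ n * A" by (intro mult_left_mono zn_norm_rb[OF w]) auto
      finally show ?thesis by (simp add: C_def)
    qed
    have aw: "act n (fps_X ^ (n - 1 - r)) (w i) = vscale (of_real (t i)) (iota n (v i))" if "t i \<noteq> 0" for i
    proof (intro ext)
      fix j k
      show "act n (fps_X ^ (n - 1 - r)) (w i) j k = vscale (of_real (t i)) (iota n (v i)) j k"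
      proof (cases "j = n - 1")
        case True
        then have "j < n" "n - 1 - r \<le> j" "j - (n - 1 - r) = r" using r by auto
        then show ?thesis using True that by (simp add: act_X_power vscale_def iota_def v_def)
      next
        case False
        have "act n (fps_X ^ (n - 1 - r)) (w i) j k = 0"
        proof (cases "j < n \<and> n - 1 - r \<le> j")
          case True
          then have "j - (n - 1 - r) < r" using False by auto
          then show ?thesis using z by (simp add: act_X_power)
        qed (simp only: act_X_power, simp)
        then show ?thesis using False by (simp add: vscale_def iota_def)
      qed
    qed
    \<comment> \<open>If slot r vanished, the shifted vector would be 0, against f (\<sigma> i)
      \<ge> \<delta>; so the division in \<open>v\<close> is a true normalisation.\<close>
    have pos: "t (\<sigma> i) > 0" for i
    proof (rule ccontr)
      assume "\<not> t (\<sigma> i) > 0"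
      then have "t (\<sigma> i) = 0" using slot_norm_nonneg[of "S (\<sigma> i)" "w (\<sigma> i)" r] by (simp add: t_def)
      then have "(\<Sum>k\<in>S (\<sigma> i). (cmod (w (\<sigma> i) r k))\<^sup>2) = 0" using slot_norm_power2[of "S (\<sigma> i)" "w (\<sigma> i)" r] by (simp add: t_def)
      then have "\<forall>k\<in>S (\<sigma> i). w (\<sigma> i) r k = 0" using rb_finite[OF w] by (subst (asm) sum_nonneg_eq_0_iff) auto
      then have zr: "w (\<sigma> i) r k = 0" for k using rb_supp[OF w, of "\<sigma> i"] by (auto simp: supp_in_def)
      have "act n (fps_X ^ (n - 1 - r)) (w (\<sigma> i)) = 0"
      proof (intro ext)
        fix j k
        have "w (\<sigma> i) (j - (n - 1 - r)) k = 0" if "j < n"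
        proof -
          have "j - (n - 1 - r) \<le> r" using that by auto
          then show ?thesis using z zr by (cases "j - (n - 1 - r) = r") auto
        qed
        then show "act n (fps_X ^ (n - 1 - r)) (w (\<sigma> i)) j k = 0 j k" by (auto simp: act_X_power)
      qed
      then have "f (\<sigma> i) = 0" by (simp add: f_def bopD[OF T])
      then show False using s(2)[of i] del by simp
    qed
    have un: "unit_on (S (\<sigma> i)) (v (\<sigma> i))" for i
    proof -
      have "(\<Sum>k\<in>S (\<sigma> i). (cmod (v (\<sigma> i) k))\<^sup>2) = (t (\<sigma> i))\<^sup>2 / (t (\<sigma> i))\<^sup>2"
        unfolding v_def t_def slot_norm_power2[of "S (\<sigma> i)"]
        by (simp add: norm_divide power_divide sum_divide_distrib[symmetric] slot_norm_power2)
      then show ?thesis using pos[of i] rb_finite[OF w] rb_supp[OF w, of "\<sigma> i"] by (auto simp: unit_on_def v_def supp_in_def)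
    qed
    have big: "\<delta> / C \<le> zn_norm n (T (iota n (v (\<sigma> i))))" for i
    proof -
      have iZ: "iota n (v (\<sigma> i)) \<in> Zn n" using Zn_rb[OF rb_iota[OF n1 un]] .
      have "\<delta> \<le> zn_norm n (T (vscale (of_real (t (\<sigma> i))) (iota n (v (\<sigma> i)))))"
        using s(2)[of i] aw[of "\<sigma> i"] pos[of i] by (simp add: f_def)
      also have "\<dots> = t (\<sigma> i) * zn_norm n (T (iota n (v (\<sigma> i))))"
        using pos[of i] by (simp add: bopD(3)[OF T iZ] zn_norm_scale bopD(1)[OF T iZ])
      also have "\<dots> \<le> C * zn_norm n (T (iota n (v (\<sigma> i))))"
        by (intro mult_right_mono tC zn_norm_nonneg bopD[OF T] iZ)
      finally show ?thesis using C0 by (simp add: divide_le_eq mult.commute)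
    qed
    have "disjoint_family (\<lambda>i. S (\<sigma> i))" using d strict_mono_imp_inj_on[OF s(1)]
      unfolding disjoint_family_on_def inj_on_def by blast
    then have "Fac n T" using del C0 by (intro block_Fac[OF T n1 un _ _ big]) auto
    then show False using nF by simp
  qed
  have "f \<longlonglongrightarrow> 0"
  proof (rule LIMSEQ_I)
    fix e :: real assume e: "e > 0"
    then obtain M where M: "\<forall>i\<in>{i. e \<le> f i}. i < M" using fin finite_nat_set_iff_bounded by blast
    have "norm (f i - 0) < e" if "i \<ge> M" for i
      using M f0[of i] that by (cases "e \<le> f i") auto
    then show "\<exists>M. \<forall>i\<ge>M. norm (f i - 0) < e" by blast
  qed
  then show ?thesis by (simp add: f_def)
qed

section \<open>Operators that are bounded below\<close>


lemma subspaceD: assumes "is_subspace n M"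
  shows "x \<in> M \<Longrightarrow> x \<in> Zn n" "0 \<in> M" "x \<in> M \<Longrightarrow> y \<in> M \<Longrightarrow> x + y \<in> M" "x \<in> M \<Longrightarrow> vscale c x \<in> M"
    "x \<in> M \<Longrightarrow> y \<in> M \<Longrightarrow> x - y \<in> M"
proof -
  show "x \<in> M \<Longrightarrow> x \<in> Zn n" "0 \<in> M" and a: "\<And>x y. x \<in> M \<Longrightarrow> y \<in> M \<Longrightarrow> x + y \<in> M"
    and b: "\<And>x c. x \<in> M \<Longrightarrow> vscale c x \<in> M"
    using assms by (auto simp: is_subspace_def vadd_eq vzero_eq)
  show "x \<in> M \<Longrightarrow> y \<in> M \<Longrightarrow> x - y \<in> M" using a[of x "vscale (-1) y"] b[of y "-1"] by (simp add: vscale_minus_one)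
qed

lemma subspace_sum: fixes x :: "'i \<Rightarrow> arr"
  assumes M: "is_subspace n M" shows "(\<And>i. i \<in> I \<Longrightarrow> x i \<in> M) \<Longrightarrow> (\<Sum>i\<in>I. x i) \<in> M"
proof (induction I rule: infinite_finite_induct)
  case (insert a I)
  have "x a + (\<Sum>i\<in>I. x i) \<in> M" using insert by (intro subspaceD[OF M]) auto
  then show ?case by (simp only: sum.insert[OF insert.hyps])
next
  case empty show ?case by (simp only: sum.empty subspaceD[OF M])
next
  case (infinite A) show ?case by (simp only: sum.infinite[OF infinite.hyps] subspaceD[OF M])
qed

lemma cspan_sum: "v \<in> cspan F \<longleftrightarrow> (\<exists>c. v = (\<Sum>u\<in>F. vscale (c u) u))"
proof -
  have "(\<lambda>j k. \<Sum>u\<in>F. c u * u j k) = (\<Sum>u\<in>F. vscale (c u) u)" for c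
    by (auto simp: fun_eq_iff sum_fun_apply vscale_def)
  then show ?thesis by (simp add: cspan_def)
qed

lemma cspan_insert:
  assumes "finite F" "v \<in> cspan F" shows "v + vscale a m \<in> cspan (insert m F)"
proof -
  obtain c where c: "v = (\<Sum>u\<in>F. vscale (c u) u)" using assms(2) by (auto simp: cspan_sum)
  show ?thesis
  proof (cases "m \<in> F")
    case True
    have "v + vscale a m = (\<Sum>u\<in>F. vscale (c u) u) + (\<Sum>u\<in>F. if u = m then vscale a u else 0)" using True assms(1) c by simp
    also have "\<dots> = (\<Sum>u\<in>F. vscale (if u = m then c u + a else c u) u)"
      unfolding sum.distrib[symmetric] by (intro sum.cong) (auto simp: vscale_def fun_eq_iff algebra_simps)
    finally show ?thesis unfolding cspan_sum insert_absorb[OF True] by (rule exI[where x = "\<lambda>u. if u = m then c u + a else c u"])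
  next
    case False
    have "(\<Sum>u\<in>insert m F. vscale (if u = m then a else c u) u) = vscale a m + (\<Sum>u\<in>F. vscale (if u = m then a else c u) u)"
      by (subst sum.insert[OF assms(1) False]) simp
    also have "(\<Sum>u\<in>F. vscale (if u = m then a else c u) u) = v" unfolding c using False by (intro sum.cong) auto
    finally have "v + vscale a m = (\<Sum>u\<in>insert m F. vscale (if u = m then a else c u) u)" by (simp add: add.commute plus_fun_def)
    then show ?thesis unfolding cspan_sum by (rule exI[where x = "\<lambda>u. if u = m then a else c u"])
  qed
qed

text \<open>A finite spanning set of the kernel together with one vector outside it would span
  M.\<close>

lemma infinite_dim_kernel:
  assumes M: "is_subspace n M" "infinite_dim M"
    and add: "\<And>x y. x \<in> M \<Longrightarrow> y \<in> M \<Longrightarrow> \<phi> (x + y) = \<phi> x + \<phi> y" and sc: "\<And>c x. x \<in> M \<Longrightarrow> \<phi> (vscale c x) = c * \<phi> x"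
  shows "is_subspace n {x \<in> M. \<phi> x = (0::complex)}" "infinite_dim {x \<in> M. \<phi> x = 0}"
proof -
  have "\<phi> (vscale 0 0) = 0 * \<phi> 0" by (rule sc) (rule subspaceD[OF M(1)])
  then have p0: "\<phi> 0 = 0" by simp
  show "is_subspace n {x \<in> M. \<phi> x = 0}"
    using subspaceD[OF M(1)] add sc p0 unfolding is_subspace_def vadd_eq vzero_eq by auto
  show "infinite_dim {x \<in> M. \<phi> x = 0}"
    unfolding infinite_dim_def
  proof (intro allI impI notI, elim conjE)
    fix F assume F: "finite F" "F \<subseteq> {x \<in> M. \<phi> x = 0}" "{x \<in> M. \<phi> x = 0} \<subseteq> cspan F"
    show False
    proof (cases "\<exists>m\<in>M. \<phi> m \<noteq> 0")
      case False
      then have "{x \<in> M. \<phi> x = 0} = M" by auto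
      then show False using F M(2) unfolding infinite_dim_def by auto
    next
      case True
      then obtain m where m: "m \<in> M" "\<phi> m \<noteq> 0" by blast
      have "x \<in> cspan (insert m F)" if x: "x \<in> M" for x
      proof -
        define a where "a = \<phi> x / \<phi> m"
        have "x + vscale (- a) m \<in> M" by (intro subspaceD[OF M(1)] x m)
        moreover have "\<phi> (x + vscale (- a) m) = 0"
          using m subspaceD(4)[OF M(1) m(1)] by (simp add: add x sc a_def)
        ultimately have "x + vscale (- a) m \<in> cspan F" using F(3) by auto
        then have "x + vscale (- a) m + vscale a m \<in> cspan (insert m F)" by (rule cspan_insert[OF F(1)])
        moreover have "x + vscale (- a) m + vscale a m = x" by (simp add: vscale_def fun_eq_iff)
        ultimately show ?thesis by simp
      qed
      then show False using M(2) F m unfolding infinite_dim_def by (metis (no_types, lifting) finite_insert insert_subset mem_Collect_eq subset_iff)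
    qed
  qed
qed

lemma infinite_dim_coords:
  assumes M: "is_subspace n M" "infinite_dim M" and P: "finite P"
  shows "is_subspace n {x \<in> M. \<forall>(j, k)\<in>P. x j k = 0} \<and> infinite_dim {x \<in> M. \<forall>(j, k)\<in>P. x j k = 0}"
  using P
proof (induction P rule: finite_induct)
  case empty
  then show ?case using M by simp
next
  case (insert a P)
  have "{x \<in> M. \<forall>(j, k)\<in>insert a P. x j k = 0} = {x \<in> {x \<in> M. \<forall>(j, k)\<in>P. x j k = 0}. x (fst a) (snd a) = 0}"
    by (cases a) auto
  then show ?case
    using infinite_dim_kernel[OF conjunct1[OF insert.IH] conjunct2[OF insert.IH], where \<phi> = "\<lambda>x. x (fst a) (snd a)"]
    by (simp add: vscale_def)
qed

lemma infinite_dim_nonzero: assumes "infinite_dim M" shows "\<exists>x\<in>M. x \<noteq> 0"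
proof (rule ccontr)
  assume "\<not> ?thesis"
  then have "M \<subseteq> cspan {}" by (auto simp: cspan_sum)
  then show False using assms unfolding infinite_dim_def by blast
qed

text \<open>Within an infinite-dimensional subspace the coordinates below K can be made 0, and
  vanishing tails allow truncation on the other side.\<close>

lemma gliding_hump:
  assumes M: "is_subspace n M" "infinite_dim M"
  obtains x S where "\<And>i. x i \<in> M" "\<And>i. zn_norm n (x i) = 1" "\<And>i. finite (S i)" "disjoint_family S"
    "\<And>i::nat. zn_norm n (x i - proj (S i) (x i)) < 1 / Suc i"
proof -
  define P where "P = (\<lambda>(K::nat) S a. a \<in> M \<and> zn_norm n a = 1 \<and> zn_norm n (a - proj S a) < 1 / Suc K)"
  have "\<exists>S a. finite S \<and> S \<subseteq> {K..} \<and> P K S a" for K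
  proof -
    have "infinite_dim {x \<in> M. \<forall>(j, k)\<in>{..<n} \<times> {..<K}. x j k = 0}"
      using infinite_dim_coords[OF M, of "{..<n} \<times> {..<K}"] by simp
    then obtain y where y: "y \<in> M" "\<And>j k. j < n \<Longrightarrow> k < K \<Longrightarrow> y j k = 0" "y \<noteq> 0" using infinite_dim_nonzero by fastforce
    have yZ: "y \<in> Zn n" using subspaceD(1)[OF M(1) y(1)] .
    have ny: "zn_norm n y > 0" using zn_norm_eq_0[OF yZ] y(3) not_le by blast
    define a where "a = vscale (of_real (1 / zn_norm n y)) y"
    have aM: "a \<in> M" unfolding a_def by (rule subspaceD(4)[OF M(1) y(1)])
    have aZ: "a \<in> Zn n" using subspaceD(1)[OF M(1) aM] .
    have an: "zn_norm n a = 1" unfolding a_def zn_norm_scale[OF yZ] using ny by (simp add: norm_divide)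
    have a0: "a j k = 0" if "k < K" for j k
      using y(2)[OF _ that, of j] Zn_below[OF yZ] by (cases "j < n") (auto simp: a_def vscale_def below_def)
    obtain L where L: "zn_norm n (a - proj {..<L} a) < 1 / Suc K" using zn_tails_K[OF aZ, of "1 / Suc K"] by auto
    have "proj {K..<L} a = proj {..<L} a" using a0 by (auto simp: proj_def fun_eq_iff)
    then have "P K {K..<L} a" using aM an L by (simp add: P_def)
    then show ?thesis by (intro exI[of _ "{K..<L}"] exI[of _ a]) auto
  qed
  then obtain S a k where Sk: "\<And>i. finite (S i)" "\<And>i. S i \<subseteq> {i..}" "\<And>i. i \<le> k i" "\<And>i. P (k i) (S i) (a i)"
    "disjoint_family S" by (rule disjoint_blocks) (rule that)
  have "zn_norm n (a i - proj (S i) (a i)) < 1 / Suc i" for i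
  proof -
    have "zn_norm n (a i - proj (S i) (a i)) < 1 / Suc (k i)" using Sk(4)[of i] by (simp add: P_def)
    also have "\<dots> \<le> 1 / Suc i" using Sk(3)[of i] by (intro divide_left_mono) auto
    finally show ?thesis .
  qed
  then show ?thesis using that[of a S] Sk by (auto simp: P_def)
qed

text \<open>A jet starting in slot r meets only the coefficients of order below n - r; in exp(s X)
  the highest effective power is therefore n - 1 - r.\<close>

lemma act_cong_start:
  assumes "\<And>j k. j < r \<Longrightarrow> b j k = 0" "\<And>i. i < n - r \<Longrightarrow> fps_nth p i = fps_nth q i"
  shows "act n p b = act n q b"
proof (intro ext)
  fix j k
  have "(\<Sum>i\<le>j. fps_nth p i * b (j - i) k) = (\<Sum>i\<le>j. fps_nth q i * b (j - i) k)" if "j < n"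
  proof (rule sum.cong[OF refl])
    fix i assume i: "i \<in> {..j}"
    show "fps_nth p i * b (j - i) k = fps_nth q i * b (j - i) k"
    proof (cases "j - i < r")
      case True
      then show ?thesis using assms(1) by simp
    next
      case False
      then have "i < n - r" using that i by auto
      then show ?thesis using assms(2) by simp
    qed
  qed
  then show "act n p b j k = act n q b j k" by (simp add: act_def)
qed

lemma act_start_zero: "(\<And>j k. j < r \<Longrightarrow> b j k = 0) \<Longrightarrow> j < r \<Longrightarrow> act n p b j k = 0"
  by (auto simp: act_def intro!: sum.neutral)

lemma vscale_act: "vscale c (act n p x) = act n (fps_const c * p) x"
  by (auto simp: act_def vscale_def fun_eq_iff sum_distrib_left mult.assoc)

lemma slot_norm_disjoint_sum:
  assumes G: "finite G" and S: "\<And>g. g \<in> G \<Longrightarrow> finite (S g) \<and> supp_in (S g) (w g)" and d: "disjoint_family_on S G"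
  shows "(slot_norm (\<Union>g\<in>G. S g) (\<Sum>g\<in>G. w g) r)\<^sup>2 = (\<Sum>g\<in>G. (slot_norm (S g) (w g) r)\<^sup>2)"
proof -
  have e: "(\<Sum>g\<in>G. w g) r k = w h r k" if "h \<in> G" "k \<in> S h" for h k
  proof -
    have "w g r k = 0" if "g \<in> G - {h}" for g
    proof -
      have "k \<notin> S g" using d that \<open>h \<in> G\<close> \<open>k \<in> S h\<close> unfolding disjoint_family_on_def by blast
      then show ?thesis using S[of g] that by (simp add: supp_in_def)
    qed
    then have "(\<Sum>g\<in>G. w g r k) = (\<Sum>g\<in>{h}. w g r k)" using G that by (intro sum.mono_neutral_right) auto
    then show ?thesis by (simp add: sum_fun_apply)
  qed
  have "(slot_norm (\<Union>g\<in>G. S g) (\<Sum>g\<in>G. w g) r)\<^sup>2 = (\<Sum>h\<in>G. \<Sum>k\<in>S h. (cmod ((\<Sum>g\<in>G. w g) r k))\<^sup>2)"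
    unfolding slot_norm_power2 using G S d by (intro sum.UNION_disjoint) (auto simp: disjoint_family_on_def)
  also have "\<dots> = (\<Sum>h\<in>G. (slot_norm (S h) (w h) r)\<^sup>2)" unfolding slot_norm_power2 by (intro sum.cong refl) (simp add: e)
  finally show ?thesis .
qed

text \<open>The key step. Averages of \<open>N\<close> disjoint vectors starting at slot \<open>r\<close> have the form \<open>e\<^sup>s\<^sup>J b\<close> with \<open>b\<close> bounded
  and \<open>s = ln N\<close>, so after normalisation they are asymptotic to \<open>J\<^sup>n\<^sup>-\<^sup>1\<^sup>-\<^sup>r b\<close>, on which \<open>T\<close> is small.\<close>
lemma start_slot_null:
  fixes S :: "nat \<Rightarrow> nat set"
  assumes T: "T \<in> bop n" and nF: "\<not> Fac n T" and M: "is_subspace n M"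
    and c: "c > 0" "\<And>x. x \<in> M \<Longrightarrow> c * zn_norm n x \<le> zn_norm n (T x)"
    and r: "r < n" and x: "\<And>i. x i \<in> M" and w: "\<And>i. rb n (S i) (w i) A" and d: "disjoint_family S"
    and z: "\<And>i j k. j < r \<Longrightarrow> w i j k = 0" and xw: "(\<lambda>i. zn_norm n (x i - w i)) \<longlonglongrightarrow> 0"
  shows "(\<lambda>i. slot_norm (S i) (w i) r) \<longlonglongrightarrow> 0"
proof (rule LIMSEQ_I, rule ccontr)
  fix \<delta> :: real assume del: "\<delta> > 0"
  assume "\<not> (\<exists>no. \<forall>i\<ge>no. norm (slot_norm (S i) (w i) r - 0) < \<delta>)"
  then have "\<forall>K. \<exists>i\<ge>K. \<delta> \<le> slot_norm (S i) (w i) r" using slot_norm_nonneg by (metis abs_of_nonneg diff_zero not_less real_norm_def)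
  then have Q: "infinite {i. \<delta> \<le> slot_norm (S i) (w i) r}"
    unfolding infinite_nat_iff_unbounded_le by blast
  have wZ: "w i \<in> Zn n" for i using Zn_rb[OF w] .
  have xZ: "x i \<in> Zn n" for i using subspaceD(1)[OF M x] .
  have A0: "A \<ge> 0" using rb_nonneg[OF w] .
  obtain CT where CT: "CT > 0" "\<And>x. x \<in> Zn n \<Longrightarrow> zn_norm n (T x) \<le> CT * zn_norm n x" using bop_bound[OF T] by blast
  define m where "m = n - 1 - r"
  \<comment> \<open>K + 3 vectors with errors at most 1 / (K + 3) have total error at most 1, which
    the factor 1 / sqrt N makes negligible; and at least three vectors give ln N \<ge> 1, as 3 \<ge>
    e.\<close>
  define P where "P = (\<lambda>(K::nat) G (a::unit). card G = K + 3 \<and> (\<forall>g\<in>G. \<delta> \<le> slot_norm (S g) (w g) r \<and> zn_norm n (x g - w g) \<le> 1 / (K + 3)))"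
  have "\<exists>G a. finite G \<and> G \<subseteq> {K..} \<and> P K G a" for K
  proof -
    have "\<forall>\<^sub>F i in sequentially. zn_norm n (x i - w i) < 1 / (K + 3)" using order_tendstoD(2)[OF xw, of "1 / (K + 3)"] by simp
    then obtain K' where K': "\<And>i. i \<ge> K' \<Longrightarrow> zn_norm n (x i - w i) < 1 / (K + 3)" by (auto simp: eventually_sequentially)
    have "{i. \<delta> \<le> slot_norm (S i) (w i) r} \<subseteq> ({i. \<delta> \<le> slot_norm (S i) (w i) r} \<inter> {max K K'..}) \<union> {..<max K K'}" by auto
    then have "infinite ({i. \<delta> \<le> slot_norm (S i) (w i) r} \<inter> {max K K'..})" using Q by (meson finite_UnI finite_lessThan finite_subset)
    then obtain G where G: "finite G" "card G = K + 3" "G \<subseteq> {i. \<delta> \<le> slot_norm (S i) (w i) r} \<inter> {max K K'..}"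
      using infinite_arbitrarily_large by blast
    have "\<delta> \<le> slot_norm (S g) (w g) r \<and> zn_norm n (x g - w g) \<le> 1 / (K + 3)" if "g \<in> G" for g
    proof -
      have "g \<ge> K'" "\<delta> \<le> slot_norm (S g) (w g) r" using G(3) that by auto
      then show ?thesis using K'[of g] by (simp add: less_imp_le)
    qed
    then have "P K G ()" unfolding P_def using G(2) by blast
    then show ?thesis using G by (intro exI[of _ G] exI[of _ "()"]) auto
  qed
  then obtain G a k where Gk: "\<And>i. finite (G i)" "\<And>i. G i \<subseteq> {i..}" "\<And>i. i \<le> k i" "\<And>i. P (k i) (G i) (a i)"
    "disjoint_family G" by (rule disjoint_blocks) (rule that)
  define N where "N = (\<lambda>i. k i + 3)"
  have N: "card (G i) = N i" "N i \<ge> 3" "i \<le> N i" for i using Gk(3,4)[of i] by (auto simp: P_def N_def)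
  have gG: "\<delta> \<le> slot_norm (S g) (w g) r" "zn_norm n (x g - w g) \<le> 1 / N i" if "g \<in> G i" for g i
    using Gk(4)[of i] that by (auto simp: P_def N_def)
  define s where "s = (\<lambda>i. ln (real (N i)))"
  have s1: "s i \<ge> 1" for i
  proof -
    have "exp 1 \<le> real (N i)" using exp_le N(2)[of i] by linarith
    then show ?thesis unfolding s_def using ln_ge_iff[of "real (N i)" 1] N(2)[of i] by simp
  qed
  have Nat: "filterlim (\<lambda>i. real (N i)) at_top sequentially"
    by (rule filterlim_at_top_mono[OF filterlim_real_sequentially]) (use N(3) in auto)
  have sat: "filterlim s at_top sequentially"
    unfolding s_def by (rule filterlim_compose[OF ln_at_top Nat])
  define b where "b = (\<lambda>i. vscale (of_real (1 / sqrt (N i))) (act n (fps_exp (- of_real (s i))) (\<Sum>g\<in>G i. w g)))"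
  define SG where "SG = (\<lambda>i. \<Union>g\<in>G i. S g)"
  have dG: "disjoint_family_on S (G i)" for i using d unfolding disjoint_family_on_def by blast
  have b: "rb n (SG i) (b i) A" for i
  proof -
    have "rb n (SG i) (b i) (cmod (of_real (1 / sqrt (N i))) * (sqrt (N i) * A))"
      unfolding b_def SG_def s_def using N(2)[of i] by (intro rb_scale rb_disjoint_sum[OF Gk(1) N(1) _ dG w]) auto
    moreover have "cmod (of_real (1 / sqrt (N i))) * (sqrt (N i) * A) = A" using N(2)[of i] by (simp add: norm_divide)
    ultimately show ?thesis by (simp only:)
  qed
  have bZ: "b i \<in> Zn n" for i using Zn_rb[OF b] .
  have wsum0: "(\<Sum>g\<in>G i. w g) j k = 0" if "j < r" for i j k using z that by (simp add: sum_fun_apply)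
  have b0: "b i j k = 0" if "j < r" for i j k
    unfolding b_def using act_start_zero[OF wsum0 that] by (simp add: vscale_def)
  have dSG: "disjoint_family SG"
    unfolding disjoint_family_on_def SG_def
  proof (intro ballI impI)
    fix i i' assume "i \<noteq> (i'::nat)"
    then have "G i \<inter> G i' = {}" using Gk(5) unfolding disjoint_family_on_def by blast
    then have "S g \<inter> S g' = {}" if "g \<in> G i" "g' \<in> G i'" for g g'
      using d that unfolding disjoint_family_on_def by (metis UNIV_I disjoint_iff)
    then show "(\<Union>g\<in>G i. S g) \<inter> (\<Union>g\<in>G i'. S g) = {}" by fastforce
  qed
  define e where "e = (\<lambda>i. act n (fps_X ^ m) (b i))"
  have eZ: "e i \<in> Zn n" for i unfolding e_def by (intro Zn_act bZ)
  have Te: "(\<lambda>i. zn_norm n (T (e i))) \<longlonglongrightarrow> 0"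
    unfolding e_def m_def by (rule top_slot_null[OF T nF r b dSG b0])
  \<comment> \<open>This makes the coefficient of X^m in \<kappa> exp(s X) equal to 1. Lower
    coefficients are at most m! / s, and higher powers annihilate b, which starts in slot r = n - 1
    - m.\<close>
  define \<kappa> where "\<kappa> = (\<lambda>i. fact m / (s i) ^ m)"
  have kap0: "0 \<le> \<kappa> i" "\<kappa> i \<le> fact m" for i
    using s1[of i] one_le_power[OF s1, of i m] unfolding \<kappa>_def by (auto simp: divide_le_eq mult_left_le intro!: divide_nonneg_nonneg)
  \<comment> \<open>\<open>Y i\<close> lies in M, where T is bounded below; \<open>Y'\<close> is the
    same combination of the disjoint vectors, which can be expanded in powers of the shift.\<close>
  define Y where "Y = (\<lambda>i. vscale (of_real (\<kappa> i / sqrt (N i))) (\<Sum>g\<in>G i. x g))"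
  have YM: "Y i \<in> M" for i unfolding Y_def by (intro subspaceD(4)[OF M] subspace_sum[OF M] x)
  have YZ: "Y i \<in> Zn n" for i using subspaceD(1)[OF M YM] .
  define Y' where "Y' = (\<lambda>i. vscale (of_real (\<kappa> i / sqrt (N i))) (\<Sum>g\<in>G i. w g))"
  have Y'Z: "Y' i \<in> Zn n" for i unfolding Y'_def by (intro Zn_scale Zn_sum wZ)
  have YY': "zn_norm n (Y i - Y' i) \<le> fact m / sqrt (N i)" for i
  proof -
    have "Y i - Y' i = vscale (of_real (\<kappa> i / sqrt (N i))) (\<Sum>g\<in>G i. x g - w g)"
      unfolding Y_def Y'_def vscale_diff[symmetric] sum_subtractf ..
    then have "zn_norm n (Y i - Y' i) = \<kappa> i / sqrt (N i) * zn_norm n (\<Sum>g\<in>G i. x g - w g)"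
      using zn_norm_scale[OF Zn_sum[of "G i" "\<lambda>g. x g - w g" n]] Zn_diff[OF xZ wZ] kap0(1)[of i] by (simp add: norm_divide)
    moreover have "zn_norm n (\<Sum>g\<in>G i. x g - w g) \<le> 1"
    proof -
      have "zn_norm n (\<Sum>g\<in>G i. x g - w g) \<le> (\<Sum>g\<in>G i. zn_norm n (x g - w g))"
        by (intro zn_norm_sum Gk Zn_diff xZ wZ)
      also have "\<dots> \<le> (\<Sum>g\<in>G i. 1 / N i)" by (rule sum_mono) (rule gG(2))
      also have "\<dots> = 1" using N(1,2)[of i] by simp
      finally show ?thesis .
    qed
    ultimately have "zn_norm n (Y i - Y' i) \<le> \<kappa> i / sqrt (N i) * 1" using kap0(1)[of i] by (simp only:) (intro mult_left_mono, auto)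
    also have "\<dots> \<le> fact m / sqrt (N i)" using kap0(2)[of i] by (simp add: divide_right_mono)
    finally show ?thesis .
  qed
  define q where "q = (\<lambda>i. Abs_fps (\<lambda>l. if l < m then of_real (\<kappa> i * s i ^ l / fact l) else (0::complex)))"
  have Y'e: "Y' i = e i + act n (q i) (b i)" for i
  proof -
    have bel: "below n (\<Sum>g\<in>G i. w g)" using rb_below[OF w] by (auto simp: below_def sum_fun_apply)
    have "act n (fps_exp (of_real (s i))) (b i) = vscale (of_real (1 / sqrt (N i))) (\<Sum>g\<in>G i. w g)"
      unfolding b_def act_scale act_mult[symmetric] fps_exp_add_mult[symmetric] using act_one[OF bel] by simp
    then have "Y' i = vscale (of_real (\<kappa> i)) (act n (fps_exp (of_real (s i))) (b i))" by (simp add: Y'_def)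
    also have "\<dots> = act n (fps_const (of_real (\<kappa> i)) * fps_exp (of_real (s i))) (b i)" by (rule vscale_act)
    also have "\<dots> = act n (fps_X ^ m + q i) (b i)"
    proof (rule act_cong_start[OF b0])
      fix l assume "l < n - r"
      then have "l < m \<or> l = m" by (auto simp: m_def)
      moreover have "s i \<noteq> 0" using s1[of i] by simp
      ultimately show "fps_nth (fps_const (of_real (\<kappa> i)) * fps_exp (of_real (s i))) l = fps_nth (fps_X ^ m + q i) l"
        by (auto simp: q_def fps_X_power_nth \<kappa>_def)
    qed
    also have "\<dots> = e i + act n (q i) (b i)" by (simp add: act_add e_def)
    finally show ?thesis .
  qed
  have qb: "zn_norm n (act n (q i) (b i)) \<le> cact n * fact m * A / s i" for i
  proof -
    have "cmod (fps_nth (q i) l) \<le> fact m / s i" for l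
    proof (cases "l < m")
      case True
      have "s i ^ l * s i \<le> s i ^ m" using power_increasing[of "Suc l" m "s i"] True s1[of i] by (simp add: mult.commute)
      then have "s i ^ l / s i ^ m \<le> 1 / s i" using s1[of i] by (simp add: field_simps)
      then have "fact m * (s i ^ l / s i ^ m) / fact l \<le> fact m * (1 / s i) / fact l"
        by (intro divide_right_mono mult_left_mono) auto
      also have "\<dots> \<le> fact m * (1 / s i) / 1"
        using s1[of i] by (intro divide_left_mono fact_ge_1) auto
      finally have "fact m * (s i ^ l / s i ^ m) / fact l \<le> fact m * (1 / s i) / 1" .
      then show ?thesis using True s1[of i] by (simp add: q_def \<kappa>_def norm_divide norm_mult norm_power)
    next
      case False
      then show ?thesis using s1[of i] by (simp add: q_def)
    qed
    then have "zn_norm n (act n (q i) (b i)) \<le> cact n * (fact m / s i) * zn_norm n (b i)"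
      using s1[of i] by (intro zn_norm_act bZ) auto
    also have "\<dots> \<le> cact n * (fact m / s i) * A" using zn_norm_rb[OF b] s1[of i] cact_nonneg by (intro mult_left_mono) auto
    finally show ?thesis by simp
  qed
  define err where "err = (\<lambda>i. fact m / sqrt (N i) + cact n * fact m * A / s i)"
  have Ye: "zn_norm n (Y i - e i) \<le> err i" for i
  proof -
    have "Y i - e i = (Y i - Y' i) + act n (q i) (b i)" by (simp add: Y'e)
    then have "zn_norm n (Y i - e i) \<le> zn_norm n (Y i - Y' i) + zn_norm n (act n (q i) (b i))"
      using zn_norm_triangle[OF Zn_diff[OF YZ Y'Z] Zn_act[OF bZ], of i i "q i" i] by (simp only:)
    then show ?thesis using YY'[of i] qb[of i] by (simp add: err_def)
  qed
  have err0: "err \<longlonglongrightarrow> 0"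
  proof -
    have sq: "filterlim (\<lambda>i. sqrt (real (N i))) at_top sequentially" by (rule filterlim_compose[OF sqrt_at_top Nat])
    have 1: "(\<lambda>i. fact m / sqrt (real (N i))) \<longlonglongrightarrow> 0"
      by (rule tendsto_divide_0[OF tendsto_const filterlim_at_top_imp_at_infinity[OF sq]])
    have 2: "(\<lambda>i. cact n * fact m * A / s i) \<longlonglongrightarrow> 0"
      by (rule tendsto_divide_0[OF tendsto_const filterlim_at_top_imp_at_infinity[OF sat]])
    show ?thesis unfolding err_def using tendsto_add[OF 1 2] by simp
  qed
  \<comment> \<open>In slot r the twist acts as the identity, so the squared l2 norm of b there is
    the mean of the squared slot norms of the w g, hence at least \<delta>^2.\<close>
  have low: "\<delta> / (4 ^ n * real n ^ n) \<le> zn_norm n (e i)" for i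
  proof -
    have "\<delta>\<^sup>2 \<le> (slot_norm (SG i) (b i) r)\<^sup>2"
    proof -
      have br: "b i r k = of_real (1 / sqrt (N i)) * (\<Sum>g\<in>G i. w g) r k" for k
      proof -
        have "(\<Sum>l\<le>r. fps_nth (fps_exp (- of_real (s i))) l * (\<Sum>g\<in>G i. w g) (r - l) k) = (\<Sum>l\<in>{0}. fps_nth (fps_exp (- of_real (s i))) l * (\<Sum>g\<in>G i. w g) (r - l) k)"
          using wsum0 by (intro sum.mono_neutral_right) auto
        then show ?thesis using r by (simp add: b_def vscale_def act_def)
      qed
      have "(slot_norm (SG i) (b i) r)\<^sup>2 = (slot_norm (SG i) (\<Sum>g\<in>G i. w g) r)\<^sup>2 / N i"
        unfolding slot_norm_power2 sum_divide_distrib br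
        by (intro sum.cong refl) (simp add: norm_mult norm_divide power_divide)
      also have "(slot_norm (SG i) (\<Sum>g\<in>G i. w g) r)\<^sup>2 = (\<Sum>g\<in>G i. (slot_norm (S g) (w g) r)\<^sup>2)"
        unfolding SG_def using rb_finite[OF w] rb_supp[OF w] by (intro slot_norm_disjoint_sum Gk dG) auto
      finally have 1: "(slot_norm (SG i) (b i) r)\<^sup>2 = (\<Sum>g\<in>G i. (slot_norm (S g) (w g) r)\<^sup>2) / N i" .
      have "(\<Sum>g\<in>G i. \<delta>\<^sup>2) \<le> (\<Sum>g\<in>G i. (slot_norm (S g) (w g) r)\<^sup>2)" using gG(1) del by (intro sum_mono power_mono) auto
      then have "N i * \<delta>\<^sup>2 \<le> (\<Sum>g\<in>G i. (slot_norm (S g) (w g) r)\<^sup>2)" using N(1)[of i] by simp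
      then show ?thesis unfolding 1 using N(2)[of i] by (simp add: field_simps)
    qed
    then have "\<delta> \<le> slot_norm (SG i) (b i) r" using slot_norm_nonneg by (rule power2_le_imp_le)
    also have "slot_norm (SG i) (b i) r = slot_norm (SG i) (e i) (n - 1)"
    proof -
      have "e i (n - 1) k = b i r k" for k using r by (simp add: e_def act_X_power m_def)
      then show ?thesis by (simp add: slot_norm_def)
    qed
    also have "\<dots> \<le> 4 ^ n * real n ^ n * zn_norm n (e i)"
    proof (rule slot_pairing_bil)
      show "finite (SG i)" "supp_in (SG i) (e i)" unfolding e_def using rb_finite[OF b] supp_in_act[OF rb_supp[OF b]] by auto
      show "\<forall>j<n - 1. \<forall>k. e i j k = 0"
      proof (intro allI impI)
        fix j k assume "j < n - 1"
        then have "j - m < r \<or> j < m" by (auto simp: m_def)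
        then show "e i j k = 0" using b0 by (auto simp: e_def act_X_power)
      qed
    qed (use r eZ in auto)
    finally show ?thesis using r by (simp add: divide_le_eq mult_ac)
  qed
  \<comment> \<open>T is small at e i, hence at the nearby Y i; the lower bound on M makes Y i
    small, and with it e i, against \<open>low\<close>.\<close>
  have "zn_norm n (e i) \<le> err i + (zn_norm n (T (e i)) + CT * err i) / c" for i
  proof -
    have "T (Y i) = T (e i) + T (Y i - e i)" using bopD(2)[OF T eZ Zn_diff[OF YZ eZ], of i i i] by simp
    then have "zn_norm n (T (Y i)) \<le> zn_norm n (T (e i)) + zn_norm n (T (Y i - e i))"
      using zn_norm_triangle[OF bopD(1)[OF T eZ] bopD(1)[OF T Zn_diff[OF YZ eZ]], of i i i] by (simp only:)
    also have "zn_norm n (T (Y i - e i)) \<le> CT * err i"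
      using CT(1) Ye[of i] by (intro order_trans[OF CT(2)[OF Zn_diff[OF YZ eZ]]] mult_left_mono) auto
    finally have "c * zn_norm n (Y i) \<le> zn_norm n (T (e i)) + CT * err i" using c(2)[OF YM, of i] by simp
    then have "zn_norm n (Y i) \<le> (zn_norm n (T (e i)) + CT * err i) / c" using c(1) by (simp add: le_divide_eq mult.commute)
    moreover have "zn_norm n (e i) - zn_norm n (Y i) \<le> err i"
      using zn_norm_triangle_sub[OF eZ YZ, of i i] Ye[of i] zn_norm_commute[OF eZ YZ, of i i] by simp
    ultimately show ?thesis by simp
  qed
  then have "\<delta> / (4 ^ n * real n ^ n) \<le> err i + (zn_norm n (T (e i)) + CT * err i) / c" for i using low order_trans by blast
  moreover have "(\<lambda>i. err i + (zn_norm n (T (e i)) + CT * err i) / c) \<longlonglongrightarrow> 0 + (0 + CT * 0) / c"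
    using c(1) by (intro tendsto_intros err0 Te) simp
  ultimately have "\<delta> / (4 ^ n * real n ^ n) \<le> 0" by (intro LIMSEQ_le_const[of _ 0]) auto
  moreover have "\<delta> / (4 ^ n * real n ^ n) > 0" using del r by simp
  ultimately show False by simp
qed

text \<open>Induction over the slots: normalised vectors of M are asymptotic to bounded disjoint
  vectors starting at slot r. By \<open>start_slot_null\<close> that slot is small in l2, so peeling
  it off costs a null sequence; at r = n the disjoint vectors are 0, which contradicts norm
  1.\<close>

lemma bounded_below_Fac:
  assumes T: "T \<in> bop n" and M: "is_subspace n M" "infinite_dim M"
    and c: "c > 0" "\<And>x. x \<in> M \<Longrightarrow> c * zn_norm n x \<le> zn_norm n (T x)"
  shows "Fac n T"
proof (rule ccontr)
  assume nF: "\<not> Fac n T"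
  define Q where "Q = (\<lambda>r. \<exists>x w S A. (\<forall>i. x i \<in> M \<and> zn_norm n (x i) = 1 \<and> rb n (S i) (w i) A \<and> (\<forall>j<r. \<forall>k. w i j k = 0)) \<and>
     disjoint_family (S :: nat \<Rightarrow> nat set) \<and> (\<lambda>i. zn_norm n (x i - w i)) \<longlonglongrightarrow> 0)"
  have "Q r" if "r \<le> n" for r
    using that
  proof (induction r)
    case 0
    obtain x S where x: "\<And>i. x i \<in> M" "\<And>i. zn_norm n (x i) = 1" "\<And>i. finite (S i)" "disjoint_family S"
      "\<And>i::nat. zn_norm n (x i - proj (S i) (x i)) < 1 / Suc i" using gliding_hump[OF M] by blast
    have xZ: "x i \<in> Zn n" for i using subspaceD(1)[OF M(1) x(1)] .
    \<comment> \<open>2 is just a bound strictly above the norm 1 of x i.\<close>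
    have "rb n (S i) (proj (S i) (x i)) 2" for i
      using x(2,3)[of i] xZ[of i] by (intro nb_rb nb_if_norm_less) auto
    moreover have "(\<lambda>i. zn_norm n (x i - proj (S i) (x i))) \<longlonglongrightarrow> 0"
    proof (rule tendsto_sandwich)
      show "\<forall>\<^sub>F i in sequentially. 0 \<le> zn_norm n (x i - proj (S i) (x i))" by (intro always_eventually allI zn_norm_nonneg Zn_diff Zn_proj xZ)
      show "\<forall>\<^sub>F i in sequentially. zn_norm n (x i - proj (S i) (x i)) \<le> 1 / real (Suc i)" by (intro always_eventually allI less_imp_le x(5))
      show "(\<lambda>i. 1 / real (Suc i)) \<longlonglongrightarrow> 0" by real_asymp
    qed simp
    ultimately show ?case unfolding Q_def using x(1,2,4) by - (rule exI[of _ x], rule exI[of _ "\<lambda>i. proj (S i) (x i)"], rule exI[of _ S], rule exI[of _ 2], auto)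
  next
    case (Suc r)
    then have r: "r < n" by simp
    have "Q r" using Suc by simp
    then obtain x w and S :: "nat \<Rightarrow> nat set" and A where H: "\<forall>i. x i \<in> M \<and> zn_norm n (x i) = 1 \<and> rb n (S i) (w i) A \<and> (\<forall>j<r. \<forall>k. w i j k = 0)"
      and d: "disjoint_family S" and xw: "(\<lambda>i. zn_norm n (x i - w i)) \<longlonglongrightarrow> 0"
      unfolding Q_def by (elim exE conjE) (rule that, assumption+)
    have x: "x i \<in> M" "zn_norm n (x i) = 1" and w: "rb n (S i) (w i) A" for i using H by auto
    have z: "w i j k = 0" if "j < r" for i j k using H that by auto
    have xZ: "x i \<in> Zn n" for i using subspaceD(1)[OF M(1) x(1)] .
    have wZ: "w i \<in> Zn n" for i using Zn_rb[OF w] .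
    define t where "t = (\<lambda>i. slot_norm (S i) (w i) r)"
    have t0: "t \<longlonglongrightarrow> 0" unfolding t_def by (rule start_slot_null[OF T nF M(1) c r x(1) w d z xw])
    have "\<forall>i. \<exists>v. rb n (S i) v (real n ^ n * t i) \<and> (\<forall>j\<le>r. \<forall>k. v j k = w i j k)"
      unfolding t_def using z by (intro allI peel_slot rb_finite[OF w] rb_supp[OF w] r) auto
    then obtain v where v: "\<And>i. rb n (S i) (v i) (real n ^ n * t i)" "\<And>i j k. j \<le> r \<Longrightarrow> v i j k = w i j k" by metis
    have vZ: "v i \<in> Zn n" for i using Zn_rb[OF v(1)] .
    have "Bseq t" using t0 convergent_imp_Bseq convergent_def by blast
    then obtain D where D: "D > 0" "\<And>i. \<bar>t i\<bar> \<le> D" by (auto elim!: BseqE)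
    define w' where "w' = (\<lambda>i. w i + vscale (-1) (v i))"
    have "rb n (S i) (w' i) (A + real n ^ n * D)" for i
    proof -
      have "rb n (S i) (vscale (-1) (v i)) (real n ^ n * D)"
      proof (rule rb_mono)
        show "rb n (S i) (vscale (-1) (v i)) (cmod (-1) * (real n ^ n * t i))" by (rule rb_scale[OF v(1)])
        show "cmod (-1) * (real n ^ n * t i) \<le> real n ^ n * D" using D(2)[of i] by (auto intro!: mult_left_mono)
      qed
      then show ?thesis unfolding w'_def by (rule rb_add[OF w])
    qed
    moreover have "\<forall>j<Suc r. \<forall>k. w' i j k = 0" for i using v(2) by (simp add: w'_def vscale_def)
    moreover have "(\<lambda>i. zn_norm n (x i - w' i)) \<longlonglongrightarrow> 0"
    proof (rule tendsto_sandwich)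
      show "\<forall>\<^sub>F i in sequentially. 0 \<le> zn_norm n (x i - w' i)"
        unfolding w'_def by (intro always_eventually allI zn_norm_nonneg Zn_diff Zn_add Zn_scale xZ wZ vZ)
      have "zn_norm n (x i - w' i) \<le> zn_norm n (x i - w i) + real n ^ n * t i" for i
      proof -
        have "x i - w' i = (x i - w i) + v i" by (simp add: w'_def vscale_minus_one)
        then have "zn_norm n (x i - w' i) = zn_norm n ((x i - w i) + v i)" by (simp only:)
        then show ?thesis using zn_norm_triangle[OF Zn_diff[OF xZ wZ] vZ, of i i i] zn_norm_rb[OF v(1), of i] by linarith
      qed
      then show "\<forall>\<^sub>F i in sequentially. zn_norm n (x i - w' i) \<le> zn_norm n (x i - w i) + real n ^ n * t i" by simp
      have "(\<lambda>i. zn_norm n (x i - w i) + real n ^ n * t i) \<longlonglongrightarrow> 0 + real n ^ n * 0" by (intro tendsto_intros xw t0)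
      then show "(\<lambda>i. zn_norm n (x i - w i) + real n ^ n * t i) \<longlonglongrightarrow> 0" by simp
    qed simp
    ultimately show ?case unfolding Q_def using x d by - (rule exI[of _ x], rule exI[of _ w'], rule exI[of _ S], rule exI[of _ "A + real n ^ n * D"], auto)
  qed
  from this[OF order_refl] have "Q n" .
  then obtain x w and S :: "nat \<Rightarrow> nat set" and A where H: "\<forall>i. x i \<in> M \<and> zn_norm n (x i) = 1 \<and> rb n (S i) (w i) A \<and> (\<forall>j<n. \<forall>k. w i j k = 0)"
    and lim: "(\<lambda>i. zn_norm n (x i - w i)) \<longlonglongrightarrow> 0"
    unfolding Q_def by (elim exE conjE) (rule that, assumption+)
  have x: "zn_norm n (x i) = 1" and w1: "rb n (S i) (w i) A" for i using H by auto
  have w2: "w i j k = 0" if "j < n" for i j k using H that by auto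
  have "w i = 0" for i
  proof (intro ext)
    fix j k
    show "w i j k = 0 j k" using w2[of j i k] rb_below[OF w1, of i] by (cases "j < n") (auto simp: below_def)
  qed
  then have "(\<lambda>i. 1 :: real) \<longlonglongrightarrow> 0" using lim x by simp
  then show False by (simp add: LIMSEQ_const_iff)
qed

section \<open>Adjoints\<close>


lemma bp_summable: assumes x: "x \<in> Zn n" and y: "y \<in> Zn n" shows "summable (bp n x y)"
  unfolding summable_Cauchy
proof (intro allI impI)
  fix e :: real assume e: "e > 0"
  obtain D where D: "nb n y D" using y by (auto simp: Zn_iff)
  have D0: "D \<ge> 0" using rb_nonneg[OF nb_rb[OF D finite.emptyI]] .
  define e' where "e' = e / (4 ^ n * (D + 1))"
  have e': "e' > 0" using e D0 by (simp add: e'_def)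
  obtain K where K: "\<And>S. S \<subseteq> {K..} \<Longrightarrow> zn_norm n (proj S x) < e'" using zn_tails[OF x e'] by blast
  show "\<exists>N. \<forall>m\<ge>N. \<forall>l. norm (sum (bp n x y) {m..<l}) < e"
  proof (intro exI[of _ K] allI impI)
    fix m l assume "m \<ge> K"
    then have "zn_norm n (proj {m..<l} x) < e'" by (intro K) auto
    then have "rb n {m..<l} (proj {m..<l} x) e'" by (intro rb_of_norm Zn_proj x) (auto simp: supp_in_def proj_def)
    from bp_bound[OF this nb_rb[OF D, of "{m..<l}"], of "{m..<l}"]
    have "cmod (\<Sum>k\<in>{m..<l}. bp n (proj {m..<l} x) (proj {m..<l} y) k) \<le> 4 ^ n * (e' * D)" by simp
    also have "(\<Sum>k\<in>{m..<l}. bp n (proj {m..<l} x) (proj {m..<l} y) k) = sum (bp n x y) {m..<l}"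
      by (intro sum.cong) (auto simp: bp_def proj_def)
    also have "4 ^ n * (e' * D) < e"
    proof -
      have "4 ^ n * (e' * D) = e * (D / (D + 1))" by (simp add: e'_def)
      also have "\<dots> < e * 1" using e D0 by (intro mult_strict_left_mono) auto
      finally show ?thesis by simp
    qed
    finally show "norm (sum (bp n x y) {m..<l}) < e" by simp
  qed
qed

text \<open>The factor 4 is 2 * 2: twice the norm of each argument is a bound for which a
  representative exists.\<close>

definition cB :: "nat \<Rightarrow> real" where "cB n = 4 ^ n * 4"

lemma cB_pos: "cB n > 0" by (simp add: cB_def)

lemma bil_bound: assumes x: "x \<in> Zn n" and y: "y \<in> Zn n" shows "cmod (bil n x y) \<le> cB n * zn_norm n x * zn_norm n y"
proof (cases "zn_norm n x \<le> 0 \<or> zn_norm n y \<le> 0")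
  case True
  then have "x = 0 \<or> y = 0" using zn_norm_eq_0 x y by blast
  then have "bp n x y = (\<lambda>k. 0)" by (auto simp: bp_def fun_eq_iff)
  then have "bil n x y = 0" by (simp add: bil_def)
  then show ?thesis using zn_norm_nonneg[OF x] zn_norm_nonneg[OF y] cB_pos[of n] by simp
next
  case False
  then have "nb n x (2 * zn_norm n x)" "nb n y (2 * zn_norm n y)" using x y by (auto intro!: nb_if_norm_less)
  then have b: "cmod (\<Sum>k<K. bp n (proj {..<K} x) (proj {..<K} y) k) \<le> 4 ^ n * ((2 * zn_norm n x) * (2 * zn_norm n y))" for K
    by (intro bp_bound[of n "{..<K}" _ _ "{..<K}"]) (auto simp: nb_def)
  have e: "(\<Sum>k<K. bp n (proj {..<K} x) (proj {..<K} y) k) = (\<Sum>k<K. bp n x y k)" for K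
    by (intro sum.cong) (auto simp: bp_def proj_def)
  have "(\<lambda>K. cmod (\<Sum>k<K. bp n x y k)) \<longlonglongrightarrow> cmod (bil n x y)"
    unfolding bil_def by (intro tendsto_norm summable_LIMSEQ bp_summable x y)
  then show ?thesis by (rule LIMSEQ_le_const2) (use b in \<open>auto simp: e cB_def mult_ac\<close>)
qed

lemma bil_add_left: "x \<in> Zn n \<Longrightarrow> x' \<in> Zn n \<Longrightarrow> y \<in> Zn n \<Longrightarrow> bil n (x + x') y = bil n x y + bil n x' y"
  unfolding bil_def using suminf_add[OF bp_summable[of x n y] bp_summable[of x' n y]]
  by (simp add: bp_add_left ext[of "bp n (x + x') y" "\<lambda>k. bp n x y k + bp n x' y k"])

lemma bil_scale_left: "x \<in> Zn n \<Longrightarrow> y \<in> Zn n \<Longrightarrow> bil n (vscale c x) y = c * bil n x y"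
  unfolding bil_def using suminf_mult[OF bp_summable[of x n y], of c]
  by (simp add: bp_scale_left ext[of "bp n (vscale c x) y" "\<lambda>k. c * bp n x y k"])

text \<open>Exchanging the factors of f(1/2 + t) g(1/2 - t) amounts to replacing t by -t, which
  changes the coefficient of order n - 1 by the sign shown.\<close>

lemma bil_commute: assumes x: "x \<in> Zn n" and y: "y \<in> Zn n" shows "bil n y x = (-1) ^ (n - 1) * bil n x y"
proof -
  have "bp n y x k = (-1) ^ (n - 1) * bp n x y k" for k
  proof -
    have "bp n y x k = (\<Sum>i<n. (-1) ^ (n - 1 - i) * y i k * x (n - 1 - i) k)"
      unfolding bp_def by (rule sum.reindex_bij_witness[where i = "\<lambda>i. n - 1 - i" and j = "\<lambda>i. n - 1 - i"]) auto
    also have "\<dots> = (\<Sum>i<n. (-1) ^ (n - 1) * ((-1) ^ i * x (n - 1 - i) k * y i k))"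
    proof (rule sum.cong[OF refl])
      fix i assume "i \<in> {..<n}"
      then have "(-1::complex) ^ (n - 1) = (-1) ^ (n - 1 - i) * (-1) ^ i" by (simp add: power_add[symmetric])
      moreover have "(-1::complex) ^ i * (-1) ^ i = 1" by (simp add: power_mult_distrib[symmetric])
      ultimately have "(-1::complex) ^ (n - 1 - i) = (-1) ^ (n - 1) * (-1) ^ i" by (simp add: mult.assoc)
      then show "(-1) ^ (n - 1 - i) * y i k * x (n - 1 - i) k = (-1) ^ (n - 1) * ((-1) ^ i * x (n - 1 - i) k * y i k)" by simp
    qed
    finally show ?thesis by (simp add: bp_def sum_distrib_left)
  qed
  then have "bp n y x = (\<lambda>k. (-1) ^ (n - 1) * bp n x y k)" by (rule ext)
  then show ?thesis unfolding bil_def using suminf_mult[OF bp_summable[OF x y], of "(-1) ^ (n - 1)"] by simp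
qed

lemma bil_add_right: assumes "x \<in> Zn n" "y \<in> Zn n" "y' \<in> Zn n" shows "bil n x (y + y') = bil n x y + bil n x y'"
  unfolding bil_def using suminf_add[OF bp_summable[OF assms(1,2)] bp_summable[OF assms(1,3)]]
  by (simp add: bp_add ext[of "bp n x (y + y')" "\<lambda>k. bp n x y k + bp n x y' k"])

lemma bil_scale_right: assumes "x \<in> Zn n" "y \<in> Zn n" shows "bil n x (vscale c y) = c * bil n x y"
  unfolding bil_def using suminf_mult[OF bp_summable[OF assms], of c]
  by (simp add: bp_scale ext[of "bp n x (vscale c y)" "\<lambda>k. c * bp n x y k"])

lemma bil_sum_right: fixes y :: "'i \<Rightarrow> arr" assumes "x \<in> Zn n" "finite I" "\<And>i. i \<in> I \<Longrightarrow> y i \<in> Zn n"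
  shows "bil n x (\<Sum>i\<in>I. vscale (c i) (y i)) = (\<Sum>i\<in>I. c i * bil n x (y i))"
  using assms(2,3)
proof (induction I rule: finite_induct)
  case (insert a I)
  have "bil n x (vscale (c a) (y a) + (\<Sum>i\<in>I. vscale (c i) (y i))) = c a * bil n x (y a) + bil n x (\<Sum>i\<in>I. vscale (c i) (y i))"
    using insert.prems assms(1) by (subst bil_add_right) (auto intro!: Zn_scale Zn_sum simp: bil_scale_right)
  also have "bil n x (\<Sum>i\<in>I. vscale (c i) (y i)) = (\<Sum>i\<in>I. c i * bil n x (y i))" using insert by auto
  finally show ?case by (simp only: sum.insert[OF insert.hyps])
next
  case empty
  have "bil n x 0 = 0" by (simp add: bil_def bp_def)
  then show ?case by (simp only: sum.empty)
qed

lemma bil_uvec: assumes "l < n" shows "bil n (uvec k l) y = (-1) ^ (n - 1 - l) * y (n - 1 - l) k"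
proof -
  have "bil n (uvec k l) y = (\<Sum>k'\<in>{k}. bp n (uvec k l) y k')"
    by (rule bil_finite) (auto simp: supp_in_def uvec_def)
  also have "\<dots> = bp n (uvec k l) y k" by simp
  also have "\<dots> = (\<Sum>i<n. if i = n - 1 - l then (-1) ^ i * y i k else 0)"
    unfolding bp_def
  proof (rule sum.cong[OF refl])
    fix i assume "i \<in> {..<n}"
    then show "(-1) ^ i * uvec k l (n - 1 - i) k * y i k = (if i = n - 1 - l then (-1) ^ i * y i k else 0)"
      using assms by (auto simp: uvec_def)
  qed
  also have "\<dots> = (-1) ^ (n - 1 - l) * y (n - 1 - l) k" using assms by simp
  finally show ?thesis .
qed

lemma bil_nondegenerate: assumes y: "y \<in> Zn n" and z: "\<And>x. x \<in> Zn n \<Longrightarrow> bil n x y = 0" shows "y = 0"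
proof (intro ext)
  fix j k
  show "y j k = 0 j k"
  proof (cases "j < n")
    case True
    then have "n - 1 - j < n" "n - 1 - (n - 1 - j) = j" by auto
    then show ?thesis using z[OF Zn_uvec[of "n - 1 - j" n k]] bil_uvec[of "n - 1 - j" n k y] by simp
  next
    case False
    then show ?thesis using Zn_below[OF y] by (simp add: below_def)
  qed
qed

lemma bil_eqI: assumes y: "y \<in> Zn n" "y' \<in> Zn n" and e: "\<And>x. x \<in> Zn n \<Longrightarrow> bil n x y = bil n x y'" shows "y = y'"
proof -
  have "bil n x (y - y') = 0" if x: "x \<in> Zn n" for x
  proof -
    have "bil n x (y + vscale (-1) y') = 0" using x y e[OF x] by (simp add: bil_add_right bil_scale_right Zn_scale)
    then show ?thesis by (simp add: vscale_minus_one)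
  qed
  then have "y - y' = 0" by (rule bil_nondegenerate[OF Zn_diff[OF y]])
  then show ?thesis by simp
qed

section \<open>Bounded functionals and adjoints\<close>

text \<open>The norming criterion involves only pairings with shifted jets of unit sequences, and
  these test vectors are bounded by n^n.\<close>

lemma dual_norm_nb:
  assumes b: "below n y" and D: "D \<ge> 0" and le: "\<And>S w A. rb n S w A \<Longrightarrow> cmod (bil n w y) \<le> D * A"
  shows "nb n y (nrm n * (D * real n ^ n))"
proof (rule nbI[OF b])
  fix S :: "nat set" assume S: "finite S"
  show "rb n S (proj S y) (nrm n * (D * real n ^ n))"
  proof (intro nrm(2) S)
    show "below n (proj S y)" "supp_in S (proj S y)" using b by (auto simp: below_def supp_in_def proj_def)
    show "0 \<le> D * real n ^ n" using D by simp
    fix r u assume r: "r < n" and u: "unit_on S u"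
    have w: "rb n S (act n (fps_X ^ (n - 1 - r)) (xvec n u)) (real n ^ n)" using r by (intro rb_shift_xvec u) auto
    have "bil n (act n (fps_X ^ (n - 1 - r)) (xvec n u)) (proj S y) = bil n (act n (fps_X ^ (n - 1 - r)) (xvec n u)) y"
      using rb_supp[OF w] S by (simp add: bil_finite[of S] bp_def proj_def cong: sum.cong)
    then show "cmod (bil n (act n (fps_X ^ (n - 1 - r)) (xvec n u)) (proj S y)) \<le> D * real n ^ n" using le[OF w] by simp
  qed
qed

lemma dual_norm:
  assumes y: "y \<in> Zn n" and D: "D \<ge> 0" and le: "\<And>z. z \<in> Zn n \<Longrightarrow> cmod (bil n z y) \<le> D * zn_norm n z"
  shows "zn_norm n y \<le> nrm n * (D * real n ^ n)"
proof (intro zn_norm_le dual_norm_nb Zn_below y D)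
  fix S w A assume w: "rb n S w A"
  show "cmod (bil n w y) \<le> D * A" using le[OF Zn_rb[OF w]] mult_left_mono[OF zn_norm_rb[OF w] D] by linarith
qed

text \<open>The candidate y is read off from the values of the functional on unit vectors. Its
  finite sections are bounded by the norming criterion, and this already puts y into the space;
  equality with the pairing extends from finitely supported vectors by vanishing tails.\<close>

lemma dual_rep:
  assumes add: "\<And>x y. x \<in> Zn n \<Longrightarrow> y \<in> Zn n \<Longrightarrow> \<phi> (x + y) = \<phi> x + \<phi> y" and sc: "\<And>c x. x \<in> Zn n \<Longrightarrow> \<phi> (vscale c x) = c * \<phi> x"
    and bd: "\<And>x. x \<in> Zn n \<Longrightarrow> cmod (\<phi> x) \<le> C * zn_norm n x" and C: "C \<ge> 0"
  shows "\<exists>y\<in>Zn n. (\<forall>x\<in>Zn n. \<phi> x = bil n x y) \<and> zn_norm n y \<le> nrm n * (C * real n ^ n)"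
proof -
  define y where "y = (\<lambda>j k. if j < n then (-1) ^ j * \<phi> (uvec k (n - 1 - j)) else (0::complex))"
  have p0: "\<phi> 0 = 0" using sc[OF Zn_zero, of 0] by simp
  have sum: "\<phi> (\<Sum>i\<in>I. x i) = (\<Sum>i\<in>I. \<phi> (x i))" if "finite I" "\<And>i. i \<in> I \<Longrightarrow> x i \<in> Zn n" for I :: "nat set" and x :: "nat \<Rightarrow> arr"
    using that
  proof (induction I rule: finite_induct)
    case (insert a I)
    have "\<phi> (x a + (\<Sum>i\<in>I. x i)) = \<phi> (x a) + (\<Sum>i\<in>I. \<phi> (x i))" using insert by (subst add) (auto intro!: Zn_sum)
    then show ?case by (simp only: sum.insert[OF insert.hyps])
  next
    case empty show ?case by (simp only: sum.empty p0)
  qed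
  have uv: "bil n (uvec k l) y = \<phi> (uvec k l)" if "l < n" for k l
  proof -
    have "n - 1 - (n - 1 - l) = l" "n - 1 - l < n" using that by auto
    moreover have "(-1::complex) ^ (n - 1 - l) * (-1) ^ (n - 1 - l) = 1" by (simp add: power_mult_distrib[symmetric])
    ultimately show ?thesis by (simp add: bil_uvec[OF that] y_def mult.assoc[symmetric])
  qed
  have fin: "\<phi> x = bil n x y" if S: "finite S" "supp_in S x" "x \<in> Zn n" for S x
  proof -
    have ex: "x = (\<Sum>k\<in>S. \<Sum>l<n. vscale (x l k) (uvec k l))" by (rule finite_expand[OF S(1,2) Zn_below[OF S(3)]])
    have "\<phi> x = \<phi> (\<Sum>k\<in>S. \<Sum>l<n. vscale (x l k) (uvec k l))" using ex by simp
    also have "\<dots> = (\<Sum>k\<in>S. \<phi> (\<Sum>l<n. vscale (x l k) (uvec k l)))" using S(1) by (intro sum Zn_sum Zn_scale Zn_uvec) auto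
    also have "\<dots> = (\<Sum>k\<in>S. \<Sum>l<n. x l k * \<phi> (uvec k l))"
    proof (rule sum.cong[OF refl])
      fix k
      have "\<phi> (\<Sum>l<n. vscale (x l k) (uvec k l)) = (\<Sum>l<n. \<phi> (vscale (x l k) (uvec k l)))" by (intro sum Zn_scale Zn_uvec) auto
      also have "\<dots> = (\<Sum>l<n. x l k * \<phi> (uvec k l))" by (intro sum.cong refl sc Zn_uvec) auto
      finally show "\<phi> (\<Sum>l<n. vscale (x l k) (uvec k l)) = (\<Sum>l<n. x l k * \<phi> (uvec k l))" .
    qed
    also have "\<dots> = (\<Sum>k\<in>S. bp n x y k)"
    proof (rule sum.cong[OF refl])
      fix k
      have "bp n x y k = (\<Sum>l<n. (-1) ^ (n - 1 - l) * x l k * y (n - 1 - l) k)"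
        unfolding bp_def by (rule sum.reindex_bij_witness[where i = "\<lambda>i. n - 1 - i" and j = "\<lambda>i. n - 1 - i"]) auto
      also have "\<dots> = (\<Sum>l<n. x l k * \<phi> (uvec k l))"
        by (intro sum.cong refl) (simp add: uv[symmetric] bil_uvec)
      finally show "(\<Sum>l<n. x l k * \<phi> (uvec k l)) = bp n x y k" by simp
    qed
    also have "\<dots> = bil n x y" by (rule bil_finite[OF S(1,2), symmetric])
    finally show ?thesis .
  qed
  have ynb: "nb n y (nrm n * (C * real n ^ n))"
  proof (rule dual_norm_nb[OF _ C])
    show "below n y" by (simp add: below_def y_def)
    fix S w A assume w: "rb n S w A"
    have "cmod (bil n w y) = cmod (\<phi> w)" using fin[OF rb_finite[OF w] rb_supp[OF w] Zn_rb[OF w]] by simp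
    then show "cmod (bil n w y) \<le> C * A" using bd[OF Zn_rb[OF w]] mult_left_mono[OF zn_norm_rb[OF w] C] by linarith
  qed
  have yZ: "y \<in> Zn n" using ynb Zn_iff by blast
  have "\<phi> x = bil n x y" if x: "x \<in> Zn n" for x
  proof -
    define E where "E = C + cB n * zn_norm n y + 1"
    have E: "E > 0" using C cB_pos[of n] zn_norm_nonneg[OF yZ] by (simp add: E_def add_nonneg_pos)
    have "cmod (\<phi> x - bil n x y) \<le> 0 + e" if e: "e > 0" for e
    proof -
      obtain K where K: "zn_norm n (proj {K..} x) < e / E" using zn_tails_K[OF x, of "e / E"] e E by auto
      have P: "proj {..<K} x \<in> Zn n" "proj {K..} x \<in> Zn n" using Zn_proj[OF x] by auto
      have "\<phi> x - bil n x y = \<phi> (proj {K..} x) - bil n (proj {K..} x) y"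
      proof -
        have "\<phi> x = \<phi> (proj {..<K} x) + \<phi> (proj {K..} x)" using add[OF P] by (simp add: proj_compl)
        moreover have "bil n x y = bil n (proj {..<K} x) y + bil n (proj {K..} x) y" using bil_add_left[OF P yZ] by (simp add: proj_compl)
        moreover have "\<phi> (proj {..<K} x) = bil n (proj {..<K} x) y" by (rule fin[OF _ _ P(1), of "{..<K}"]) (auto simp: supp_in_def proj_def)
        ultimately show ?thesis by simp
      qed
      then have "cmod (\<phi> x - bil n x y) \<le> cmod (\<phi> (proj {K..} x)) + cmod (bil n (proj {K..} x) y)" by (simp add: norm_triangle_ineq4)
      also have "\<dots> \<le> C * zn_norm n (proj {K..} x) + cB n * zn_norm n (proj {K..} x) * zn_norm n y"
        by (intro add_mono bd bil_bound P yZ)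
      also have "\<dots> \<le> E * zn_norm n (proj {K..} x)" using zn_norm_nonneg[OF P(2)] by (simp add: E_def algebra_simps)
      also have "\<dots> \<le> e" using K E by (simp add: field_simps)
      finally show ?thesis by simp
    qed
    then have "cmod (\<phi> x - bil n x y) \<le> 0" by (rule field_le_epsilon)
    then show ?thesis by simp
  qed
  then show ?thesis using yZ zn_norm_le[OF ynb] by blast
qed

lemma adjoint_exists:
  assumes T: "T \<in> bop n" shows "\<exists>T'\<in>bop n. \<forall>x\<in>Zn n. \<forall>y\<in>Zn n. bil n (T x) y = bil n x (T' y)"
proof -
  obtain CT where CT: "CT > 0" "\<And>x. x \<in> Zn n \<Longrightarrow> zn_norm n (T x) \<le> CT * zn_norm n x" using bop_bound[OF T] by blast
  define E where "E = nrm n * (cB n * CT * real n ^ n)"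
  have ex: "\<exists>y'\<in>Zn n. (\<forall>x\<in>Zn n. bil n (T x) y = bil n x y') \<and> zn_norm n y' \<le> E * zn_norm n y" if y: "y \<in> Zn n" for y
  proof -
    have "\<exists>y'\<in>Zn n. (\<forall>x\<in>Zn n. bil n (T x) y = bil n x y') \<and> zn_norm n y' \<le> nrm n * (cB n * CT * zn_norm n y * real n ^ n)"
    proof (rule dual_rep[where \<phi> = "\<lambda>x. bil n (T x) y"])
      show "cmod (bil n (T x) y) \<le> cB n * CT * zn_norm n y * zn_norm n x" if x: "x \<in> Zn n" for x
      proof -
        have "cmod (bil n (T x) y) \<le> cB n * zn_norm n (T x) * zn_norm n y" by (intro bil_bound bopD[OF T] x y)
        also have "\<dots> \<le> cB n * (CT * zn_norm n x) * zn_norm n y"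
          using cB_pos[of n] zn_norm_nonneg[OF y] by (intro mult_right_mono mult_left_mono CT x) auto
        finally show ?thesis by (simp add: mult_ac)
      qed
      show "0 \<le> cB n * CT * zn_norm n y" using cB_pos[of n] CT(1) zn_norm_nonneg[OF y] by simp
    qed (simp_all add: bopD[OF T] bil_add_left bil_scale_left y)
    then show ?thesis by (simp add: E_def mult_ac)
  qed
  \<comment> \<open>The representing vector is unique by nondegeneracy, which makes this pointwise
    choice linear.\<close>
  define T' where "T' = restr n (\<lambda>y. SOME y'. y' \<in> Zn n \<and> (\<forall>x\<in>Zn n. bil n (T x) y = bil n x y') \<and> zn_norm n y' \<le> E * zn_norm n y)"
  have T': "T' y \<in> Zn n \<and> (\<forall>x\<in>Zn n. bil n (T x) y = bil n x (T' y)) \<and> zn_norm n (T' y) \<le> E * zn_norm n y" if y: "y \<in> Zn n" for y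
  proof -
    have "\<exists>y'. y' \<in> Zn n \<and> (\<forall>x\<in>Zn n. bil n (T x) y = bil n x y') \<and> zn_norm n y' \<le> E * zn_norm n y" using ex[OF y] by blast
    from someI_ex[OF this] show ?thesis unfolding T'_def restr_eq[OF y] .
  qed
  have "T' \<in> bop n"
  proof (rule bopI[where C = E])
    show "T' (y + z) = T' y + T' z" if yz: "y \<in> Zn n" "z \<in> Zn n" for y z
    proof (rule bil_eqI)
      show "T' (y + z) \<in> Zn n" "T' y + T' z \<in> Zn n" using T' yz Zn_add by auto
      fix x assume x: "x \<in> Zn n"
      have "bil n x (T' (y + z)) = bil n (T x) (y + z)" using T'[OF Zn_add[OF yz]] x by simp
      also have "\<dots> = bil n (T x) y + bil n (T x) z" by (intro bil_add_right bopD[OF T] x yz)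
      also have "\<dots> = bil n x (T' y + T' z)" using T'[OF yz(1)] T'[OF yz(2)] x by (simp add: bil_add_right)
      finally show "bil n x (T' (y + z)) = bil n x (T' y + T' z)" .
    qed
    show "T' (vscale c y) = vscale c (T' y)" if y: "y \<in> Zn n" for y c
    proof (rule bil_eqI)
      show "T' (vscale c y) \<in> Zn n" "vscale c (T' y) \<in> Zn n" using T' y Zn_scale by auto
      fix x assume x: "x \<in> Zn n"
      have "bil n x (T' (vscale c y)) = bil n (T x) (vscale c y)" using T'[OF Zn_scale[OF y]] x by simp
      also have "\<dots> = c * bil n (T x) y" by (intro bil_scale_right bopD[OF T] x y)
      also have "\<dots> = bil n x (vscale c (T' y))" using T'[OF y] x by (simp add: bil_scale_right)
      finally show "bil n x (T' (vscale c y)) = bil n x (vscale c (T' y))" .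
    qed
    show "T' x \<in> Zn n" "zn_norm n (T' x) \<le> E * zn_norm n x" if "x \<in> Zn n" for x using T'[OF that] by blast+
    show "T' x = 0" if "x \<notin> Zn n" for x using that by (simp add: T'_def restr_def)
  qed
  then show ?thesis using T' by blast
qed

text \<open>A T' B = 1 transposes to B' T A' = 1; the sign from exchanging the arguments of the
  pairing occurs twice and cancels.\<close>

lemma Fac_adjoint:
  assumes T: "T \<in> bop n" and T': "T' \<in> bop n" and adj: "\<And>x y. x \<in> Zn n \<Longrightarrow> y \<in> Zn n \<Longrightarrow> bil n (T x) y = bil n x (T' y)"
    and F: "Fac n T'"
  shows "Fac n T"
proof -
  obtain A B where A: "A \<in> bop n" and B: "B \<in> bop n" and AB: "\<And>y. y \<in> Zn n \<Longrightarrow> A (T' (B y)) = y" using F unfolding Fac_def by blast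
  obtain A' where A': "A' \<in> bop n" "\<And>x y. x \<in> Zn n \<Longrightarrow> y \<in> Zn n \<Longrightarrow> bil n (A x) y = bil n x (A' y)" using adjoint_exists[OF A] by blast
  obtain B' where B': "B' \<in> bop n" "\<And>x y. x \<in> Zn n \<Longrightarrow> y \<in> Zn n \<Longrightarrow> bil n (B x) y = bil n x (B' y)" using adjoint_exists[OF B] by blast
  have "B' (T (A' x)) = x" if x: "x \<in> Zn n" for x
  proof (rule bil_eqI[symmetric, OF x])
    have ax: "A' x \<in> Zn n" using bopD(1)[OF A'(1) x] .
    have tax: "T (A' x) \<in> Zn n" using bopD(1)[OF T ax] .
    show "B' (T (A' x)) \<in> Zn n" using bopD(1)[OF B'(1) tax] .
    fix y assume y: "y \<in> Zn n"
    have By: "B y \<in> Zn n" using bopD(1)[OF B y] .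
    have TBy: "T' (B y) \<in> Zn n" using bopD(1)[OF T' By] .
    have "bil n y x = bil n (A (T' (B y))) x" using AB[OF y] by simp
    also have "\<dots> = bil n (T' (B y)) (A' x)" by (rule A'(2)[OF TBy x])
    also have "\<dots> = (-1) ^ (n - 1) * bil n (A' x) (T' (B y))" by (rule bil_commute[OF ax TBy])
    also have "\<dots> = (-1) ^ (n - 1) * bil n (T (A' x)) (B y)" using adj[OF ax By] by simp
    also have "\<dots> = bil n (B y) (T (A' x))" by (rule bil_commute[OF tax By, symmetric])
    also have "\<dots> = bil n y (B' (T (A' x)))" by (rule B'(2)[OF y tax])
    finally show "bil n y x = bil n y (B' (T (A' x)))" .
  qed
  then show ?thesis unfolding Fac_def using A'(1) B'(1) by blast
qed

section \<open>Separation and annihilators\<close>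


definition sublinear_Zn :: "nat \<Rightarrow> (arr \<Rightarrow> real) \<Rightarrow> bool" where
  "sublinear_Zn n q \<longleftrightarrow> (\<forall>x\<in>Zn n. \<forall>y\<in>Zn n. q (x + y) \<le> q x + q y) \<and>
     (\<forall>x\<in>Zn n. \<forall>t\<ge>0. q (vscale (complex_of_real t) x) = t * q x)"

lemma sublinearD: assumes "sublinear_Zn n q"
  shows "x \<in> Zn n \<Longrightarrow> y \<in> Zn n \<Longrightarrow> q (x + y) \<le> q x + q y" "x \<in> Zn n \<Longrightarrow> t \<ge> 0 \<Longrightarrow> q (vscale (complex_of_real t) x) = t * q x"
    "q 0 = 0" "x \<in> Zn n \<Longrightarrow> - q (- x) \<le> q x"
proof -
  show a: "\<And>x y. x \<in> Zn n \<Longrightarrow> y \<in> Zn n \<Longrightarrow> q (x + y) \<le> q x + q y"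
    and b: "\<And>x t. x \<in> Zn n \<Longrightarrow> t \<ge> 0 \<Longrightarrow> q (vscale (complex_of_real t) x) = t * q x"
    using assms by (auto simp: sublinear_Zn_def)
  show q0: "q 0 = 0" using b[OF Zn_zero, of 0] by simp
  show "x \<in> Zn n \<Longrightarrow> - q (- x) \<le> q x" using a[of x "- x"] Zn_scale[of x n "-1"] q0 by (simp add: vscale_minus_one)
qed

text \<open>The largest sublinear functional below \<open>q\<close> that agrees with \<open>q\<close> at \<open>a\<close> and is linear along \<open>a\<close>: a
  Hahn--Banach step.\<close>
definition linearize :: "arr \<Rightarrow> (arr \<Rightarrow> real) \<Rightarrow> arr \<Rightarrow> real" where
  "linearize a q x = (INF t\<in>{0..}. q (x + vscale (complex_of_real t) a) - t * q a)"

lemma linearize_props: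
  assumes q: "sublinear_Zn n q" and a: "a \<in> Zn n"
  shows "sublinear_Zn n (linearize a q)" "x \<in> Zn n \<Longrightarrow> linearize a q x \<le> q x" "linearize a q (- a) \<le> - q a"
proof -
  note qD = sublinearD[OF q]
  have mZ: "- x \<in> Zn n" if "x \<in> Zn n" for x using Zn_scale[OF that, of "-1"] by (simp add: vscale_minus_one)
  \<comment> \<open>Sublinearity bounds the values from below, which keeps the infimum in
    \<open>linearize\<close> finite.\<close>
  have lb: "- q (- x) \<le> q (x + vscale (complex_of_real t) a) - t * q a" if x: "x \<in> Zn n" and t: "t \<ge> 0" for x t
  proof -
    have "q (vscale (complex_of_real t) a) = q ((x + vscale (complex_of_real t) a) + (- x))" by simp
    also have "\<dots> \<le> q (x + vscale (complex_of_real t) a) + q (- x)" by (intro qD Zn_add Zn_scale x a mZ)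
    finally show ?thesis using qD(2)[OF a t] by simp
  qed
  have bdd: "bdd_below ((\<lambda>t. q (x + vscale (complex_of_real t) a) - t * q a) ` {0..})" if x: "x \<in> Zn n" for x
    using lb[OF x] by (intro bdd_belowI2[of _ "- q (- x)"]) auto
  have le: "linearize a q x \<le> q (x + vscale (complex_of_real t) a) - t * q a" if "x \<in> Zn n" "t \<ge> 0" for x t
    unfolding linearize_def using that by (intro cINF_lower bdd) auto
  have ge: "c \<le> linearize a q x" if "\<And>t. t \<ge> 0 \<Longrightarrow> c \<le> q (x + vscale (complex_of_real t) a) - t * q a" for c x
    unfolding linearize_def using that by (intro cINF_greatest) auto
  show "linearize a q x \<le> q x" if "x \<in> Zn n" for x using le[OF that, of 0] by simp
  show "linearize a q (- a) \<le> - q a" using le[OF mZ[OF a], of 1] qD(3) by simp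
  have sub: "linearize a q (x + y) \<le> linearize a q x + linearize a q y" if xy: "x \<in> Zn n" "y \<in> Zn n" for x y
  proof -
    have 1: "linearize a q (x + y) - (q (y + vscale (complex_of_real t') a) - t' * q a) \<le> linearize a q x" if t': "t' \<ge> 0" for t'
    proof (rule ge)
      fix t :: real assume t: "t \<ge> 0"
      have e: "x + y + vscale (complex_of_real (t + t')) a = (x + vscale (complex_of_real t) a) + (y + vscale (complex_of_real t') a)"
        by (simp add: vscale_def fun_eq_iff algebra_simps)
      have "linearize a q (x + y) \<le> q (x + y + vscale (complex_of_real (t + t')) a) - (t + t') * q a"
        using t t' by (intro le Zn_add xy) auto
      also have "q (x + y + vscale (complex_of_real (t + t')) a) \<le> q (x + vscale (complex_of_real t) a) + q (y + vscale (complex_of_real t') a)"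
        unfolding e by (intro qD Zn_add Zn_scale xy a)
      finally show "linearize a q (x + y) - (q (y + vscale (complex_of_real t') a) - t' * q a) \<le> q (x + vscale (complex_of_real t) a) - t * q a"
        by (simp add: algebra_simps)
    qed
    have "linearize a q (x + y) - linearize a q x \<le> linearize a q y" by (rule ge) (use 1 in \<open>simp add: algebra_simps\<close>)
    then show ?thesis by simp
  qed
  have hom_le: "linearize a q (vscale (complex_of_real s) x) \<le> s * linearize a q x" if x: "x \<in> Zn n" and s: "s > 0" for x s
  proof -
    have "linearize a q (vscale (complex_of_real s) x) / s \<le> linearize a q x"
    proof (rule ge)
      fix t :: real assume t: "t \<ge> 0"
      have "linearize a q (vscale (complex_of_real s) x) \<le> q (vscale (complex_of_real s) x + vscale (complex_of_real (s * t)) a) - (s * t) * q a"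
        using s t by (intro le Zn_scale x) auto
      also have "vscale (complex_of_real s) x + vscale (complex_of_real (s * t)) a = vscale (complex_of_real s) (x + vscale (complex_of_real t) a)"
        by (simp add: vscale_add)
      also have "q \<dots> = s * q (x + vscale (complex_of_real t) a)" using s by (intro qD Zn_add Zn_scale x a) auto
      finally show "linearize a q (vscale (complex_of_real s) x) / s \<le> q (x + vscale (complex_of_real t) a) - t * q a"
        unfolding pos_divide_le_eq[OF s] by (simp add: algebra_simps)
    qed
    then show ?thesis using s by (simp add: divide_le_eq mult.commute)
  qed
  have hom: "linearize a q (vscale (complex_of_real s) x) = s * linearize a q x" if x: "x \<in> Zn n" and s: "s \<ge> 0" for x s
  proof (cases "s = 0")
    case True
    have "linearize a q 0 \<le> 0" using le[OF Zn_zero, of 0] qD(3) by simp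
    moreover have "0 \<le> linearize a q 0" by (rule ge) (simp add: qD(2)[OF a])
    ultimately show ?thesis using True by simp
  next
    case False
    then have s: "s > 0" using that by simp
    have "linearize a q (vscale (complex_of_real (1 / s)) (vscale (complex_of_real s) x)) \<le> (1 / s) * linearize a q (vscale (complex_of_real s) x)"
      using s by (intro hom_le Zn_scale x) auto
    then have "s * linearize a q x \<le> linearize a q (vscale (complex_of_real s) x)" using s by (simp add: field_simps)
    then show ?thesis using hom_le[OF x s] by simp
  qed
  show "sublinear_Zn n (linearize a q)" unfolding sublinear_Zn_def using sub hom by blast
qed

text \<open>Hahn-Banach for the distance p to M. The space is separable, so it suffices to linearise
  p along x0 and along countably many further directions with dense real span, and to take the
  infimum of the resulting decreasing sequence. The limit lies below p, hence vanishes on M, and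
  keeps the positive value of p at x0.\<close>

lemma separation:
  assumes M: "is_subspace n M" "closed_sub n M" and x0: "x0 \<in> Zn n" "x0 \<notin> M"
  shows "\<exists>y\<in>Zn n. (\<forall>m\<in>M. bil n m y = 0) \<and> bil n x0 y \<noteq> 0"
proof -
  note MD = subspaceD[OF M(1)]
  have mZ: "- x \<in> Zn n" if "x \<in> Zn n" for x using Zn_scale[OF that, of "-1"] by (simp add: vscale_minus_one)
  define p where "p = (\<lambda>x. INF m\<in>M. zn_norm n (x - m))"
  have bdd: "bdd_below ((\<lambda>m. zn_norm n (x - m)) ` M)" if "x \<in> Zn n" for x
    using that MD(1) by (intro bdd_belowI2[of _ 0] zn_norm_nonneg Zn_diff) auto
  have ple: "p x \<le> zn_norm n (x - m)" if "x \<in> Zn n" "m \<in> M" for x m unfolding p_def using that by (intro cINF_lower bdd)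
  have pge: "c \<le> p x" if "\<And>m. m \<in> M \<Longrightarrow> c \<le> zn_norm n (x - m)" for c x
    unfolding p_def using that MD(2) by (intro cINF_greatest) auto
  have p_norm: "p x \<le> zn_norm n x" if "x \<in> Zn n" for x using ple[OF that MD(2)] by simp
  have p0: "0 \<le> p x" if "x \<in> Zn n" for x using that MD(1) by (intro pge zn_norm_nonneg Zn_diff) auto
  have pM: "p m \<le> 0" if "m \<in> M" for m using ple[OF MD(1)[OF that] that] by simp
  have psub: "sublinear_Zn n p"
    unfolding sublinear_Zn_def
  proof (intro conjI ballI allI impI)
    fix x y assume xy: "x \<in> Zn n" "y \<in> Zn n"
    have "p (x + y) - zn_norm n (y - m') \<le> p x" if m': "m' \<in> M" for m'
    proof (rule pge)
      fix m assume m: "m \<in> M"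
      have "p (x + y) \<le> zn_norm n (x + y - (m + m'))" by (intro ple Zn_add xy MD m m')
      moreover have "x + y - (m + m') = (x - m) + (y - m')" by simp
      moreover have "zn_norm n ((x - m) + (y - m')) \<le> zn_norm n (x - m) + zn_norm n (y - m')"
        by (intro zn_norm_triangle Zn_diff xy MD(1) m m')
      ultimately show "p (x + y) - zn_norm n (y - m') \<le> zn_norm n (x - m)" by (simp only:)
    qed
    then have "p (x + y) - p x \<le> p y" by (intro pge) (simp add: algebra_simps)
    then show "p (x + y) \<le> p x + p y" by simp
  next
    have hle: "p (vscale (complex_of_real s) x) \<le> s * p x" if x: "x \<in> Zn n" and s: "s > 0" for x s
    proof -
      have "p (vscale (complex_of_real s) x) / s \<le> p x"
      proof (rule pge)
        fix m assume m: "m \<in> M"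
        have "p (vscale (complex_of_real s) x) \<le> zn_norm n (vscale (complex_of_real s) x - vscale (complex_of_real s) m)"
          by (intro ple Zn_scale x MD m)
        also have "\<dots> = s * zn_norm n (x - m)"
          unfolding vscale_diff[symmetric] using s zn_norm_scale[OF Zn_diff[OF x MD(1)[OF m]], of "complex_of_real s"] by simp
        finally show "p (vscale (complex_of_real s) x) / s \<le> zn_norm n (x - m)" using s by (simp add: divide_le_eq mult.commute)
      qed
      then show ?thesis using s by (simp add: divide_le_eq mult.commute)
    qed
    fix x and t :: real assume x: "x \<in> Zn n" and t: "t \<ge> 0"
    show "p (vscale (complex_of_real t) x) = t * p x"
    proof (cases "t = 0")
      case True
      then show ?thesis using p0[OF Zn_zero] p_norm[OF Zn_zero] by simp
    next
      case False
      then have t: "t > 0" using t by simp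
      have "p (vscale (complex_of_real (1 / t)) (vscale (complex_of_real t) x)) \<le> (1 / t) * p (vscale (complex_of_real t) x)"
        using t by (intro hle Zn_scale x) auto
      then have "t * p x \<le> p (vscale (complex_of_real t) x)" using t by (simp add: field_simps)
      then show ?thesis using hle[OF x t] by simp
    qed
  qed
  have ppos: "p x0 > 0"
  proof (rule ccontr)
    assume "\<not> p x0 > 0"
    then have "p x0 < e" if "e > 0" for e using that by simp
    then have "\<exists>m\<in>M. zn_norm n (x0 - m) < e" if "e > 0" for e using that pge[of e x0] not_less by blast
    then show False using M(2) x0 unfolding closed_sub_def vsub_eq by blast
  qed
  \<comment> \<open>x0 comes at the start, while p is unchanged, to preserve its value there. The
    decoded c gives the slot by c div 2, and its parity selects the unit vector or i times it, as
    linearity is only real at this stage; codes without a slot give 0.\<close>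
  define dir where "dir = (\<lambda>i. case i of 0 \<Rightarrow> x0 | Suc m \<Rightarrow>
     (let (k, c) = prod_decode m in if c div 2 < n then vscale (if even c then 1 else \<i>) (uvec k (c div 2)) else 0))"
  have dZ: "dir i \<in> Zn n" for i
    unfolding dir_def using x0(1) by (auto split: nat.split prod.split simp: Zn_uvec intro!: Zn_scale)
  define Q where "Q = rec_nat p (\<lambda>i q. linearize (dir i) q)"
  have Q0: "Q 0 = p" and QS: "Q (Suc i) = linearize (dir i) (Q i)" for i by (simp_all add: Q_def)
  have Qsub: "sublinear_Zn n (Q i)" for i by (induction i) (auto simp: Q0 QS psub linearize_props(1)[OF _ dZ])
  have Qdec: "Q (Suc i) x \<le> Q i x" if "x \<in> Zn n" for i x unfolding QS by (rule linearize_props(2)[OF Qsub dZ that])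
  have Qmono: "Q j x \<le> Q i x" if "i \<le> j" "x \<in> Zn n" for i j x
    using that(1) by (induction rule: dec_induct) (auto intro: order_trans[OF Qdec[OF that(2)]])
  have Qp: "Q i x \<le> p x" if "x \<in> Zn n" for i x using Qmono[OF _ that, of 0 i] by (simp add: Q0)
  have Qlb: "- p (- x) \<le> Q i x" if x: "x \<in> Zn n" for i x using sublinearD(4)[OF Qsub x, of i] Qp[OF mZ[OF x], of i] by linarith
  define q where "q = (\<lambda>x. INF i. Q i x)"
  have qle: "q x \<le> Q i x" if "x \<in> Zn n" for x i
    unfolding q_def using Qlb[OF that] by (intro cINF_lower bdd_belowI2[of _ "- p (- x)"]) auto
  have qge: "c \<le> q x" if "\<And>i. c \<le> Q i x" for c x unfolding q_def using that by (intro cINF_greatest) auto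
  have qp: "q x \<le> p x" if "x \<in> Zn n" for x using qle[OF that, of 0] by (simp add: Q0)
  have qsub: "q (x + y) \<le> q x + q y" if xy: "x \<in> Zn n" "y \<in> Zn n" for x y
  proof -
    have "q (x + y) - Q j y \<le> q x" for j
    proof (rule qge)
      fix i
      have "q (x + y) \<le> Q (max i j) (x + y)" by (intro qle Zn_add xy)
      also have "\<dots> \<le> Q (max i j) x + Q (max i j) y" by (rule sublinearD(1)[OF Qsub xy])
      also have "\<dots> \<le> Q i x + Q j y" by (intro add_mono Qmono xy) auto
      finally show "q (x + y) - Q j y \<le> Q i x" by simp
    qed
    then have "q (x + y) - q x \<le> q y" by (intro qge) (simp add: algebra_simps)
    then show ?thesis by simp
  qed
  have qhom: "q (vscale (complex_of_real t) x) = t * q x" if x: "x \<in> Zn n" and t: "t \<ge> 0" for x t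
  proof (rule antisym)
    show "q (vscale (complex_of_real t) x) \<le> t * q x"
    proof (cases "t = 0")
      case True
      then show ?thesis using qle[OF Zn_zero, of 0] sublinearD(3)[OF psub] by (simp add: Q0)
    next
      case False
      then have t': "t > 0" using t by simp
      have "q (vscale (complex_of_real t) x) / t \<le> q x"
      proof (rule qge)
        fix i
        have "q (vscale (complex_of_real t) x) \<le> t * Q i x"
          using qle[OF Zn_scale[OF x], of "complex_of_real t" i] sublinearD(2)[OF Qsub x t] by simp
        then show "q (vscale (complex_of_real t) x) / t \<le> Q i x" using t' by (simp add: divide_le_eq mult.commute)
      qed
      then show ?thesis using t' by (simp add: divide_le_eq mult.commute)
    qed
    show "t * q x \<le> q (vscale (complex_of_real t) x)"
      by (rule qge) (use sublinearD(2)[OF Qsub x t] qle[OF x] t in \<open>simp add: mult_left_mono\<close>)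
  qed
  have q0: "q 0 = 0" using qhom[OF Zn_zero, of 0] by simp
  \<comment> \<open>The vectors at which q is odd, since q a + q (-a) is never negative. They form a
    real subspace, on which a sublinear functional is linear.\<close>
  define Dom where "Dom = {a \<in> Zn n. q a + q (- a) \<le> 0}"
  have Dom_dir: "dir i \<in> Dom" for i
  proof -
    have "q (- dir i) \<le> Q (Suc i) (- dir i)" by (intro qle mZ dZ)
    also have "\<dots> \<le> - Q i (dir i)" unfolding QS by (rule linearize_props(3)[OF Qsub dZ])
    also have "\<dots> \<le> - q (dir i)" using qle[OF dZ] by simp
    finally show ?thesis using dZ by (simp add: Dom_def)
  qed
  have Dom_add: "a + b \<in> Dom" if "a \<in> Dom" "b \<in> Dom" for a b
    using that qsub[of a b] qsub[of "- a" "- b"] mZ unfolding Dom_def by (auto simp: Zn_add)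
  have Dom_minus: "- a \<in> Dom" if "a \<in> Dom" for a using that mZ unfolding Dom_def by (simp add: add.commute)
  have Dom_scale: "vscale (complex_of_real t) a \<in> Dom" if a: "a \<in> Dom" for a t
  proof -
    have pos: "vscale (complex_of_real t) a \<in> Dom" if a: "a \<in> Dom" and t: "t \<ge> 0" for a t
    proof -
      have aZ: "a \<in> Zn n" using a by (simp add: Dom_def)
      have e: "- vscale (complex_of_real t) a = vscale (complex_of_real t) (- a)" by (simp add: vscale_def fun_eq_iff)
      have "q (vscale (complex_of_real t) a) + q (- vscale (complex_of_real t) a) = t * (q a + q (- a))"
        unfolding e qhom[OF aZ t] qhom[OF mZ[OF aZ] t] by (simp add: algebra_simps)
      also have "\<dots> \<le> 0" using a t by (simp add: Dom_def mult_nonneg_nonpos)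
      finally show ?thesis using Zn_scale[OF aZ] by (simp add: Dom_def)
    qed
    show ?thesis
    proof (cases "t \<ge> 0")
      case True
      then show ?thesis by (rule pos[OF a])
    next
      case False
      then have "vscale (complex_of_real (- t)) (- a) \<in> Dom" by (intro pos Dom_minus a) simp
      moreover have "vscale (complex_of_real (- t)) (- a) = vscale (complex_of_real t) a" by (simp add: vscale_def fun_eq_iff)
      ultimately show ?thesis by simp
    qed
  qed
  have Dom_0: "0 \<in> Dom" using q0 by (simp add: Dom_def)
  have Dom_sum: "(\<Sum>i\<in>I. f i) \<in> Dom" if "finite I" "\<And>i. i \<in> I \<Longrightarrow> f i \<in> Dom" for I :: "nat set" and f :: "nat \<Rightarrow> arr"
    using that
  proof (induction I rule: finite_induct)
    case (insert a I)
    have "f a + (\<Sum>i\<in>I. f i) \<in> Dom" using insert by (intro Dom_add) auto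
    then show ?case by (simp only: sum.insert[OF insert.hyps])
  next
    case empty show ?case by (simp only: sum.empty Dom_0)
  qed
  have Dom_uvec: "vscale c (uvec k l) \<in> Dom" if l: "l < n" for c k l
  proof -
    have "uvec k l = dir (Suc (prod_encode (k, 2 * l)))" using l by (simp add: dir_def)
    moreover have "vscale \<i> (uvec k l) = dir (Suc (prod_encode (k, 2 * l + 1)))" using l by (simp add: dir_def)
    ultimately have 1: "uvec k l \<in> Dom" "vscale \<i> (uvec k l) \<in> Dom" using Dom_dir by simp_all
    have "vscale c (uvec k l) = vscale (complex_of_real (Re c)) (uvec k l) + vscale (complex_of_real (Im c)) (vscale \<i> (uvec k l))"
      by (simp add: vscale_def fun_eq_iff complex_eq_iff algebra_simps)
    then show ?thesis using Dom_add[OF Dom_scale[OF 1(1)] Dom_scale[OF 1(2)]] by (simp only:)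
  qed
  have Dom_fin: "proj {..<K} x \<in> Dom" if x: "x \<in> Zn n" for x K
  proof -
    have "proj {..<K} x = (\<Sum>k<K. \<Sum>l<n. vscale (proj {..<K} x l k) (uvec k l))"
      using Zn_below[OF x] by (intro finite_expand) (auto simp: supp_in_def proj_def below_def)
    also have "\<dots> \<in> Dom" by (intro Dom_sum Dom_uvec) auto
    finally show ?thesis .
  qed
  \<comment> \<open>q is dominated by the norm, so oddness passes from truncations to all
    vectors.\<close>
  have Dom_all: "q x + q (- x) \<le> 0" if x: "x \<in> Zn n" for x
  proof -
    have "q x + q (- x) \<le> 0 + e" if e: "e > 0" for e
    proof -
      obtain K where K: "zn_norm n (proj {K..} x) < e / 2" using zn_tails_K[OF x, of "e / 2"] e by auto
      have P: "proj {..<K} x \<in> Zn n" "proj {K..} x \<in> Zn n" using Zn_proj[OF x] by auto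
      have "q x \<le> q (proj {..<K} x) + q (proj {K..} x)" using qsub[OF P] by (simp add: proj_compl)
      moreover have "q (- x) \<le> q (- proj {..<K} x) + q (- proj {K..} x)"
      proof -
        have "- x = - proj {..<K} x + - proj {K..} x" using proj_compl[of K x] by (metis minus_add_distrib)
        then show ?thesis using qsub[OF mZ[OF P(1)] mZ[OF P(2)]] by simp
      qed
      moreover have "q (proj {K..} x) \<le> zn_norm n (proj {K..} x)" using qp[OF P(2)] p_norm[OF P(2)] by simp
      moreover have "q (- proj {K..} x) \<le> zn_norm n (proj {K..} x)"
        using qp[OF mZ[OF P(2)]] p_norm[OF mZ[OF P(2)]] zn_norm_minus[OF P(2)] by simp
      moreover have "q (proj {..<K} x) + q (- proj {..<K} x) \<le> 0" using Dom_fin[OF x, of K] by (simp add: Dom_def)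
      ultimately show ?thesis using K by linarith
    qed
    then show ?thesis by (rule field_le_epsilon)
  qed
  have qneg: "q (- x) = - q x" if x: "x \<in> Zn n" for x using Dom_all[OF x] qsub[OF x mZ[OF x]] q0 by simp
  have qadd: "q (x + y) = q x + q y" if xy: "x \<in> Zn n" "y \<in> Zn n" for x y
  proof (rule antisym[OF qsub[OF xy]])
    have "q x = q ((x + y) + (- y))" by simp
    also have "\<dots> \<le> q (x + y) + q (- y)" by (intro qsub Zn_add xy mZ)
    finally show "q x + q y \<le> q (x + y)" using qneg[OF xy(2)] by simp
  qed
  have qscale: "q (vscale (complex_of_real t) x) = t * q x" if x: "x \<in> Zn n" for t x
  proof (cases "t \<ge> 0")
    case True
    then show ?thesis by (rule qhom[OF x])
  next
    case False
    have "vscale (complex_of_real t) x = - vscale (complex_of_real (- t)) x" by (simp add: vscale_def fun_eq_iff)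
    then have "q (vscale (complex_of_real t) x) = - q (vscale (complex_of_real (- t)) x)" using qneg[OF Zn_scale[OF x]] by simp
    also have "\<dots> = t * q x" using qhom[OF x, of "- t"] False by simp
    finally show ?thesis .
  qed
  have qabs: "\<bar>q x\<bar> \<le> zn_norm n x" if x: "x \<in> Zn n" for x
    using qp[OF x] p_norm[OF x] qp[OF mZ[OF x]] p_norm[OF mZ[OF x]] qneg[OF x] zn_norm_minus[OF x] by linarith
  have qM: "q m = 0" if m: "m \<in> M" for m
  proof -
    have "- m \<in> M" using MD(4)[OF m, of "-1"] by (simp add: vscale_minus_one)
    then show ?thesis using qp[OF MD(1)[OF m]] pM[OF m] qp[of "- m"] pM[of "- m"] qneg[OF MD(1)[OF m]] MD(1) by force
  qed
  have qx0: "q x0 > 0"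
  proof -
    have "q (- x0) \<le> Q (Suc 0) (- x0)" by (intro qle mZ x0(1))
    also have "\<dots> \<le> - p x0" using linearize_props(3)[OF Qsub dZ, of 0 0] by (simp add: QS Q0 dir_def)
    finally show ?thesis using ppos qneg[OF x0(1)] by simp
  qed
  \<comment> \<open>The complex linear functional whose real part is q.\<close>
  define \<phi> where "\<phi> = (\<lambda>x. complex_of_real (q x) - \<i> * complex_of_real (q (vscale \<i> x)))"
  have "\<exists>y\<in>Zn n. (\<forall>x\<in>Zn n. \<phi> x = bil n x y) \<and> zn_norm n y \<le> nrm n * (2 * real n ^ n)"
  proof (rule dual_rep)
    show "\<phi> (x + y) = \<phi> x + \<phi> y" if "x \<in> Zn n" "y \<in> Zn n" for x y
      using that by (simp add: \<phi>_def qadd vscale_add Zn_scale algebra_simps)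
    show "\<phi> (vscale c x) = c * \<phi> x" if x: "x \<in> Zn n" for c x
    proof -
      have e1: "vscale c x = vscale (complex_of_real (Re c)) x + vscale (complex_of_real (Im c)) (vscale \<i> x)"
        by (simp add: vscale_def fun_eq_iff complex_eq_iff algebra_simps)
      have e2: "vscale \<i> (vscale c x) = vscale (complex_of_real (Re c)) (vscale \<i> x) + vscale (complex_of_real (- Im c)) x"
        by (simp add: vscale_def fun_eq_iff complex_eq_iff algebra_simps)
      have 1: "q (vscale c x) = Re c * q x + Im c * q (vscale \<i> x)"
        unfolding e1 using x by (simp only: qadd qscale Zn_scale)
      have 2: "q (vscale \<i> (vscale c x)) = Re c * q (vscale \<i> x) - Im c * q x"
        unfolding e2 using x by (simp only: qadd qscale Zn_scale)
      show ?thesis unfolding \<phi>_def 1 2 by (simp add: complex_eq_iff algebra_simps)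
    qed
    show "cmod (\<phi> x) \<le> 2 * zn_norm n x" if x: "x \<in> Zn n" for x
    proof -
      have "cmod (\<phi> x) \<le> \<bar>q x\<bar> + \<bar>q (vscale \<i> x)\<bar>"
        unfolding \<phi>_def using norm_triangle_ineq4[of "complex_of_real (q x)" "\<i> * complex_of_real (q (vscale \<i> x))"] by (simp add: norm_mult)
      also have "\<dots> \<le> zn_norm n x + zn_norm n (vscale \<i> x)" by (intro add_mono qabs Zn_scale x)
      finally show ?thesis using zn_norm_scale[OF x, of "\<i>"] by simp
    qed
  qed simp
  then obtain y where y: "y \<in> Zn n" "\<And>x. x \<in> Zn n \<Longrightarrow> \<phi> x = bil n x y" by blast
  have "bil n m y = 0" if m: "m \<in> M" for m
    using y(2)[OF MD(1)[OF m]] qM[OF m] qM[OF MD(4)[OF m]] by (simp add: \<phi>_def)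
  moreover have "bil n x0 y \<noteq> 0"
  proof -
    have "Re (\<phi> x0) \<noteq> 0" using qx0 by (simp add: \<phi>_def)
    then show ?thesis using y(2)[OF x0(1)] by auto
  qed
  ultimately show ?thesis using y(1) by blast
qed

text \<open>For each new functional there are two cases: it vanishes on the common kernel of the
  earlier ones, and nothing has to be corrected; or some vector of that kernel corrects its value
  without disturbing the others.\<close>

lemma finite_codim_of_functionals:
  assumes "finite F" "F \<subseteq> Zn n"
  shows "\<exists>G. finite G \<and> G \<subseteq> Zn n \<and> (\<forall>x\<in>Zn n. \<exists>u\<in>cspan G. u \<in> Zn n \<and> (\<forall>y\<in>F. bil n (x - u) y = 0))"
  using assms
proof (induction F rule: finite_induct)
  case empty
  have "(0::arr) \<in> cspan {}" by (simp add: cspan_sum)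
  then show ?case by (intro exI[of _ "{}"]) (auto intro: Zn_zero)
next
  case (insert y F)
  have yZ: "y \<in> Zn n" and FZ: "F \<subseteq> Zn n" using insert.prems by auto
  obtain G where G: "finite G" "G \<subseteq> Zn n" "\<And>x. x \<in> Zn n \<Longrightarrow> \<exists>u\<in>cspan G. u \<in> Zn n \<and> (\<forall>y\<in>F. bil n (x - u) y = 0)"
    using insert.IH[OF FZ] by blast
  show ?case
  proof (cases "\<exists>g\<in>Zn n. (\<forall>y\<in>F. bil n g y = 0) \<and> bil n g y \<noteq> 0")
    case False
    have "\<exists>u\<in>cspan G. u \<in> Zn n \<and> (\<forall>y\<in>insert y F. bil n (x - u) y = 0)" if x: "x \<in> Zn n" for x
    proof -
      obtain u where u: "u \<in> cspan G" "u \<in> Zn n" "\<forall>y\<in>F. bil n (x - u) y = 0" using G(3)[OF x] by blast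
      then have "bil n (x - u) y = 0" using False Zn_diff[OF x u(2)] by blast
      then show ?thesis using u by blast
    qed
    then show ?thesis using G by blast
  next
    case True
    then obtain g where g: "g \<in> Zn n" "\<forall>y\<in>F. bil n g y = 0" "bil n g y \<noteq> 0" by blast
    have "\<exists>u\<in>cspan (insert g G). u \<in> Zn n \<and> (\<forall>y\<in>insert y F. bil n (x - u) y = 0)" if x: "x \<in> Zn n" for x
    proof -
      obtain u where u: "u \<in> cspan G" "u \<in> Zn n" "\<forall>y\<in>F. bil n (x - u) y = 0" using G(3)[OF x] by blast
      define c where "c = bil n (x - u) y / bil n g y"
      have e: "x - (u + vscale c g) = (x - u) + vscale (- c) g" by (simp add: vscale_def fun_eq_iff)
      have b: "bil n (x - (u + vscale c g)) y' = bil n (x - u) y' - c * bil n g y'" if "y' \<in> Zn n" for y'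
        unfolding e using that by (simp add: bil_add_left bil_scale_left Zn_diff Zn_scale x u(2) g(1))
      have "\<forall>y'\<in>insert y F. bil n (x - (u + vscale c g)) y' = 0"
        using b[OF yZ] b u(3) g FZ by (auto simp: c_def)
      then show ?thesis using cspan_insert[OF G(1) u(1), of c g] Zn_add[OF u(2) Zn_scale[OF g(1)]] by blast
    qed
    moreover have "finite (insert g G)" "insert g G \<subseteq> Zn n" using G(1,2) g(1) by auto
    ultimately show ?thesis by blast
  qed
qed

definition annihilator :: "nat \<Rightarrow> arr set \<Rightarrow> arr set" where
  "annihilator n M = {y \<in> Zn n. \<forall>m\<in>M. bil n m y = 0}"

lemma annihilator_subspace: assumes M: "M \<subseteq> Zn n" shows "is_subspace n (annihilator n M)"
proof -
  have "bil n m 0 = 0" for m by (simp add: bil_def bp_def)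
  then show ?thesis using M unfolding is_subspace_def annihilator_def vadd_eq vzero_eq
    by (auto simp: Zn_add Zn_scale bil_add_right bil_scale_right subset_iff)
qed

text \<open>If finitely many functionals spanned the annihilator, separation would make M their
  common kernel, which has finite codimension.\<close>

lemma annihilator_infinite_dim:
  assumes M: "is_subspace n M" "closed_sub n M" "infinite_codim n M" shows "infinite_dim (annihilator n M)"
  unfolding infinite_dim_def
proof (intro allI impI notI, elim conjE)
  fix F assume F: "finite F" "F \<subseteq> annihilator n M" "annihilator n M \<subseteq> cspan F"
  have FZ: "F \<subseteq> Zn n" using F(2) by (auto simp: annihilator_def)
  obtain G where G: "finite G" "G \<subseteq> Zn n" "\<And>x. x \<in> Zn n \<Longrightarrow> \<exists>u\<in>cspan G. u \<in> Zn n \<and> (\<forall>y\<in>F. bil n (x - u) y = 0)"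
    using finite_codim_of_functionals[OF F(1) FZ] by blast
  have "x \<in> {vadd u m |u m. u \<in> cspan G \<and> m \<in> M}" if x: "x \<in> Zn n" for x
  proof -
    obtain u where u: "u \<in> cspan G" "u \<in> Zn n" "\<forall>y\<in>F. bil n (x - u) y = 0" using G(3)[OF x] by blast
    have "x - u \<in> M"
    proof (rule ccontr)
      assume "x - u \<notin> M"
      then obtain y where y: "y \<in> Zn n" "\<forall>m\<in>M. bil n m y = 0" "bil n (x - u) y \<noteq> 0"
        using separation[OF M(1,2) Zn_diff[OF x u(2)]] by blast
      then have "y \<in> cspan F" using F(3) by (auto simp: annihilator_def)
      then obtain c where c: "y = (\<Sum>v\<in>F. vscale (c v) v)" by (auto simp: cspan_sum)
      have "bil n (x - u) y = (\<Sum>v\<in>F. c v * bil n (x - u) v)"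
        unfolding c using FZ F(1) by (intro bil_sum_right Zn_diff x u) auto
      also have "\<dots> = 0" using u(3) by (intro sum.neutral) auto
      finally show False using y(3) by simp
    qed
    then have "x = vadd u (x - u) \<and> u \<in> cspan G \<and> x - u \<in> M" using u(1) by (simp add: vadd_eq)
    then show ?thesis by blast
  qed
  then show False using M(3) G(1,2) unfolding infinite_codim_def by blast
qed

section \<open>Operators that are onto modulo a subspace\<close>


text \<open>Sokal's argument: at stage \<open>m\<close> move by \<open>\<plusminus>3\<^sup>-\<^sup>m \<xi>\<^sub>m\<close>, with the sign for which a functional of norm at least
  \<open>4\<^sup>m\<close> that almost attains its norm at \<open>\<xi>\<^sub>m\<close> gets large. All later moves together are too short to undo this.\<close>
lemma uniform_boundedness:
  fixes \<phi> :: "'i \<Rightarrow> arr \<Rightarrow> complex"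
  assumes add: "\<And>i x y. i \<in> I \<Longrightarrow> x \<in> Zn n \<Longrightarrow> y \<in> Zn n \<Longrightarrow> \<phi> i (x + y) = \<phi> i x + \<phi> i y"
    and sc: "\<And>i x c. i \<in> I \<Longrightarrow> x \<in> Zn n \<Longrightarrow> \<phi> i (vscale c x) = c * \<phi> i x"
    and bd: "\<And>i. i \<in> I \<Longrightarrow> \<exists>B. \<forall>x\<in>Zn n. cmod (\<phi> i x) \<le> B * zn_norm n x"
    and pt: "\<And>x. x \<in> Zn n \<Longrightarrow> \<exists>B. \<forall>i\<in>I. cmod (\<phi> i x) \<le> B"
  shows "\<exists>B. \<forall>i\<in>I. \<forall>x\<in>Zn n. cmod (\<phi> i x) \<le> B * zn_norm n x"
proof (rule ccontr)
  assume neg: "\<not> ?thesis"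
  have dif: "\<phi> i (x - y) = \<phi> i x - \<phi> i y" if "i \<in> I" "x \<in> Zn n" "y \<in> Zn n" for i x y
    using add[OF that(1) Zn_diff[OF that(2,3)] that(3)] by simp
  define U where "U = {x \<in> Zn n. zn_norm n x \<le> 1}"
  define N where "N = (\<lambda>i. SUP x\<in>U. cmod (\<phi> i x))"
  have U0: "0 \<in> U" by (simp add: U_def)
  have bddU: "bdd_above ((\<lambda>x. cmod (\<phi> i x)) ` U)" if i: "i \<in> I" for i
  proof -
    obtain B where B: "\<forall>x\<in>Zn n. cmod (\<phi> i x) \<le> B * zn_norm n x" using bd[OF i] by blast
    have "cmod (\<phi> i x) \<le> \<bar>B\<bar>" if x: "x \<in> U" for x
    proof -
      have xZ: "x \<in> Zn n" and x1: "zn_norm n x \<le> 1" using x by (auto simp: U_def)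
      have "cmod (\<phi> i x) \<le> B * zn_norm n x" using B xZ by blast
      also have "\<dots> \<le> \<bar>B\<bar> * zn_norm n x" using zn_norm_nonneg[OF xZ] by (intro mult_right_mono) auto
      also have "\<dots> \<le> \<bar>B\<bar>" using x1 by (simp add: mult_left_le)
      finally show ?thesis .
    qed
    then show ?thesis by (intro bdd_aboveI2)
  qed
  have NU: "cmod (\<phi> i x) \<le> N i" if "i \<in> I" "x \<in> U" for i x unfolding N_def by (intro cSUP_upper bddU that)
  have N0: "0 \<le> N i" if "i \<in> I" for i using NU[OF that U0] norm_ge_zero order_trans by blast
  have Nb: "cmod (\<phi> i x) \<le> N i * zn_norm n x" if i: "i \<in> I" and x: "x \<in> Zn n" for i x
  proof (cases "zn_norm n x = 0")
    case True
    then have "x = 0" using zn_norm_eq_0[OF x] by simp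
    moreover have "\<phi> i 0 = 0" using sc[OF i Zn_zero, of 0] by simp
    ultimately show ?thesis by simp
  next
    case False
    define a where "a = zn_norm n x"
    have a: "a > 0" using False zn_norm_nonneg[OF x] by (simp add: a_def)
    have "vscale (complex_of_real (1 / a)) x \<in> U"
      using a zn_norm_scale[OF x, of "complex_of_real (1 / a)"] by (simp add: U_def Zn_scale x a_def norm_divide)
    from NU[OF i this] have "cmod (\<phi> i x) / a \<le> N i" using a by (simp add: sc[OF i x] norm_mult norm_divide)
    then show ?thesis using a by (simp add: a_def[symmetric] pos_divide_le_eq)
  qed
  have "\<exists>i\<in>I. 4 ^ m < N i" for m :: nat
  proof (rule ccontr)
    assume "\<not> ?thesis"
    then have le: "N i \<le> 4 ^ m" if "i \<in> I" for i using that by force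
    have "cmod (\<phi> i x) \<le> 4 ^ m * zn_norm n x" if "i \<in> I" "x \<in> Zn n" for i x
      using Nb[OF that] mult_right_mono[OF le[OF that(1)] zn_norm_nonneg[OF that(2)]] by linarith
    then show False using neg by blast
  qed
  then obtain idx where idx: "\<And>m::nat. idx m \<in> I" "\<And>m. 4 ^ m < N (idx m)" by metis
  \<comment> \<open>Any fraction strictly between 1/2 and 1 would do: the stage gains 2/3 of N s,
    later moves undo at most half of N s, and 1/6 of it remains.\<close>
  have "\<exists>\<xi>\<in>U. 2/3 * N (idx m) < cmod (\<phi> (idx m) \<xi>)" for m
  proof (rule ccontr)
    assume "\<not> ?thesis"
    then have "N (idx m) \<le> 2/3 * N (idx m)" unfolding N_def[of] using U0 by (intro cSUP_least) force+
    moreover have "0 < N (idx m)" using idx(2)[of m] less_trans[of 0 "4 ^ m" "N (idx m)"] by simp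
    ultimately show False by simp
  qed
  then obtain \<xi> where \<xi>: "\<And>m. \<xi> m \<in> U" "\<And>m. 2/3 * N (idx m) < cmod (\<phi> (idx m) (\<xi> m))" by metis
  have \<xi>Z: "\<xi> m \<in> Zn n" "zn_norm n (\<xi> m) \<le> 1" for m using \<xi>(1)[of m] by (auto simp: U_def)
  define s where "s = (\<lambda>m. (1/3::real) ^ m)"
  \<comment> \<open>The values at the two possible new points differ by twice the value at the
    increment, so the larger one is at least the size of the latter, whatever z is.\<close>
  define step where "step = (\<lambda>m z. if cmod (\<phi> (idx m) (z - vscale (complex_of_real (s m)) (\<xi> m))) \<le> cmod (\<phi> (idx m) (z + vscale (complex_of_real (s m)) (\<xi> m)))
      then z + vscale (complex_of_real (s m)) (\<xi> m) else z - vscale (complex_of_real (s m)) (\<xi> m))"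
  define Z where "Z = rec_nat (0::arr) step"
  have s0: "s m > 0" and sS: "s (Suc m) = s m / 3" for m by (simp_all add: s_def)
  have ZS: "Z (Suc m) = step m (Z m)" and Z0: "Z 0 = 0" for m by (simp_all add: Z_def)
  have vZ: "vscale (complex_of_real (s m)) (\<xi> m) \<in> Zn n" for m by (intro Zn_scale \<xi>Z)
  have vN: "zn_norm n (vscale (complex_of_real (s m)) (\<xi> m)) \<le> s m" for m
    using zn_norm_scale[OF \<xi>Z(1)[of m], of "complex_of_real (s m)"] \<xi>Z(2)[of m] s0[of m] by (simp add: mult_left_le)
  have stepZ: "step m z \<in> Zn n" if "z \<in> Zn n" for m z using that Zn_add Zn_diff vZ by (simp add: step_def)
  have ZZ: "Z m \<in> Zn n" for m by (rule nat.induct[of "\<lambda>m. Z m \<in> Zn n"]) (simp_all only: Z0 ZS Zn_zero stepZ)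
  have stepN: "zn_norm n (step m z - z) \<le> s m" for m z
  proof -
    have "step m z - z = vscale (complex_of_real (s m)) (\<xi> m) \<or> step m z - z = - vscale (complex_of_real (s m)) (\<xi> m)"
      by (simp add: step_def)
    then show ?thesis using vN[of m] zn_norm_minus[OF vZ[of m]] by (elim disjE) (simp_all only:)
  qed
  have stepB: "s m * cmod (\<phi> (idx m) (\<xi> m)) \<le> cmod (\<phi> (idx m) (step m z))" if z: "z \<in> Zn n" for m z
  proof -
    define v where "v = vscale (complex_of_real (s m)) (\<xi> m)"
    have a: "\<phi> (idx m) (z + v) = \<phi> (idx m) z + \<phi> (idx m) v" and b: "\<phi> (idx m) (z - v) = \<phi> (idx m) z - \<phi> (idx m) v"
      using add[OF idx(1) z vZ] dif[OF idx(1) z vZ] by (simp_all only: v_def)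
    have "\<phi> (idx m) (z + v) - \<phi> (idx m) (z - v) = 2 * \<phi> (idx m) v" unfolding a b by simp
    then have "2 * cmod (\<phi> (idx m) v) \<le> cmod (\<phi> (idx m) (z + v)) + cmod (\<phi> (idx m) (z - v))"
      using norm_triangle_ineq4[of "\<phi> (idx m) (z + v)" "\<phi> (idx m) (z - v)"] by (simp add: norm_mult)
    moreover have "cmod (\<phi> (idx m) v) = s m * cmod (\<phi> (idx m) (\<xi> m))"
      using s0[of m] by (simp add: v_def sc[OF idx(1) \<xi>Z(1)] norm_mult)
    moreover have "cmod (\<phi> (idx m) (step m z)) = max (cmod (\<phi> (idx m) (z + v))) (cmod (\<phi> (idx m) (z - v)))"
      unfolding step_def v_def by (simp add: max_def)
    ultimately show ?thesis by simp
  qed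
  have dist: "zn_norm n (Z (m + k) - Z m) \<le> 3/2 * s m - 3/2 * s (m + k)" for m k
  proof (induction k)
    case 0
    show ?case by (simp add: zero_fun_def[symmetric])
  next
    case (Suc k)
    have "zn_norm n ((Z (m + Suc k) - Z (m + k)) + (Z (m + k) - Z m)) \<le> zn_norm n (Z (m + Suc k) - Z (m + k)) + zn_norm n (Z (m + k) - Z m)"
      by (intro zn_norm_triangle Zn_diff ZZ)
    moreover have "(Z (m + Suc k) - Z (m + k)) + (Z (m + k) - Z m) = Z (m + Suc k) - Z m" by simp
    moreover have "zn_norm n (Z (m + Suc k) - Z (m + k)) \<le> s (m + k)" using stepN[of "m + k" "Z (m + k)"] by (simp only: add_Suc_right ZS)
    moreover have "s (m + Suc k) = s (m + k) / 3" using sS by simp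
    ultimately show ?case using Suc.IH by (simp only:)
  qed
  have dist2: "zn_norm n (Z l - Z m) \<le> 3/2 * s m" if "m \<le> l" for l m
    using dist[of m "l - m"] s0[of l] that by simp
  have s_lim: "s \<longlonglongrightarrow> 0" unfolding s_def by (rule LIMSEQ_power_zero) simp
  have "\<exists>x\<in>Zn n. (\<lambda>m. zn_norm n (Z m - x)) \<longlonglongrightarrow> 0"
  proof (rule zn_complete[OF ZZ])
    fix e :: real assume e: "e > 0"
    obtain M where M: "s M < e / 3" using order_tendstoD(2)[OF s_lim, of "e / 3"] e by (auto simp: eventually_sequentially)
    have "zn_norm n (Z l - Z m) < e" if lm: "m \<ge> M" "l \<ge> M" for l m
    proof -
      have "zn_norm n ((Z l - Z M) - (Z m - Z M)) \<le> zn_norm n (Z l - Z M) + zn_norm n (Z m - Z M)" by (intro zn_norm_triangle_diff Zn_diff ZZ)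
      moreover have "(Z l - Z M) - (Z m - Z M) = Z l - Z m" by simp
      ultimately have "zn_norm n (Z l - Z m) \<le> zn_norm n (Z l - Z M) + zn_norm n (Z m - Z M)" by (simp only:)
      then show ?thesis using dist2[OF lm(1)] dist2[OF lm(2)] M by linarith
    qed
    then show "\<exists>M. \<forall>m\<ge>M. \<forall>l\<ge>M. zn_norm n (Z l - Z m) < e" by blast
  qed
  then obtain x where x: "x \<in> Zn n" "(\<lambda>m. zn_norm n (Z m - x)) \<longlonglongrightarrow> 0" by blast
  have xdist: "zn_norm n (x - Z m) \<le> 3/2 * s m" for m
  proof (rule field_le_epsilon)
    fix e :: real assume "e > 0"
    then obtain L where L: "\<And>l. l \<ge> L \<Longrightarrow> zn_norm n (Z l - x) < e"
      using order_tendstoD(2)[OF x(2), of e] by (auto simp: eventually_sequentially)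
    define l where "l = max L m"
    have "zn_norm n ((Z l - Z m) - (Z l - x)) \<le> zn_norm n (Z l - Z m) + zn_norm n (Z l - x)" by (intro zn_norm_triangle_diff Zn_diff ZZ x(1))
    moreover have "(Z l - Z m) - (Z l - x) = x - Z m" by simp
    ultimately have "zn_norm n (x - Z m) \<le> zn_norm n (Z l - Z m) + zn_norm n (Z l - x)" by (simp only:)
    then show "zn_norm n (x - Z m) \<le> 3/2 * s m + e" using dist2[of m l] L[of l] by (simp add: l_def)
  qed
  \<comment> \<open>The moves after stage m have total length at most s m / 2; since N exceeds 4^m
    and s m = 3^-m, the surplus grows like (4/3)^m.\<close>
  have large: "(4/3) ^ m / 6 \<le> cmod (\<phi> (idx m) x)" for m
  proof -
    have "cmod (\<phi> (idx m) (x - Z (Suc m))) \<le> N (idx m) * zn_norm n (x - Z (Suc m))" by (intro Nb idx Zn_diff x(1) ZZ)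
    also have "\<dots> \<le> N (idx m) * (s m / 2)"
      using xdist[of "Suc m"] N0[OF idx(1)] by (intro mult_left_mono) (simp_all add: sS)
    finally have 1: "cmod (\<phi> (idx m) x - \<phi> (idx m) (Z (Suc m))) \<le> N (idx m) * s m / 2" using dif[OF idx(1) x(1) ZZ] by simp
    have "s m * (2/3 * N (idx m)) \<le> s m * cmod (\<phi> (idx m) (\<xi> m))" using \<xi>(2)[of m] s0[of m] by (intro mult_left_mono) auto
    also have "\<dots> \<le> cmod (\<phi> (idx m) (Z (Suc m)))" unfolding ZS by (rule stepB[OF ZZ])
    finally have 2: "2/3 * (N (idx m) * s m) \<le> cmod (\<phi> (idx m) (Z (Suc m)))" by (simp add: mult_ac)
    have 3: "cmod (\<phi> (idx m) (Z (Suc m))) - cmod (\<phi> (idx m) x) \<le> cmod (\<phi> (idx m) x - \<phi> (idx m) (Z (Suc m)))"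
      by (metis norm_triangle_ineq2 norm_minus_commute)
    have "4 ^ m * s m \<le> N (idx m) * s m" using idx(2)[of m] s0[of m] by (intro mult_right_mono) auto
    moreover have "4 ^ m * s m = (4/3) ^ m" by (simp add: s_def power_mult_distrib[symmetric])
    ultimately show ?thesis using 1 2 3 by linarith
  qed
  obtain B where B: "\<forall>i\<in>I. cmod (\<phi> i x) \<le> B" using pt[OF x(1)] by blast
  obtain m where "6 * B < (4/3) ^ m" using real_arch_pow[of "4/3" "6 * B"] by auto
  then show False using large[of m] B idx(1)[of m] by force
qed

text \<open>The adjoint is bounded below on the annihilator of M. Writing z = T x + m bounds the
  functionals y divided by the norm of T' y at each single z, and uniform boundedness takes the
  place of the open mapping theorem; the result for operators bounded below then applies to
  T'.\<close>

lemma onto_quotient_Fac: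
  assumes T: "T \<in> bop n" and M: "is_subspace n M" "closed_sub n M" "infinite_codim n M"
    and onto: "\<And>z. z \<in> Zn n \<Longrightarrow> \<exists>x\<in>Zn n. \<exists>m\<in>M. z = T x + m"
  shows "Fac n T"
proof -
  obtain T' where T': "T' \<in> bop n" and adj: "\<And>x y. x \<in> Zn n \<Longrightarrow> y \<in> Zn n \<Longrightarrow> bil n (T x) y = bil n x (T' y)"
    using adjoint_exists[OF T] by blast
  \<comment> \<open>Elements with T' y = 0 cannot be normalised; by z = T x + m they pair to 0 with
    every z and so are 0.\<close>
  define I where "I = {y \<in> annihilator n M. zn_norm n (T' y) \<noteq> 0}"
  define \<phi> where "\<phi> = (\<lambda>y z. bil n z y / complex_of_real (zn_norm n (T' y)))"
  have aZ: "y \<in> Zn n" if "y \<in> annihilator n M" for y using that by (simp add: annihilator_def)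
  have key: "\<exists>D\<ge>0. \<forall>y\<in>annihilator n M. cmod (bil n z y) \<le> D * zn_norm n (T' y)" if z: "z \<in> Zn n" for z
  proof -
    obtain x m where x: "x \<in> Zn n" "m \<in> M" "z = T x + m" using onto[OF z] by blast
    have mZ: "m \<in> Zn n" using subspaceD(1)[OF M(1) x(2)] .
    have "cmod (bil n z y) \<le> cB n * zn_norm n x * zn_norm n (T' y)" if y: "y \<in> annihilator n M" for y
    proof -
      have "bil n z y = bil n (T x) y + bil n m y" unfolding x(3) by (intro bil_add_left bopD(1)[OF T] x mZ aZ y)
      also have "bil n m y = 0" using y x(2) by (simp add: annihilator_def)
      finally have "bil n z y = bil n x (T' y)" using adj[OF x(1) aZ[OF y]] by simp
      then show ?thesis using bil_bound[OF x(1) bopD(1)[OF T' aZ[OF y]]] by simp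
    qed
    moreover have "0 \<le> cB n * zn_norm n x" using cB_pos[of n] zn_norm_nonneg[OF x(1)] by simp
    ultimately show ?thesis by blast
  qed
  have tpos: "zn_norm n (T' y) > 0" if "y \<in> I" for y
    using that zn_norm_nonneg[OF bopD(1)[OF T' aZ, of y]] by (auto simp: I_def)
  have \<phi>n: "cmod (\<phi> y z) = cmod (bil n z y) / zn_norm n (T' y)" if "y \<in> I" for y z
    using tpos[OF that] by (simp add: \<phi>_def norm_divide)
  have "\<exists>B. \<forall>y\<in>I. \<forall>z\<in>Zn n. cmod (\<phi> y z) \<le> B * zn_norm n z"
  proof (rule uniform_boundedness)
    show "\<phi> y (u + v) = \<phi> y u + \<phi> y v" if "y \<in> I" "u \<in> Zn n" "v \<in> Zn n" for y u v
      using that bil_add_left[of u n v y] aZ by (auto simp: \<phi>_def I_def add_divide_distrib)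
    show "\<phi> y (vscale c u) = c * \<phi> y u" if "y \<in> I" "u \<in> Zn n" for y u c
      using that bil_scale_left[of u n y] aZ by (auto simp: \<phi>_def I_def)
    show "\<exists>B. \<forall>z\<in>Zn n. cmod (\<phi> y z) \<le> B * zn_norm n z" if y: "y \<in> I" for y
    proof (intro exI ballI)
      fix z assume z: "z \<in> Zn n"
      have yZ: "y \<in> Zn n" using y aZ by (simp add: I_def)
      show "cmod (\<phi> y z) \<le> (cB n * zn_norm n y / zn_norm n (T' y)) * zn_norm n z"
        using divide_right_mono[OF bil_bound[OF z yZ], of "zn_norm n (T' y)"] tpos[OF y] \<phi>n[OF y] by (simp add: mult_ac)
    qed
    show "\<exists>B. \<forall>y\<in>I. cmod (\<phi> y z) \<le> B" if z: "z \<in> Zn n" for z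
    proof -
      obtain D where D: "\<forall>y\<in>annihilator n M. cmod (bil n z y) \<le> D * zn_norm n (T' y)" using key[OF z] by blast
      have "cmod (\<phi> y z) \<le> D" if y: "y \<in> I" for y
      proof -
        have "cmod (bil n z y) \<le> D * zn_norm n (T' y)" using D y by (simp add: I_def)
        then show ?thesis unfolding \<phi>n[OF y] pos_divide_le_eq[OF tpos[OF y]] .
      qed
      then show ?thesis by blast
    qed
  qed
  then obtain B where B: "\<And>y z. y \<in> I \<Longrightarrow> z \<in> Zn n \<Longrightarrow> cmod (\<phi> y z) \<le> B * zn_norm n z" by blast
  define E where "E = nrm n * (\<bar>B\<bar> * real n ^ n)"
  have low: "zn_norm n y \<le> E * zn_norm n (T' y)" if y: "y \<in> annihilator n M" for y
  proof (cases "y \<in> I")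
    case True
    have "zn_norm n y \<le> nrm n * ((\<bar>B\<bar> * zn_norm n (T' y)) * real n ^ n)"
    proof (rule dual_norm[OF aZ[OF y]])
      show "0 \<le> \<bar>B\<bar> * zn_norm n (T' y)" using tpos[OF True] by simp
      fix z assume z: "z \<in> Zn n"
      have "cmod (bil n z y) = cmod (\<phi> y z) * zn_norm n (T' y)" using tpos[OF True] by (simp add: \<phi>n[OF True])
      also have "\<dots> \<le> (B * zn_norm n z) * zn_norm n (T' y)" using B[OF True z] tpos[OF True] by (intro mult_right_mono) auto
      also have "\<dots> \<le> (\<bar>B\<bar> * zn_norm n z) * zn_norm n (T' y)"
        using tpos[OF True] zn_norm_nonneg[OF z] by (intro mult_right_mono) auto
      finally show "cmod (bil n z y) \<le> (\<bar>B\<bar> * zn_norm n (T' y)) * zn_norm n z" by (simp add: mult_ac)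
    qed
    then show ?thesis by (simp add: E_def mult_ac)
  next
    case False
    then have t0: "zn_norm n (T' y) = 0" using y by (simp add: I_def)
    have "bil n z y = 0" if "z \<in> Zn n" for z using key[OF that] y t0 by force
    then have "y = 0" by (rule bil_nondegenerate[OF aZ[OF y]])
    then show ?thesis using t0 by simp
  qed
  have "Fac n T'"
  proof (rule bounded_below_Fac[OF T' annihilator_subspace annihilator_infinite_dim[OF M]])
    show "M \<subseteq> Zn n" using M(1) by (simp add: is_subspace_def)
    show "0 < 1 / (\<bar>E\<bar> + 1)" by simp
    fix y assume y: "y \<in> annihilator n M"
    have "zn_norm n y \<le> E * zn_norm n (T' y)" by (rule low[OF y])
    also have "\<dots> \<le> (\<bar>E\<bar> + 1) * zn_norm n (T' y)"
      using zn_norm_nonneg[OF bopD(1)[OF T' aZ[OF y]]] by (intro mult_right_mono) auto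
    finally show "1 / (\<bar>E\<bar> + 1) * zn_norm n y \<le> zn_norm n (T' y)" by (simp add: divide_le_eq mult.commute add_nonneg_pos)
  qed
  then show ?thesis using Fac_adjoint[OF T T'] adj by blast
qed

section \<open>The ideal of operators that do not factor the identity\<close>

text \<open>Gives access to independence and dimension counting for arrays.\<close>

interpretation arr_space: vector_space vscale
proof
  fix a b :: complex and x y :: arr
  show "vscale a (x + y) = vscale a x + vscale a y" by (rule vscale_add)
  show "vscale (a + b) x = vscale a x + vscale b x" by (simp add: vscale_def fun_eq_iff distrib_right)
  show "vscale a (vscale b x) = vscale (a * b) x" "vscale 1 x = x" by (rule vscale_vscale vscale_one)+
qed

lemma cspan_eq_span: "finite F \<Longrightarrow> cspan F = arr_space.span F"
  by (auto simp: arr_space.span_finite cspan_sum)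

lemma cspan_image:
  assumes T: "T \<in> bop n" and F: "finite F" "F \<subseteq> Zn n" and v: "v \<in> cspan F" shows "T v \<in> cspan (T ` F)"
proof -
  obtain c where c: "v = (\<Sum>u\<in>F. vscale (c u) u)" using v by (auto simp: cspan_sum)
  have "T v = (\<Sum>u\<in>F. vscale (c u) (T u))" unfolding c using F(2) by (intro bop_sum_scale[OF T]) auto
  also have "\<dots> \<in> arr_space.span (T ` F)"
    by (intro arr_space.span_sum arr_space.span_scale arr_space.span_base) auto
  finally show ?thesis using F(1) by (simp add: cspan_eq_span)
qed

lemma cspan_Zn: assumes "F \<subseteq> Zn n" "v \<in> cspan F" shows "v \<in> Zn n"
proof -
  obtain c where c: "v = (\<Sum>u\<in>F. vscale (c u) u)" using assms(2) by (auto simp: cspan_sum)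
  show ?thesis unfolding c using assms(1) by (intro Zn_sum Zn_scale) auto
qed

lemma Zn_not_subset_cspan: assumes "n \<ge> 1" "finite F" shows "\<not> Zn n \<subseteq> cspan F"
proof
  assume sub: "Zn n \<subseteq> cspan F"
  have inj: "inj (\<lambda>k. uvec k 0)"
  proof (rule injI)
    fix k l assume "uvec k 0 = uvec l 0"
    from fun_cong[OF fun_cong[OF this, of 0], of k] show "k = l" by (simp add: uvec_def split: if_splits)
  qed
  have "arr_space.independent (range (\<lambda>k. uvec k 0))"
    unfolding arr_space.independent_explicit_finite_subsets
  proof (intro allI impI ballI)
    fix S c v assume S: "S \<subseteq> range (\<lambda>k. uvec k 0)" "finite S" "(\<Sum>v\<in>S. vscale (c v) v) = 0" and v: "v \<in> S"
    obtain k where k: "v = uvec k 0" using S(1) v by blast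
    have "0 = (\<Sum>u\<in>S. vscale (c u) u) 0 k" unfolding S(3) by simp
    also have "\<dots> = (\<Sum>u\<in>S. c u * u 0 k)" by (simp add: sum_fun_apply vscale_def)
    also have "\<dots> = (\<Sum>u\<in>S. if u = v then c u else 0)"
    proof (rule sum.cong[OF refl])
      fix u assume "u \<in> S"
      then obtain l where l: "u = uvec l 0" using S(1) by blast
      show "c u * u 0 k = (if u = v then c u else 0)"
        using inj_eq[OF inj, of l k] unfolding l k by (simp add: uvec_def)
    qed
    also have "\<dots> = c v" using S(2) v by simp
    finally show "c v = 0" by simp
  qed
  moreover have "range (\<lambda>k. uvec k 0) \<subseteq> arr_space.span F"
    using sub Zn_uvec[of 0 n] assms by (auto simp: cspan_eq_span)
  ultimately have "finite (range (\<lambda>k. uvec k 0))" using arr_space.independent_span_bound[OF assms(2)] by blast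
  then show False using finite_imageD inj by blast
qed

lemma kernel_closed_subspace:
  assumes K: "K \<in> bop n" shows "is_subspace n {x \<in> Zn n. K x = 0}" "closed_sub n {x \<in> Zn n. K x = 0}"
proof -
  show "is_subspace n {x \<in> Zn n. K x = 0}"
    unfolding is_subspace_def vadd_eq vzero_eq by (auto simp: Zn_add Zn_scale bopD[OF K])
  show "closed_sub n {x \<in> Zn n. K x = 0}"
    unfolding closed_sub_def vsub_eq
  proof (intro ballI impI)
    fix x assume x: "x \<in> Zn n" and ap: "\<forall>e>0. \<exists>m\<in>{x \<in> Zn n. K x = 0}. zn_norm n (x - m) < e"
    obtain C where C: "C > 0" "\<And>x. x \<in> Zn n \<Longrightarrow> zn_norm n (K x) \<le> C * zn_norm n x" using bop_bound[OF K] by blast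
    have "zn_norm n (K x) \<le> 0 + e" if e: "e > 0" for e
    proof -
      have "e / C > 0" using e C(1) by simp
      then obtain m where m: "m \<in> Zn n" "K m = 0" "zn_norm n (x - m) < e / C" using ap by blast
      have "K x = K (x - m)" using bopD(6)[OF K x m(1)] m(2) by simp
      then have "zn_norm n (K x) \<le> C * zn_norm n (x - m)" using C(2)[OF Zn_diff[OF x m(1)]] by simp
      also have "\<dots> \<le> C * (e / C)" using m(3) C(1) by (intro mult_left_mono) auto
      finally show ?thesis using C(1) by simp
    qed
    then have "zn_norm n (K x) \<le> 0" by (rule field_le_epsilon)
    then show "x \<in> {x \<in> Zn n. K x = 0}" using zn_norm_eq_0[OF bopD(1)[OF K x]] x by simp
  qed
qed

section \<open>Strict singularity and cosingularity as failure to factor the identity\<close>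

text \<open>If A T B = 1, then T is bounded below on the range of B. This range is the kernel of B A
  T - 1, from which its closedness is immediate.\<close>

lemma strictly_singular_iff:
  assumes n1: "n \<ge> 1" and T: "T \<in> bop n" shows "strictly_singular n T \<longleftrightarrow> \<not> Fac n T"
proof
  assume "\<not> Fac n T"
  then show "strictly_singular n T" unfolding strictly_singular_def using bounded_below_Fac[OF T] by blast
next
  assume ss: "strictly_singular n T"
  show "\<not> Fac n T"
  proof
    assume "Fac n T"
    then obtain A B where A: "A \<in> bop n" and B: "B \<in> bop n" and AB: "\<And>x. x \<in> Zn n \<Longrightarrow> A (T (B x)) = x" unfolding Fac_def by blast
    define K where "K = (\<lambda>x. (B \<circ> (A \<circ> T)) x + vscale (-1) (idop n x))"
    have K: "K \<in> bop n" unfolding K_def by (intro bop_add bop_scale bop_comp idop_bop A B T)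
    have K0: "K x = 0 \<longleftrightarrow> B (A (T x)) = x" if "x \<in> Zn n" for x
      using that by (simp add: K_def idop_def restr_eq vscale_minus_one)
    define M where "M = {x \<in> Zn n. K x = 0}"
    have dim: "infinite_dim M"
      unfolding infinite_dim_def
    proof (intro allI impI notI, elim conjE)
      fix F assume F: "finite F" "F \<subseteq> M" "M \<subseteq> cspan F"
      have FZ: "F \<subseteq> Zn n" using F(2) by (auto simp: M_def)
      have "x \<in> cspan ((A \<circ> T) ` F)" if x: "x \<in> Zn n" for x
      proof -
        have Bx: "B x \<in> Zn n" by (rule bopD(1)[OF B x])
        then have "B x \<in> cspan F" using F(3) AB[OF x] by (auto simp: M_def K0)
        from cspan_image[OF bop_comp[OF A T] F(1) FZ this] show ?thesis using AB[OF x] by simp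
      qed
      then show False using Zn_not_subset_cspan[OF n1, of "(A \<circ> T) ` F"] F(1) by blast
    qed
    obtain C where C: "C > 0" "\<And>x. x \<in> Zn n \<Longrightarrow> zn_norm n ((B \<circ> A) x) \<le> C * zn_norm n x" using bop_bound[OF bop_comp[OF B A]] by blast
    have "1 / C * zn_norm n x \<le> zn_norm n (T x)" if "x \<in> M" for x
    proof -
      have x: "x \<in> Zn n" "B (A (T x)) = x" using that K0 by (auto simp: M_def)
      then show ?thesis using C(2)[OF bopD(1)[OF T x(1)]] C(1) by (simp add: divide_le_eq mult.commute)
    qed
    moreover have "1 / C > 0" using C(1) by simp
    ultimately show False using ss kernel_closed_subspace[OF K] dim unfolding strictly_singular_def M_def[symmetric] by blast
  qed
qed

text \<open>If A T B = 1, every y is T (B (A y)) plus an element of the kernel of A, and this kernel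
  has infinite codimension because A maps T (B x) back to x.\<close>

lemma strictly_cosingular_iff:
  assumes n1: "n \<ge> 1" and T: "T \<in> bop n" shows "strictly_cosingular n T \<longleftrightarrow> \<not> Fac n T"
proof
  assume nF: "\<not> Fac n T"
  show "strictly_cosingular n T"
    unfolding strictly_cosingular_def
  proof (intro notI, elim exE conjE)
    fix M assume M: "is_subspace n M" "closed_sub n M" "infinite_codim n M"
      and onto: "Zn n \<subseteq> {vadd (T x) m |x m. x \<in> Zn n \<and> m \<in> M}"
    have "\<exists>x\<in>Zn n. \<exists>m\<in>M. z = T x + m" if "z \<in> Zn n" for z using subsetD[OF onto that] unfolding vadd_eq by blast
    from onto_quotient_Fac[OF T M this] show False using nF by blast
  qed
next
  assume sc: "strictly_cosingular n T"
  show "\<not> Fac n T"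
  proof
    assume "Fac n T"
    then obtain A B where A: "A \<in> bop n" and B: "B \<in> bop n" and AB: "\<And>x. x \<in> Zn n \<Longrightarrow> A (T (B x)) = x" unfolding Fac_def by blast
    define M where "M = {x \<in> Zn n. A x = 0}"
    have "infinite_codim n M"
      unfolding infinite_codim_def
    proof (intro allI impI notI, elim conjE)
      fix F assume F: "finite F" "F \<subseteq> Zn n" "Zn n \<subseteq> {vadd u m |u m. u \<in> cspan F \<and> m \<in> M}"
      have "x \<in> cspan (A ` F)" if x: "x \<in> Zn n" for x
      proof -
        have "T (B x) \<in> Zn n" by (intro bopD(1)[OF T] bopD(1)[OF B] x)
        then obtain u m where u: "T (B x) = u + m" "u \<in> cspan F" "m \<in> M" using F(3) unfolding vadd_eq by blast
        have m: "m \<in> Zn n" "A m = 0" using u(3) by (auto simp: M_def)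
        have "x = A (u + m)" using AB[OF x] u(1) by simp
        also have "\<dots> = A u" using bopD(2)[OF A cspan_Zn[OF F(2) u(2)] m(1)] m(2) by simp
        finally show ?thesis using cspan_image[OF A F(1,2) u(2)] by simp
      qed
      then show False using Zn_not_subset_cspan[OF n1, of "A ` F"] F(1) by blast
    qed
    moreover have "Zn n \<subseteq> {vadd (T x) m |x m. x \<in> Zn n \<and> m \<in> M}"
    proof
      fix y assume y: "y \<in> Zn n"
      have By: "B (A y) \<in> Zn n" by (intro bopD(1)[OF A] bopD(1)[OF B] y)
      have TBy: "T (B (A y)) \<in> Zn n" by (rule bopD(1)[OF T By])
      have "A (y - T (B (A y))) = 0" using bopD(6)[OF A y TBy] AB[OF bopD(1)[OF A y]] by simp
      then have "y - T (B (A y)) \<in> M" using Zn_diff[OF y TBy] by (simp add: M_def)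
      moreover have "y = vadd (T (B (A y))) (y - T (B (A y)))" by (simp add: vadd_eq)
      ultimately show "y \<in> {vadd (T x) m |x m. x \<in> Zn n \<and> m \<in> M}" using By by blast
    qed
    ultimately show False using sc kernel_closed_subspace[OF A] unfolding strictly_cosingular_def M_def[symmetric] by blast
  qed
qed

section \<open>The maximal ideal\<close>

text \<open>Compressed by A and B, the two operators add up to the identity, and so do their
  diagonal entries in the last slot. For one of them these have modulus at least 1/2 infinitely
  often, and the diagonal criterion applies.\<close>

lemma Fac_add:
  assumes n1: "n \<ge> 1" and S: "S \<in> bop n" and T: "T \<in> bop n" and F: "Fac n (\<lambda>x. S x + T x)"
  shows "Fac n S \<or> Fac n T"
proof -
  obtain A B where A: "A \<in> bop n" and B: "B \<in> bop n" and AB: "\<And>x. x \<in> Zn n \<Longrightarrow> A (S (B x) + T (B x)) = x" using F unfolding Fac_def by blast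
  define P where "P = A \<circ> (S \<circ> B)"
  define Q where "Q = A \<circ> (T \<circ> B)"
  have P: "P \<in> bop n" and Q: "Q \<in> bop n" unfolding P_def Q_def by (intro bop_comp A S T B)+
  have PQ: "P x + Q x = x" if x: "x \<in> Zn n" for x
    using AB[OF x] bopD(2)[OF A bopD(1)[OF S bopD(1)[OF B x]] bopD(1)[OF T bopD(1)[OF B x]]] by (simp add: P_def Q_def)
  have r: "n - 1 < n" using n1 by simp
  have "1/2 \<le> cmod (P (uvec i (n - 1)) (n - 1) i) \<or> 1/2 \<le> cmod (Q (uvec i (n - 1)) (n - 1) i)" for i
  proof -
    have "P (uvec i (n - 1)) (n - 1) i + Q (uvec i (n - 1)) (n - 1) i = uvec i (n - 1) (n - 1) i"
      using fun_cong[OF fun_cong[OF PQ[OF Zn_uvec[OF r]]]] unfolding plus_fun_def .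
    also have "\<dots> = 1" by (simp add: uvec_def)
    finally have "1 \<le> cmod (P (uvec i (n - 1)) (n - 1) i) + cmod (Q (uvec i (n - 1)) (n - 1) i)"
      by (metis norm_one norm_triangle_ineq)
    then show ?thesis by linarith
  qed
  then have U: "{i. 1/2 \<le> cmod (P (uvec i (n - 1)) (n - 1) i)} \<union> {i. 1/2 \<le> cmod (Q (uvec i (n - 1)) (n - 1) i)} = UNIV" by blast
  have "infinite {i. 1/2 \<le> cmod (P (uvec i (n - 1)) (n - 1) i)} \<or> infinite {i. 1/2 \<le> cmod (Q (uvec i (n - 1)) (n - 1) i)}"
    unfolding de_Morgan_conj[symmetric] finite_Un[symmetric] U by (rule infinite_UNIV_nat)
  then have "Fac n P \<or> Fac n Q" using diagonal_Fac[OF P r, of "1/2"] diagonal_Fac[OF Q r, of "1/2"] by auto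
  then show ?thesis using Fac_comp[OF _ A B, of S] Fac_comp[OF _ A B, of T] by (auto simp: P_def Q_def comp_def)
qed

lemma not_Fac_finite_rank:
  assumes n1: "n \<ge> 1" and F: "finite F" "F \<subseteq> Zn n" and T: "\<And>x. x \<in> Zn n \<Longrightarrow> T x \<in> cspan F" shows "\<not> Fac n T"
proof
  assume "Fac n T"
  then obtain A B where A: "A \<in> bop n" and B: "B \<in> bop n" and AB: "\<And>x. x \<in> Zn n \<Longrightarrow> A (T (B x)) = x" unfolding Fac_def by blast
  have "x \<in> cspan (A ` F)" if x: "x \<in> Zn n" for x
    using cspan_image[OF A F T[OF bopD(1)[OF B x]]] AB[OF x] by simp
  then show False using Zn_not_subset_cspan[OF n1, of "A ` F"] F(1) by blast
qed

text \<open>A nonzero operator of finite rank; it shows that the maximal ideal is not zero.\<close>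

lemma not_Fac_coordinate_proj: assumes n1: "n \<ge> 1" shows "\<not> Fac n (restr n (proj {0}))"
proof (rule not_Fac_finite_rank[OF n1])
  show "finite (uvec 0 ` {..<n})" "uvec 0 ` {..<n} \<subseteq> Zn n" using Zn_uvec by auto
  fix x assume x: "x \<in> Zn n"
  have "supp_in {0} (proj {0} x)" by (auto simp: supp_in_def proj_def)
  from finite_expand[OF _ this Zn_below[OF Zn_proj[OF x]]] have e: "proj {0} x = (\<Sum>j<n. vscale (proj {0} x j 0) (uvec 0 j))" by simp
  have "(\<Sum>j<n. vscale (proj {0} x j 0) (uvec 0 j)) \<in> arr_space.span (uvec 0 ` {..<n})"
    by (intro arr_space.span_sum arr_space.span_scale arr_space.span_base) auto
  then show "restr n (proj {0}) x \<in> cspan (uvec 0 ` {..<n})" unfolding restr_eq[OF x] using e by (simp add: cspan_eq_span)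
qed

lemma SS_eq: "n \<ge> 1 \<Longrightarrow> SS n = {T \<in> bop n. \<not> Fac n T}" unfolding SS_def using strictly_singular_iff by blast

lemma SC_eq: "n \<ge> 1 \<Longrightarrow> SC n = {T \<in> bop n. \<not> Fac n T}" unfolding SC_def using strictly_cosingular_iff by blast

lemma op_ideal_SS: assumes n1: "n \<ge> 1" shows "op_ideal n (SS n)"
  unfolding op_ideal_def SS_eq[OF n1] vadd_eq vzero_eq
proof (intro conjI ballI allI subsetI)
  have "\<not> Fac n (\<lambda>x. 0)" by (rule not_Fac_finite_rank[OF n1, of "{}"]) (auto simp: cspan_sum)
  then show "(\<lambda>x. 0) \<in> {T \<in> bop n. \<not> Fac n T}" using bop_zero by simp
next
  fix S T assume "S \<in> {T \<in> bop n. \<not> Fac n T}" "T \<in> {T \<in> bop n. \<not> Fac n T}"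
  then show "(\<lambda>x. S x + T x) \<in> {T \<in> bop n. \<not> Fac n T}" using Fac_add[OF n1] bop_add by blast
next
  fix S c assume S: "S \<in> {T \<in> bop n. \<not> Fac n T}"
  have "Fac n S" if "Fac n (\<lambda>x. vscale c (S x))"
  proof -
    \<comment> \<open>Composition with \<open>idop n\<close> changes nothing for operators that
      vanish outside the space; it turns the scalar into a left factor, as \<open>Fac_comp\<close>
      requires.\<close>
    have "(\<lambda>x. vscale c (S x)) = (\<lambda>x. (\<lambda>y. vscale c (idop n y)) (S (idop n x)))"
    proof
      fix x show "vscale c (S x) = (\<lambda>y. vscale c (idop n y)) (S (idop n x))"
        using S bopD(1)[of S n x] bopD(4,5)[of S n] by (cases "x \<in> Zn n") (auto simp: idop_def restr_def)
    qed
    then show ?thesis using Fac_comp[of n "\<lambda>y. vscale c (idop n y)" S "idop n"] that bop_scale[OF idop_bop] idop_bop by simp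
  qed
  then show "(\<lambda>x. vscale c (S x)) \<in> {T \<in> bop n. \<not> Fac n T}" using S bop_scale by blast
next
  fix S A assume S: "S \<in> {T \<in> bop n. \<not> Fac n T}" and A: "A \<in> bop n"
  have "Fac n S" if "Fac n (A \<circ> S)"
  proof -
    have "A \<circ> S = (\<lambda>x. A (S (idop n x)))"
    proof
      fix x show "(A \<circ> S) x = A (S (idop n x))"
        using S bopD(4,5)[of S n] by (cases "x \<in> Zn n") (auto simp: idop_def restr_def)
    qed
    then show ?thesis using Fac_comp[of n A S "idop n"] that A idop_bop by simp
  qed
  then show "A \<circ> S \<in> {T \<in> bop n. \<not> Fac n T}" using S bop_comp[OF A] by blast
  have "Fac n S" if "Fac n (S \<circ> A)"
  proof -
    have "S \<circ> A = (\<lambda>x. idop n (S (A x)))"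
    proof
      fix x show "(S \<circ> A) x = idop n (S (A x))"
        using S bopD(1)[of S n "A x"] bopD(4)[of S n "A x"] by (cases "A x \<in> Zn n") (auto simp: idop_def restr_def)
    qed
    then show ?thesis using Fac_comp[of n "idop n" S A] that A idop_bop by simp
  qed
  then show "S \<circ> A \<in> {T \<in> bop n. \<not> Fac n T}" using S bop_comp[OF _ A] by blast
qed blast

text \<open>The ideal contains the identity in the form A T B, and composing S with it gives S
  back.\<close>

lemma op_ideal_Fac:
  assumes I: "op_ideal n I" and T: "T \<in> I" "Fac n T" shows "I = bop n"
proof -
  obtain A B where A: "A \<in> bop n" and B: "B \<in> bop n" and AB: "\<And>x. x \<in> Zn n \<Longrightarrow> A (T (B x)) = x" using T(2) unfolding Fac_def by blast
  have TI: "T \<in> bop n" using I T(1) by (auto simp: op_ideal_def)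
  have ATB: "A \<circ> (T \<circ> B) \<in> I" using I T(1) A B unfolding op_ideal_def by blast
  have "S \<in> I" if S: "S \<in> bop n" for S
  proof -
    have "S \<circ> (A \<circ> (T \<circ> B)) = S"
    proof
      fix x show "(S \<circ> (A \<circ> (T \<circ> B))) x = S x"
        using AB[of x] bopD(4)[OF B, of x]
        by (cases "x \<in> Zn n") (auto simp: bopD[OF S] bopD[OF TI] bopD[OF A])
    qed
    moreover have "S \<circ> (A \<circ> (T \<circ> B)) \<in> I" using I ATB S unfolding op_ideal_def by blast
    ultimately show ?thesis by simp
  qed
  then show ?thesis using I by (auto simp: op_ideal_def)
qed

theorem theorem5p6:
  fixes n :: nat
  assumes "n \<ge> 1"
  shows "SS n = SC n \<and> op_ideal n (SS n) \<and> SS n \<noteq> {\<lambda>x. vzero} \<and> SS n \<noteq> bop n \<and>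
         (\<forall>I. op_ideal n I \<and> I \<noteq> bop n \<longrightarrow> I \<subseteq> SS n)"
proof (intro conjI allI impI)
  show "SS n = SC n" using SS_eq[OF assms] SC_eq[OF assms] by simp
  show "op_ideal n (SS n)" by (rule op_ideal_SS[OF assms])
  have "restr n (proj {0}) (uvec 0 0) 0 0 = 1"
    using Zn_uvec[of 0 n 0] assms by (simp add: restr_def proj_def uvec_def)
  then have "restr n (proj {0}) \<noteq> (\<lambda>x. vzero)" by (auto simp: vzero_def)
  moreover have "restr n (proj {0}) \<in> SS n" using not_Fac_coordinate_proj[OF assms] proj_bop SS_eq[OF assms] by blast
  ultimately show "SS n \<noteq> {\<lambda>x. vzero}" by blast
  have "Fac n (idop n)" unfolding Fac_def using idop_bop by (intro bexI[of _ "idop n"]) (simp_all add: idop_def restr_def)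
  then show "SS n \<noteq> bop n" using idop_bop[of n] SS_eq[OF assms] by blast
  fix I assume I: "op_ideal n I \<and> I \<noteq> bop n"
  then have "I \<subseteq> bop n" by (simp add: op_ideal_def)
  moreover have "\<not> Fac n T" if "T \<in> I" for T using op_ideal_Fac[of n I T] I that by blast
  ultimately show "I \<subseteq> SS n" unfolding SS_eq[OF assms] by blast
qed

end
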